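(* Let $k\ge 1$ be an integer, let $\Omega$ be a macro element, let $\bar f\in C^{k+2}(\Omega;\mathbb R)$, and let $\overline{\mathcal T}_{h,\Omega}$ with $h<h_0$ be a symmetric triangulation of $\Omega$ such that the boundary of $\Omega$ has a uniform induced boundary triangulation. Let $\bar f_h=\bar I_h^k(\bar f)\in C^0(\Omega;\mathbb R)$ be the piecewise Lagrange interpolation of degree $k$. Let $\bar g\in W^{\ell,1}(\Omega)$ with $\ell\in\{1,2\}$. Then, for every $\vec\beta\in\mathbb N_0^2$ with $|\vec\beta|=1$, $$\left|\int_\Omega\bar g\,\big(\bar D^{\vec\beta}\bar f_h-\bar D^{\vec\beta}\bar f\big)\,d\bar\sigma\right|\le\begin{cases}C\,h^{k+\ell}\,\|\bar g\|_{W^{\ell,1}(\Omega)}\,\|\bar f\|_{C^{k+\ell}(\Omega)},&k\text{ even},\\ C\,h^{k+1}\,\|\bar g\|_{W^{1,1}(\Omega)}\,\|\bar f\|_{C^{k+1}(\Omega)},&k\text{ odd},\end{cases}$$ with a constant $C$ independent of $h$, $\bar f$ and $\bar g$.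
   Context: A macro element $\Omega$ is a fixed nondegenerate closed planar triangle (one of the finitely many triangles of a fixed macro grid of mesh size $h_0$). After choosing an orthonormal basis of its plane, $\Omega\subset\mathbb R^2$; $\bar D^{\vec\beta}$ denotes partial derivatives with multi-index $\vec\beta$ and $d\bar\sigma$ is Lebesgue measure. For $h<h_0$, $\overline{\mathcal T}_{h,\Omega}$ is a conforming triangulation of $\Omega$ into closed triangles; the family of triangulations is uniformly shape regular and quasi-uniform with mesh size $h$ (the maximal element diameter). Constants may depend on $\Omega$, on $k$, and on the shape-regularity and quasi-uniformity constants. Interpolation: $T_{\mathrm{ref}}$ is the reference triangle (with a vertex at $0$), $F_T:T_{\mathrm{ref}}\to T$ is an affine bijection, and $\hat I^k$ is Lagrange interpolation by polynomials of degree $k$ at the standard degree-$k$ Lagrange nodes of $T_{\mathrm{ref}}$. Then $\bar I_h^k(\bar f)|_T=\hat I^k(\bar f\circ F_T)\circ F_T^{-1}$ for every $T\in\overline{\mathcal T}_{h,\Omega}$. Derivatives of $\bar f_h$ are taken elementwise. Symmetric pair: two elements $T_1,T_2\in\overline{\mathcal T}_{h,\Omega}$ form a symmetric pair if $T_1\cap T_2=\{\bar x_0\}$ is a single point and there are affine reference maps $F_{T_i}:T_{\mathrm{ref}}\to T_i$ (onto) with $F_{T_1}(0)=F_{T_2}(0)=\bar x_0$ and $F_{T_1}(\xi)-\bar x_0=\bar x_0-F_{T_2}(\xi)$ for all $\xi\in T_{\mathrm{ref}}$. Symmetric triangulation: $\overline{\mathcal T}_{h,\Omega}$ is symmetric if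 it is a disjoint union $\mathcal A_{h,\Omega}\,\dot\cup\,\mathcal B_{h,\Omega}$, where $\mathcal A_{h,\Omega}$ can be partitioned into disjoint symmetric pairs, and the unpaired elements satisfy $\bigcup_{T\in\mathcal B_{h,\Omega}}T\subset\{\bar x\in\Omega:\operatorname{dist}(\bar x,\partial\Omega)\le h\}$ and hence $|\mathcal B_{h,\Omega}|\le C_{\partial\Omega}h^{-1}$, with $C_{\partial\Omega}$ depending only on $\Omega$ and the shape-regularity and quasi-uniformity constants. Uniform induced boundary triangulation: on each of the edges of the triangle $\Omega$, the subdivision induced by $\overline{\mathcal T}_{h,\Omega}$ consists of line segments of equal length. *)

theory Defs
  imports "HOL-Analysis.Analysis"
begin

section \<open>Multi-indices and partial derivatives\<close>

definition mi_order :: "nat^2 \<Rightarrow> nat" where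
  "mi_order \<beta> = \<beta> $ 1 + \<beta> $ 2"

definition partial :: "2 \<Rightarrow> (real^2 \<Rightarrow> real) \<Rightarrow> real^2 \<Rightarrow> real" where
  "partial i u x = frechet_derivative u (at x) (axis i 1)"

definition mpartial :: "nat^2 \<Rightarrow> (real^2 \<Rightarrow> real) \<Rightarrow> real^2 \<Rightarrow> real" where
  "mpartial \<beta> u = (partial 1 ^^ (\<beta> $ 1)) ((partial 2 ^^ (\<beta> $ 2)) u)"


section \<open>The spaces \<open>C\<^sup>m\<close>\<close>

primrec Ck_on :: "nat \<Rightarrow> (real^2) set \<Rightarrow> (real^2 \<Rightarrow> real) \<Rightarrow> bool" where
  "Ck_on 0 U u \<longleftrightarrow> continuous_on U u"
| "Ck_on (Suc m) U u \<longleftrightarrow> u differentiable_on U \<and> (\<forall>i. Ck_on m U (partial i u))"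

text \<open>
  \<open>C\<^sup>m\<close> on a closed domain: \<open>u\<close> is \<open>C\<^sup>m\<close> in the interior and its derivatives of order at
  most \<open>m\<close> extend continuously up to the boundary. Functions on the domain are represented by
  total functions on the plane whose values outside the domain are irrelevant.
\<close>

definition Ck_closed :: "nat \<Rightarrow> (real^2) set \<Rightarrow> (real^2 \<Rightarrow> real) \<Rightarrow> bool" where
  "Ck_closed m S u \<longleftrightarrow>
     continuous_on S u \<and> Ck_on m (interior S) u \<and>
     (\<forall>\<beta>. mi_order \<beta> \<le> m \<longrightarrow>
        (\<exists>v. continuous_on S v \<and> (\<forall>x\<in>interior S. v x = mpartial \<beta> u x)))"

definition Ck_norm :: "nat \<Rightarrow> (real^2) set \<Rightarrow> (real^2 \<Rightarrow> real) \<Rightarrow> real" where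
  "Ck_norm m S u =
     (MAX \<beta>\<in>{\<beta>. mi_order \<beta> \<le> m}. SUP x\<in>interior S. \<bar>mpartial \<beta> u x\<bar>)"

lemma finite_mi_order_le: "finite {\<beta>. mi_order \<beta> \<le> m}"
proof (rule finite_subset)
  show "{\<beta>. mi_order \<beta> \<le> m} \<subseteq> (\<lambda>(i, j). vector [i, j]) ` ({..m} \<times> {..m})"
  proof
    fix \<beta> :: "nat^2" assume "\<beta> \<in> {\<beta>. mi_order \<beta> \<le> m}"
    then have "\<beta> $ 1 \<le> m" "\<beta> $ 2 \<le> m" by (auto simp: mi_order_def)
    moreover have "\<beta> = vector [\<beta> $ 1, \<beta> $ 2]" by (simp add: vec_eq_iff forall_2)
    ultimately show "\<beta> \<in> (\<lambda>(i, j). vector [i, j]) ` ({..m} \<times> {..m})" by force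
  qed
qed auto


section \<open>The Sobolev spaces \<open>W\<^sup>l\<^sup>,\<^sup>1\<close>\<close>

definition test_function :: "(real^2) set \<Rightarrow> (real^2 \<Rightarrow> real) \<Rightarrow> bool" where
  "test_function U \<phi> \<longleftrightarrow>
     (\<forall>m. Ck_on m UNIV \<phi>) \<and> compact (closure {x. \<phi> x \<noteq> 0}) \<and> closure {x. \<phi> x \<noteq> 0} \<subseteq> U"

definition is_weak_derivative ::
    "(real^2) set \<Rightarrow> nat^2 \<Rightarrow> (real^2 \<Rightarrow> real) \<Rightarrow> (real^2 \<Rightarrow> real) \<Rightarrow> bool" where
  "is_weak_derivative S \<beta> u v \<longleftrightarrow>
     v absolutely_integrable_on S \<and>
     (\<forall>\<phi>. test_function (interior S) \<phi> \<longrightarrow>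
        (LINT x:S|lebesgue. u x * mpartial \<beta> \<phi> x) =
          (-1) ^ mi_order \<beta> * (LINT x:S|lebesgue. v x * \<phi> x))"

definition sobolev_W1 :: "nat \<Rightarrow> (real^2) set \<Rightarrow> (real^2 \<Rightarrow> real) \<Rightarrow> bool" where
  "sobolev_W1 l S u \<longleftrightarrow>
     u absolutely_integrable_on S \<and>
     (\<forall>\<beta>. mi_order \<beta> \<le> l \<longrightarrow> (\<exists>v. is_weak_derivative S \<beta> u v))"

text \<open>Weak derivatives are unique almost everywhere, so the choice below does not affect the norm.\<close>

definition weak_derivative ::
    "(real^2) set \<Rightarrow> nat^2 \<Rightarrow> (real^2 \<Rightarrow> real) \<Rightarrow> real^2 \<Rightarrow> real" where
  "weak_derivative S \<beta> u = (SOME v. is_weak_derivative S \<beta> u v)"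

definition sobolev_W1_norm :: "nat \<Rightarrow> (real^2) set \<Rightarrow> (real^2 \<Rightarrow> real) \<Rightarrow> real" where
  "sobolev_W1_norm l S u =
     (\<Sum>\<beta> | mi_order \<beta> \<le> l. LINT x:S|lebesgue. \<bar>weak_derivative S \<beta> u x\<bar>)"


section \<open>Lagrange interpolation\<close>

definition ref_triangle :: "(real^2) set" where
  "ref_triangle = convex hull {0, axis 1 1, axis 2 1}"

definition affine_ref_map :: "(real^2 \<Rightarrow> real^2) \<Rightarrow> (real^2) set \<Rightarrow> bool" where
  "affine_ref_map F T \<longleftrightarrow>
     (\<exists>A b. linear A \<and> F = (\<lambda>\<xi>. A \<xi> + b)) \<and> bij F \<and> F ` ref_triangle = T"

definition polys_upto :: "nat \<Rightarrow> (real^2 \<Rightarrow> real) set" where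
  "polys_upto k =
     {p. \<exists>c :: nat \<Rightarrow> nat \<Rightarrow> real.
           p = (\<lambda>\<xi>. \<Sum>i\<le>k. \<Sum>j\<le>k - i. c i j * (\<xi> $ 1) ^ i * (\<xi> $ 2) ^ j)}"

definition lagrange_nodes :: "nat \<Rightarrow> (real^2) set" where
  "lagrange_nodes k = {vector [real i / real k, real j / real k] |i j. i + j \<le> k}"

definition ref_interp :: "nat \<Rightarrow> (real^2 \<Rightarrow> real) \<Rightarrow> real^2 \<Rightarrow> real" where
  "ref_interp k u = (THE p. p \<in> polys_upto k \<and> (\<forall>\<xi>\<in>lagrange_nodes k. p \<xi> = u \<xi>))"

text \<open>
  \<open>uh\<close> is the piecewise Lagrange interpolant of \<open>u\<close>. It does not depend on the choice of
  the reference maps, and conformity makes the elementwise prescriptions consistent on common edges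
  and vertices.
\<close>

definition is_lagrange_interpolant ::
    "nat \<Rightarrow> (real^2) set set \<Rightarrow> (real^2 \<Rightarrow> real) \<Rightarrow> (real^2 \<Rightarrow> real) \<Rightarrow> bool" where
  "is_lagrange_interpolant k \<T> u uh \<longleftrightarrow>
     (\<forall>T\<in>\<T>. \<exists>F. affine_ref_map F T \<and> (\<forall>x\<in>T. uh x = ref_interp k (u \<circ> F) (inv F x)))"

text \<open>
  The value on the skeleton of the mesh, which is a null set, is set to \<open>0\<close>.
\<close>

definition elementwise_mpartial ::
    "(real^2) set set \<Rightarrow> nat^2 \<Rightarrow> (real^2 \<Rightarrow> real) \<Rightarrow> real^2 \<Rightarrow> real" where
  "elementwise_mpartial \<T> \<beta> u x =
     (if \<exists>T\<in>\<T>. x \<in> interior T then mpartial \<beta> u x else 0)"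


section \<open>Triangulations\<close>

definition conforming_triangulation_of :: "(real^2) set set \<Rightarrow> (real^2) set \<Rightarrow> bool" where
  "conforming_triangulation_of \<T> \<Omega> \<longleftrightarrow>
     triangulation \<T> \<and> (\<forall>T\<in>\<T>. 2 simplex T) \<and> \<Union>\<T> = \<Omega>"

definition mesh_size :: "(real^2) set set \<Rightarrow> real" where
  "mesh_size \<T> = (MAX T\<in>\<T>. diameter T)"

definition inradius :: "(real^2) set \<Rightarrow> real" where
  "inradius T = Sup {r. 0 \<le> r \<and> (\<exists>x. cball x r \<subseteq> T)}"

definition shape_regular :: "real \<Rightarrow> (real^2) set set \<Rightarrow> bool" where
  "shape_regular \<kappa> \<T> \<longleftrightarrow> (\<forall>T\<in>\<T>. diameter T \<le> \<kappa> * inradius T)"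

definition quasi_uniform :: "real \<Rightarrow> (real^2) set set \<Rightarrow> bool" where
  "quasi_uniform q \<T> \<longleftrightarrow> (\<forall>T\<in>\<T>. mesh_size \<T> \<le> q * diameter T)"

definition symmetric_pair :: "(real^2) set \<Rightarrow> (real^2) set \<Rightarrow> bool" where
  "symmetric_pair T1 T2 \<longleftrightarrow>
     (\<exists>x0 F1 F2. T1 \<inter> T2 = {x0} \<and> affine_ref_map F1 T1 \<and> affine_ref_map F2 T2 \<and>
        F1 0 = x0 \<and> F2 0 = x0 \<and> (\<forall>\<xi>\<in>ref_triangle. F1 \<xi> - x0 = x0 - F2 \<xi>))"

text \<open>
  The bound on the number of unpaired elements by a multiple of the inverse mesh size is not part of
  the definition: it follows from the inclusion in the boundary strip and quasi-uniformity and
  shape regularity of the mesh.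
\<close>

definition symmetric_triangulation :: "(real^2) set set \<Rightarrow> (real^2) set \<Rightarrow> bool" where
  "symmetric_triangulation \<T> \<Omega> \<longleftrightarrow>
     (\<exists>\<A> \<B>. \<T> = \<A> \<union> \<B> \<and> \<A> \<inter> \<B> = {} \<and>
        (\<exists>P. partition_on \<A> P \<and> (\<forall>p\<in>P. \<exists>T1 T2. p = {T1, T2} \<and> symmetric_pair T1 T2)) \<and>
        \<Union>\<B> \<subseteq> {x\<in>\<Omega>. infdist x (frontier \<Omega>) \<le> mesh_size \<T>})"

definition uniform_boundary :: "(real^2) set set \<Rightarrow> (real^2) set \<Rightarrow> bool" where
  "uniform_boundary \<T> \<Omega> \<longleftrightarrow>
     (\<forall>E. E edge_of \<Omega> \<longrightarrow>
        (\<forall>T1\<in>\<T>. \<forall>T2\<in>\<T>. \<forall>e1 e2.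
           e1 edge_of T1 \<and> e1 \<subseteq> E \<and> e2 edge_of T2 \<and> e2 \<subseteq> E \<longrightarrow> diameter e1 = diameter e2))"

end

theory Submission
  imports Defs
begin

text \<open>
  Let \<open>e\<close> be the interpolation error. Since the two edge directions of \<open>\<Omega>\<close> span the plane, it is enough
  to bound the integral of \<open>g\<close> times the derivative of \<open>e\<close> along an edge direction \<open>a\<close>, and by mollification
  \<open>g\<close> may be taken smooth. Integration by parts leaves integrals of \<open>g e\<close> over two edges of \<open>\<Omega>\<close> and the
  integral of \<open>(\<partial>\<^sub>a g) e\<close> over \<open>\<Omega>\<close>. The bound \<open>\<bar>e\<bar> \<le> C h\<^bsup>k+1\<^esup>\<close> and the trace inequality give the estimate
  with \<open>l = 1\<close> for every \<open>k\<close>.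

  Let \<open>k\<close> be even. The Taylor terms of degree \<open>k + 1\<close> are odd about their centre, so
  \<open>e(x) + e(2 x\<^sub>0 - x) = O(h\<^bsup>k+2\<^esup>)\<close> on a symmetric pair with common vertex \<open>x\<^sub>0\<close>, and likewise under
  the reflection of a mesh edge in its midpoint. Up to \<open>O(h\<^bsup>k+2\<^esup>)\<close>, the integral of \<open>w e\<close> over a pair or
  over an edge therefore only sees the difference of \<open>w\<close> at reflected points, which gains a factor \<open>h\<close> at the
  price of one derivative of \<open>w\<close>. The unpaired elements lie in a strip of width \<open>h\<close> along the boundary, over
  which the integral of \<open>\<bar>w\<bar>\<close> is at most \<open>C h\<close> times its \<open>W\<^sup>1\<^sup>,\<^sup>1\<close> norm.
\<close>

section \<open>Polynomials of two variables and Lagrange interpolation\<close>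

text \<open>The constant must be fixed before the mesh is known. On an element the interpolant is
  compared with a Taylor polynomial of \<open>f\<close> at the Lagrange nodes only, and one
  stability constant of the reference triangle, valid for every affine image, carries the comparison
  to the whole element. The same constant serves in the symmetric case: the even part of a Taylor
  polynomial of degree \<open>k + 1\<close> has degree \<open>k\<close> when \<open>k\<close> is
  even.

  The error is continuous, but its gradient jumps across the mesh. Integrating by parts along lines
  through all of \<open>\<Omega>\<close>, not element by element, leaves no terms on interior edges.

  Comparing \<open>w\<close> at reflected points uses derivatives of \<open>w\<close> in the convex
  hull of the pair, which reaches into neighbouring elements. Hulls of different pairs overlap, and
  shape regularity and quasi-uniformity enter by bounding how often.

  All estimates run on smooth weights, for which traces and restrictions to lines are elementary.
  The mollified functions are only asked to be bounded in the Sobolev norm, with convergence of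
  their integrals against the fixed bounded gradient of the error.\<close>

lemma polys_uptoI: "(\<lambda>\<xi>. \<Sum>i\<le>k. \<Sum>j\<le>k - i. c i j * (\<xi> $ 1) ^ i * (\<xi> $ 2) ^ j) \<in> polys_upto k"
  unfolding polys_upto_def by blast

lemma polys_uptoE:
  assumes "p \<in> polys_upto k"
  obtains c where "p = (\<lambda>\<xi>. \<Sum>i\<le>k. \<Sum>j\<le>k - i. c i j * (\<xi> $ 1) ^ i * (\<xi> $ 2) ^ j)"
  using assms unfolding polys_upto_def by blast

lemma polys_upto_add:
  assumes "p \<in> polys_upto k" "q \<in> polys_upto k"
  shows "(\<lambda>\<xi>. p \<xi> + q \<xi>) \<in> polys_upto k"
proof -
  obtain c d where "p = (\<lambda>\<xi>. \<Sum>i\<le>k. \<Sum>j\<le>k - i. c i j * (\<xi> $ 1) ^ i * (\<xi> $ 2) ^ j)"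
    "q = (\<lambda>\<xi>. \<Sum>i\<le>k. \<Sum>j\<le>k - i. d i j * (\<xi> $ 1) ^ i * (\<xi> $ 2) ^ j)"
    using assms by (elim polys_uptoE) blast
  then have "(\<lambda>\<xi>. p \<xi> + q \<xi>) =
      (\<lambda>\<xi>. \<Sum>i\<le>k. \<Sum>j\<le>k - i. (c i j + d i j) * (\<xi> $ 1) ^ i * (\<xi> $ 2) ^ j)"
    by (simp add: sum.distrib algebra_simps)
  then show ?thesis by (simp only: polys_uptoI)
qed

lemma polys_upto_cmult:
  assumes "p \<in> polys_upto k"
  shows "(\<lambda>\<xi>. a * p \<xi>) \<in> polys_upto k"
proof -
  obtain c where "p = (\<lambda>\<xi>. \<Sum>i\<le>k. \<Sum>j\<le>k - i. c i j * (\<xi> $ 1) ^ i * (\<xi> $ 2) ^ j)"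
    using assms by (rule polys_uptoE)
  then have "(\<lambda>\<xi>. a * p \<xi>) =
      (\<lambda>\<xi>. \<Sum>i\<le>k. \<Sum>j\<le>k - i. (a * c i j) * (\<xi> $ 1) ^ i * (\<xi> $ 2) ^ j)"
    by (simp add: sum_distrib_left algebra_simps)
  then show ?thesis by (simp only: polys_uptoI)
qed

lemma polys_upto_zero: "(\<lambda>_. 0) \<in> polys_upto k"
  using polys_uptoI[of "\<lambda>_ _. 0" k] by simp

lemma polys_upto_diff:
  assumes "p \<in> polys_upto k" "q \<in> polys_upto k"
  shows "(\<lambda>\<xi>. p \<xi> - q \<xi>) \<in> polys_upto k"
  using polys_upto_add[OF assms(1) polys_upto_cmult[OF assms(2), of "-1"]] by simp

lemma polys_upto_sum:
  assumes "\<And>a. a \<in> A \<Longrightarrow> p a \<in> polys_upto k"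
  shows "(\<lambda>\<xi>. \<Sum>a\<in>A. p a \<xi>) \<in> polys_upto k"
  using assms by (induction A rule: infinite_finite_induct) (auto intro: polys_upto_zero polys_upto_add)

lemma polys_upto_monom:
  assumes "i + j \<le> k"
  shows "(\<lambda>\<xi>. (\<xi> $ 1) ^ i * (\<xi> $ 2) ^ j) \<in> polys_upto k"
proof -
  have "(\<Sum>a\<le>k. \<Sum>b\<le>k - a. (if a = i \<and> b = j then 1 else 0) * (\<xi> $ 1) ^ a * (\<xi> $ 2) ^ b)
      = (\<xi> $ 1) ^ i * (\<xi> $ 2) ^ j" for \<xi> :: "real^2"
  proof -
    have "(\<Sum>b\<le>k - a. (if a = i \<and> b = j then 1 else 0) * (\<xi> $ 1) ^ a * (\<xi> $ 2) ^ b)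
        = (if a = i then \<Sum>b\<le>k - a. if b = j then (\<xi> $ 1) ^ a * (\<xi> $ 2) ^ b else 0 else 0)" for a
    proof (cases "a = i")
      case True
      then show ?thesis by (intro trans[OF sum.cong if_P[symmetric]]) auto
    qed simp
    also have "(if a = i then \<Sum>b\<le>k - a. if b = j then (\<xi> $ 1) ^ a * (\<xi> $ 2) ^ b else 0 else 0)
        = (if a = i then (\<xi> $ 1) ^ i * (\<xi> $ 2) ^ j else 0)" for a
      using assms by (auto simp: sum.delta)
    finally show ?thesis using assms by (simp add: sum.delta)
  qed
  then show ?thesis using polys_uptoI[of "\<lambda>a b. if a = i \<and> b = j then 1 else 0" k] by simp
qed

text \<open>Replaces work with the double sum of the definition: a property that is closed under
  linear combinations need only be checked on monomials. Products, affine substitution, the even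
  part and gradients are all handled this way.\<close>

lemma polys_upto_induct [consumes 1, case_names monom cmult add zero]:
  assumes "p \<in> polys_upto k"
    and monom: "\<And>i j. i + j \<le> k \<Longrightarrow> Q (\<lambda>\<xi>. (\<xi> $ 1) ^ i * (\<xi> $ 2) ^ j)"
    and cmult: "\<And>a p. Q p \<Longrightarrow> Q (\<lambda>\<xi>. a * p \<xi>)"
    and add: "\<And>p q. Q p \<Longrightarrow> Q q \<Longrightarrow> Q (\<lambda>\<xi>. p \<xi> + q \<xi>)"
    and zero: "Q (\<lambda>_. 0)"
  shows "Q p"
proof -
  obtain c where p: "p = (\<lambda>\<xi>. \<Sum>i\<le>k. \<Sum>j\<le>k - i. c i j * (\<xi> $ 1) ^ i * (\<xi> $ 2) ^ j)"
    using assms(1) by (rule polys_uptoE)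
  have sumQ: "Q (\<lambda>\<xi>. \<Sum>a\<in>S. r a \<xi>)" if "finite S" "\<And>a. a \<in> S \<Longrightarrow> Q (r a)" for S :: "nat set" and r
    using that by (induction S rule: finite_induct) (auto intro: zero add)
  have "Q (\<lambda>\<xi>. c i j * (\<xi> $ 1) ^ i * (\<xi> $ 2) ^ j)" if "i \<le> k" "j \<le> k - i" for i j
    using cmult[OF monom, of i j "c i j"] that by (simp add: mult.assoc)
  then show ?thesis unfolding p by (intro sumQ) auto
qed

lemma polys_upto_mono:
  assumes "p \<in> polys_upto k" "k \<le> m"
  shows "p \<in> polys_upto m"
  using assms(1) by (induction p rule: polys_upto_induct)
    (use assms(2) in \<open>auto intro: polys_upto_monom polys_upto_cmult polys_upto_add polys_upto_zero\<close>)

lemma polys_upto_mult: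
  assumes "p \<in> polys_upto k" "q \<in> polys_upto m"
  shows "(\<lambda>\<xi>. p \<xi> * q \<xi>) \<in> polys_upto (k + m)"
  using assms(1)
proof (induction p rule: polys_upto_induct)
  case (monom i j)
  from assms(2) show ?case
  proof (induction q rule: polys_upto_induct)
    case (monom i' j')
    have "(\<lambda>\<xi>::real^2. (\<xi> $ 1) ^ (i + i') * (\<xi> $ 2) ^ (j + j')) \<in> polys_upto (k + m)"
      by (rule polys_upto_monom) (use \<open>i + j \<le> k\<close> \<open>i' + j' \<le> m\<close> in simp)
    then show ?case by (simp add: power_add mult_ac)
  next
    case (cmult a p)
    then show ?case using polys_upto_cmult[OF cmult, of a] by (simp add: mult_ac)
  next
    case (add p q)
    then show ?case using polys_upto_add[OF add] by (simp add: algebra_simps)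
  next
    case zero
    then show ?case using polys_upto_zero by simp
  qed
next
  case (cmult a p)
  then show ?case using polys_upto_cmult[OF cmult, of a] by (simp add: mult_ac)
next
  case (add p q)
  then show ?case using polys_upto_add[OF add] by (simp add: algebra_simps)
next
  case zero
  then show ?case using polys_upto_zero by simp
qed

lemma polys_upto_const: "(\<lambda>_. a) \<in> polys_upto k"
  using polys_upto_cmult[OF polys_upto_monom[of 0 0 k], of a] by simp

lemma polys_upto_coord: "(\<lambda>\<xi>. \<xi> $ i) \<in> polys_upto 1"
  using polys_upto_monom[of 1 0 1] polys_upto_monom[of 0 1 1] exhaust_2[of i] by auto

lemma polys_upto_power:
  assumes "p \<in> polys_upto 1"
  shows "(\<lambda>\<xi>. p \<xi> ^ n) \<in> polys_upto n"
proof (induction n)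
  case 0
  then show ?case using polys_upto_const by simp
next
  case (Suc n)
  then show ?case using polys_upto_mult[OF assms Suc] by simp
qed

lemma polys_upto_prod:
  assumes "finite A" "\<And>a. a \<in> A \<Longrightarrow> p a \<in> polys_upto 1"
  shows "(\<lambda>\<xi>. \<Prod>a\<in>A. p a \<xi>) \<in> polys_upto (card A)"
  using assms
proof (induction A rule: finite_induct)
  case empty
  then show ?case using polys_upto_const by simp
next
  case (insert a A)
  then show ?case using polys_upto_mult[of "p a" 1 "\<lambda>\<xi>. \<Prod>a\<in>A. p a \<xi>" "card A"] by simp
qed

lemma polys_upto_compose:
  assumes "p \<in> polys_upto k" and G: "\<And>i. (\<lambda>\<xi>. G \<xi> $ i) \<in> polys_upto 1"
  shows "(\<lambda>\<xi>. p (G \<xi>)) \<in> polys_upto k"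
  using assms(1)
proof (induction p rule: polys_upto_induct)
  case (monom i j)
  then show ?case
    by (rule polys_upto_mono[OF polys_upto_mult[OF polys_upto_power[OF G] polys_upto_power[OF G]]])
qed (auto intro: polys_upto_zero polys_upto_add polys_upto_cmult)

lemma polys_upto_affine:
  assumes "linear A"
  shows "(\<lambda>\<xi>. (A \<xi> + b) $ i) \<in> polys_upto 1"
proof -
  have A: "A \<xi> = \<xi> $ 1 *\<^sub>R A (axis 1 1) + \<xi> $ 2 *\<^sub>R A (axis 2 1)" for \<xi> :: "real^2"
  proof -
    have "\<xi> = \<xi> $ 1 *\<^sub>R axis 1 1 + \<xi> $ 2 *\<^sub>R axis 2 1"
      by (simp add: vec_eq_iff forall_2 axis_def)
    then have "A \<xi> = A (\<xi> $ 1 *\<^sub>R axis 1 1 + \<xi> $ 2 *\<^sub>R axis 2 1)" by (rule arg_cong)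
    then show ?thesis by (simp only: linear_add[OF assms] linear_scale[OF assms])
  qed
  have "(\<lambda>\<xi>. (A \<xi> + b) $ i) =
      (\<lambda>\<xi>. (A (axis 1 1) $ i * \<xi> $ 1 + A (axis 2 1) $ i * \<xi> $ 2) + b $ i)"
    by (rule ext, subst A) simp
  moreover have "\<dots> \<in> polys_upto 1"
    by (intro polys_upto_add polys_upto_cmult polys_upto_coord polys_upto_const)
  ultimately show ?thesis by simp
qed

lemma polys_upto_compose_affine:
  assumes "p \<in> polys_upto k" "linear A"
  shows "(\<lambda>\<xi>. p (A \<xi> + b)) \<in> polys_upto k"
  using polys_upto_compose[OF assms(1) polys_upto_affine[OF assms(2)]] .

text \<open>For even \<open>k\<close> the terms of degree \<open>k + 1\<close> are odd about \<open>c\<close> and cancel.\<close>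

lemma polys_upto_even_part:
  assumes "p \<in> polys_upto (Suc k)" "even k"
  shows "(\<lambda>x. p x + p (d - x)) \<in> polys_upto k"
proof -
  \<comment> \<open>\<open>c\<close> is the centre of the reflection
    \<open>x \<mapsto> d - x\<close>; in the coordinate \<open>y = x - c\<close> it becomes
    \<open>y \<mapsto> - y\<close>, which multiplies a monomial by a sign.\<close>
  define c where "c = (1/2) *\<^sub>R d"
  define P where "P = (\<lambda>y. p (y + c))"
  have "P \<in> polys_upto (Suc k)"
    unfolding P_def using polys_upto_compose_affine[OF assms(1), of "\<lambda>x. x" c] by (simp add: linear_iff)
  then have "(\<lambda>y. P y + P (- y)) \<in> polys_upto k"
  proof (induction P rule: polys_upto_induct)
    case (monom i j)
    have eq: "(\<lambda>y::real^2. y $ 1 ^ i * y $ 2 ^ j + (- y) $ 1 ^ i * (- y) $ 2 ^ j)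
        = (\<lambda>y. (1 + (-1) ^ (i + j)) * (y $ 1 ^ i * y $ 2 ^ j))"
    proof
      fix y :: "real^2"
      have "(- y) $ 1 ^ i * (- y) $ 2 ^ j = (-1) ^ (i + j) * (y $ 1 ^ i * y $ 2 ^ j)"
        using power_minus[of "y$1" i] power_minus[of "y$2" j] by (simp add: power_add)
      then show "y $ 1 ^ i * y $ 2 ^ j + (- y) $ 1 ^ i * (- y) $ 2 ^ j
        = (1 + (-1) ^ (i + j)) * (y $ 1 ^ i * y $ 2 ^ j)" by (simp add: algebra_simps)
    qed
    show ?case
    proof (cases "i + j \<le> k")
      case True
      then show ?thesis unfolding eq by (intro polys_upto_cmult polys_upto_monom)
    next
      case False
      then have "odd (i + j)" using monom \<open>even k\<close> by (metis even_Suc le_SucE)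
      then show ?thesis unfolding eq using polys_upto_zero by simp
    qed
  next
    case (cmult a p)
    then show ?case using polys_upto_cmult[OF cmult, of a] by (simp add: algebra_simps)
  next
    case (add p q)
    then show ?case using polys_upto_add[OF add] by (simp add: algebra_simps)
  next
    case zero
    then show ?case using polys_upto_zero by simp
  qed
  from polys_upto_compose_affine[OF this, of "\<lambda>x. x" "- c"]
  have "(\<lambda>x. P (x - c) + P (c - x)) \<in> polys_upto k" by (simp add: linear_iff)
  moreover have "P (x - c) + P (c - x) = p x + p (d - x)" for x
    by (simp add: P_def c_def algebra_simps flip: scaleR_add_left)
  ultimately show ?thesis by simp
qed

text \<open>The derivative is represented by a continuous vector field, the form in which the
  gradient of the error is treated later.\<close>

lemma polys_upto_has_gradient:
  assumes "p \<in> polys_upto k"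
  shows "\<exists>G. continuous_on UNIV G \<and> (\<forall>x. (p has_derivative (\<lambda>d. G x \<bullet> d)) (at x))"
  using assms
proof (induction p rule: polys_upto_induct)
  case (monom i j)
  let ?G = "\<lambda>x::real^2. (real i * x $ 1 ^ (i - 1) * x $ 2 ^ j) *\<^sub>R axis 1 1
      + (real j * x $ 1 ^ i * x $ 2 ^ (j - 1)) *\<^sub>R axis 2 (1::real)"
  have "((\<lambda>\<xi>. \<xi> $ 1 ^ i * \<xi> $ 2 ^ j) has_derivative (\<lambda>d. ?G x \<bullet> d)) (at x)" for x
    by (auto intro!: derivative_eq_intros bounded_linear.has_derivative[OF bounded_linear_vec_nth]
        simp: fun_eq_iff inner_add_left inner_axis' algebra_simps)
  moreover have "continuous_on UNIV ?G" by (intro continuous_intros)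
  ultimately show ?case by blast
next
  case (cmult a p)
  then obtain G where "continuous_on UNIV G" "\<And>x. (p has_derivative (\<lambda>d. G x \<bullet> d)) (at x)" by blast
  then have "continuous_on UNIV (\<lambda>x. a *\<^sub>R G x)"
    "\<And>x. ((\<lambda>\<xi>. a * p \<xi>) has_derivative (\<lambda>d. (a *\<^sub>R G x) \<bullet> d)) (at x)"
    by (auto intro!: continuous_intros derivative_eq_intros)
  then show ?case by blast
next
  case (add p q)
  then obtain G H where "continuous_on UNIV G" "\<And>x. (p has_derivative (\<lambda>d. G x \<bullet> d)) (at x)"
    "continuous_on UNIV H" "\<And>x. (q has_derivative (\<lambda>d. H x \<bullet> d)) (at x)" by blast
  then have "continuous_on UNIV (\<lambda>x. G x + H x)"
    "\<And>x. ((\<lambda>\<xi>. p \<xi> + q \<xi>) has_derivative (\<lambda>d. (G x + H x) \<bullet> d)) (at x)"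
    by (auto intro!: continuous_intros derivative_eq_intros simp: inner_add_left)
  then show ?case by blast
next
  case zero
  have "continuous_on UNIV (\<lambda>x::real^2. 0::real^2)"
    "\<And>x::real^2. ((\<lambda>\<xi>. 0) has_derivative (\<lambda>d. (0::real^2) \<bullet> d)) (at x)"
    by auto
  then show ?case by blast
qed

lemma polys_upto_continuous:
  assumes "p \<in> polys_upto k"
  shows "continuous_on S p"
  using polys_upto_has_gradient[OF assms]
  by (metis continuous_at_imp_continuous_on has_derivative_continuous)

section \<open>Unisolvence of the Lagrange nodes and the Lagrange basis\<close>

lemma polys_upto_integer_lattice_unique:
  assumes "p \<in> polys_upto k" "\<And>i j. i + j \<le> k \<Longrightarrow> p (vector [real i, real j]) = 0"
  shows "p = (\<lambda>_. 0)"
  using assms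
proof (induction k arbitrary: p)
  case 0
  obtain c where "p = (\<lambda>\<xi>. \<Sum>i\<le>0. \<Sum>j\<le>0 - i. c i j * (\<xi> $ 1) ^ i * (\<xi> $ 2) ^ j)"
    using 0(1) by (rule polys_uptoE)
  then have "p = (\<lambda>_. c 0 0)" by simp
  then show ?case using 0(2)[of 0 0] by simp
next
  case (Suc k)
  obtain c where p: "p = (\<lambda>\<xi>. \<Sum>i\<le>Suc k. \<Sum>j\<le>Suc k - i. c i j * (\<xi> $ 1) ^ i * (\<xi> $ 2) ^ j)"
    using Suc.prems(1) by (rule polys_uptoE)
  define q where "q = (\<lambda>\<xi>::real^2. \<Sum>i\<le>k. \<Sum>j\<le>k - i. c (Suc i) j * (\<xi> $ 1) ^ i * (\<xi> $ 2) ^ j)"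
  have q: "q \<in> polys_upto k" unfolding q_def by (rule polys_uptoI)
  have split: "p \<xi> = (\<Sum>j\<le>Suc k. c 0 j * (\<xi> $ 2) ^ j) + \<xi> $ 1 * q \<xi>" for \<xi>
    unfolding p q_def by (subst sum.atMost_Suc_shift) (simp add: sum_distrib_left mult_ac del: sum.atMost_Suc)
  \<comment> \<open>On the line \<open>\<xi> $ 1 = 0\<close>, \<open>p\<close> is a polynomial in
    one variable of degree at most \<open>Suc k\<close> with the \<open>k + 2\<close> zeros
    \<open>0, ..., Suc k\<close>. It vanishes on this line, so \<open>\<xi> $ 1\<close> divides
    \<open>p\<close>.\<close>
  have c0: "c 0 j = 0" if "j \<le> Suc k" for j
  proof (rule ccontr)
    assume "c 0 j \<noteq> 0"
    then have "card {z::real. (\<Sum>j\<le>Suc k. c 0 j * z ^ j) = 0} \<le> Suc k"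
      and fin: "finite {z::real. (\<Sum>j\<le>Suc k. c 0 j * z ^ j) = 0}"
      using Transcendental.polyfun_rootbound[of "c 0" j "Suc k"] that by auto
    moreover have "real ` {..Suc k} \<subseteq> {z. (\<Sum>j\<le>Suc k. c 0 j * z ^ j) = 0}"
      using Suc.prems(2)[of 0] split by (force simp: )
    then have "card (real ` {..Suc k}) \<le> card {z. (\<Sum>j\<le>Suc k. c 0 j * z ^ j) = 0}"
      by (rule card_mono[OF fin])
    moreover have "card (real ` {..Suc k}) = Suc (Suc k)"
      by (subst card_image) (auto simp: inj_on_def)
    ultimately show False by simp
  qed
  then have pq: "p \<xi> = \<xi> $ 1 * q \<xi>" for \<xi> using split by simp
  \<comment> \<open>The quotient vanishes at the lattice points whose first coordinate is at least
    1; a shift by one moves them onto the lattice of size \<open>k\<close>.\<close>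
  have "(\<lambda>\<xi>. q (\<xi> + axis 1 1)) = (\<lambda>_. 0)"
  proof (rule Suc.IH)
    show "(\<lambda>\<xi>. q (\<xi> + axis 1 1)) \<in> polys_upto k"
      using polys_upto_compose_affine[OF q, of "\<lambda>x. x"] by (simp add: linear_iff)
    fix i j assume "i + j \<le> k"
    have "vector [real i, real j] + axis 1 1 = (vector [real (Suc i), real j] :: real^2)"
      by (simp add: vec_eq_iff forall_2 axis_def)
    moreover have "real (Suc i) * q (vector [real (Suc i), real j]) = 0"
      using Suc.prems(2)[of "Suc i" j] pq[of "vector [real (Suc i), real j]"] \<open>i + j \<le> k\<close>
      by simp
    ultimately show "q (vector [real i, real j] + axis 1 1) = 0" by (simp del: of_nat_Suc)
  qed
  then have "q \<xi> = 0" for \<xi> by (metis add.commute diff_add_cancel)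
  then show ?case using pq by auto
qed

lemma polys_upto_unique:
  assumes "k \<ge> 1" "p \<in> polys_upto k" "q \<in> polys_upto k" "\<And>\<xi>. \<xi> \<in> lagrange_nodes k \<Longrightarrow> p \<xi> = q \<xi>"
  shows "p = q"
proof -
  \<comment> \<open>Scaling by \<open>k\<close> turns the Lagrange nodes into integer
    points.\<close>
  define r where "r = (\<lambda>\<xi>. p ((1 / real k) *\<^sub>R \<xi>) - q ((1 / real k) *\<^sub>R \<xi>))"
  have "r \<in> polys_upto k" unfolding r_def
    using polys_upto_compose_affine[OF assms(2), of "\<lambda>x. (1 / real k) *\<^sub>R x" 0]
      polys_upto_compose_affine[OF assms(3), of "\<lambda>x. (1 / real k) *\<^sub>R x" 0]
    by (auto intro!: polys_upto_diff simp: linear_iff algebra_simps)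
  moreover have "r (vector [real i, real j]) = 0" if "i + j \<le> k" for i j
  proof -
    have "(1 / real k) *\<^sub>R vector [real i, real j] = (vector [real i / real k, real j / real k] :: real^2)"
      by (simp add: vec_eq_iff forall_2)
    moreover have "\<dots> \<in> lagrange_nodes k" using that unfolding lagrange_nodes_def by blast
    ultimately show ?thesis using assms(4) unfolding r_def by simp
  qed
  ultimately have r0: "r = (\<lambda>_. 0)" by (rule polys_upto_integer_lattice_unique)
  show ?thesis
  proof
    fix \<xi>
    have "r (real k *\<^sub>R \<xi>) = 0" using r0 by simp
    then show "p \<xi> = q \<xi>" using assms(1) by (simp add: r_def)
  qed
qed

text \<open>The Lagrange basis polynomial of a node before normalisation, in barycentric form. Its
  zero lines are the lattice lines on which one of the three barycentric coordinates is smaller than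
  at the node \<open>(i, j)\<close>. There are \<open>i\<close>, \<open>j\<close> and
  \<open>k - i - j\<close> of them, hence the degree \<open>k\<close>.\<close>

definition lattice_poly :: "nat \<Rightarrow> nat \<times> nat \<Rightarrow> real^2 \<Rightarrow> real" where
  "lattice_poly k n \<xi> = (\<Prod>a<fst n. real k * \<xi> $ 1 - real a) * (\<Prod>b<snd n. real k * \<xi> $ 2 - real b)
     * (\<Prod>c<k - fst n - snd n. real k * (1 - \<xi> $ 1 - \<xi> $ 2) - real c)"

abbreviation lattice :: "nat \<Rightarrow> (nat \<times> nat) set" where
  "lattice k \<equiv> {(i, j). i + j \<le> k}"

abbreviation node :: "nat \<Rightarrow> nat \<times> nat \<Rightarrow> real^2" where
  "node k n \<equiv> vector [real (fst n) / real k, real (snd n) / real k]"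

lemma lagrange_nodes_eq: "lagrange_nodes k = node k ` lattice k"
  by (force simp: lagrange_nodes_def)

lemma finite_lattice: "finite (lattice k)"
  by (rule finite_subset[of _ "{..k} \<times> {..k}"]) auto

lemma lattice_poly_in_polys_upto:
  assumes "n \<in> lattice k"
  shows "lattice_poly k n \<in> polys_upto k"
proof -
  have 1: "(\<lambda>\<xi>. real k * \<xi> $ i - real a) \<in> polys_upto 1" for i a
    by (intro polys_upto_diff polys_upto_cmult polys_upto_coord polys_upto_const)
  have 2: "(\<lambda>\<xi>. real k * (1 - \<xi> $ 1 - \<xi> $ 2) - real a) \<in> polys_upto 1" for a
    by (intro polys_upto_diff polys_upto_cmult polys_upto_coord polys_upto_const)
  have "lattice_poly k n \<in> polys_upto (fst n + snd n + (k - fst n - snd n))"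
    unfolding lattice_poly_def[abs_def]
    using polys_upto_prod[of "{..<fst n}"] polys_upto_prod[of "{..<snd n}"] polys_upto_prod[of "{..<k - fst n - snd n}"]
      1 2 by (intro polys_upto_mult) auto
  then show ?thesis using assms by auto
qed

lemma lattice_poly_node_eq_0:
  assumes "k \<ge> 1" "n \<in> lattice k" "m \<in> lattice k" "n \<noteq> m"
  shows "lattice_poly k n (node k m) = 0"
proof -
  obtain i j where n: "n = (i, j)" by fastforce
  obtain i' j' where m: "m = (i', j')" by fastforce
  \<comment> \<open>The three integer barycentric coordinates sum to \<open>k\<close> at both nodes,
    so at a different node one of them is smaller and a factor of the corresponding product
    vanishes.\<close>
  have "i' < i \<or> j' < j \<or> k - i' - j' < k - i - j"
    using assms n m by auto
  moreover have "real k * (1 - real i' / real k - real j' / real k) = real (k - i' - j')"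
    using assms m by (simp add: field_simps of_nat_diff)
  ultimately show ?thesis
    using assms(1) by (auto simp: lattice_poly_def n m prod_zero_iff)
qed

lemma lattice_poly_node_neq_0:
  assumes "k \<ge> 1" "n \<in> lattice k"
  shows "lattice_poly k n (node k n) \<noteq> 0"
proof -
  obtain i j where n: "n = (i, j)" by fastforce
  have "real k * (1 - real i / real k - real j / real k) = real (k - i - j)"
    using assms n by (simp add: field_simps of_nat_diff)
  then show ?thesis
    using assms(1) by (auto simp: lattice_poly_def n)
qed

definition lattice_basis :: "nat \<Rightarrow> nat \<times> nat \<Rightarrow> real^2 \<Rightarrow> real" where
  "lattice_basis k n \<xi> = inverse (lattice_poly k n (node k n)) * lattice_poly k n \<xi>"

lemma lattice_basis_in_polys_upto: "n \<in> lattice k \<Longrightarrow> lattice_basis k n \<in> polys_upto k"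
  unfolding lattice_basis_def[abs_def] by (intro polys_upto_cmult lattice_poly_in_polys_upto)

lemma lattice_basis_node:
  assumes "k \<ge> 1" "n \<in> lattice k" "m \<in> lattice k"
  shows "lattice_basis k n (node k m) = (if n = m then 1 else 0)"
  using lattice_poly_node_eq_0[OF assms] lattice_poly_node_neq_0[OF assms(1,2)]
  by (auto simp: lattice_basis_def)

lemma lagrange_sum:
  assumes "k \<ge> 1"
  shows "(\<lambda>\<xi>. \<Sum>n\<in>lattice k. u (node k n) * lattice_basis k n \<xi>) \<in> polys_upto k"
    and "\<And>\<xi>. \<xi> \<in> lagrange_nodes k \<Longrightarrow> (\<Sum>n\<in>lattice k. u (node k n) * lattice_basis k n \<xi>) = u \<xi>"
proof -
  show "(\<lambda>\<xi>. \<Sum>n\<in>lattice k. u (node k n) * lattice_basis k n \<xi>) \<in> polys_upto k"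
    by (intro polys_upto_sum polys_upto_cmult lattice_basis_in_polys_upto)
  fix \<xi> assume "\<xi> \<in> lagrange_nodes k"
  then obtain m where m: "m \<in> lattice k" "\<xi> = node k m" by (auto simp: lagrange_nodes_eq)
  have "(\<Sum>n\<in>lattice k. u (node k n) * lattice_basis k n \<xi>)
      = (\<Sum>n\<in>lattice k. if n = m then u (node k n) else 0)"
    unfolding m(2) using m(1) by (intro sum.cong) (auto simp: lattice_basis_node[OF assms])
  also have "\<dots> = u \<xi>" using m finite_lattice by (simp add: sum.delta)
  finally show "(\<Sum>n\<in>lattice k. u (node k n) * lattice_basis k n \<xi>) = u \<xi>" .
qed

text \<open>Makes the definite description usable: existence comes from the explicit basis,
  uniqueness from the integer lattice.\<close>

lemma ref_interp_spec:
  assumes "k \<ge> 1"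
  shows "ref_interp k u \<in> polys_upto k \<and> (\<forall>\<xi>\<in>lagrange_nodes k. ref_interp k u \<xi> = u \<xi>)"
proof -
  have "\<exists>!p. p \<in> polys_upto k \<and> (\<forall>\<xi>\<in>lagrange_nodes k. p \<xi> = u \<xi>)"
  proof (rule ex_ex1I)
    show "\<exists>p. p \<in> polys_upto k \<and> (\<forall>\<xi>\<in>lagrange_nodes k. p \<xi> = u \<xi>)"
      by (intro exI[of _ "\<lambda>\<xi>. \<Sum>n\<in>lattice k. u (node k n) * lattice_basis k n \<xi>"] conjI ballI lagrange_sum[OF assms])
  qed (use polys_upto_unique[OF assms] in \<open>metis (no_types, lifting)\<close>)
  from theI'[OF this] show ?thesis unfolding ref_interp_def .
qed

lemma compact_ref_triangle: "compact ref_triangle"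
  unfolding ref_triangle_def by (simp add: finite_imp_compact_convex_hull)

text \<open>The constant is a sum over the nodes of bounds for the basis polynomials on the
  reference triangle. Elements are affine images of this triangle, so the same constant serves every
  element of every mesh, whatever its shape.\<close>

lemma lagrange_stability:
  assumes "k \<ge> 1"
  obtains \<Lambda> where "\<Lambda> \<ge> 0"
    and "\<And>p M \<xi>. p \<in> polys_upto k \<Longrightarrow> (\<And>\<eta>. \<eta> \<in> lagrange_nodes k \<Longrightarrow> \<bar>p \<eta>\<bar> \<le> M) \<Longrightarrow>
      \<xi> \<in> ref_triangle \<Longrightarrow> \<bar>p \<xi>\<bar> \<le> \<Lambda> * M"
proof -
  have "\<exists>B\<ge>0. \<forall>\<xi>\<in>ref_triangle. \<bar>lattice_basis k n \<xi>\<bar> \<le> B" if "n \<in> lattice k" for n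
  proof -
    have "continuous_on ref_triangle (lattice_basis k n)"
      by (rule polys_upto_continuous[OF lattice_basis_in_polys_upto[OF that]])
    then have "bounded (lattice_basis k n ` ref_triangle)"
      by (intro compact_imp_bounded compact_continuous_image compact_ref_triangle)
    then obtain B where "B > 0" "\<forall>x\<in>lattice_basis k n ` ref_triangle. norm x \<le> B"
      unfolding bounded_pos by blast
    then show ?thesis by (intro exI[of _ B]) auto
  qed
  then obtain B where B: "\<And>n. n \<in> lattice k \<Longrightarrow> B n \<ge> 0"
    "\<And>n \<xi>. n \<in> lattice k \<Longrightarrow> \<xi> \<in> ref_triangle \<Longrightarrow> \<bar>lattice_basis k n \<xi>\<bar> \<le> B n"
    by metis
  show ?thesis
  proof
    show "(\<Sum>n\<in>lattice k. B n) \<ge> 0" by (intro sum_nonneg B)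
    fix p M \<xi>
    assume p: "p \<in> polys_upto k" and M: "\<And>\<eta>. \<eta> \<in> lagrange_nodes k \<Longrightarrow> \<bar>p \<eta>\<bar> \<le> M"
      and \<xi>: "\<xi> \<in> ref_triangle"
    have "p = (\<lambda>\<xi>. \<Sum>n\<in>lattice k. p (node k n) * lattice_basis k n \<xi>)"
      using lagrange_sum[OF assms] p by (intro polys_upto_unique[OF assms]) auto
    then have "\<bar>p \<xi>\<bar> = \<bar>\<Sum>n\<in>lattice k. p (node k n) * lattice_basis k n \<xi>\<bar>" by metis
    also have "\<dots> \<le> (\<Sum>n\<in>lattice k. \<bar>p (node k n) * lattice_basis k n \<xi>\<bar>)" by (rule sum_abs)
    also have "\<dots> \<le> (\<Sum>n\<in>lattice k. B n * M)"
    proof (rule sum_mono)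
      fix n assume n: "n \<in> lattice k"
      then have "\<bar>p (node k n)\<bar> \<le> M" by (intro M) (auto simp: lagrange_nodes_eq)
      then show "\<bar>p (node k n) * lattice_basis k n \<xi>\<bar> \<le> B n * M"
        using B[OF n] \<xi> by (simp add: abs_mult mult.commute[of "B n"] mult_mono')
    qed
    finally show "\<bar>p \<xi>\<bar> \<le> (\<Sum>n\<in>lattice k. B n) * M" by (simp add: sum_distrib_right)
  qed
qed

section \<open>Partial derivatives and Taylor expansion\<close>

lemma vec2_axis: "(x::real^2) = x $ 1 *\<^sub>R axis 1 1 + x $ 2 *\<^sub>R axis 2 1"
  by (simp add: vec_eq_iff forall_2 axis_def)

lemma abs_vec2_le: "\<bar>(x::real^2) $ 1\<bar> + \<bar>x $ 2\<bar> \<le> 2 * norm x"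
  using component_le_norm_cart[of x 1] component_le_norm_cart[of x 2] by simp

lemma has_derivative_partial:
  assumes "u differentiable at x"
  shows "(u has_derivative (\<lambda>d. d $ 1 * partial 1 u x + d $ 2 * partial 2 u x)) (at x)"
proof -
  have D: "(u has_derivative frechet_derivative u (at x)) (at x)"
    using assms frechet_derivative_works by blast
  then have lin: "linear (frechet_derivative u (at x))" by (rule has_derivative_linear)
  have "frechet_derivative u (at x) d = d $ 1 * partial 1 u x + d $ 2 * partial 2 u x" for d
    by (subst vec2_axis[of d]) (simp only: linear_add[OF lin] linear_scale[OF lin] partial_def real_scaleR_def)
  then have "frechet_derivative u (at x) = (\<lambda>d. d $ 1 * partial 1 u x + d $ 2 * partial 2 u x)" by auto
  with D show ?thesis by simp
qed

lemma partial_eqI: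
  assumes "(u has_derivative D) (at x)"
  shows "partial i u x = D (axis i 1)"
  using frechet_derivative_at[OF assms] by (simp add: partial_def)

lemma has_real_derivative_along:
  assumes "u differentiable at (y + t *\<^sub>R d)"
  shows "((\<lambda>t. u (y + t *\<^sub>R d)) has_real_derivative
      d $ 1 * partial 1 u (y + t *\<^sub>R d) + d $ 2 * partial 2 u (y + t *\<^sub>R d)) (at t)"
proof -
  have "((\<lambda>t. y + t *\<^sub>R d) has_derivative (\<lambda>h. h *\<^sub>R d)) (at t)"
    by (auto intro!: derivative_eq_intros)
  from has_derivative_compose[OF this has_derivative_partial[OF assms]]
  show ?thesis
    unfolding has_field_derivative_def
    by (rule has_derivative_eq_rhs) (simp add: fun_eq_iff algebra_simps)
qed

lemma has_derivative_cong_open: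
  assumes "open U" "x \<in> U" "\<And>x. x \<in> U \<Longrightarrow> u x = v x"
  shows "(u has_derivative D) (at x) \<longleftrightarrow> (v has_derivative D) (at x)"
  using has_derivative_transform_within_open[OF _ assms(1,2), of u D UNIV v]
    has_derivative_transform_within_open[OF _ assms(1,2), of v D UNIV u] assms(3) by auto

lemma partial_cong_open:
  assumes "open U" "x \<in> U" "\<And>x. x \<in> U \<Longrightarrow> u x = v x"
  shows "partial i u x = partial i v x"
  using has_derivative_cong_open[OF assms] by (simp add: partial_def frechet_derivative_def)

lemma Ck_on_Suc_imp: "Ck_on (Suc m) U u \<Longrightarrow> Ck_on m U u"
  by (induction m arbitrary: u) (auto intro: differentiable_imp_continuous_on)

lemma Ck_on_mono: "Ck_on n U u \<Longrightarrow> m \<le> n \<Longrightarrow> Ck_on m U u"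
  by (induction n) (auto simp: le_Suc_eq dest: Ck_on_Suc_imp simp del: Ck_on.simps)

lemma Ck_on_partial_pow: "Ck_on (a + m) U u \<Longrightarrow> Ck_on m U ((partial i ^^ a) u)"
  by (induction a arbitrary: u) (auto simp: funpow_swap1 simp del: funpow.simps(2) simp: funpow_Suc_right)

section \<open>Symmetry of mixed partial derivatives\<close>

lemma mixed_difference_mvt:
  assumes "0 < s" "open U" "u differentiable_on U" "partial i u differentiable_on U"
    and sub: "\<And>r r'. 0 \<le> r \<Longrightarrow> r \<le> s \<Longrightarrow> 0 \<le> r' \<Longrightarrow> r' \<le> s \<Longrightarrow> x + r *\<^sub>R axis i 1 + r' *\<^sub>R axis j 1 \<in> U"
  shows "\<exists>r r'. 0 \<le> r \<and> r \<le> s \<and> 0 \<le> r' \<and> r' \<le> s \<and>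
    u (x + s *\<^sub>R axis i 1 + s *\<^sub>R axis j 1) - u (x + s *\<^sub>R axis i 1) - u (x + s *\<^sub>R axis j 1) + u x
      = s * s * partial j (partial i u) (x + r *\<^sub>R axis i 1 + r' *\<^sub>R axis j 1)"
proof -
  have along: "((\<lambda>t. v (y + t *\<^sub>R axis l 1)) has_real_derivative partial l v (y + t *\<^sub>R axis l 1)) (at t)"
    if "v differentiable_on U" "y + t *\<^sub>R axis l 1 \<in> U" for v y t l
  proof -
    have "v differentiable at (y + t *\<^sub>R axis l 1)"
      using that by (simp add: differentiable_on_eq_differentiable_at[OF assms(2)])
    from has_real_derivative_along[OF this] show ?thesis
      using exhaust_2[of l] by (auto simp: axis_def)
  qed
  \<comment> \<open>The mean value theorem is applied first in direction \<open>i\<close> to the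
    difference in direction \<open>j\<close>, then in direction \<open>j\<close> to
    \<open>partial i u\<close>. The second difference itself is symmetric in \<open>i\<close> and
    \<open>j\<close>, so exchanging them compares the two mixed derivatives.\<close>
  let ?\<psi> = "\<lambda>r. u (x + s *\<^sub>R axis j 1 + r *\<^sub>R axis i 1) - u (x + r *\<^sub>R axis i 1)"
  have "\<exists>r>0. r < s \<and> ?\<psi> s - ?\<psi> 0
      = (s - 0) * (partial i u (x + s *\<^sub>R axis j 1 + r *\<^sub>R axis i 1) - partial i u (x + r *\<^sub>R axis i 1))"
  proof (rule MVT2[OF assms(1)])
    fix r assume r: "0 \<le> r" "r \<le> s"
    have "x + s *\<^sub>R axis j 1 + r *\<^sub>R axis i 1 \<in> U" "x + r *\<^sub>R axis i 1 \<in> U"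
      using sub[of r s] sub[of r 0] r assms(1) by (auto simp: algebra_simps)
    then show "(?\<psi> has_real_derivative partial i u (x + s *\<^sub>R axis j 1 + r *\<^sub>R axis i 1) - partial i u (x + r *\<^sub>R axis i 1)) (at r)"
      by (intro DERIV_diff along assms(3))
  qed
  then obtain r where r: "0 < r" "r < s" "?\<psi> s - ?\<psi> 0
      = s * (partial i u (x + s *\<^sub>R axis j 1 + r *\<^sub>R axis i 1) - partial i u (x + r *\<^sub>R axis i 1))" by auto
  let ?v = "\<lambda>r'. partial i u (x + r *\<^sub>R axis i 1 + r' *\<^sub>R axis j 1)"
  have "\<exists>r'>0. r' < s \<and> ?v s - ?v 0 = (s - 0) * partial j (partial i u) (x + r *\<^sub>R axis i 1 + r' *\<^sub>R axis j 1)"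
    by (rule MVT2[OF assms(1)], rule along[OF assms(4)]) (use sub r in auto)
  then obtain r' where r': "0 < r'" "r' < s"
    "?v s - ?v 0 = s * partial j (partial i u) (x + r *\<^sub>R axis i 1 + r' *\<^sub>R axis j 1)" by auto
  have "u (x + s *\<^sub>R axis i 1 + s *\<^sub>R axis j 1) - u (x + s *\<^sub>R axis i 1) - u (x + s *\<^sub>R axis j 1) + u x
      = ?\<psi> s - ?\<psi> 0" by (simp add: algebra_simps)
  also have "\<dots> = s * (?v s - ?v 0)" unfolding r(3) by (simp add: algebra_simps)
  finally show ?thesis using r r' by (intro exI[of _ r] exI[of _ r']) simp
qed

lemma partial_commute:
  assumes "open U" "x \<in> U" "Ck_on 2 U u"
  shows "partial 2 (partial 1 u) x = partial 1 (partial 2 u) x"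
proof -
  have u: "u differentiable_on U" "partial i u differentiable_on U" "continuous_on U (partial j (partial i u))" for i j
    using assms(3) by (auto simp: numeral_2_eq_2)
  have close: "\<bar>partial 2 (partial 1 u) x - partial 1 (partial 2 u) x\<bar> \<le> 2 * \<epsilon>" if "\<epsilon> > 0" for \<epsilon>
  proof -
    have "\<exists>\<delta>>0. ball x \<delta> \<subseteq> U \<and> (\<forall>y\<in>ball x \<delta>. \<bar>partial j (partial i u) y - partial j (partial i u) x\<bar> < \<epsilon>)" for i j
    proof -
      have "isCont (partial j (partial i u)) x"
        using u(3) assms(1,2) continuous_on_eq_continuous_at by blast
      then obtain d where "d > 0" "\<And>y. dist y x < d \<Longrightarrow> \<bar>partial j (partial i u) y - partial j (partial i u) x\<bar> < \<epsilon>"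
        using \<open>\<epsilon> > 0\<close> unfolding continuous_at_eps_delta dist_real_def by blast
      moreover obtain d' where "d' > 0" "ball x d' \<subseteq> U" using assms(1,2) openE by blast
      ultimately show ?thesis by (intro exI[of _ "min d d'"]) (auto simp: dist_commute)
    qed
    then obtain \<delta>1 \<delta>2 where \<delta>: "\<delta>1 > 0" "ball x \<delta>1 \<subseteq> U"
      "\<forall>y\<in>ball x \<delta>1. \<bar>partial 2 (partial 1 u) y - partial 2 (partial 1 u) x\<bar> < \<epsilon>" "\<delta>2 > 0"
      "\<forall>y\<in>ball x \<delta>2. \<bar>partial 1 (partial 2 u) y - partial 1 (partial 2 u) x\<bar> < \<epsilon>" by meson
    \<comment> \<open>Points of the square of side \<open>s\<close> are at distance at most
      \<open>2 * s\<close> from \<open>x\<close>, hence inside both balls, whose radii are at least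
      \<open>3 * s\<close>.\<close>
    define s where "s = min \<delta>1 \<delta>2 / 3"
    have s: "s > 0" "3 * s \<le> \<delta>1" "3 * s \<le> \<delta>2" using \<delta> by (auto simp: s_def)
    have near: "x + r *\<^sub>R axis i 1 + r' *\<^sub>R axis j 1 \<in> ball x \<delta>1 \<inter> ball x \<delta>2"
      if "0 \<le> r" "r \<le> s" "0 \<le> r'" "r' \<le> s" for r r' and i j :: 2
    proof -
      have "norm (r *\<^sub>R axis i (1::real) + r' *\<^sub>R axis j 1) \<le> r + r'"
        using norm_triangle_ineq[of "r *\<^sub>R axis i (1::real)" "r' *\<^sub>R axis j 1"] that
        by (simp add: norm_axis_1)
      also have "\<dots> < 3 * s" using that s by simp
      finally show ?thesis
        using s norm_minus_cancel[of "r *\<^sub>R axis i (1::real) + r' *\<^sub>R axis j 1"]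
        by (simp add: dist_norm)
    qed
    have inU: "\<And>r r' i j. 0 \<le> r \<Longrightarrow> r \<le> s \<Longrightarrow> 0 \<le> r' \<Longrightarrow> r' \<le> s \<Longrightarrow> x + r *\<^sub>R axis i 1 + r' *\<^sub>R axis j 1 \<in> U"
      using near \<delta>(2) by blast
    obtain r r' where r: "0 \<le> r" "r \<le> s" "0 \<le> r'" "r' \<le> s"
      "u (x + s *\<^sub>R axis 1 1 + s *\<^sub>R axis 2 1) - u (x + s *\<^sub>R axis 1 1) - u (x + s *\<^sub>R axis 2 1) + u x
      = s * s * partial 2 (partial 1 u) (x + r *\<^sub>R axis 1 1 + r' *\<^sub>R axis 2 1)"
      using mixed_difference_mvt[OF s(1) assms(1) u(1) u(2) inU, of 1 2] by blast
    obtain q q' where q: "0 \<le> q" "q \<le> s" "0 \<le> q'" "q' \<le> s"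
      "u (x + s *\<^sub>R axis 2 1 + s *\<^sub>R axis 1 1) - u (x + s *\<^sub>R axis 2 1) - u (x + s *\<^sub>R axis 1 1) + u x
      = s * s * partial 1 (partial 2 u) (x + q *\<^sub>R axis 2 1 + q' *\<^sub>R axis 1 1)"
      using mixed_difference_mvt[OF s(1) assms(1) u(1) u(2) inU, of 2 1] by blast
    have "s * s * partial 2 (partial 1 u) (x + r *\<^sub>R axis 1 1 + r' *\<^sub>R axis 2 1)
        = s * s * partial 1 (partial 2 u) (x + q *\<^sub>R axis 2 1 + q' *\<^sub>R axis 1 1)"
      using r(5) q(5) by (simp add: algebra_simps)
    then have "partial 2 (partial 1 u) (x + r *\<^sub>R axis 1 1 + r' *\<^sub>R axis 2 1)
        = partial 1 (partial 2 u) (x + q *\<^sub>R axis 2 1 + q' *\<^sub>R axis 1 1)" using s(1) by simp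
    moreover have "\<bar>partial 2 (partial 1 u) (x + r *\<^sub>R axis 1 1 + r' *\<^sub>R axis 2 1) - partial 2 (partial 1 u) x\<bar> < \<epsilon>"
      using near[OF r(1-4)] \<delta>(3) by blast
    moreover have "\<bar>partial 1 (partial 2 u) (x + q *\<^sub>R axis 2 1 + q' *\<^sub>R axis 1 1) - partial 1 (partial 2 u) x\<bar> < \<epsilon>"
      using near[OF q(1-4)] \<delta>(5) by blast
    ultimately show ?thesis by linarith
  qed
  show ?thesis
  proof (rule ccontr)
    assume "\<not> ?thesis"
    then have "\<bar>partial 2 (partial 1 u) x - partial 1 (partial 2 u) x\<bar> > 0" by simp
    with close[of "\<bar>partial 2 (partial 1 u) x - partial 1 (partial 2 u) x\<bar> / 4"] show False by simp
  qed
qed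

text \<open>\<open>mpartial\<close> applies all derivatives in direction 2 before those in direction
  1. A derivative in direction 2 that is taken last has to be moved inside to reach this normal
  form.\<close>

lemma partial_pow_commute:
  assumes "open U" "Ck_on (Suc a) U u" "x \<in> U"
  shows "partial 2 ((partial 1 ^^ a) u) x = (partial 1 ^^ a) (partial 2 u) x"
  using assms(2,3)
proof (induction a arbitrary: x)
  case 0
  then show ?case by simp
next
  case (Suc a)
  have "Ck_on 2 U ((partial 1 ^^ a) u)"
    using Suc.prems(1) by (intro Ck_on_partial_pow) (simp del: Ck_on.simps)
  from partial_commute[OF assms(1) Suc.prems(2) this]
  have "partial 2 ((partial 1 ^^ Suc a) u) x = partial 1 (partial 2 ((partial 1 ^^ a) u)) x" by simp
  also have "\<dots> = partial 1 ((partial 1 ^^ a) (partial 2 u)) x"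
    by (rule partial_cong_open[OF assms(1) Suc.prems(2)], rule Suc.IH[OF Ck_on_Suc_imp[OF Suc.prems(1)]])
  finally show ?case by simp
qed

section \<open>Taylor polynomials with a remainder controlled by the norm of order m\<close>

primrec bounded_partials :: "nat \<Rightarrow> (real^2) set \<Rightarrow> real \<Rightarrow> (real^2 \<Rightarrow> real) \<Rightarrow> bool" where
  "bounded_partials 0 U M u \<longleftrightarrow> (\<forall>x\<in>U. \<bar>u x\<bar> \<le> M)"
| "bounded_partials (Suc j) U M u \<longleftrightarrow> (\<forall>i. bounded_partials j U M (partial i u))"

lemma bounded_partials_cong:
  assumes "open U" "\<And>x. x \<in> U \<Longrightarrow> u x = v x"
  shows "bounded_partials j U M u \<longleftrightarrow> bounded_partials j U M v"
  using assms(2)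
proof (induction j arbitrary: u v)
  case (Suc j)
  have "bounded_partials j U M (partial i u) \<longleftrightarrow> bounded_partials j U M (partial i v)" for i
    by (rule Suc.IH) (rule partial_cong_open[OF assms(1) _ Suc.prems])
  then show ?case by simp
qed simp

text \<open>Directional derivatives expand into partial derivatives in every order, whereas the
  hypothesis bounds only the order fixed by \<open>mpartial\<close>. Symmetry of the mixed
  derivatives closes the gap.\<close>

lemma bounded_partials_mpartial:
  assumes "open U" "Ck_on m U u" "\<And>\<beta> x. mi_order \<beta> = m \<Longrightarrow> x \<in> U \<Longrightarrow> \<bar>mpartial \<beta> u x\<bar> \<le> M"
  shows "bounded_partials m U M u"
proof -
  \<comment> \<open>Generalised to an inner part that is already in normal form: a further
    \<open>partial 1\<close> keeps it so, a further \<open>partial 2\<close> is commuted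
    inside.\<close>
  have "bounded_partials j U M ((partial 1 ^^ a) ((partial 2 ^^ b) u))" if "j + (a + b) = m" for j a b
    using that
  proof (induction j arbitrary: a b)
    case 0
    then show ?case using assms(3)[of "vector [a, b]"] by (simp add: mi_order_def mpartial_def)
  next
    case (Suc j)
    have "bounded_partials j U M (partial 1 ((partial 1 ^^ a) ((partial 2 ^^ b) u)))"
      using Suc.IH[of "Suc a" b] Suc.prems by simp
    moreover have "bounded_partials j U M (partial 2 ((partial 1 ^^ a) ((partial 2 ^^ b) u)))"
    proof -
      have "Ck_on (Suc a) U ((partial 2 ^^ b) u)"
        using Suc.prems by (intro Ck_on_partial_pow Ck_on_mono[OF assms(2)]) simp
      then have eq: "\<And>x. x \<in> U \<Longrightarrow> partial 2 ((partial 1 ^^ a) ((partial 2 ^^ b) u)) x = (partial 1 ^^ a) ((partial 2 ^^ Suc b) u) x"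
        using partial_pow_commute[OF assms(1)] by simp
      have "bounded_partials j U M ((partial 1 ^^ a) ((partial 2 ^^ Suc b) u))"
        by (rule Suc.IH) (use Suc.prems in simp)
      then show ?thesis
        using bounded_partials_cong[of U _ "(partial 1 ^^ a) ((partial 2 ^^ Suc b) u)", OF assms(1) eq] by blast
    qed
    ultimately show ?case unfolding bounded_partials.simps(2) forall_2 by blast
  qed
  from this[of m 0 0] show ?thesis by simp
qed

text \<open>The \<open>j\<close>-th derivative in the constant direction \<open>d\<close>, expanded
  into partial derivatives of \<open>u\<close>. For a fixed point \<open>z\<close> this is visibly a
  polynomial in \<open>d\<close>, which puts the Taylor sum into \<open>polys_upto\<close>.\<close>

primrec dir_deriv :: "real^2 \<Rightarrow> nat \<Rightarrow> (real^2 \<Rightarrow> real) \<Rightarrow> real^2 \<Rightarrow> real" where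
  "dir_deriv d 0 u = u"
| "dir_deriv d (Suc j) u = (\<lambda>z. d $ 1 * dir_deriv d j (partial 1 u) z + d $ 2 * dir_deriv d j (partial 2 u) z)"

lemma dir_deriv_has_real_derivative:
  assumes "open U" "Ck_on (Suc j) U u" "y + t *\<^sub>R d \<in> U"
  shows "((\<lambda>t. dir_deriv d j u (y + t *\<^sub>R d)) has_real_derivative dir_deriv d (Suc j) u (y + t *\<^sub>R d)) (at t)"
  using assms(2)
proof (induction j arbitrary: u)
  case 0
  then show ?case using has_real_derivative_along[of u y t d] assms(3)
    by (simp add: differentiable_on_eq_differentiable_at[OF assms(1)])
next
  case (Suc j)
  have "((\<lambda>t. dir_deriv d j (partial i u) (y + t *\<^sub>R d)) has_real_derivative
      dir_deriv d (Suc j) (partial i u) (y + t *\<^sub>R d)) (at t)" for i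
    by (rule Suc.IH) (use Suc.prems in auto)
  then show ?case
    by (subst (1) dir_deriv.simps, subst dir_deriv.simps(2)) (intro DERIV_add DERIV_cmult)
qed

lemma dir_deriv_in_polys_upto: "(\<lambda>d. dir_deriv d j u z) \<in> polys_upto j"
proof (induction j arbitrary: u)
  case 0
  then show ?case by (simp add: polys_upto_const)
next
  case (Suc j)
  then show ?case using polys_upto_mult[OF polys_upto_coord]
    by (auto intro!: polys_upto_add)
qed

lemma abs_dir_deriv_le:
  assumes "bounded_partials j U M u" "x \<in> U"
  shows "\<bar>dir_deriv d j u x\<bar> \<le> (\<bar>d $ 1\<bar> + \<bar>d $ 2\<bar>) ^ j * M"
  using assms(1)
proof (induction j arbitrary: u)
  case 0
  then show ?case using assms(2) by simp
next
  case (Suc j)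
  have "\<bar>dir_deriv d (Suc j) u x\<bar> \<le> \<bar>d $ 1\<bar> * \<bar>dir_deriv d j (partial 1 u) x\<bar> + \<bar>d $ 2\<bar> * \<bar>dir_deriv d j (partial 2 u) x\<bar>"
    using abs_triangle_ineq by (simp add: abs_mult[symmetric])
  also have "\<dots> \<le> \<bar>d $ 1\<bar> * ((\<bar>d $ 1\<bar> + \<bar>d $ 2\<bar>) ^ j * M) + \<bar>d $ 2\<bar> * ((\<bar>d $ 1\<bar> + \<bar>d $ 2\<bar>) ^ j * M)"
    using Suc.prems by (intro add_mono mult_left_mono Suc.IH) auto
  finally show ?case by (simp add: algebra_simps)
qed

text \<open>Maclaurin's formula along the segment from \<open>y\<close> to \<open>x\<close>. The
  factor \<open>2 ^ m\<close> comes from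
  \<open>\<bar>d $ 1\<bar> + \<bar>d $ 2\<bar> \<le> 2 * norm d\<close>; the factorial in the
  remainder is estimated by 1.\<close>

lemma taylor_polys_upto:
  assumes "open U" "convex U" "y \<in> U" "Ck_on m U u" "m \<ge> 1"
    and bound: "\<And>\<beta> x. mi_order \<beta> = m \<Longrightarrow> x \<in> U \<Longrightarrow> \<bar>mpartial \<beta> u x\<bar> \<le> M"
  shows "\<exists>p\<in>polys_upto (m - 1). \<forall>x\<in>U. \<bar>u x - p x\<bar> \<le> 2 ^ m * M * norm (x - y) ^ m"
proof -
  define p where "p = (\<lambda>x. \<Sum>j<m. inverse (fact j) * dir_deriv (x + (- y)) j u y)"
  have "(\<lambda>x. dir_deriv (x + (- y)) j u y) \<in> polys_upto (m - 1)" if "j < m" for j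
    by (rule polys_upto_mono[OF polys_upto_compose_affine[OF dir_deriv_in_polys_upto, of "\<lambda>x. x"]])
      (use that in \<open>auto simp: linear_iff\<close>)
  then have "p \<in> polys_upto (m - 1)"
    unfolding p_def by (intro polys_upto_sum polys_upto_cmult) auto
  moreover have "\<bar>u x - p x\<bar> \<le> 2 ^ m * M * norm (x - y) ^ m" if x: "x \<in> U" for x
  proof -
    define d where "d = x - y"
    have seg: "y + t *\<^sub>R d \<in> U" if "0 \<le> t" "t \<le> 1" for t
      using convexD_alt[OF assms(2,3) x that] by (simp add: d_def algebra_simps)
    have "\<exists>t::real. 0 < t \<and> t < 1 \<and> u (y + 1 *\<^sub>R d) =
        (\<Sum>j<m. (dir_deriv d j u (y + 0 *\<^sub>R d) / fact j) * 1 ^ j) + (dir_deriv d m u (y + t *\<^sub>R d) / fact m) * 1 ^ m"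
    proof (rule Maclaurin)
      show "\<forall>j t. j < m \<and> 0 \<le> t \<and> t \<le> 1 \<longrightarrow>
        DERIV (\<lambda>t. dir_deriv d j u (y + t *\<^sub>R d)) t :> dir_deriv d (Suc j) u (y + t *\<^sub>R d)"
        using dir_deriv_has_real_derivative[OF assms(1) Ck_on_mono[OF assms(4)]] seg by simp
    qed (use assms(5) in auto)
    then obtain t where t: "0 < t" "t < 1"
      "u x = (\<Sum>j<m. dir_deriv d j u y / fact j) + dir_deriv d m u (y + t *\<^sub>R d) / fact m"
      by (auto simp: d_def)
    have pos: "0 \<le> M" using bound[of "vector [m, 0]" y] assms(3) by (force simp: mi_order_def)
    have "\<bar>u x - p x\<bar> = \<bar>dir_deriv d m u (y + t *\<^sub>R d)\<bar> / fact m"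
    proof -
      have "u x - p x = dir_deriv d m u (y + t *\<^sub>R d) / fact m"
        unfolding t(3) p_def by (simp add: d_def divide_inverse mult.commute)
      then show ?thesis by simp
    qed
    also have "\<dots> \<le> \<bar>dir_deriv d m u (y + t *\<^sub>R d)\<bar> / 1"
      by (rule divide_left_mono) auto
    also have "\<dots> \<le> (\<bar>d $ 1\<bar> + \<bar>d $ 2\<bar>) ^ m * M"
      using abs_dir_deriv_le[OF bounded_partials_mpartial[OF assms(1,4) bound] seg[of t]] t by simp
    also have "\<dots> \<le> (2 * norm d) ^ m * M"
      by (intro mult_right_mono power_mono abs_vec2_le pos) auto
    finally show ?thesis by (simp add: d_def power_mult_distrib mult_ac)
  qed
  ultimately show ?thesis by blast
qed

text \<open>The supremum in \<open>Ck_norm\<close> dominates its members only if they are bounded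
  above; the continuous extension of the derivative to the compact set provides this.\<close>

lemma abs_mpartial_le_Ck_norm:
  assumes "Ck_closed n S u" "compact S" "mi_order \<beta> \<le> m" "m \<le> n" "x \<in> interior S"
  shows "\<bar>mpartial \<beta> u x\<bar> \<le> Ck_norm m S u"
proof -
  obtain v where v: "continuous_on S v" "\<And>x. x \<in> interior S \<Longrightarrow> v x = mpartial \<beta> u x"
    using assms unfolding Ck_closed_def by (meson order_trans)
  have "bounded (v ` S)" using v(1) assms(2) by (intro compact_imp_bounded compact_continuous_image)
  then obtain B where "\<And>x. x \<in> S \<Longrightarrow> \<bar>v x\<bar> \<le> B" unfolding bounded_iff by auto
  then have "bdd_above ((\<lambda>x. \<bar>mpartial \<beta> u x\<bar>) ` interior S)"
  proof (intro bdd_aboveI2[of _ _ B])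
    fix x assume "x \<in> interior S"
    then show "\<bar>mpartial \<beta> u x\<bar> \<le> B"
      using v(2)[of x] \<open>\<And>x. x \<in> S \<Longrightarrow> \<bar>v x\<bar> \<le> B\<close>[of x] interior_subset[of S] by auto
  qed
  then have "\<bar>mpartial \<beta> u x\<bar> \<le> (SUP x\<in>interior S. \<bar>mpartial \<beta> u x\<bar>)"
    using assms(5) by (rule cSUP_upper2) auto
  also have "\<dots> \<le> Ck_norm m S u"
    unfolding Ck_norm_def using assms(3) by (intro Max_ge finite_imageI finite_mi_order_le) auto
  finally show ?thesis .
qed

text \<open>Derivatives are available only in the interior, so the estimate is obtained there and
  passes to the boundary by continuity of \<open>f\<close>. The interior centre also shows that
  \<open>\<Omega>\<close> is the closure of its interior.\<close>

lemma taylor_Ck_closed: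
  assumes "Ck_closed n \<Omega> f" "compact \<Omega>" "convex \<Omega>" "y \<in> interior \<Omega>" "1 \<le> m" "m \<le> n"
  shows "\<exists>p\<in>polys_upto (m - 1). \<forall>x\<in>\<Omega>. \<bar>f x - p x\<bar> \<le> 2 ^ m * Ck_norm m \<Omega> f * norm (x - y) ^ m"
proof -
  have "Ck_on m (interior \<Omega>) f"
    using assms(1,6) Ck_on_mono unfolding Ck_closed_def by blast
  then obtain p where p: "p \<in> polys_upto (m - 1)"
    "\<And>x. x \<in> interior \<Omega> \<Longrightarrow> \<bar>f x - p x\<bar> \<le> 2 ^ m * Ck_norm m \<Omega> f * norm (x - y) ^ m"
    using taylor_polys_upto[of "interior \<Omega>" y m f "Ck_norm m \<Omega> f"] assms
      abs_mpartial_le_Ck_norm[OF assms(1,2)] by (auto simp: convex_interior)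
  have cl: "closure (interior \<Omega>) = \<Omega>"
    using assms by (metis closure_closed compact_imp_closed convex_closure_interior empty_iff)
  have cont: "continuous_on \<Omega> f" using assms(1) by (simp add: Ck_closed_def)
  have "\<bar>f x - p x\<bar> - 2 ^ m * Ck_norm m \<Omega> f * norm (x - y) ^ m \<le> 0" if "x \<in> \<Omega>" for x
  proof (rule continuous_le_on_closure[of "interior \<Omega>" "\<lambda>x. \<bar>f x - p x\<bar> - 2 ^ m * Ck_norm m \<Omega> f * norm (x - y) ^ m"])
    show "continuous_on (closure (interior \<Omega>)) (\<lambda>x. \<bar>f x - p x\<bar> - 2 ^ m * Ck_norm m \<Omega> f * norm (x - y) ^ m)"
      unfolding cl by (intro continuous_intros cont polys_upto_continuous[OF p(1)])
  qed (use that p(2) cl in auto)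
  then show ?thesis using p(1) by (intro bexI[of _ p]) auto
qed

section \<open>Triangles\<close>

text \<open>The determinant of two edge vectors: nonzero for a nondegenerate triangle, and the
  Jacobian of \<open>par v a b\<close>.\<close>

definition crs :: "real^2 \<Rightarrow> real^2 \<Rightarrow> real" where
  "crs a b = a $ 1 * b $ 2 - a $ 2 * b $ 1"

definition par :: "real^2 \<Rightarrow> real^2 \<Rightarrow> real^2 \<Rightarrow> real^2 \<Rightarrow> real^2" where
  "par v a b \<xi> = v + \<xi> $ 1 *\<^sub>R a + \<xi> $ 2 *\<^sub>R b"

definition tri :: "real^2 \<Rightarrow> real^2 \<Rightarrow> real^2 \<Rightarrow> (real^2) set" where
  "tri v a b = par v a b ` ref_triangle"

text \<open>
  Coordinates in the affine frame \<open>(v; a, b)\<close>, by Cramer's rule; they are \<open>0\<close> if \<open>crs a b = 0\<close>.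
\<close>

definition co1 :: "real^2 \<Rightarrow> real^2 \<Rightarrow> real^2 \<Rightarrow> real^2 \<Rightarrow> real" where
  "co1 v a b x = crs (x - v) b / crs a b"

definition co2 :: "real^2 \<Rightarrow> real^2 \<Rightarrow> real^2 \<Rightarrow> real^2 \<Rightarrow> real" where
  "co2 v a b x = crs a (x - v) / crs a b"

lemma ref_triangle_eq: "ref_triangle = {\<xi>. 0 \<le> \<xi> $ 1 \<and> 0 \<le> \<xi> $ 2 \<and> \<xi> $ 1 + \<xi> $ 2 \<le> 1}"
proof -
  have "(\<xi>::real^2) = 0 + \<xi> $ 1 *\<^sub>R (axis 1 1 - 0) + \<xi> $ 2 *\<^sub>R (axis 2 1 - 0)" for \<xi>
    by (simp add: vec_eq_iff forall_2 axis_def)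
  then show ?thesis unfolding ref_triangle_def convex_hull_3_alt
    by (fastforce simp: axis_def)
qed

lemma par_coords:
  assumes "crs a b \<noteq> 0"
  shows "x = v + co1 v a b x *\<^sub>R a + co2 v a b x *\<^sub>R b"
proof -
  have "x $ i = v $ i + co1 v a b x * a $ i + co2 v a b x * b $ i" for i
    using assms exhaust_2[of i] by (auto simp: co1_def co2_def field_simps) (auto simp: crs_def algebra_simps)
  then show ?thesis by (simp add: vec_eq_iff)
qed

lemma coords_par:
  assumes "crs a b \<noteq> 0"
  shows "co1 v a b (v + s *\<^sub>R a + t *\<^sub>R b) = s" "co2 v a b (v + s *\<^sub>R a + t *\<^sub>R b) = t"
  using assms by (simp_all add: co1_def co2_def field_simps) (simp_all add: crs_def algebra_simps)

lemma tri_eq: "tri v a b = {v + s *\<^sub>R a + t *\<^sub>R b | s t. 0 \<le> s \<and> 0 \<le> t \<and> s + t \<le> 1}"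
proof (intro subset_antisym subsetI)
  fix x assume "x \<in> {v + s *\<^sub>R a + t *\<^sub>R b | s t. 0 \<le> s \<and> 0 \<le> t \<and> s + t \<le> 1}"
  then obtain s t where "x = par v a b (vector [s, t])" "0 \<le> s" "0 \<le> t" "s + t \<le> 1"
    by (auto simp: par_def)
  then show "x \<in> tri v a b" unfolding tri_def ref_triangle_eq by auto
qed (auto simp: tri_def par_def ref_triangle_eq)

lemma tri_memI: "0 \<le> s \<Longrightarrow> 0 \<le> t \<Longrightarrow> s + t \<le> 1 \<Longrightarrow> v + s *\<^sub>R a + t *\<^sub>R b \<in> tri v a b"
  unfolding tri_eq by blast

lemma mem_tri_iff:
  assumes "crs a b \<noteq> 0"
  shows "x \<in> tri v a b \<longleftrightarrow> 0 \<le> co1 v a b x \<and> 0 \<le> co2 v a b x \<and> co1 v a b x + co2 v a b x \<le> 1"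
proof
  assume "x \<in> tri v a b"
  then show "0 \<le> co1 v a b x \<and> 0 \<le> co2 v a b x \<and> co1 v a b x + co2 v a b x \<le> 1"
    unfolding tri_eq using coords_par[OF assms] by auto
next
  assume "0 \<le> co1 v a b x \<and> 0 \<le> co2 v a b x \<and> co1 v a b x + co2 v a b x \<le> 1"
  then have "v + co1 v a b x *\<^sub>R a + co2 v a b x *\<^sub>R b \<in> tri v a b" by (intro tri_memI) auto
  then show "x \<in> tri v a b" unfolding par_coords[OF assms, symmetric] .
qed

lemma tri_eq_hull: "tri v a b = convex hull {v, v + a, v + b}"
  unfolding tri_eq convex_hull_3_alt by simp

lemma compact_tri: "compact (tri v a b)"
  unfolding tri_eq_hull by (simp add: finite_imp_compact_convex_hull)

lemma closed_tri: "closed (tri v a b)"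
  using compact_tri compact_imp_closed by blast

lemma continuous_on_co:
  "continuous_on S (co1 v a b)" "continuous_on S (co2 v a b)"
  unfolding co1_def[abs_def] co2_def[abs_def] crs_def divide_inverse by (auto intro!: continuous_intros)

text \<open>An explicit open subset of the triangle. Its points are interior by openness and
  inclusion, without determining \<open>interior (tri v a b)\<close>.\<close>

definition otri :: "real^2 \<Rightarrow> real^2 \<Rightarrow> real^2 \<Rightarrow> (real^2) set" where
  "otri v a b = {x. 0 < co1 v a b x \<and> 0 < co2 v a b x \<and> co1 v a b x + co2 v a b x < 1}"

lemma open_otri: "open (otri v a b)"
  unfolding otri_def by (intro open_Collect_conj open_Collect_less continuous_intros continuous_on_co)

lemma otri_subset: "crs a b \<noteq> 0 \<Longrightarrow> otri v a b \<subseteq> tri v a b"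
  by (auto simp: otri_def mem_tri_iff)

lemma otri_subset_interior: "crs a b \<noteq> 0 \<Longrightarrow> otri v a b \<subseteq> interior (tri v a b)"
  by (simp add: interior_maximal open_otri otri_subset)

lemma otriI:
  assumes "crs a b \<noteq> 0" "0 < s" "0 < t" "s + t < 1"
  shows "v + s *\<^sub>R a + t *\<^sub>R b \<in> otri v a b"
  using assms coords_par[OF assms(1)] by (simp add: otri_def)

lemma otri_nonempty: "crs a b \<noteq> 0 \<Longrightarrow> v + (1/3) *\<^sub>R a + (1/3) *\<^sub>R b \<in> otri v a b"
  by (rule otriI) auto

lemma interior_tri_nonempty: "crs a b \<noteq> 0 \<Longrightarrow> interior (tri v a b) \<noteq> {}"
  using otri_nonempty otri_subset_interior by blast

lemma linear_2: "linear (\<lambda>\<xi>::real^2. \<xi> $ 1 *\<^sub>R a + \<xi> $ 2 *\<^sub>R b)"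
  by (auto simp: linear_iff algebra_simps)

lemma inv_par:
  assumes "crs a b \<noteq> 0"
  shows "inv (par v a b) = (\<lambda>x. vector [co1 v a b x, co2 v a b x])"
  by (rule inv_equality)
    (use par_coords[OF assms, of _ v, symmetric] in \<open>auto simp: par_def coords_par[OF assms] vec_eq_iff forall_2\<close>)

lemma affine_ref_mapE:
  assumes "affine_ref_map F T"
  obtains v a b where "F = par v a b" "crs a b \<noteq> 0" "T = tri v a b"
proof -
  obtain A c where A: "linear A" "F = (\<lambda>\<xi>. A \<xi> + c)" and bij: "bij F" and T: "F ` ref_triangle = T"
    using assms unfolding affine_ref_map_def by blast
  define a where "a = A (axis 1 1)"
  define b where "b = A (axis 2 1)"
  have "A \<xi> = \<xi> $ 1 *\<^sub>R a + \<xi> $ 2 *\<^sub>R b" for \<xi>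
    by (subst vec2_axis[of \<xi>]) (simp only: linear_add[OF A(1)] linear_scale[OF A(1)] a_def b_def)
  then have F: "F = par c a b" by (auto simp: A(2) par_def fun_eq_iff)
  moreover have "crs a b \<noteq> 0"
  proof
    assume 0: "crs a b = 0"
    \<comment> \<open>The linear part annihilates both vectors if the determinant is 0. Injectivity
      makes the vectors 0, so \<open>a\<close> and \<open>b\<close> are 0 and the map is constant,
      which injectivity forbids again.\<close>
    have "F (vector [b $ 1, - a $ 1]) = F 0" "F (vector [b $ 2, - a $ 2]) = F 0"
      using 0 by (auto simp: F par_def crs_def vec_eq_iff forall_2 algebra_simps)
    then have "vector [b $ 1, - a $ 1] = (0 :: real^2)" "vector [b $ 2, - a $ 2] = (0 :: real^2)"
      using injD[OF bij_is_inj[OF bij]] by blast+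
    then have "a = 0" "b = 0" by (auto simp: vec_eq_iff forall_2)
    then have "F (axis 1 1) = F 0" by (simp add: F par_def)
    then show False using bij by (auto dest!: bij_is_inj injD simp: axis_eq_0_iff)
  qed
  ultimately show ?thesis using that[of c a b] T by (simp add: tri_def)
qed

lemma collinear_translate: "collinear {v, v + a, v + b} \<longleftrightarrow> collinear {0, a, b}"
  by (auto simp: collinear_def)

lemma tri_affine_independent:
  assumes "crs a b \<noteq> 0"
  shows "\<not> affine_dependent {v, v + a, v + b}" "a \<noteq> 0" "b \<noteq> 0" "a \<noteq> b"
proof -
  show "a \<noteq> 0" "b \<noteq> 0" "a \<noteq> b" using assms by (auto simp: crs_def)
  have "\<not> collinear {0, a, b}"
    using assms by (auto simp: collinear_lemma crs_def)
  moreover have "collinear {v, v + a, v + b} \<longleftrightarrow> collinear {0, a, b}"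
    by (rule collinear_translate)
  ultimately show "\<not> affine_dependent {v, v + a, v + b}"
    using collinear_3_eq_affine_dependent by blast
qed

lemma crs_neq_0:
  assumes "\<not> collinear {0, a, b}"
  shows "crs a b \<noteq> 0"
proof
  have nc: "a \<noteq> 0" "b \<noteq> 0" "\<And>c. b \<noteq> c *\<^sub>R a" using assms by (auto simp: collinear_lemma)
  assume 0: "crs a b = 0"
  show False
  proof (cases "a $ 1 = 0")
    case True
    then have "a $ 2 \<noteq> 0" using nc(1) by (auto simp: vec_eq_iff forall_2)
    then show False using nc(3)[of "b $ 2 / a $ 2"] True 0 by (auto simp: vec_eq_iff forall_2 crs_def)
  next
    case False
    then show False using nc(3)[of "b $ 1 / a $ 1"] 0 by (auto simp: vec_eq_iff forall_2 crs_def field_simps)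
  qed
qed

lemma two_simplexE:
  assumes "2 simplex S"
  obtains v a b where "S = tri v a b" "crs a b \<noteq> 0"
proof -
  obtain C where C: "\<not> affine_dependent C" "int (card C) = 3" "S = convex hull C"
    using assms by (auto simp: simplex_def)
  then have "card C = 3" by simp
  then obtain x y z where xyz: "C = {x, y, z}" "x \<noteq> y" "y \<noteq> z" "x \<noteq> z"
    by (auto simp: card_3_iff)
  define a where "a = y - x"
  define b where "b = z - x"
  have S: "S = tri x a b" unfolding C(3) xyz(1) tri_eq_hull by (simp add: a_def b_def)
  have "\<not> collinear {x, y, z}" using C(1) xyz by (simp add: collinear_3_eq_affine_dependent)
  moreover have "collinear {x, y, z} \<longleftrightarrow> collinear {0, a, b}"
    using collinear_translate[of x a b] by (simp add: a_def b_def)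
  ultimately have "crs a b \<noteq> 0" using crs_neq_0 by blast
  with S show ?thesis using that by blast
qed

lemma tri_rotate: "tri v a b = tri (v + a) (b - a) (- a)" "tri v a b = tri v b a"
  unfolding tri_eq_hull by (simp_all add: insert_commute)

lemma crs_rotate: "crs (b - a) (- a) = crs a b" "crs b a = - crs a b" "crs (- a) (- b) = crs a b"
  by (simp_all add: crs_def algebra_simps)

text \<open>The nodes expressed by the three vertices, a form that is symmetric in them.\<close>

definition bary_nodes :: "nat \<Rightarrow> real^2 \<Rightarrow> real^2 \<Rightarrow> real^2 \<Rightarrow> (real^2) set" where
  "bary_nodes k p q r = {(1 / real k) *\<^sub>R (real l *\<^sub>R p + real i *\<^sub>R q + real j *\<^sub>R r) | l i j. l + i + j = k}"

lemma bary_nodes_swap: "bary_nodes k p q r = bary_nodes k q p r" "bary_nodes k p q r = bary_nodes k p r q"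
proof -
  have 1: "bary_nodes k p q r \<subseteq> bary_nodes k q p r" for p q r
  proof
    fix x assume "x \<in> bary_nodes k p q r"
    then obtain l i j where "l + i + j = k" "x = (1 / real k) *\<^sub>R (real l *\<^sub>R p + real i *\<^sub>R q + real j *\<^sub>R r)"
      unfolding bary_nodes_def by blast
    then show "x \<in> bary_nodes k q p r"
      unfolding bary_nodes_def by (intro CollectI exI[of _ i] exI[of _ l] exI[of _ j]) (simp add: add_ac)
  qed
  have 2: "bary_nodes k p q r \<subseteq> bary_nodes k p r q" for p q r
  proof
    fix x assume "x \<in> bary_nodes k p q r"
    then obtain l i j where "l + i + j = k" "x = (1 / real k) *\<^sub>R (real l *\<^sub>R p + real i *\<^sub>R q + real j *\<^sub>R r)"
      unfolding bary_nodes_def by blast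
    then show "x \<in> bary_nodes k p r q"
      unfolding bary_nodes_def by (intro CollectI exI[of _ l] exI[of _ j] exI[of _ i]) (simp add: add_ac)
  qed
  show "bary_nodes k p q r = bary_nodes k q p r" "bary_nodes k p q r = bary_nodes k p r q"
    using 1 2 by blast+
qed

lemma par_lagrange_nodes:
  assumes "k \<ge> 1"
  shows "par v a b ` lagrange_nodes k = bary_nodes k v (v + a) (v + b)"
proof -
  have *: "par v a b (vector [real i / real k, real j / real k]) =
      (1 / real k) *\<^sub>R (real (k - i - j) *\<^sub>R v + real i *\<^sub>R (v + a) + real j *\<^sub>R (v + b))" if "i + j \<le> k" for i j
  proof -
    have "v = (1 / real k) *\<^sub>R ((real (k - i - j) + real i + real j) *\<^sub>R v)"
      using assms that by (simp add: of_nat_diff)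
    then show ?thesis
      unfolding par_def by (simp add: scaleR_add_right scaleR_add_left add.assoc del: of_nat_diff)
  qed
  show ?thesis
  proof (intro subset_antisym subsetI)
    fix x assume "x \<in> par v a b ` lagrange_nodes k"
    then obtain i j where ij: "i + j \<le> k" "x = par v a b (vector [real i / real k, real j / real k])"
      unfolding lagrange_nodes_def by blast
    then show "x \<in> bary_nodes k v (v + a) (v + b)"
      unfolding bary_nodes_def using *[OF ij(1)] by (intro CollectI exI[of _ "k - i - j"] exI[of _ i] exI[of _ j]) simp
  next
    fix x assume "x \<in> bary_nodes k v (v + a) (v + b)"
    then obtain l i j where ij: "l + i + j = k"
      "x = (1 / real k) *\<^sub>R (real l *\<^sub>R v + real i *\<^sub>R (v + a) + real j *\<^sub>R (v + b))"
      unfolding bary_nodes_def by blast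
    moreover have "l = k - i - j" "i + j \<le> k" using ij(1) by auto
    ultimately have "x = par v a b (vector [real i / real k, real j / real k])" using *[of i j] by simp
    then show "x \<in> par v a b ` lagrange_nodes k"
      unfolding lagrange_nodes_def using \<open>i + j \<le> k\<close> by blast
  qed
qed

text \<open>Two parametrisations of one triangle have the same vertices up to order, since these are
  its extreme points, and the node set is symmetric in the vertices. This matters because the
  definition of the interpolant leaves its reference map open.\<close>

lemma par_lagrange_nodes_unique:
  assumes "k \<ge> 1" "crs a b \<noteq> 0" "crs a' b' \<noteq> 0" "tri v a b = tri v' a' b'"
  shows "par v a b ` lagrange_nodes k = par v' a' b' ` lagrange_nodes k"
proof -
  have ext: "{x. x extreme_point_of tri v a b} = {v, v + a, v + b}" if "crs a b \<noteq> 0" for v a b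
    unfolding tri_eq_hull
    using extreme_point_of_convex_hull_affine_independent[OF tri_affine_independent(1)[OF that]] by auto
  have distinct: "v \<noteq> v + a" "v \<noteq> v + b" "v + a \<noteq> v + b" "v' \<noteq> v' + a'" "v' \<noteq> v' + b'" "v' + a' \<noteq> v' + b'"
    using tri_affine_independent[OF assms(2)] tri_affine_independent[OF assms(3)] by auto
  have "bary_nodes k p q r = bary_nodes k p' q' r'"
    if "{p, q, r} = {p', q', r'}" "p \<noteq> q" "p \<noteq> r" "q \<noteq> r" "p' \<noteq> q'" "p' \<noteq> r'" "q' \<noteq> r'" for p q r p' q' r'
  proof -
    have "p \<in> {p', q', r'}" "q \<in> {p', q', r'}" "r \<in> {p', q', r'}" using that(1) by blast+
    then have "(p = p' \<and> q = q' \<and> r = r') \<or> (p = p' \<and> q = r' \<and> r = q') \<or> (p = q' \<and> q = p' \<and> r = r')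
      \<or> (p = q' \<and> q = r' \<and> r = p') \<or> (p = r' \<and> q = p' \<and> r = q') \<or> (p = r' \<and> q = q' \<and> r = p')"
      using that(2-4) by blast
    then show ?thesis
      by (elim disjE conjE, simp_all) (metis bary_nodes_swap)+
  qed
  then show ?thesis
    unfolding par_lagrange_nodes[OF assms(1)]
    using ext[OF assms(2), of v] ext[OF assms(3), of v'] assms(4) distinct by metis
qed

lemma co_in_polys_upto: "co1 v a b \<in> polys_upto 1" "co2 v a b \<in> polys_upto 1"
proof -
  have "co1 v a b = (\<lambda>x. (inverse (crs a b) * b $ 2) * (x $ 1 - v $ 1) - (inverse (crs a b) * b $ 1) * (x $ 2 - v $ 2))"
    "co2 v a b = (\<lambda>x. (inverse (crs a b) * a $ 1) * (x $ 2 - v $ 2) - (inverse (crs a b) * a $ 2) * (x $ 1 - v $ 1))"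
    by (auto simp: co1_def co2_def crs_def fun_eq_iff divide_inverse algebra_simps)
  then show "co1 v a b \<in> polys_upto 1" "co2 v a b \<in> polys_upto 1"
    by (simp_all only:) (intro polys_upto_diff polys_upto_cmult polys_upto_coord polys_upto_const)+
qed

lemma polys_upto_compose_par:
  assumes "p \<in> polys_upto k"
  shows "(\<lambda>\<xi>. p (par v a b \<xi>)) \<in> polys_upto k"
  using polys_upto_compose_affine[OF assms linear_2, of a b v] by (simp add: par_def add_ac)

text \<open>The polynomial is built with the reference map that the definition supplies, but its
  nodal values can be read off in any parametrisation, because the node sets agree.\<close>

lemma element_interpolant:
  assumes "k \<ge> 1" "is_lagrange_interpolant k \<T> f fh" "tri v a b \<in> \<T>" "crs a b \<noteq> 0"
  obtains p where "p \<in> polys_upto k" "\<And>x. x \<in> tri v a b \<Longrightarrow> fh x = p x"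
    "\<And>\<xi>. \<xi> \<in> lagrange_nodes k \<Longrightarrow> p (par v a b \<xi>) = f (par v a b \<xi>)"
proof -
  obtain F where F: "affine_ref_map F (tri v a b)" "\<And>x. x \<in> tri v a b \<Longrightarrow> fh x = ref_interp k (f \<circ> F) (inv F x)"
    using assms(2,3) unfolding is_lagrange_interpolant_def by blast
  obtain v' a' b' where F': "F = par v' a' b'" "crs a' b' \<noteq> 0" "tri v a b = tri v' a' b'"
    using F(1) by (rule affine_ref_mapE)
  define p where "p = (\<lambda>x. ref_interp k (f \<circ> F) (inv F x))"
  have "(\<lambda>x. inv F x $ i) \<in> polys_upto 1" for i
  proof -
    have "i = 1 \<or> i = 2" by (rule exhaust_2)
    then show ?thesis
      unfolding F'(1) inv_par[OF F'(2)] using co_in_polys_upto[of v' a' b'] by (elim disjE) simp_all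
  qed
  then have "p \<in> polys_upto k"
    unfolding p_def using ref_interp_spec[OF assms(1), of "f \<circ> F"] polys_upto_compose[of _ k "inv F"] by blast
  then show ?thesis
  proof (rule that)
    show "fh x = p x" if "x \<in> tri v a b" for x using F(2)[OF that] by (simp add: p_def)
    fix \<xi> assume "\<xi> \<in> lagrange_nodes k"
    then obtain \<eta> where \<eta>: "\<eta> \<in> lagrange_nodes k" "par v a b \<xi> = F \<eta>"
      using par_lagrange_nodes_unique[OF assms(1,4) F'(2,3)] F'(1) by (metis imageE imageI)
    have "inv F (F \<eta>) = \<eta>"
      using F(1) unfolding affine_ref_map_def by (meson bij_is_inj inv_f_f)
    then show "p (par v a b \<xi>) = f (par v a b \<xi>)"
      using ref_interp_spec[OF assms(1), of "f \<circ> F"] \<eta> by (simp add: p_def)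
  qed
qed

section \<open>The pointwise interpolation error\<close>

text \<open>A choice that depends on \<open>k\<close> alone, so that the constant of the theorem can
  be named before any mesh is given.\<close>

definition lebesgue_const :: "nat \<Rightarrow> real" where
  "lebesgue_const k = (SOME \<Lambda>. \<Lambda> \<ge> 0 \<and> (\<forall>p M \<xi>. p \<in> polys_upto k \<longrightarrow> (\<forall>\<eta>\<in>lagrange_nodes k. \<bar>p \<eta>\<bar> \<le> M) \<longrightarrow>
      \<xi> \<in> ref_triangle \<longrightarrow> \<bar>p \<xi>\<bar> \<le> \<Lambda> * M))"

lemma lebesgue_const:
  assumes "k \<ge> 1"
  shows "lebesgue_const k \<ge> 0"
    and "p \<in> polys_upto k \<Longrightarrow> (\<And>\<eta>. \<eta> \<in> lagrange_nodes k \<Longrightarrow> \<bar>p \<eta>\<bar> \<le> M) \<Longrightarrow>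
      \<xi> \<in> ref_triangle \<Longrightarrow> \<bar>p \<xi>\<bar> \<le> lebesgue_const k * M"
proof -
  have "\<exists>\<Lambda>. \<Lambda> \<ge> 0 \<and> (\<forall>p M \<xi>. p \<in> polys_upto k \<longrightarrow> (\<forall>\<eta>\<in>lagrange_nodes k. \<bar>p \<eta>\<bar> \<le> M) \<longrightarrow>
      \<xi> \<in> ref_triangle \<longrightarrow> \<bar>p \<xi>\<bar> \<le> \<Lambda> * M)"
    using lagrange_stability[OF assms] by metis
  from someI_ex[OF this] show "lebesgue_const k \<ge> 0"
    "p \<in> polys_upto k \<Longrightarrow> (\<And>\<eta>. \<eta> \<in> lagrange_nodes k \<Longrightarrow> \<bar>p \<eta>\<bar> \<le> M) \<Longrightarrow>
      \<xi> \<in> ref_triangle \<Longrightarrow> \<bar>p \<xi>\<bar> \<le> lebesgue_const k * M"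
    unfolding lebesgue_const_def by blast+
qed

lemma lagrange_nodes_subset: "k \<ge> 1 \<Longrightarrow> lagrange_nodes k \<subseteq> ref_triangle"
  by (auto simp: lagrange_nodes_def ref_triangle_eq field_simps simp flip: of_nat_add)

text \<open>Symmetry, shape regularity and quasi-uniformity are left to the individual estimates,
  which keeps visible where they enter.\<close>

locale fe_mesh =
  fixes k :: nat and \<Omega> :: "(real^2) set" and \<T> :: "(real^2) set set" and f fh :: "real^2 \<Rightarrow> real"
  assumes k1: "k \<ge> 1" and simplex_domain: "2 simplex \<Omega>" and conforming: "conforming_triangulation_of \<T> \<Omega>"
    and smooth: "Ck_closed (k + 2) \<Omega> f" and interpolant: "is_lagrange_interpolant k \<T> f fh"
begin

definition "h = mesh_size \<T>"
definition "err x = fh x - f x"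

lemma compact_domain: "compact \<Omega>" and convex_domain: "convex \<Omega>"
  using simplex_domain compact_simplex convex_simplex by blast+

lemma finite_mesh: "finite \<T>" and union_mesh: "\<Union>\<T> = \<Omega>"
  and element_simplex: "T \<in> \<T> \<Longrightarrow> 2 simplex T"
  and element_Int_face: "T \<in> \<T> \<Longrightarrow> T' \<in> \<T> \<Longrightarrow> (T \<inter> T') face_of T"
  using conforming by (auto simp: conforming_triangulation_of_def triangulation_def)

lemma elementE:
  assumes "T \<in> \<T>"
  obtains v a b where "T = tri v a b" "crs a b \<noteq> 0"
  using element_simplex[OF assms] by (rule two_simplexE)

lemma mesh_nonempty: "\<T> \<noteq> {}"
  using union_mesh two_simplexE[OF simplex_domain] interior_tri_nonempty by (metis Sup_empty interior_empty)

lemma element_diameter: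
  assumes "T \<in> \<T>" "x \<in> T" "y \<in> T"
  shows "norm (x - y) \<le> h"
proof -
  have "bounded T" using element_simplex[OF assms(1)] compact_simplex compact_imp_bounded by blast
  then have "norm (x - y) \<le> diameter T"
    using diameter_bounded_bound assms by (metis dist_norm)
  also have "\<dots> \<le> h" unfolding h_def mesh_size_def using finite_mesh assms(1) by auto
  finally show ?thesis .
qed

lemma h_nonneg: "h \<ge> 0"
proof -
  obtain T where "T \<in> \<T>" using mesh_nonempty by blast
  moreover obtain v a b where "T = tri v a b" using elementE[OF \<open>T \<in> \<T>\<close>] by metis
  then have "v \<in> T" using tri_memI[of 0 0 v a b] by simp
  ultimately show ?thesis using element_diameter[of T v v] by simp
qed

lemma element_subset: "T \<in> \<T> \<Longrightarrow> T \<subseteq> \<Omega>"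
  using union_mesh by blast

lemma taylor:
  assumes "y \<in> interior \<Omega>" "1 \<le> m" "m \<le> k + 2"
  obtains p where "p \<in> polys_upto (m - 1)"
    "\<And>x. x \<in> \<Omega> \<Longrightarrow> norm (x - y) \<le> h \<Longrightarrow> \<bar>f x - p x\<bar> \<le> 2 ^ m * Ck_norm m \<Omega> f * h ^ m"
proof -
  obtain p where p: "p \<in> polys_upto (m - 1)"
    "\<And>x. x \<in> \<Omega> \<Longrightarrow> \<bar>f x - p x\<bar> \<le> 2 ^ m * Ck_norm m \<Omega> f * norm (x - y) ^ m"
    using taylor_Ck_closed[OF smooth compact_domain convex_domain assms] by blast
  have "\<bar>mpartial 0 f y\<bar> \<le> Ck_norm m \<Omega> f"
    using assms by (intro abs_mpartial_le_Ck_norm[OF smooth compact_domain]) (auto simp: mi_order_def)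
  then have "Ck_norm m \<Omega> f \<ge> 0" by linarith
  then have "2 ^ m * Ck_norm m \<Omega> f * norm (x - y) ^ m \<le> 2 ^ m * Ck_norm m \<Omega> f * h ^ m"
    if "norm (x - y) \<le> h" for x
    using that by (intro mult_left_mono power_mono) auto
  then show ?thesis using that[OF p(1)] p(2) by (meson order_trans)
qed

text \<open>Taylor's formula takes its centre in the interior of \<open>\<Omega>\<close>, also for
  elements that touch the boundary.\<close>

lemma element_point:
  assumes "T \<in> \<T>"
  obtains y where "y \<in> interior \<Omega>" "y \<in> T"
proof -
  obtain v a b where T: "T = tri v a b" "crs a b \<noteq> 0" using elementE[OF assms] by metis
  then obtain y where "y \<in> interior T" using interior_tri_nonempty by blast
  then show ?thesis using that interior_mono[OF element_subset[OF assms]] interior_subset[of T] by blast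
qed

text \<open>At the nodes \<open>p = f\<close>, so \<open>p - q\<close> is bounded there by the
  Taylor remainder. Being of degree \<open>k\<close>, it is bounded on the element by
  \<open>lebesgue_const k\<close> times as much; the summand 1 accounts for the remainder
  \<open>f - q\<close> itself.\<close>

lemma err_bound:
  assumes "x \<in> \<Omega>"
  shows "\<bar>err x\<bar> \<le> (lebesgue_const k + 1) * (2 ^ (k + 1) * Ck_norm (k + 1) \<Omega> f * h ^ (k + 1))"
proof -
  obtain T where T: "T \<in> \<T>" "x \<in> T" using assms union_mesh by blast
  obtain v a b where vab: "T = tri v a b" "crs a b \<noteq> 0" using elementE[OF T(1)] by metis
  obtain p where p: "p \<in> polys_upto k" "\<And>x. x \<in> tri v a b \<Longrightarrow> fh x = p x"
    "\<And>\<xi>. \<xi> \<in> lagrange_nodes k \<Longrightarrow> p (par v a b \<xi>) = f (par v a b \<xi>)"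
    using element_interpolant[OF k1 interpolant] T(1) vab by metis
  obtain y where y: "y \<in> interior \<Omega>" "y \<in> T" using element_point[OF T(1)] .
  let ?B = "2 ^ (k + 1) * Ck_norm (k + 1) \<Omega> f * h ^ (k + 1)"
  obtain q where q: "q \<in> polys_upto k" "\<And>x. x \<in> \<Omega> \<Longrightarrow> norm (x - y) \<le> h \<Longrightarrow> \<bar>f x - q x\<bar> \<le> ?B"
    using taylor[OF y(1), of "k + 1"] by auto
  then have q': "\<bar>f z - q z\<bar> \<le> ?B" if "z \<in> T" for z
    using that element_diameter[OF T(1) _ y(2)] element_subset[OF T(1)] by blast
  obtain \<xi> where \<xi>: "\<xi> \<in> ref_triangle" "x = par v a b \<xi>" using T(2) vab(1) by (auto simp: tri_def)
  have "\<bar>p (par v a b \<xi>) - q (par v a b \<xi>)\<bar> \<le> lebesgue_const k * ?B"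
  proof (rule lebesgue_const(2)[OF k1 _ _ \<xi>(1)])
    show "(\<lambda>\<xi>. p (par v a b \<xi>) - q (par v a b \<xi>)) \<in> polys_upto k"
      by (intro polys_upto_diff polys_upto_compose_par p(1) q(1))
    fix \<eta> assume \<eta>: "\<eta> \<in> lagrange_nodes k"
    then have "par v a b \<eta> \<in> T" using lagrange_nodes_subset[OF k1] by (auto simp: vab tri_def)
    then show "\<bar>p (par v a b \<eta>) - q (par v a b \<eta>)\<bar> \<le> ?B" using q' p(3)[OF \<eta>] by simp
  qed
  moreover have "\<bar>f x - q x\<bar> \<le> ?B" using q' T(2) by blast
  moreover have "fh x = p x" using p(2) T(2) vab(1) by simp
  moreover have "(lebesgue_const k + 1) * ?B = lebesgue_const k * ?B + ?B" by (simp add: algebra_simps)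
  ultimately show ?thesis unfolding err_def \<xi>(2) by linarith
qed

lemma symmetric_pairE:
  assumes "T1 \<in> \<T>" "T2 \<in> \<T>" "symmetric_pair T1 T2"
  obtains x0 a b where "crs a b \<noteq> 0" "T1 = tri x0 a b" "T2 = tri x0 (- a) (- b)" "x0 \<in> interior \<Omega>" "T1 \<inter> T2 = {x0}"
proof -
  obtain x0 F1 F2 where F: "T1 \<inter> T2 = {x0}" "affine_ref_map F1 T1" "affine_ref_map F2 T2"
    "F1 0 = x0" "F2 0 = x0" "\<And>\<xi>. \<xi> \<in> ref_triangle \<Longrightarrow> F1 \<xi> - x0 = x0 - F2 \<xi>"
    using assms(3) unfolding symmetric_pair_def by blast
  obtain v a b where 1: "F1 = par v a b" "crs a b \<noteq> 0" "T1 = tri v a b" using F(2) by (rule affine_ref_mapE)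
  obtain v' a' b' where 2: "F2 = par v' a' b'" "crs a' b' \<noteq> 0" "T2 = tri v' a' b'" using F(3) by (rule affine_ref_mapE)
  have v: "v = x0" "v' = x0" using F(4,5) 1(1) 2(1) by (auto simp: par_def)
  have "axis 1 1 \<in> ref_triangle" "axis 2 1 \<in> ref_triangle" by (auto simp: ref_triangle_eq axis_def)
  from F(6)[OF this(1)] F(6)[OF this(2)] have ab: "a' = - a" "b' = - b"
    by (auto simp: 1(1) 2(1) v par_def axis_def add_eq_0_iff)
  \<comment> \<open>The common vertex is the midpoint of the barycentres of the two elements, both
    interior points of the convex set \<open>\<Omega>\<close>. This allows it to be the Taylor
    centre of the pair.\<close>
  have in1: "x0 + (1/3) *\<^sub>R a + (1/3) *\<^sub>R b \<in> interior \<Omega>"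
    using otri_nonempty[OF 1(2)] otri_subset_interior[OF 1(2)] interior_mono[OF element_subset[OF assms(1)]] 1(3) v by blast
  have in2: "x0 + (1/3) *\<^sub>R (- a) + (1/3) *\<^sub>R (- b) \<in> interior \<Omega>"
    using otri_nonempty[OF 2(2)] otri_subset_interior[OF 2(2)] interior_mono[OF element_subset[OF assms(2)]] 2(3) v ab by blast
  have "(1/2) *\<^sub>R (x0 + (1/3) *\<^sub>R a + (1/3) *\<^sub>R b) + (1/2) *\<^sub>R (x0 + (1/3) *\<^sub>R (- a) + (1/3) *\<^sub>R (- b)) \<in> interior \<Omega>"
    using convexD[OF convex_interior[OF convex_domain] in1 in2, of "1/2" "1/2"] by simp
  moreover have "(1/2) *\<^sub>R (x0 + (1/3) *\<^sub>R a + (1/3) *\<^sub>R b) + (1/2) *\<^sub>R (x0 + (1/3) *\<^sub>R (- a) + (1/3) *\<^sub>R (- b)) = x0"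
    by (simp add: algebra_simps flip: scaleR_add_left)
  ultimately show ?thesis using that 1 2 v ab F(1) by metis
qed

text \<open>The two interpolants, pulled back to the reference triangle and added, are compared at
  the nodes with \<open>r\<close>, the Taylor polynomial plus its reflection. Although
  \<open>q\<close> has degree \<open>k + 1\<close>, \<open>r\<close> has degree \<open>k\<close>, so
  stability for degree \<open>k\<close> applies to remainders of order \<open>k + 2\<close>. The
  factor 2 stands for the two elements.\<close>

lemma err_pair:
  assumes "even k" "tri x0 a b \<in> \<T>" "tri x0 (- a) (- b) \<in> \<T>" "crs a b \<noteq> 0" "x0 \<in> interior \<Omega>" "x \<in> tri x0 a b"
  shows "\<bar>err x + err (2 *\<^sub>R x0 - x)\<bar> \<le> 2 * (lebesgue_const k + 1) * (2 ^ (k + 2) * Ck_norm (k + 2) \<Omega> f * h ^ (k + 2))"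
proof -
  have crs': "crs (- a) (- b) \<noteq> 0" using assms(4) crs_rotate(3) by simp
  have refl: "par x0 (- a) (- b) \<xi> = 2 *\<^sub>R x0 - par x0 a b \<xi>" for \<xi>
    by (simp add: par_def algebra_simps scaleR_2)
  obtain p1 where p1: "p1 \<in> polys_upto k" "\<And>x. x \<in> tri x0 a b \<Longrightarrow> fh x = p1 x"
    "\<And>\<xi>. \<xi> \<in> lagrange_nodes k \<Longrightarrow> p1 (par x0 a b \<xi>) = f (par x0 a b \<xi>)"
    using element_interpolant[OF k1 interpolant assms(2,4)] by metis
  obtain p2 where p2: "p2 \<in> polys_upto k" "\<And>x. x \<in> tri x0 (- a) (- b) \<Longrightarrow> fh x = p2 x"
    "\<And>\<xi>. \<xi> \<in> lagrange_nodes k \<Longrightarrow> p2 (par x0 (- a) (- b) \<xi>) = f (par x0 (- a) (- b) \<xi>)"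
    using element_interpolant[OF k1 interpolant assms(3) crs'] by metis
  let ?B = "2 ^ (k + 2) * Ck_norm (k + 2) \<Omega> f * h ^ (k + 2)"
  obtain q where q: "q \<in> polys_upto (Suc k)" "\<And>x. x \<in> \<Omega> \<Longrightarrow> norm (x - x0) \<le> h \<Longrightarrow> \<bar>f x - q x\<bar> \<le> ?B"
    using taylor[OF assms(5), of "k + 2"] by auto
  have x0: "x0 \<in> tri x0 a b" "x0 \<in> tri x0 (- a) (- b)"
    using tri_memI[of 0 0] by simp_all
  have q': "\<bar>f z - q z\<bar> \<le> ?B" if "z \<in> tri x0 a b \<union> tri x0 (- a) (- b)" for z
    using that element_diameter[OF assms(2) _ x0(1)] element_diameter[OF assms(3) _ x0(2)]
      element_subset[OF assms(2)] element_subset[OF assms(3)] by (intro q(2)) auto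
  define r where "r x = q x + q (2 *\<^sub>R x0 - x)" for x
  have r: "r \<in> polys_upto k" unfolding r_def[abs_def] by (rule polys_upto_even_part[OF q(1) assms(1)])
  obtain \<xi> where \<xi>: "\<xi> \<in> ref_triangle" "x = par x0 a b \<xi>" using assms(6) by (auto simp: tri_def)
  have mem: "par x0 a b \<eta> \<in> tri x0 a b" "par x0 (- a) (- b) \<eta> \<in> tri x0 (- a) (- b)" if "\<eta> \<in> ref_triangle" for \<eta>
    using that by (auto simp: tri_def)
  have "\<bar>p1 (par x0 a b \<xi>) + p2 (par x0 (- a) (- b) \<xi>) - r (par x0 a b \<xi>)\<bar> \<le> lebesgue_const k * (2 * ?B)"
  proof (rule lebesgue_const(2)[OF k1 _ _ \<xi>(1)])
    show "(\<lambda>\<xi>. p1 (par x0 a b \<xi>) + p2 (par x0 (- a) (- b) \<xi>) - r (par x0 a b \<xi>)) \<in> polys_upto k"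
      by (intro polys_upto_diff polys_upto_add polys_upto_compose_par p1(1) p2(1) r)
    fix \<eta> assume \<eta>: "\<eta> \<in> lagrange_nodes k"
    then have "\<eta> \<in> ref_triangle" using lagrange_nodes_subset[OF k1] by blast
    then show "\<bar>p1 (par x0 a b \<eta>) + p2 (par x0 (- a) (- b) \<eta>) - r (par x0 a b \<eta>)\<bar> \<le> 2 * ?B"
      using q'[of "par x0 a b \<eta>"] q'[of "par x0 (- a) (- b) \<eta>"] mem[of \<eta>] p1(3)[OF \<eta>] p2(3)[OF \<eta>]
      unfolding r_def refl by auto
  qed
  moreover have "\<bar>f x - q x\<bar> \<le> ?B" "\<bar>f (2 *\<^sub>R x0 - x) - q (2 *\<^sub>R x0 - x)\<bar> \<le> ?B"
    using q'[of x] q'[of "2 *\<^sub>R x0 - x"] mem[OF \<xi>(1)] unfolding refl \<xi>(2) by auto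
  moreover have "fh x = p1 x" "fh (2 *\<^sub>R x0 - x) = p2 (2 *\<^sub>R x0 - x)"
    using p1(2)[of x] p2(2)[of "2 *\<^sub>R x0 - x"] mem[OF \<xi>(1)] unfolding refl \<xi>(2) by auto
  moreover have "2 * (lebesgue_const k + 1) * ?B = lebesgue_const k * (2 * ?B) + 2 * ?B" by (simp add: algebra_simps)
  ultimately show ?thesis unfolding err_def refl r_def \<xi>(2)[symmetric] by linarith
qed

text \<open>
  A point of the edge is parametrised by the first reference coordinate, and the edge error is
  compared with a polynomial that depends on that coordinate only.
\<close>

lemma err_edge:
  assumes "even k" "tri v a b \<in> \<T>" "crs a b \<noteq> 0" "0 \<le> \<theta>" "\<theta> \<le> 1"
  shows "\<bar>err (v + \<theta> *\<^sub>R a) + err (v + (1 - \<theta>) *\<^sub>R a)\<bar>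
    \<le> 2 * (lebesgue_const k + 1) * (2 ^ (k + 2) * Ck_norm (k + 2) \<Omega> f * h ^ (k + 2))"
proof -
  obtain p where p: "p \<in> polys_upto k" "\<And>x. x \<in> tri v a b \<Longrightarrow> fh x = p x"
    "\<And>\<xi>. \<xi> \<in> lagrange_nodes k \<Longrightarrow> p (par v a b \<xi>) = f (par v a b \<xi>)"
    using element_interpolant[OF k1 interpolant assms(2,3)] by metis
  obtain y where y: "y \<in> interior \<Omega>" "y \<in> tri v a b" using element_point[OF assms(2)] .
  let ?B = "2 ^ (k + 2) * Ck_norm (k + 2) \<Omega> f * h ^ (k + 2)"
  obtain q where q: "q \<in> polys_upto (Suc k)" "\<And>x. x \<in> \<Omega> \<Longrightarrow> norm (x - y) \<le> h \<Longrightarrow> \<bar>f x - q x\<bar> \<le> ?B"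
    using taylor[OF y(1), of "k + 2"] by auto
  have q': "\<bar>f z - q z\<bar> \<le> ?B" if "z \<in> tri v a b" for z
    using that element_diameter[OF assms(2) _ y(2)] element_subset[OF assms(2)] by (intro q(2)) auto
  define r where "r x = q x + q (2 *\<^sub>R v + a - x)" for x
  have r: "r \<in> polys_upto k" unfolding r_def[abs_def] by (rule polys_upto_even_part[OF q(1) assms(1)])
  have mem: "v + t *\<^sub>R a \<in> tri v a b" if "0 \<le> t" "t \<le> 1" for t
    using tri_memI[of t 0 v a b] that by simp
  \<comment> \<open>\<open>par v a 0\<close> and \<open>par (v + a) (- a) 0\<close> are degenerate:
    they run along the edge in the two directions and ignore the second reference coordinate.
    Composition with them still preserves \<open>polys_upto k\<close>.\<close>
  have par0: "par v a 0 \<eta> = v + \<eta> $ 1 *\<^sub>R a" for \<eta> by (simp add: par_def)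
  have par1: "par (v + a) (- a) 0 \<eta> = v + (1 - \<eta> $ 1) *\<^sub>R a" for \<eta> by (simp add: par_def algebra_simps)
  have refl: "2 *\<^sub>R v + a - (v + t *\<^sub>R a) = v + (1 - t) *\<^sub>R a" for t by (simp add: algebra_simps scaleR_2)
  have "\<bar>p (par v a 0 (vector [\<theta>, 0])) + p (par (v + a) (- a) 0 (vector [\<theta>, 0])) - r (par v a 0 (vector [\<theta>, 0]))\<bar>
      \<le> lebesgue_const k * (2 * ?B)"
  proof (rule lebesgue_const(2)[OF k1, of "\<lambda>\<xi>. p (par v a 0 \<xi>) + p (par (v + a) (- a) 0 \<xi>) - r (par v a 0 \<xi>)"])
    show "(\<lambda>\<xi>. p (par v a 0 \<xi>) + p (par (v + a) (- a) 0 \<xi>) - r (par v a 0 \<xi>)) \<in> polys_upto k"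
      by (intro polys_upto_diff polys_upto_add polys_upto_compose_par p(1) r)
    show "vector [\<theta>, 0] \<in> ref_triangle" using assms by (simp add: ref_triangle_eq)
    fix \<eta> assume \<eta>: "\<eta> \<in> lagrange_nodes k"
    then obtain i j where ij: "i + j \<le> k" "\<eta> = vector [real i / real k, real j / real k]"
      unfolding lagrange_nodes_def by blast
    \<comment> \<open>Only the first coordinate of a node matters here. The edge nodes with first
      coordinates \<open>i / k\<close> and \<open>(k - i) / k\<close> are exchanged by the
      reflection, and the interpolant agrees with \<open>f\<close> at both.\<close>
    have "vector [real i / real k, 0] \<in> lagrange_nodes k" "vector [real (k - i) / real k, 0] \<in> lagrange_nodes k"
      unfolding lagrange_nodes_eq using ij(1) imageI[of "(i, 0)" "lattice k" "node k"]
        imageI[of "(k - i, 0)" "lattice k" "node k"] by simp_all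
    from p(3)[OF this(1)] p(3)[OF this(2)] have pf: "p (v + \<eta> $ 1 *\<^sub>R a) = f (v + \<eta> $ 1 *\<^sub>R a)"
      "p (v + (1 - \<eta> $ 1) *\<^sub>R a) = f (v + (1 - \<eta> $ 1) *\<^sub>R a)"
      using k1 ij(1) by (auto simp: par_def ij(2) of_nat_diff diff_divide_distrib)
    have "0 \<le> \<eta> $ 1" "\<eta> $ 1 \<le> 1" using ij k1 by auto
    then show "\<bar>p (par v a 0 \<eta>) + p (par (v + a) (- a) 0 \<eta>) - r (par v a 0 \<eta>)\<bar> \<le> 2 * ?B"
      using q'[OF mem[of "\<eta> $ 1"]] q'[OF mem[of "1 - \<eta> $ 1"]] pf
      unfolding r_def par0 par1 refl by auto
  qed
  then have "\<bar>p (v + \<theta> *\<^sub>R a) + p (v + (1 - \<theta>) *\<^sub>R a) - (q (v + \<theta> *\<^sub>R a) + q (v + (1 - \<theta>) *\<^sub>R a))\<bar>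
      \<le> lebesgue_const k * (2 * ?B)"
    unfolding par0 par1 r_def refl by simp
  moreover have "\<bar>f (v + \<theta> *\<^sub>R a) - q (v + \<theta> *\<^sub>R a)\<bar> \<le> ?B" "\<bar>f (v + (1 - \<theta>) *\<^sub>R a) - q (v + (1 - \<theta>) *\<^sub>R a)\<bar> \<le> ?B"
    using q' mem assms by auto
  moreover have "fh (v + \<theta> *\<^sub>R a) = p (v + \<theta> *\<^sub>R a)" "fh (v + (1 - \<theta>) *\<^sub>R a) = p (v + (1 - \<theta>) *\<^sub>R a)"
    using p(2) mem assms by auto
  moreover have "2 * (lebesgue_const k + 1) * ?B = lebesgue_const k * (2 * ?B) + 2 * ?B" by (simp add: algebra_simps)
  ultimately show ?thesis unfolding err_def by linarith
qed

end

section \<open>Traces, strips, reflections and integration by parts\<close>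

lemma lborel_vec2:
  "(lborel :: (real^2) measure) = distr (lborel \<Otimes>\<^sub>M lborel) borel (\<lambda>p. fst p *\<^sub>R axis 1 1 + snd p *\<^sub>R axis 2 1)"
  (is "_ = distr ?M _ ?T")
proof (rule lborel_eqI)
  have T [measurable]: "?T \<in> ?M \<rightarrow>\<^sub>M borel" by measurable
  fix l u :: "real^2" assume le: "\<And>b. b \<in> Basis \<Longrightarrow> l \<bullet> b \<le> u \<bullet> b"
  have le': "l $ i \<le> u $ i" for i using le[of "axis i 1"] by (simp add: inner_axis axis_in_Basis_iff)
  have "?T -` box l u \<inter> space ?M = {l $ 1<..<u $ 1} \<times> {l $ 2<..<u $ 2}"
    by (auto simp: mem_box_cart forall_2 space_pair_measure axis_def)
  then have "emeasure (distr ?M borel ?T) (box l u) = emeasure ?M ({l $ 1<..<u $ 1} \<times> {l $ 2<..<u $ 2})"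
    by (simp add: emeasure_distr)
  also have "\<dots> = ennreal ((u $ 1 - l $ 1) * (u $ 2 - l $ 2))"
    using le' by (simp add: lborel.emeasure_pair_measure_Times ennreal_mult)
  also have "(u $ 1 - l $ 1) * (u $ 2 - l $ 2) = (\<Prod>b\<in>Basis. (u - l) \<bullet> b)"
  proof -
    have B: "(Basis :: (real^2) set) = {axis 1 1, axis 2 1}"
      unfolding Basis_vec_def UNIV_2 by auto
    have "axis 1 1 \<noteq> (axis 2 1 :: real^2)" by (simp add: axis_eq_axis)
    then show ?thesis unfolding B by (simp add: inner_axis)
  qed
  finally show "emeasure (distr ?M borel ?T) (box l u) = ennreal (\<Prod>b\<in>Basis. (u - l) \<bullet> b)" .
qed simp

lemma continuous_on_par: "continuous_on S (par v a b)"
  unfolding par_def[abs_def] by (intro continuous_intros)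

text \<open>Lebesgue measure is determined by its values on boxes. The preimage of a box is a linear
  image of a translated box, so the determinant formula gives its measure.\<close>

lemma lborel_par:
  assumes "crs a b \<noteq> 0"
  shows "(lborel :: (real^2) measure) = density (distr lborel borel (par v a b)) (\<lambda>_. ennreal \<bar>crs a b\<bar>)"
proof (rule lborel_eqI)
  have P [measurable]: "par v a b \<in> borel_measurable borel"
    by (intro borel_measurable_continuous_onI continuous_on_par)
  fix l u :: "real^2" assume le: "\<And>b. b \<in> Basis \<Longrightarrow> l \<bullet> b \<le> u \<bullet> b"
  define A where "A = (\<lambda>\<xi>::real^2. \<xi> $ 1 *\<^sub>R a + \<xi> $ 2 *\<^sub>R b)"
  define g where "g = (\<lambda>x. vector [co1 0 a b x, co2 0 a b x] :: real^2)"
  define X where "X = (+) (- v) ` box l u"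
  have A: "linear A" unfolding A_def by (rule linear_2)
  have g: "linear g"
    by (rule linearI) (auto simp: g_def vec_eq_iff forall_2 co1_def co2_def crs_def add_divide_distrib algebra_simps diff_divide_distrib)
  have Ag: "A (g x) = x" for x using par_coords[OF assms, of x 0] by (simp add: A_def g_def)
  have gA: "g (A \<xi>) = \<xi>" for \<xi>
    using coords_par[OF assms, of 0 "\<xi> $ 1" "\<xi> $ 2"] by (simp add: A_def g_def vec_eq_iff forall_2)
  have pre: "par v a b -` box l u = g ` X"
  proof (intro subset_antisym subsetI)
    fix \<xi> assume "\<xi> \<in> par v a b -` box l u"
    moreover have "par v a b \<xi> = v + A \<xi>" by (simp add: par_def A_def)
    ultimately have "A \<xi> \<in> X" unfolding X_def by (intro image_eqI[of _ _ "par v a b \<xi>"]) auto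
    then show "\<xi> \<in> g ` X" by (intro image_eqI[of _ _ "A \<xi>"]) (simp_all add: gA)
  next
    fix \<xi> assume "\<xi> \<in> g ` X"
    then obtain y where "y \<in> box l u" "\<xi> = g (y - v)" unfolding X_def by auto
    moreover have "par v a b \<xi> = v + A \<xi>" for \<xi> by (simp add: par_def A_def)
    ultimately show "\<xi> \<in> par v a b -` box l u" by (simp add: Ag)
  qed
  have X: "X \<in> lmeasurable" unfolding X_def by (intro measurable_translation) simp
  have gX: "g ` X \<in> lmeasurable" by (rule measurable_linear_image[OF g X])
  have det: "\<bar>det (matrix A)\<bar> = \<bar>crs a b\<bar>"
    by (simp add: det_2 matrix_def A_def crs_def axis_def mult.commute[of "b $ 1" "a $ 2"])
  have "A ` g ` X = X" using Ag by (auto simp: image_image)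
  then have "measure lebesgue X = \<bar>crs a b\<bar> * measure lebesgue (g ` X)"
    using measure_linear_image[OF A gX] det by simp
  moreover have "measure lebesgue X = measure lebesgue (box l u)"
    unfolding X_def by (rule measure_translation)
  moreover have "emeasure lborel (par v a b -` box l u) = ennreal (measure lebesgue (g ` X))"
  proof -
    have "par v a b -` box l u \<in> sets borel"
      by (intro open_vimage borel_open open_box continuous_on_par)
    then have "emeasure lborel (par v a b -` box l u) = emeasure lebesgue (g ` X)"
      using pre by simp
    then show ?thesis using emeasure_eq_measure2[OF gX] by simp
  qed
  moreover have "emeasure lborel (box l u) = ennreal (measure lebesgue (box l u))"
    using le by (simp add: emeasure_lborel_box_eq measure_lborel_box_eq)
  ultimately have "ennreal \<bar>crs a b\<bar> * emeasure lborel (par v a b -` box l u) = emeasure lborel (box l u)"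
    by (simp add: ennreal_mult')
  then show "emeasure (density (distr lborel borel (par v a b)) (\<lambda>_. ennreal \<bar>crs a b\<bar>)) (box l u)
      = ennreal (\<Prod>b\<in>Basis. (u - l) \<bullet> b)"
    using le by (simp add: emeasure_density_const emeasure_distr emeasure_lborel_box_eq)
qed simp

lemma nn_integral_par:
  assumes "crs a b \<noteq> 0" and u [measurable]: "u \<in> borel_measurable borel"
  shows "(\<integral>\<^sup>+x. u x \<partial>lborel) = ennreal \<bar>crs a b\<bar> * (\<integral>\<^sup>+t. \<integral>\<^sup>+s. u (v + s *\<^sub>R a + t *\<^sub>R b) \<partial>lborel \<partial>lborel)"
    and "(\<integral>\<^sup>+x. u x \<partial>lborel) = ennreal \<bar>crs a b\<bar> * (\<integral>\<^sup>+s. \<integral>\<^sup>+t. u (v + s *\<^sub>R a + t *\<^sub>R b) \<partial>lborel \<partial>lborel)"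
proof -
  have P [measurable]: "par v a b \<in> borel_measurable borel"
    by (intro borel_measurable_continuous_onI continuous_on_par)
  have "(\<integral>\<^sup>+x. u x \<partial>lborel) = ennreal \<bar>crs a b\<bar> * (\<integral>\<^sup>+\<xi>. u (par v a b \<xi>) \<partial>lborel)"
    by (subst lborel_par[OF assms(1), of v]) (simp add: nn_integral_density nn_integral_distr nn_integral_cmult)
  also have "(\<integral>\<^sup>+\<xi>. u (par v a b \<xi>) \<partial>lborel) =
      (\<integral>\<^sup>+p. u (v + fst p *\<^sub>R a + snd p *\<^sub>R b) \<partial>(lborel \<Otimes>\<^sub>M lborel))"
    by (subst lborel_vec2) (simp add: nn_integral_distr par_def axis_def)
  also have "\<dots> = (\<integral>\<^sup>+s. \<integral>\<^sup>+t. u (v + s *\<^sub>R a + t *\<^sub>R b) \<partial>lborel \<partial>lborel)"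
    by (subst lborel.nn_integral_fst[symmetric]) auto
  finally show 2: "(\<integral>\<^sup>+x. u x \<partial>lborel) = ennreal \<bar>crs a b\<bar> * (\<integral>\<^sup>+s. \<integral>\<^sup>+t. u (v + s *\<^sub>R a + t *\<^sub>R b) \<partial>lborel \<partial>lborel)" .
  also have "(\<integral>\<^sup>+s. \<integral>\<^sup>+t. u (v + s *\<^sub>R a + t *\<^sub>R b) \<partial>lborel \<partial>lborel)
      = (\<integral>\<^sup>+t. \<integral>\<^sup>+s. u (v + s *\<^sub>R a + t *\<^sub>R b) \<partial>lborel \<partial>lborel)"
    by (rule lborel_pair.Fubini'[symmetric]) simp
  finally show "(\<integral>\<^sup>+x. u x \<partial>lborel) = ennreal \<bar>crs a b\<bar> * (\<integral>\<^sup>+t. \<integral>\<^sup>+s. u (v + s *\<^sub>R a + t *\<^sub>R b) \<partial>lborel \<partial>lborel)" .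
qed

lemma integral_par:
  fixes u :: "real^2 \<Rightarrow> real"
  assumes "crs a b \<noteq> 0" and u: "integrable lborel u"
  shows "(\<integral>x. u x \<partial>lborel) = \<bar>crs a b\<bar> * (\<integral>t. \<integral>s. u (v + s *\<^sub>R a + t *\<^sub>R b) \<partial>lborel \<partial>lborel)"
    and "AE t in lborel. integrable lborel (\<lambda>s. u (v + s *\<^sub>R a + t *\<^sub>R b))"
    and "integrable lborel (\<lambda>t. \<integral>s. u (v + s *\<^sub>R a + t *\<^sub>R b) \<partial>lborel)"
proof -
  have [measurable]: "u \<in> borel_measurable borel" using u by simp
  \<comment> \<open>The roles of \<open>a\<close> and \<open>b\<close> are exchanged so that the
    inner integral of Fubini's theorem runs along \<open>a\<close>.\<close>
  have crs': "crs b a \<noteq> 0" "\<bar>crs b a\<bar> = \<bar>crs a b\<bar>"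
    using assms(1) by (auto simp: crs_def abs_minus_commute mult.commute)
  have P [measurable]: "par v b a \<in> borel_measurable borel"
    by (intro borel_measurable_continuous_onI continuous_on_par)
  have i1: "integrable lborel (\<lambda>\<xi>. u (par v b a \<xi>))"
  proof -
    have "integrable (density (distr lborel borel (par v b a)) (\<lambda>_. ennreal \<bar>crs b a\<bar>)) u"
      using u lborel_par[OF crs'(1), of v] by metis
    then show ?thesis using crs'(1) by (simp add: integrable_density integrable_distr_eq)
  qed
  have e1: "(\<integral>x. u x \<partial>lborel) = \<bar>crs a b\<bar> * (\<integral>\<xi>. u (par v b a \<xi>) \<partial>lborel)"
    by (subst lborel_par[OF crs'(1), of v]) (simp add: integral_density integral_distr crs'(2))
  have i2: "integrable (lborel \<Otimes>\<^sub>M lborel) (\<lambda>p. u (v + fst p *\<^sub>R b + snd p *\<^sub>R a))"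
  proof -
    have "integrable (distr (lborel \<Otimes>\<^sub>M lborel) borel (\<lambda>p. fst p *\<^sub>R axis 1 1 + snd p *\<^sub>R axis 2 1)) (\<lambda>\<xi>. u (par v b a \<xi>))"
      using i1 unfolding lborel_vec2 .
    then show ?thesis by (simp add: integrable_distr_eq par_def axis_def)
  qed
  have e2: "(\<integral>\<xi>. u (par v b a \<xi>) \<partial>lborel) = (\<integral>p. u (v + fst p *\<^sub>R b + snd p *\<^sub>R a) \<partial>(lborel \<Otimes>\<^sub>M lborel))"
    by (subst lborel_vec2) (simp add: integral_distr par_def axis_def)
  have sw: "v + t *\<^sub>R b + s *\<^sub>R a = v + s *\<^sub>R a + t *\<^sub>R b" for s t by simp
  show "(\<integral>x. u x \<partial>lborel) = \<bar>crs a b\<bar> * (\<integral>t. \<integral>s. u (v + s *\<^sub>R a + t *\<^sub>R b) \<partial>lborel \<partial>lborel)"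
    unfolding e1 e2 using lborel_pair.integral_fst'[OF i2] by (simp add: sw)
  show "AE t in lborel. integrable lborel (\<lambda>s. u (v + s *\<^sub>R a + t *\<^sub>R b))"
    using lborel_pair.AE_integrable_fst'[OF i2] by (simp add: sw)
  show "integrable lborel (\<lambda>t. \<integral>s. u (v + s *\<^sub>R a + t *\<^sub>R b) \<partial>lborel)"
    using lborel_pair.integrable_fst'[OF i2] by (simp add: sw)
qed

section \<open>Trace and strip inequalities for smooth functions\<close>

lemma ennreal_abs_diff_le_nn_integral:
  fixes \<phi> \<phi>' :: "real \<Rightarrow> real"
  assumes der: "\<And>r. (\<phi> has_real_derivative \<phi>' r) (at r)" and cont: "continuous_on UNIV \<phi>'"
    and "s \<in> {\<alpha>..\<beta>}" "\<sigma> \<in> {\<alpha>..\<beta>}"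
  shows "ennreal \<bar>\<phi> s - \<phi> \<sigma>\<bar> \<le> (\<integral>\<^sup>+r\<in>{\<alpha>..\<beta>}. ennreal \<bar>\<phi>' r\<bar> \<partial>lborel)"
proof -
  have *: "ennreal \<bar>\<phi> s - \<phi> \<sigma>\<bar> \<le> (\<integral>\<^sup>+r\<in>{\<alpha>..\<beta>}. ennreal \<bar>\<phi>' r\<bar> \<partial>lborel)"
    if "\<sigma> \<le> s" "s \<in> {\<alpha>..\<beta>}" "\<sigma> \<in> {\<alpha>..\<beta>}" for s \<sigma>
  proof -
    have "(\<phi>' has_integral (\<phi> s - \<phi> \<sigma>)) {\<sigma>..s}"
      using that(1) der by (intro fundamental_theorem_of_calculus)
        (auto simp: has_real_derivative_iff_has_vector_derivative[symmetric] intro: has_field_derivative_at_within)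
    moreover have c: "continuous_on {\<sigma>..s} (\<lambda>r. \<bar>\<phi>' r\<bar>)"
      using cont by (intro continuous_intros) (auto intro: continuous_on_subset)
    ultimately have "\<bar>\<phi> s - \<phi> \<sigma>\<bar> \<le> integral {\<sigma>..s} (\<lambda>r. \<bar>\<phi>' r\<bar>)"
      using integral_norm_bound_integral[of \<phi>' "{\<sigma>..s}" "\<lambda>r. \<bar>\<phi>' r\<bar>"] integrable_continuous_real[OF c]
      by (auto simp: integral_unique has_integral_integrable)
    moreover have "(\<integral>\<^sup>+r\<in>{\<sigma>..s}. ennreal \<bar>\<phi>' r\<bar> \<partial>lborel) = ennreal (integral {\<sigma>..s} (\<lambda>r. \<bar>\<phi>' r\<bar>))"
      using integrable_continuous_real[OF c] by (intro nn_integral_has_integral_lebesgue') auto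
    moreover have "(\<integral>\<^sup>+r\<in>{\<sigma>..s}. ennreal \<bar>\<phi>' r\<bar> \<partial>lborel) \<le> (\<integral>\<^sup>+r\<in>{\<alpha>..\<beta>}. ennreal \<bar>\<phi>' r\<bar> \<partial>lborel)"
      using that by (intro nn_integral_mono) (auto simp: indicator_def)
    ultimately show ?thesis by (metis ennreal_leI order_trans)
  qed
  show ?thesis
    using *[of \<sigma> s] *[of s \<sigma>] assms(3,4) by (cases "\<sigma> \<le> s") (auto simp: abs_minus_commute)
qed

text \<open>Average \<open>\<bar>\<phi> s\<bar> \<le> \<bar>\<phi> \<sigma>\<bar> + V\<close> over
  \<open>\<sigma>\<close>, where \<open>V\<close> is the variation of \<open>\<phi>\<close> on the
  interval. Values in \<open>ennreal\<close> allow the bound to be integrated over families of lines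
  without integrability conditions.\<close>

lemma ennreal_abs_le_nn_integral:
  fixes \<phi> \<phi>' :: "real \<Rightarrow> real"
  assumes der: "\<And>r. (\<phi> has_real_derivative \<phi>' r) (at r)" and cont: "continuous_on UNIV \<phi>'"
    and "s \<in> {\<alpha>..\<beta>}"
  shows "ennreal (\<beta> - \<alpha>) * ennreal \<bar>\<phi> s\<bar> \<le> (\<integral>\<^sup>+r\<in>{\<alpha>..\<beta>}. ennreal \<bar>\<phi> r\<bar> \<partial>lborel)
    + ennreal (\<beta> - \<alpha>) * (\<integral>\<^sup>+r\<in>{\<alpha>..\<beta>}. ennreal \<bar>\<phi>' r\<bar> \<partial>lborel)" (is "_ \<le> ?A + _ * ?V")
proof -
  have [measurable]: "\<phi> \<in> borel_measurable borel"
    by (intro borel_measurable_continuous_onI continuous_at_imp_continuous_on) (use der DERIV_isCont in blast)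
  have em: "emeasure lborel {\<alpha>..\<beta>} = ennreal (\<beta> - \<alpha>)" using assms(3) by simp
  have "ennreal (\<beta> - \<alpha>) * ennreal \<bar>\<phi> s\<bar> = (\<integral>\<^sup>+\<sigma>\<in>{\<alpha>..\<beta>}. ennreal \<bar>\<phi> s\<bar> \<partial>lborel)"
    by (subst nn_integral_cmult_indicator) (auto simp: em mult.commute simp del: emeasure_lborel_Icc emeasure_lborel_Icc_eq)
  also have "\<dots> \<le> (\<integral>\<^sup>+\<sigma>. (ennreal \<bar>\<phi> \<sigma>\<bar> * indicator {\<alpha>..\<beta>} \<sigma> + ?V * indicator {\<alpha>..\<beta>} \<sigma>) \<partial>lborel)"
  proof (intro nn_integral_mono)
    fix \<sigma> :: real
    show "ennreal \<bar>\<phi> s\<bar> * indicator {\<alpha>..\<beta>} \<sigma> \<le> ennreal \<bar>\<phi> \<sigma>\<bar> * indicator {\<alpha>..\<beta>} \<sigma> + ?V * indicator {\<alpha>..\<beta>} \<sigma>"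
    proof (cases "\<sigma> \<in> {\<alpha>..\<beta>}")
      case True
      have "ennreal \<bar>\<phi> s\<bar> \<le> ennreal (\<bar>\<phi> \<sigma>\<bar> + \<bar>\<phi> s - \<phi> \<sigma>\<bar>)" by (rule ennreal_leI) simp
      also have "\<dots> = ennreal \<bar>\<phi> \<sigma>\<bar> + ennreal \<bar>\<phi> s - \<phi> \<sigma>\<bar>" by simp
      also have "\<dots> \<le> ennreal \<bar>\<phi> \<sigma>\<bar> + ?V"
        by (intro add_left_mono ennreal_abs_diff_le_nn_integral[OF der cont assms(3) True])
      finally show ?thesis using True by simp
    qed simp
  qed
  also have "\<dots> = ?A + ?V * emeasure lborel {\<alpha>..\<beta>}"
    by (subst nn_integral_add) (auto simp: nn_integral_cmult_indicator simp del: emeasure_lborel_Icc emeasure_lborel_Icc_eq)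
  finally show ?thesis by (simp add: em mult.commute del: emeasure_lborel_Icc emeasure_lborel_Icc_eq)
qed

text \<open>The gradient field is an explicit argument, so that second derivatives can be expressed
  by gradients of its components.\<close>

definition gradient :: "(real^2 \<Rightarrow> real) \<Rightarrow> (real^2 \<Rightarrow> real^2) \<Rightarrow> bool" where
  "gradient w W \<longleftrightarrow> continuous_on UNIV W \<and> (\<forall>x. (w has_derivative (\<lambda>d. W x \<bullet> d)) (at x))"

lemma gradient_continuous:
  assumes "gradient w W"
  shows "continuous_on S w" "continuous_on S W"
  using assms unfolding gradient_def
  by (metis continuous_at_imp_continuous_on has_derivative_continuous, metis continuous_on_subset subset_UNIV)

lemma gradient_measurable:
  assumes "gradient w W"
  shows "w \<in> borel_measurable borel" "W \<in> borel_measurable borel"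
  using gradient_continuous[OF assms] by (auto intro: borel_measurable_continuous_onI)

lemma gradient_along:
  assumes "gradient w W"
  shows "((\<lambda>s. w (c + s *\<^sub>R a)) has_real_derivative (W (c + s *\<^sub>R a) \<bullet> a)) (at s)"
    "continuous_on UNIV (\<lambda>s. W (c + s *\<^sub>R a) \<bullet> a)"
proof -
  have "((\<lambda>s. c + s *\<^sub>R a) has_derivative (\<lambda>h. h *\<^sub>R a)) (at s)"
    by (auto intro!: derivative_eq_intros)
  moreover have "(w has_derivative (\<lambda>d. W (c + s *\<^sub>R a) \<bullet> d)) (at (c + s *\<^sub>R a))"
    using assms by (simp add: gradient_def)
  ultimately have "((\<lambda>s. w (c + s *\<^sub>R a)) has_derivative (\<lambda>h. W (c + s *\<^sub>R a) \<bullet> (h *\<^sub>R a))) (at s)"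
    by (rule has_derivative_compose)
  then show "((\<lambda>s. w (c + s *\<^sub>R a)) has_real_derivative (W (c + s *\<^sub>R a) \<bullet> a)) (at s)"
    unfolding has_field_derivative_def by (rule has_derivative_eq_rhs) (auto simp: fun_eq_iff)
  show "continuous_on UNIV (\<lambda>s. W (c + s *\<^sub>R a) \<bullet> a)"
    by (intro continuous_intros continuous_on_compose2[OF gradient_continuous(2)[OF assms, of UNIV]]) auto
qed

text \<open>For \<open>t \<le> 1/2\<close> the line in direction \<open>a\<close> stays in the
  triangle on a parameter interval of length 1/2, over which the value at \<open>s\<close> is
  averaged. Towards the vertex \<open>v + b\<close> these intervals shrink, which is why only half
  of the segment is treated.\<close>

lemma half_trace:
  assumes w: "gradient w W" and crs: "crs a b \<noteq> 0" and s: "0 \<le> s" "s \<le> 1/2"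
  shows "ennreal \<bar>crs a b\<bar> * (\<integral>\<^sup>+t\<in>{0..1/2}. ennreal \<bar>w (v + s *\<^sub>R a + t *\<^sub>R b)\<bar> \<partial>lborel)
    \<le> 2 * (\<integral>\<^sup>+x\<in>tri v a b. ennreal \<bar>w x\<bar> \<partial>lborel) + (\<integral>\<^sup>+x\<in>tri v a b. ennreal \<bar>W x \<bullet> a\<bar> \<partial>lborel)"
proof -
  note [measurable] = gradient_measurable[OF w]
  have T [measurable]: "tri v a b \<in> sets borel" by (intro borel_closed closed_tri)
  let ?u = "\<lambda>x. ennreal (2 * \<bar>w x\<bar> + \<bar>W x \<bullet> a\<bar>) * indicator (tri v a b) x"
  have "ennreal \<bar>w (v + s *\<^sub>R a + t *\<^sub>R b)\<bar> \<le> (\<integral>\<^sup>+\<sigma>. ?u (v + \<sigma> *\<^sub>R a + t *\<^sub>R b) \<partial>lborel)" if t: "t \<in> {0..1/2}" for t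
  proof -
    let ?c = "v + t *\<^sub>R b"
    have "2 * (ennreal (1/2 - 0) * ennreal \<bar>w (?c + s *\<^sub>R a)\<bar>) \<le>
      2 * ((\<integral>\<^sup>+\<sigma>\<in>{0..1/2}. ennreal \<bar>w (?c + \<sigma> *\<^sub>R a)\<bar> \<partial>lborel) +
       ennreal (1/2 - 0) * (\<integral>\<^sup>+\<sigma>\<in>{0..1/2}. ennreal \<bar>W (?c + \<sigma> *\<^sub>R a) \<bullet> a\<bar> \<partial>lborel))"
      by (intro mult_left_mono ennreal_abs_le_nn_integral[OF gradient_along[OF w]]) (use s in auto)
    moreover have "2 * (ennreal (1/2 - 0) * y) = y" for y
    proof -
      have "2 * (ennreal (1/2 - 0) * y) = ennreal (2 * (1/2)) * y"
        by (subst ennreal_mult) (auto simp: mult.assoc)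
      then show ?thesis by simp
    qed
    ultimately have "ennreal \<bar>w (?c + s *\<^sub>R a)\<bar> \<le>
      2 * (\<integral>\<^sup>+\<sigma>\<in>{0..1/2}. ennreal \<bar>w (?c + \<sigma> *\<^sub>R a)\<bar> \<partial>lborel) +
       (\<integral>\<^sup>+\<sigma>\<in>{0..1/2}. ennreal \<bar>W (?c + \<sigma> *\<^sub>R a) \<bullet> a\<bar> \<partial>lborel)"
      by (simp only: distrib_left)
    also have "\<dots> = (\<integral>\<^sup>+\<sigma>. (2 * (ennreal \<bar>w (?c + \<sigma> *\<^sub>R a)\<bar> * indicator {0..1/2} \<sigma>) +
        ennreal \<bar>W (?c + \<sigma> *\<^sub>R a) \<bullet> a\<bar> * indicator {0..1/2} \<sigma>) \<partial>lborel)"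
      by (subst nn_integral_add) (auto simp: nn_integral_cmult)
    also have "\<dots> \<le> (\<integral>\<^sup>+\<sigma>. ?u (v + \<sigma> *\<^sub>R a + t *\<^sub>R b) \<partial>lborel)"
    proof (intro nn_integral_mono)
      fix \<sigma> :: real
      have eq: "?c + \<sigma> *\<^sub>R a = v + \<sigma> *\<^sub>R a + t *\<^sub>R b" by simp
      have "v + \<sigma> *\<^sub>R a + t *\<^sub>R b \<in> tri v a b" if "\<sigma> \<in> {0..1/2}"
        using that t by (intro tri_memI) auto
      then show "2 * (ennreal \<bar>w (?c + \<sigma> *\<^sub>R a)\<bar> * indicator {0..1/2} \<sigma>) +
        ennreal \<bar>W (?c + \<sigma> *\<^sub>R a) \<bullet> a\<bar> * indicator {0..1/2} \<sigma> \<le> ?u (v + \<sigma> *\<^sub>R a + t *\<^sub>R b)"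
        unfolding eq by (cases "\<sigma> \<in> {0..1/2}") (auto simp: ennreal_mult'' mult.commute)
    qed
    finally show ?thesis by (simp add: add_ac)
  qed
  then have "(\<integral>\<^sup>+t\<in>{0..1/2}. ennreal \<bar>w (v + s *\<^sub>R a + t *\<^sub>R b)\<bar> \<partial>lborel)
      \<le> (\<integral>\<^sup>+t. \<integral>\<^sup>+\<sigma>. ?u (v + \<sigma> *\<^sub>R a + t *\<^sub>R b) \<partial>lborel \<partial>lborel)"
    by (intro nn_integral_mono) (auto simp: indicator_def)
  then have "ennreal \<bar>crs a b\<bar> * (\<integral>\<^sup>+t\<in>{0..1/2}. ennreal \<bar>w (v + s *\<^sub>R a + t *\<^sub>R b)\<bar> \<partial>lborel)
      \<le> ennreal \<bar>crs a b\<bar> * (\<integral>\<^sup>+t. \<integral>\<^sup>+\<sigma>. ?u (v + \<sigma> *\<^sub>R a + t *\<^sub>R b) \<partial>lborel \<partial>lborel)"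
    by (rule mult_left_mono) simp
  also have "\<dots> = (\<integral>\<^sup>+x. ?u x \<partial>lborel)"
    by (rule nn_integral_par(1)[OF crs, symmetric]) measurable
  also have "\<dots> = (\<integral>\<^sup>+x. (2 * (ennreal \<bar>w x\<bar> * indicator (tri v a b) x) + ennreal \<bar>W x \<bullet> a\<bar> * indicator (tri v a b) x) \<partial>lborel)"
    by (intro nn_integral_cong) (auto simp: indicator_def ennreal_mult'')
  also have "\<dots> = 2 * (\<integral>\<^sup>+x\<in>tri v a b. ennreal \<bar>w x\<bar> \<partial>lborel) + (\<integral>\<^sup>+x\<in>tri v a b. ennreal \<bar>W x \<bullet> a\<bar> \<partial>lborel)"
    by (subst nn_integral_add) (auto simp: nn_integral_cmult)
  finally show ?thesis .
qed

lemma nn_integral_reflect_real: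
  fixes u :: "real \<Rightarrow> ennreal"
  assumes [measurable]: "u \<in> borel_measurable borel"
  shows "(\<integral>\<^sup>+t. u (c - t) \<partial>lborel) = (\<integral>\<^sup>+t. u t \<partial>lborel)"
  using nn_integral_real_affine[of u "-1" c] by simp

text \<open>The sum of two half bounds, one with transversal direction \<open>a\<close> and one,
  seen from the vertex \<open>v + b\<close>, with direction \<open>a - b\<close>. Hence
  \<open>4 = 2 + 2\<close>.\<close>

definition trace_bound :: "real^2 \<Rightarrow> real^2 \<Rightarrow> real^2 \<Rightarrow> (real^2 \<Rightarrow> real) \<Rightarrow> (real^2 \<Rightarrow> real^2) \<Rightarrow> ennreal" where
  "trace_bound v a b w W = 4 * (\<integral>\<^sup>+x\<in>tri v a b. ennreal \<bar>w x\<bar> \<partial>lborel)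
    + (\<integral>\<^sup>+x\<in>tri v a b. ennreal \<bar>W x \<bullet> a\<bar> \<partial>lborel) + (\<integral>\<^sup>+x\<in>tri v a b. ennreal \<bar>W x \<bullet> (a - b)\<bar> \<partial>lborel)"

lemma tri_flip: "tri (v + b) (a - b) (- b) = tri v a b"
  unfolding tri_eq_hull by (simp add: insert_commute)

lemma crs_flip: "crs (a - b) (- b) = - crs a b"
  by (simp add: crs_def algebra_simps)

lemma trace_halves:
  assumes w: "gradient w W" and crs: "crs a b \<noteq> 0" and s: "0 \<le> s" "s \<le> 1/2"
  shows "ennreal \<bar>crs a b\<bar> * (\<integral>\<^sup>+t\<in>{0..1/2}. ennreal \<bar>w (v + s *\<^sub>R a + t *\<^sub>R b)\<bar> \<partial>lborel)
    + ennreal \<bar>crs a b\<bar> * (\<integral>\<^sup>+t\<in>{0..1/2}. ennreal \<bar>w (v + b + s *\<^sub>R (a - b) + t *\<^sub>R (- b))\<bar> \<partial>lborel)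
    \<le> trace_bound v a b w W"
proof -
  have crs': "crs (a - b) (- b) \<noteq> 0" using crs crs_flip by simp
  have eq: "2 * y + z + (2 * y + z') = 4 * y + z + z'" for y z z' :: ennreal
  proof -
    have "4 * y = 2 * y + 2 * y" by (simp flip: distrib_right)
    then show ?thesis by (simp add: add_ac)
  qed
  show ?thesis
    using add_mono[OF half_trace[OF w crs s, of v] half_trace[OF w crs' s, of "v + b"]]
    unfolding trace_bound_def tri_flip crs_flip abs_minus_cancel eq .
qed

lemma edge_trace:
  assumes w: "gradient w W" and crs: "crs a b \<noteq> 0"
  shows "ennreal \<bar>crs a b\<bar> * (\<integral>\<^sup>+t\<in>{0..1}. ennreal \<bar>w (v + t *\<^sub>R b)\<bar> \<partial>lborel) \<le> trace_bound v a b w W"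
proof -
  note [measurable] = gradient_measurable[OF w]
  \<comment> \<open>The first half of the edge seen from \<open>v + b\<close> is the second half
    seen from \<open>v\<close>.\<close>
  have refl: "(\<integral>\<^sup>+t\<in>{0..1/2}. ennreal \<bar>w (v + b + t *\<^sub>R (- b))\<bar> \<partial>lborel) = (\<integral>\<^sup>+t\<in>{1/2..1}. ennreal \<bar>w (v + t *\<^sub>R b)\<bar> \<partial>lborel)"
    by (subst nn_integral_reflect_real[of _ 1, symmetric])
      (auto intro!: nn_integral_cong simp: indicator_def algebra_simps)
  have "(\<integral>\<^sup>+t\<in>{0..1}. ennreal \<bar>w (v + t *\<^sub>R b)\<bar> \<partial>lborel) \<le>
      (\<integral>\<^sup>+t. (ennreal \<bar>w (v + t *\<^sub>R b)\<bar> * indicator {0..1/2} t + ennreal \<bar>w (v + t *\<^sub>R b)\<bar> * indicator {1/2..1} t) \<partial>lborel)"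
    by (intro nn_integral_mono) (auto simp: indicator_def)
  also have "\<dots> = (\<integral>\<^sup>+t\<in>{0..1/2}. ennreal \<bar>w (v + t *\<^sub>R b)\<bar> \<partial>lborel) + (\<integral>\<^sup>+t\<in>{1/2..1}. ennreal \<bar>w (v + t *\<^sub>R b)\<bar> \<partial>lborel)"
    by (rule nn_integral_add) auto
  finally have "ennreal \<bar>crs a b\<bar> * (\<integral>\<^sup>+t\<in>{0..1}. ennreal \<bar>w (v + t *\<^sub>R b)\<bar> \<partial>lborel) \<le>
     ennreal \<bar>crs a b\<bar> * ((\<integral>\<^sup>+t\<in>{0..1/2}. ennreal \<bar>w (v + t *\<^sub>R b)\<bar> \<partial>lborel) + (\<integral>\<^sup>+t\<in>{1/2..1}. ennreal \<bar>w (v + t *\<^sub>R b)\<bar> \<partial>lborel))"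
    by (rule mult_left_mono) simp
  also have "\<dots> \<le> trace_bound v a b w W"
    unfolding refl[symmetric] distrib_left using trace_halves[OF w crs, of 0 v] by simp
  finally show ?thesis .
qed

text \<open>The strip is swept by the segments on which \<open>co1\<close> is a constant
  \<open>s\<close> between 0 and \<open>\<delta>\<close>, and each of them is controlled by the same
  trace bound.\<close>

lemma strip_bound:
  assumes w: "gradient w W" and crs: "crs a b \<noteq> 0" and \<delta>: "\<delta> \<ge> 0"
  shows "(\<integral>\<^sup>+x\<in>{x \<in> tri v a b. co1 v a b x \<le> \<delta>}. ennreal \<bar>w x\<bar> \<partial>lborel) \<le> ennreal \<delta> * trace_bound v a b w W"
proof (cases "\<delta> \<le> 1/2")
  \<comment> \<open>A wide strip leaves the range of the segment bound, but then
    \<open>4 * \<delta> \<ge> 1\<close> and the first term of \<open>trace_bound\<close>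
    dominates.\<close>
  case False
  have "(\<integral>\<^sup>+x\<in>{x \<in> tri v a b. co1 v a b x \<le> \<delta>}. ennreal \<bar>w x\<bar> \<partial>lborel) \<le> 1 * (\<integral>\<^sup>+x\<in>tri v a b. ennreal \<bar>w x\<bar> \<partial>lborel)"
    by (auto intro!: nn_integral_mono simp: indicator_def)
  also have "\<dots> \<le> (ennreal \<delta> * 4) * (\<integral>\<^sup>+x\<in>tri v a b. ennreal \<bar>w x\<bar> \<partial>lborel)"
  proof (rule mult_right_mono)
    have "ennreal \<delta> * 4 = ennreal (\<delta> * 4)" using \<delta> by (simp add: ennreal_mult'')
    then show "1 \<le> ennreal \<delta> * 4" using False by (simp add: ennreal_le_iff flip: ennreal_1)
  qed simp
  also have "\<dots> \<le> ennreal \<delta> * trace_bound v a b w W"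
    unfolding trace_bound_def mult.assoc by (intro mult_left_mono) (auto simp: add.assoc)
  finally show ?thesis .
next
  case True
  note [measurable] = gradient_measurable[OF w]
  have part: "(\<integral>\<^sup>+x\<in>{x. 0 \<le> co1 v a b x \<and> co1 v a b x \<le> \<delta> \<and> 0 \<le> co2 v a b x \<and> co2 v a b x \<le> 1/2}. ennreal \<bar>w x\<bar> \<partial>lborel)
      \<le> (\<integral>\<^sup>+s\<in>{0..\<delta>}. ennreal \<bar>crs a b\<bar> * (\<integral>\<^sup>+t\<in>{0..1/2}. ennreal \<bar>w (v + s *\<^sub>R a + t *\<^sub>R b)\<bar> \<partial>lborel) \<partial>lborel)"
    if crs: "crs a b \<noteq> 0" for v a b
  proof -
    have [measurable]: "co1 v a b \<in> borel_measurable borel" "co2 v a b \<in> borel_measurable borel"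
      by (auto intro: borel_measurable_continuous_onI continuous_on_co)
    have "(\<integral>\<^sup>+x\<in>{x. 0 \<le> co1 v a b x \<and> co1 v a b x \<le> \<delta> \<and> 0 \<le> co2 v a b x \<and> co2 v a b x \<le> 1/2}. ennreal \<bar>w x\<bar> \<partial>lborel)
      = ennreal \<bar>crs a b\<bar> * (\<integral>\<^sup>+s. \<integral>\<^sup>+t. (ennreal \<bar>w (v + s *\<^sub>R a + t *\<^sub>R b)\<bar> * indicator {0..1/2} t) * indicator {0..\<delta>} s \<partial>lborel \<partial>lborel)"
      by (subst nn_integral_par(2)[OF crs, of _ v], measurable)
        (auto intro!: arg_cong[where f="\<lambda>x. _ * x"] nn_integral_cong simp: coords_par[OF crs] indicator_def)
    also have "\<dots> = (\<integral>\<^sup>+s. ennreal \<bar>crs a b\<bar> * (\<integral>\<^sup>+t. (ennreal \<bar>w (v + s *\<^sub>R a + t *\<^sub>R b)\<bar> * indicator {0..1/2} t) * indicator {0..\<delta>} s \<partial>lborel) \<partial>lborel)"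
      by (rule nn_integral_cmult[symmetric]) measurable
    also have "\<dots> = (\<integral>\<^sup>+s\<in>{0..\<delta>}. ennreal \<bar>crs a b\<bar> * (\<integral>\<^sup>+t\<in>{0..1/2}. ennreal \<bar>w (v + s *\<^sub>R a + t *\<^sub>R b)\<bar> \<partial>lborel) \<partial>lborel)"
      by (intro nn_integral_cong) (subst nn_integral_multc, auto simp: mult.assoc)
    finally show ?thesis by simp
  qed
  have crs': "crs (a - b) (- b) \<noteq> 0" using crs crs_flip by simp
  have co': "co1 (v + b) (a - b) (- b) x = co1 v a b x" "co2 (v + b) (a - b) (- b) x = 1 - co1 v a b x - co2 v a b x" for x
    using crs unfolding co1_def co2_def crs_flip by (simp_all add: field_simps) (simp_all add: crs_def algebra_simps)
  \<comment> \<open>\<open>?A\<close> and \<open>?B\<close> cover the strip, because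
    \<open>co2\<close> and \<open>1 - co1 - co2\<close> cannot both exceed 1/2 in the triangle. The
    latter is the second coordinate as seen from \<open>v + b\<close>.\<close>
  let ?A = "{x. 0 \<le> co1 v a b x \<and> co1 v a b x \<le> \<delta> \<and> 0 \<le> co2 v a b x \<and> co2 v a b x \<le> 1/2}"
  let ?B = "{x. 0 \<le> co1 (v + b) (a - b) (- b) x \<and> co1 (v + b) (a - b) (- b) x \<le> \<delta> \<and>
    0 \<le> co2 (v + b) (a - b) (- b) x \<and> co2 (v + b) (a - b) (- b) x \<le> 1/2}"
  have [measurable]: "?A \<in> sets borel" "?B \<in> sets borel"
    by (intro borel_closed closed_Collect_conj closed_Collect_le continuous_intros continuous_on_co)+
  let ?F = "\<lambda>s. ennreal \<bar>crs a b\<bar> * (\<integral>\<^sup>+t\<in>{0..1/2}. ennreal \<bar>w (v + s *\<^sub>R a + t *\<^sub>R b)\<bar> \<partial>lborel)"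
  let ?G = "\<lambda>s. ennreal \<bar>crs a b\<bar> * (\<integral>\<^sup>+t\<in>{0..1/2}. ennreal \<bar>w (v + b + s *\<^sub>R (a - b) + t *\<^sub>R (- b))\<bar> \<partial>lborel)"
  have "(\<integral>\<^sup>+x\<in>{x \<in> tri v a b. co1 v a b x \<le> \<delta>}. ennreal \<bar>w x\<bar> \<partial>lborel) \<le>
    (\<integral>\<^sup>+x. (ennreal \<bar>w x\<bar> * indicator ?A x + ennreal \<bar>w x\<bar> * indicator ?B x) \<partial>lborel)"
    by (intro nn_integral_mono) (auto simp: indicator_def mem_tri_iff[OF crs] co')
  also have "\<dots> = (\<integral>\<^sup>+x\<in>?A. ennreal \<bar>w x\<bar> \<partial>lborel) + (\<integral>\<^sup>+x\<in>?B. ennreal \<bar>w x\<bar> \<partial>lborel)"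
    by (rule nn_integral_add; measurable)
  also have "\<dots> \<le> (\<integral>\<^sup>+s\<in>{0..\<delta>}. ?F s \<partial>lborel) + (\<integral>\<^sup>+s\<in>{0..\<delta>}. ?G s \<partial>lborel)"
    using add_mono[OF part[OF crs, of v] part[OF crs', of "v + b"]] unfolding crs_flip by simp
  also have "\<dots> = (\<integral>\<^sup>+s. (?F s * indicator {0..\<delta>} s + ?G s * indicator {0..\<delta>} s) \<partial>lborel)"
    by (rule nn_integral_add[symmetric]) measurable
  also have "\<dots> \<le> (\<integral>\<^sup>+s. trace_bound v a b w W * indicator {0..\<delta>} s \<partial>lborel)"
  proof (intro nn_integral_mono)
    fix s :: real
    show "?F s * indicator {0..\<delta>} s + ?G s * indicator {0..\<delta>} s \<le> trace_bound v a b w W * indicator {0..\<delta>} s"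
      using trace_halves[OF w crs, of s v] True by (cases "s \<in> {0..\<delta>}") auto
  qed
  also have "\<dots> = ennreal \<delta> * trace_bound v a b w W"
    using \<delta> by (subst nn_integral_cmult_indicator) (auto simp: mult.commute)
  finally show ?thesis .
qed

text \<open>
  The straight segment from \<open>x\<close> to its reflection \<open>2v - x\<close> passes through \<open>v\<close>, where the transported
  mass would concentrate; the detour through \<open>v - s a + t b\<close> avoids this.
\<close>

lemma pair_difference:
  fixes v :: "real^2"
  assumes w: "gradient w W" and crs: "crs a b \<noteq> 0"
  defines "D \<equiv> {x. \<bar>co1 v a b x\<bar> + \<bar>co2 v a b x\<bar> \<le> 1}"
  shows "(\<integral>\<^sup>+x\<in>tri v a b. ennreal \<bar>w x - w (2 *\<^sub>R v - x)\<bar> \<partial>lborel)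
    \<le> (\<integral>\<^sup>+x\<in>D. ennreal \<bar>W x \<bullet> a\<bar> \<partial>lborel) + (\<integral>\<^sup>+x\<in>D. ennreal \<bar>W x \<bullet> b\<bar> \<partial>lborel)"
proof -
  note [measurable] = gradient_measurable[OF w]
  have [measurable]: "D \<in> sets borel" "tri v a b \<in> sets borel"
    unfolding D_def by (intro borel_closed closed_Collect_le continuous_intros continuous_on_co closed_tri)+
  have D: "v + s *\<^sub>R a + t *\<^sub>R b \<in> D \<longleftrightarrow> \<bar>s\<bar> + \<bar>t\<bar> \<le> 1" for s t
    by (simp add: D_def coords_par[OF crs])
  let ?x = "\<lambda>s t. v + s *\<^sub>R a + t *\<^sub>R b"
  let ?Fa = "\<lambda>x. ennreal \<bar>W x \<bullet> a\<bar> * indicator D x" and ?Fb = "\<lambda>x. ennreal \<bar>W x \<bullet> b\<bar> * indicator D x"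
  have T: "?x s t \<in> tri v a b \<longleftrightarrow> 0 \<le> s \<and> 0 \<le> t \<and> s + t \<le> 1" for s t
    by (simp add: mem_tri_iff[OF crs] coords_par[OF crs])
  have pt: "ennreal \<bar>w (?x s t) - w (2 *\<^sub>R v - ?x s t)\<bar> * indicator (tri v a b) (?x s t)
      \<le> (\<integral>\<^sup>+\<sigma>. ?Fa (?x \<sigma> t) \<partial>lborel) * indicator {0..1} s + (\<integral>\<^sup>+\<tau>. ?Fb (?x (- s) \<tau>) \<partial>lborel) * indicator {0..1} t" for s t
  proof (cases "0 \<le> s \<and> 0 \<le> t \<and> s + t \<le> 1")
    case True
    have "ennreal \<bar>w ((v + t *\<^sub>R b) + s *\<^sub>R a) - w ((v + t *\<^sub>R b) + (- s) *\<^sub>R a)\<bar>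
        \<le> (\<integral>\<^sup>+\<sigma>\<in>{- (1 - t)..1 - t}. ennreal \<bar>W ((v + t *\<^sub>R b) + \<sigma> *\<^sub>R a) \<bullet> a\<bar> \<partial>lborel)"
      by (intro ennreal_abs_diff_le_nn_integral[OF gradient_along[OF w]]) (use True in auto)
    also have "\<dots> \<le> (\<integral>\<^sup>+\<sigma>. ?Fa (?x \<sigma> t) \<partial>lborel)"
    proof (intro nn_integral_mono)
      fix \<sigma> :: real
      have "v + t *\<^sub>R b + \<sigma> *\<^sub>R a = ?x \<sigma> t" by simp
      then show "ennreal \<bar>W (v + t *\<^sub>R b + \<sigma> *\<^sub>R a) \<bullet> a\<bar> * indicator {- (1 - t)..1 - t} \<sigma> \<le> ?Fa (?x \<sigma> t)"
        unfolding \<open>v + t *\<^sub>R b + \<sigma> *\<^sub>R a = ?x \<sigma> t\<close> using True by (auto simp: indicator_def D)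
    qed
    also have "v + t *\<^sub>R b + s *\<^sub>R a = ?x s t" by simp
    also have "v + t *\<^sub>R b + (- s) *\<^sub>R a = ?x (- s) t" by simp
    finally have 1: "ennreal \<bar>w (?x s t) - w (?x (- s) t)\<bar> \<le> (\<integral>\<^sup>+\<sigma>. ?Fa (?x \<sigma> t) \<partial>lborel)" .
    have "ennreal \<bar>w ((v + (- s) *\<^sub>R a) + t *\<^sub>R b) - w ((v + (- s) *\<^sub>R a) + (- t) *\<^sub>R b)\<bar>
        \<le> (\<integral>\<^sup>+\<tau>\<in>{- (1 - s)..1 - s}. ennreal \<bar>W ((v + (- s) *\<^sub>R a) + \<tau> *\<^sub>R b) \<bullet> b\<bar> \<partial>lborel)"
      by (intro ennreal_abs_diff_le_nn_integral[OF gradient_along[OF w]]) (use True in auto)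
    also have "\<dots> \<le> (\<integral>\<^sup>+\<tau>. ?Fb (?x (- s) \<tau>) \<partial>lborel)"
    proof (intro nn_integral_mono)
      fix \<tau> :: real
      show "ennreal \<bar>W (v + (- s) *\<^sub>R a + \<tau> *\<^sub>R b) \<bullet> b\<bar> * indicator {- (1 - s)..1 - s} \<tau> \<le> ?Fb (?x (- s) \<tau>)"
        using True by (auto simp: indicator_def D[of "- s" \<tau>, simplified])
    qed
    finally have 2: "ennreal \<bar>w (?x (- s) t) - w (?x (- s) (- t))\<bar> \<le> (\<integral>\<^sup>+\<tau>. ?Fb (?x (- s) \<tau>) \<partial>lborel)" .
    have opp: "2 *\<^sub>R v - ?x s t = ?x (- s) (- t)" by (simp add: scaleR_2)
    have "ennreal \<bar>w (?x s t) - w (2 *\<^sub>R v - ?x s t)\<bar>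
        \<le> ennreal (\<bar>w (?x s t) - w (?x (- s) t)\<bar> + \<bar>w (?x (- s) t) - w (?x (- s) (- t))\<bar>)"
      unfolding opp by (intro ennreal_leI) linarith
    also have "\<dots> = ennreal \<bar>w (?x s t) - w (?x (- s) t)\<bar> + ennreal \<bar>w (?x (- s) t) - w (?x (- s) (- t))\<bar>"
      by (rule ennreal_plus) auto
    also have "\<dots> \<le> (\<integral>\<^sup>+\<sigma>. ?Fa (?x \<sigma> t) \<partial>lborel) + (\<integral>\<^sup>+\<tau>. ?Fb (?x (- s) \<tau>) \<partial>lborel)"
      by (rule add_mono[OF 1 2])
    finally show ?thesis using True by (simp add: T del: scaleR_minus_left)
  qed (simp add: T)
  have "(\<integral>\<^sup>+x\<in>tri v a b. ennreal \<bar>w x - w (2 *\<^sub>R v - x)\<bar> \<partial>lborel)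
      = ennreal \<bar>crs a b\<bar> * (\<integral>\<^sup>+t. \<integral>\<^sup>+s. ennreal \<bar>w (?x s t) - w (2 *\<^sub>R v - ?x s t)\<bar> * indicator (tri v a b) (?x s t) \<partial>lborel \<partial>lborel)"
    by (rule nn_integral_par(1)[OF crs]) measurable
  also have "\<dots> \<le> ennreal \<bar>crs a b\<bar> * (\<integral>\<^sup>+t. \<integral>\<^sup>+s.
      ((\<integral>\<^sup>+\<sigma>. ?Fa (?x \<sigma> t) \<partial>lborel) * indicator {0..1} s + (\<integral>\<^sup>+\<tau>. ?Fb (?x (- s) \<tau>) \<partial>lborel) * indicator {0..1} t) \<partial>lborel \<partial>lborel)"
    by (intro mult_left_mono nn_integral_mono pt) simp
  \<comment> \<open>The first bound does not depend on \<open>s\<close> and the second not on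
    \<open>t\<close>, so integrating them over the unit interval costs nothing. Each leg of the
    detour is charged only with the derivative along it.\<close>
  also have "(\<integral>\<^sup>+t. \<integral>\<^sup>+s.
      ((\<integral>\<^sup>+\<sigma>. ?Fa (?x \<sigma> t) \<partial>lborel) * indicator {0..1} s + (\<integral>\<^sup>+\<tau>. ?Fb (?x (- s) \<tau>) \<partial>lborel) * indicator {0..1} t) \<partial>lborel \<partial>lborel)
    = (\<integral>\<^sup>+t. \<integral>\<^sup>+\<sigma>. ?Fa (?x \<sigma> t) \<partial>lborel \<partial>lborel) + (\<integral>\<^sup>+s. \<integral>\<^sup>+\<tau>. ?Fb (?x (- s) \<tau>) \<partial>lborel \<partial>lborel)"
  proof -
    have "(\<integral>\<^sup>+s. ((\<integral>\<^sup>+\<sigma>. ?Fa (?x \<sigma> t) \<partial>lborel) * indicator {0..1} s + (\<integral>\<^sup>+\<tau>. ?Fb (?x (- s) \<tau>) \<partial>lborel) * indicator {0..1} t) \<partial>lborel)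
      = (\<integral>\<^sup>+\<sigma>. ?Fa (?x \<sigma> t) \<partial>lborel) + (\<integral>\<^sup>+s. \<integral>\<^sup>+\<tau>. ?Fb (?x (- s) \<tau>) \<partial>lborel \<partial>lborel) * indicator {0..1} t" for t
    proof -
      have "(\<integral>\<^sup>+s. ((\<integral>\<^sup>+\<sigma>. ?Fa (?x \<sigma> t) \<partial>lborel) * indicator {0..1} s + (\<integral>\<^sup>+\<tau>. ?Fb (?x (- s) \<tau>) \<partial>lborel) * indicator {0..1} t) \<partial>lborel)
        = (\<integral>\<^sup>+s. (\<integral>\<^sup>+\<sigma>. ?Fa (?x \<sigma> t) \<partial>lborel) * indicator {0..1::real} s \<partial>lborel)
          + (\<integral>\<^sup>+s. (\<integral>\<^sup>+\<tau>. ?Fb (?x (- s) \<tau>) \<partial>lborel) * indicator {0..1} t \<partial>lborel)"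
        by (rule nn_integral_add) measurable
      also have "(\<integral>\<^sup>+s. (\<integral>\<^sup>+\<sigma>. ?Fa (?x \<sigma> t) \<partial>lborel) * indicator {0..1::real} s \<partial>lborel) = (\<integral>\<^sup>+\<sigma>. ?Fa (?x \<sigma> t) \<partial>lborel)"
        by (subst nn_integral_cmult_indicator) auto
      also have "(\<integral>\<^sup>+s. (\<integral>\<^sup>+\<tau>. ?Fb (?x (- s) \<tau>) \<partial>lborel) * indicator {0..1} t \<partial>lborel)
        = (\<integral>\<^sup>+s. \<integral>\<^sup>+\<tau>. ?Fb (?x (- s) \<tau>) \<partial>lborel \<partial>lborel) * indicator {0..1} t"
        by (rule nn_integral_multc) measurable
      finally show ?thesis .
    qed
    then have "(\<integral>\<^sup>+t. \<integral>\<^sup>+s.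
      ((\<integral>\<^sup>+\<sigma>. ?Fa (?x \<sigma> t) \<partial>lborel) * indicator {0..1} s + (\<integral>\<^sup>+\<tau>. ?Fb (?x (- s) \<tau>) \<partial>lborel) * indicator {0..1} t) \<partial>lborel \<partial>lborel)
      = (\<integral>\<^sup>+t. ((\<integral>\<^sup>+\<sigma>. ?Fa (?x \<sigma> t) \<partial>lborel) + (\<integral>\<^sup>+s. \<integral>\<^sup>+\<tau>. ?Fb (?x (- s) \<tau>) \<partial>lborel \<partial>lborel) * indicator {0..1} t) \<partial>lborel)"
      by simp
    also have "\<dots> = (\<integral>\<^sup>+t. \<integral>\<^sup>+\<sigma>. ?Fa (?x \<sigma> t) \<partial>lborel \<partial>lborel)
        + (\<integral>\<^sup>+t. (\<integral>\<^sup>+s. \<integral>\<^sup>+\<tau>. ?Fb (?x (- s) \<tau>) \<partial>lborel \<partial>lborel) * indicator {0..1::real} t \<partial>lborel)"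
      by (rule nn_integral_add) measurable
    also have "(\<integral>\<^sup>+t. (\<integral>\<^sup>+s. \<integral>\<^sup>+\<tau>. ?Fb (?x (- s) \<tau>) \<partial>lborel \<partial>lborel) * indicator {0..1::real} t \<partial>lborel)
        = (\<integral>\<^sup>+s. \<integral>\<^sup>+\<tau>. ?Fb (?x (- s) \<tau>) \<partial>lborel \<partial>lborel)"
      by (subst nn_integral_cmult_indicator) auto
    finally show ?thesis .
  qed
  also have "(\<integral>\<^sup>+s. \<integral>\<^sup>+\<tau>. ?Fb (?x (- s) \<tau>) \<partial>lborel \<partial>lborel) = (\<integral>\<^sup>+s. \<integral>\<^sup>+\<tau>. ?Fb (?x s \<tau>) \<partial>lborel \<partial>lborel)"
  proof -
    have m: "(\<lambda>s. \<integral>\<^sup>+\<tau>. ?Fb (?x s \<tau>) \<partial>lborel) \<in> borel_measurable borel" by measurable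
    from nn_integral_reflect_real[OF m, of 0] show ?thesis by simp
  qed
  also have "ennreal \<bar>crs a b\<bar> * ((\<integral>\<^sup>+t. \<integral>\<^sup>+\<sigma>. ?Fa (?x \<sigma> t) \<partial>lborel \<partial>lborel) + (\<integral>\<^sup>+s. \<integral>\<^sup>+\<tau>. ?Fb (?x s \<tau>) \<partial>lborel \<partial>lborel))
      = (\<integral>\<^sup>+x. ?Fa x \<partial>lborel) + (\<integral>\<^sup>+x. ?Fb x \<partial>lborel)"
  proof -
    have "(\<integral>\<^sup>+x. ?Fa x \<partial>lborel) = ennreal \<bar>crs a b\<bar> * (\<integral>\<^sup>+t. \<integral>\<^sup>+\<sigma>. ?Fa (?x \<sigma> t) \<partial>lborel \<partial>lborel)"
      by (rule nn_integral_par(1)[OF crs]) measurable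
    moreover have "(\<integral>\<^sup>+x. ?Fb x \<partial>lborel) = ennreal \<bar>crs a b\<bar> * (\<integral>\<^sup>+s. \<integral>\<^sup>+\<tau>. ?Fb (?x s \<tau>) \<partial>lborel \<partial>lborel)"
      by (rule nn_integral_par(2)[OF crs]) measurable
    ultimately show ?thesis by (simp only: distrib_left)
  qed
  finally show ?thesis .
qed

text \<open>A segment parallel to \<open>a\<close> lies at a single height, and the line at that
  height is excluded. Any other segment meets a line parallel to \<open>a\<close> at most
  once.\<close>

lemma finite_segment_line:
  assumes crs: "crs a b \<noteq> 0" and t: "t \<noteq> co2 v a b p"
  shows "finite {s. v + s *\<^sub>R a + t *\<^sub>R b \<in> closed_segment p q}"
proof (rule finite_subset)
  let ?\<theta> = "(t - co2 v a b p) / (co2 v a b q - co2 v a b p)"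
  show "{s. v + s *\<^sub>R a + t *\<^sub>R b \<in> closed_segment p q} \<subseteq> {co1 v a b p + ?\<theta> * (co1 v a b q - co1 v a b p)}"
  proof clarify
    fix s assume "v + s *\<^sub>R a + t *\<^sub>R b \<in> closed_segment p q"
    then obtain \<theta> where \<theta>: "v + s *\<^sub>R a + t *\<^sub>R b = (1 - \<theta>) *\<^sub>R p + \<theta> *\<^sub>R q"
      by (auto simp: closed_segment_def)
    have aff: "co1 v a b ((1 - \<theta>) *\<^sub>R p + \<theta> *\<^sub>R q) = co1 v a b p + \<theta> * (co1 v a b q - co1 v a b p)"
      "co2 v a b ((1 - \<theta>) *\<^sub>R p + \<theta> *\<^sub>R q) = co2 v a b p + \<theta> * (co2 v a b q - co2 v a b p)"
      using crs unfolding co1_def co2_def by (simp_all add: field_simps) (simp_all add: crs_def algebra_simps)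
    have "s = co1 v a b p + \<theta> * (co1 v a b q - co1 v a b p)" "t = co2 v a b p + \<theta> * (co2 v a b q - co2 v a b p)"
      using coords_par[OF crs, of v s t] unfolding \<theta> aff by simp_all
    moreover from this have "co2 v a b q - co2 v a b p \<noteq> 0" using t by auto
    ultimately show "s = co1 v a b p + ?\<theta> * (co1 v a b q - co1 v a b p)" by simp
  qed
qed simp

lemma has_real_derivative_along_gradient:
  fixes e :: "real^2 \<Rightarrow> real"
  assumes "(e has_derivative (\<lambda>d. E \<bullet> d)) (at (c + s *\<^sub>R a))"
  shows "((\<lambda>s. e (c + s *\<^sub>R a)) has_real_derivative E \<bullet> a) (at s)"
proof -
  have "((\<lambda>s. c + s *\<^sub>R a) has_derivative (\<lambda>h. h *\<^sub>R a)) (at s)"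
    by (auto intro!: derivative_eq_intros)
  from has_derivative_compose[OF this assms] show ?thesis
    unfolding has_field_derivative_def by (rule has_derivative_eq_rhs) (auto simp: fun_eq_iff)
qed

lemma measurable_indicator_mult:
  fixes e :: "real^2 \<Rightarrow> real"
  assumes "continuous_on S e" "S \<in> sets borel"
  shows "(\<lambda>x. indicator S x * e x) \<in> borel_measurable borel"
  using borel_measurable_continuous_on_indicator[OF assms(2,1)] by simp

text \<open>
  Almost every line parallel to \<open>a\<close> meets the exceptional segments in finitely many points, so the
  fundamental theorem of calculus applies on it.
\<close>

lemma integration_by_parts_tri:
  fixes e g :: "real^2 \<Rightarrow> real"
  assumes crs: "crs a b \<noteq> 0" and e: "continuous_on (tri v a b) e"
    and U: "open U" "U \<subseteq> tri v a b" and S: "finite S" "tri v a b - U \<subseteq> (\<Union>(p, q)\<in>S. closed_segment p q)"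
    and E: "\<And>x. x \<in> U \<Longrightarrow> (e has_derivative (\<lambda>d. E x \<bullet> d)) (at x)" "continuous_on U E"
      "\<And>x. x \<notin> U \<Longrightarrow> E x = 0" "\<And>x. norm (E x) \<le> K"
    and g: "gradient g G"
  shows "(LINT x:tri v a b|lborel. g x * (E x \<bullet> a)) =
    \<bar>crs a b\<bar> * (LINT t:{0..1}|lborel. g (v + (1 - t) *\<^sub>R a + t *\<^sub>R b) * e (v + (1 - t) *\<^sub>R a + t *\<^sub>R b)
        - g (v + t *\<^sub>R b) * e (v + t *\<^sub>R b))
    - (LINT x:tri v a b|lborel. e x * (G x \<bullet> a))"
proof -
  let ?\<Omega> = "tri v a b"
  note [measurable] = gradient_measurable[OF g]
  have T [measurable]: "?\<Omega> \<in> sets borel" by (intro borel_closed closed_tri)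
  have E_ind: "E = (\<lambda>x. indicator U x *\<^sub>R E x)" using E(3) by (auto simp: indicator_def fun_eq_iff)
  have [measurable]: "E \<in> borel_measurable borel"
    by (subst E_ind, rule borel_measurable_continuous_on_indicator) (use U E in auto)
  define I1 where "I1 x = indicator ?\<Omega> x *\<^sub>R (g x * (E x \<bullet> a))" for x
  define I2 where "I2 x = indicator ?\<Omega> x *\<^sub>R (e x * (G x \<bullet> a))" for x
  have I2: "integrable lborel I2"
    unfolding I2_def by (intro borel_integrable_compact compact_tri continuous_intros e gradient_continuous[OF g])
  have "bounded (g ` ?\<Omega>)" by (intro compact_imp_bounded compact_continuous_image compact_tri gradient_continuous[OF g])
  then obtain B where B: "\<And>x. x \<in> ?\<Omega> \<Longrightarrow> \<bar>g x\<bar> \<le> B" by (auto simp: bounded_iff)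
  have I1: "integrable lborel I1"
    unfolding I1_def
  proof (rule integrableI_bounded_set_indicator[where B = "B * (K * norm a)"])
    show "emeasure lborel ?\<Omega> < \<infinity>" using emeasure_compact_finite[OF compact_tri] by simp
    show "AE x in lborel. x \<in> ?\<Omega> \<longrightarrow> norm (g x * (E x \<bullet> a)) \<le> B * (K * norm a)"
    proof (intro AE_I2 impI)
      fix x assume x: "x \<in> ?\<Omega>"
      have "\<bar>E x \<bullet> a\<bar> \<le> norm (E x) * norm a" by (rule Cauchy_Schwarz_ineq2)
      also have "\<dots> \<le> K * norm a" by (intro mult_right_mono E(4)) simp
      finally show "norm (g x * (E x \<bullet> a)) \<le> B * (K * norm a)"
        unfolding real_norm_def abs_mult using B[OF x] by (intro mult_mono) auto
    qed
  qed auto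
  \<comment> \<open>On \<open>U\<close> this is the derivative of \<open>g * e\<close> along
    \<open>a\<close>. Integrable on the plane, it is integrable on almost every line, where its
    integral is the difference of the end values.\<close>
  define H where "H x = I1 x + I2 x" for x
  have H: "integrable lborel H" unfolding H_def using I1 I2 by simp
  have mem: "v + s *\<^sub>R a + t *\<^sub>R b \<in> ?\<Omega> \<longleftrightarrow> 0 \<le> s \<and> 0 \<le> t \<and> s + t \<le> 1" for s t
    by (simp add: mem_tri_iff[OF crs] coords_par[OF crs])
  let ?\<psi> = "\<lambda>t s. g (v + s *\<^sub>R a + t *\<^sub>R b) * e (v + s *\<^sub>R a + t *\<^sub>R b)"
  have line: "(\<integral>s. H (v + s *\<^sub>R a + t *\<^sub>R b) \<partial>lborel) = indicator {0..1} t *\<^sub>R (?\<psi> t (1 - t) - ?\<psi> t 0)"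
    if t: "t \<notin> (\<lambda>(p, q). co2 v a b p) ` S" and int: "integrable lborel (\<lambda>s. H (v + s *\<^sub>R a + t *\<^sub>R b))" for t
  proof (cases "t \<in> {0..1}")
    case False
    then have "H (v + s *\<^sub>R a + t *\<^sub>R b) = 0" for s using mem[of s t] by (auto simp: H_def I1_def I2_def)
    then show ?thesis using False by simp
  next
    case True
    \<comment> \<open>The parameters at which the line meets exceptional segments. The fundamental
      theorem tolerates finitely many of them, because \<open>g * e\<close> is continuous
      across.\<close>
    define N where "N = (\<Union>(p, q)\<in>S. {s. v + s *\<^sub>R a + t *\<^sub>R b \<in> closed_segment p q})"
    have N: "finite N" unfolding N_def using t S(1) finite_segment_line[OF crs] by (force intro!: finite_UN_I)
    have "((\<lambda>s. H (v + s *\<^sub>R a + t *\<^sub>R b)) has_integral ?\<psi> t (1 - t) - ?\<psi> t 0) {0..1 - t}"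
    proof (rule fundamental_theorem_of_calculus_interior_strong[OF N])
      show "0 \<le> 1 - t" using True by simp
      have "continuous_on {0..1 - t} (\<lambda>s. e (v + s *\<^sub>R a + t *\<^sub>R b))"
        by (rule continuous_on_compose2[OF e]) (use True mem in \<open>auto intro!: continuous_intros\<close>)
      moreover have "continuous_on {0..1 - t} (\<lambda>s. g (v + s *\<^sub>R a + t *\<^sub>R b))"
        by (rule continuous_on_compose2[OF gradient_continuous(1)[OF g, of UNIV]]) (auto intro!: continuous_intros)
      ultimately show "continuous_on {0..1 - t} (?\<psi> t)" by (intro continuous_intros)
      fix s assume s: "s \<in> {0<..<1 - t} - N"
      let ?x = "v + t *\<^sub>R b + s *\<^sub>R a"
      have sw: "v + s *\<^sub>R a + t *\<^sub>R b = v + t *\<^sub>R b + s *\<^sub>R a" for s by simp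
      have x\<Omega>: "?x \<in> ?\<Omega>" using mem[of s t] s True by (simp add: sw)
      have "?x \<in> U"
      proof (rule ccontr)
        assume "?x \<notin> U"
        then obtain p q where "(p, q) \<in> S" "?x \<in> closed_segment p q" using S(2) x\<Omega> by blast
        then have "s \<in> N" unfolding N_def by (auto simp: sw)
        then show False using s by simp
      qed
      then have "((\<lambda>s. g (v + t *\<^sub>R b + s *\<^sub>R a) * e (v + t *\<^sub>R b + s *\<^sub>R a)) has_real_derivative
          (G ?x \<bullet> a) * e ?x + (E ?x \<bullet> a) * g ?x) (at s)"
        by (intro DERIV_mult gradient_along[OF g] has_real_derivative_along_gradient E(1))
      moreover have "(G ?x \<bullet> a) * e ?x + (E ?x \<bullet> a) * g ?x = H ?x"
        using x\<Omega> by (simp add: H_def I1_def I2_def)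
      ultimately show "(?\<psi> t has_vector_derivative H (v + s *\<^sub>R a + t *\<^sub>R b)) (at s)"
        unfolding sw by (simp add: has_real_derivative_iff_has_vector_derivative)
    qed
    then have "((\<lambda>s. if s \<in> {0..1 - t} then H (v + s *\<^sub>R a + t *\<^sub>R b) else 0) has_integral ?\<psi> t (1 - t) - ?\<psi> t 0) UNIV"
      by (subst has_integral_restrict_UNIV)
    moreover have "(if s \<in> {0..1 - t} then H (v + s *\<^sub>R a + t *\<^sub>R b) else 0) = H (v + s *\<^sub>R a + t *\<^sub>R b)" for s
      using mem[of s t] by (auto simp: H_def I1_def I2_def)
    ultimately have "((\<lambda>s. H (v + s *\<^sub>R a + t *\<^sub>R b)) has_integral ?\<psi> t (1 - t) - ?\<psi> t 0) UNIV" by simp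
    then show ?thesis using has_integral_unique[OF has_integral_integral_lborel[OF int]] True by simp
  qed
  \<comment> \<open>The excluded heights are those of the first end points of the segments, finitely
    many.\<close>
  have "AE t in lborel. t \<notin> (\<lambda>(p, q). co2 v a b p) ` S"
    using S(1) by (intro AE_not_in finite_imp_null_set_lborel finite_imageI)
  with integral_par(2)[OF crs H, of v]
  have AE: "AE t in lborel. (\<integral>s. H (v + s *\<^sub>R a + t *\<^sub>R b) \<partial>lborel) = indicator {0..1} t *\<^sub>R (?\<psi> t (1 - t) - ?\<psi> t 0)"
    by eventually_elim (rule line)
  have "(LINT x|lborel. H x) = \<bar>crs a b\<bar> * (\<integral>t. \<integral>s. H (v + s *\<^sub>R a + t *\<^sub>R b) \<partial>lborel \<partial>lborel)"
    by (rule integral_par(1)[OF crs H])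
  also have "(\<integral>t. \<integral>s. H (v + s *\<^sub>R a + t *\<^sub>R b) \<partial>lborel \<partial>lborel)
      = (\<integral>t. indicator {0..1} t *\<^sub>R (?\<psi> t (1 - t) - ?\<psi> t 0) \<partial>lborel)"
  proof (rule integral_cong_AE[OF _ _ AE])
    show "(\<lambda>t. \<integral>s. H (v + s *\<^sub>R a + t *\<^sub>R b) \<partial>lborel) \<in> borel_measurable lborel"
      using integral_par(3)[OF crs H, of v] by (rule borel_measurable_integrable)
    have "continuous_on {0..1} (\<lambda>t. ?\<psi> t (1 - t) - ?\<psi> t 0)"
      by (intro continuous_intros continuous_on_compose2[OF e] continuous_on_compose2[OF gradient_continuous(1)[OF g, of UNIV]])
        (use mem mem[of 0] in auto)
    then show "(\<lambda>t. indicator {0..1} t *\<^sub>R (?\<psi> t (1 - t) - ?\<psi> t 0)) \<in> borel_measurable lborel"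
      using borel_measurable_continuous_on_indicator[of "{0..1::real}" "\<lambda>t. ?\<psi> t (1 - t) - ?\<psi> t 0"] by simp
  qed
  finally have "(LINT x|lborel. I1 x) + (LINT x|lborel. I2 x)
      = \<bar>crs a b\<bar> * (\<integral>t. indicator {0..1} t *\<^sub>R (?\<psi> t (1 - t) - ?\<psi> t 0) \<partial>lborel)"
    unfolding H_def using I1 I2 by simp
  then show ?thesis
    unfolding set_lebesgue_integral_def I1_def I2_def by simp
qed

section \<open>The error on edges\<close>

lemma compact_continuous_integral:
  fixes u :: "'a::euclidean_space \<Rightarrow> real"
  assumes "compact S" "continuous_on S u"
  shows "u integrable_on S" "(LINT x:S|lborel. u x) = integral S u" "set_integrable lborel S u"
proof -
  show 1: "set_integrable lborel S u"
    unfolding set_integrable_def by (rule borel_integrable_compact[OF assms])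
  show "u integrable_on S" "(LINT x:S|lborel. u x) = integral S u"
    using set_borel_integral_eq_integral[OF 1] by auto
qed

lemma compact_nn_integral:
  fixes u :: "'a::euclidean_space \<Rightarrow> real"
  assumes "compact S" "continuous_on S u"
  shows "(\<integral>\<^sup>+x\<in>S. ennreal \<bar>u x\<bar> \<partial>lborel) = ennreal (integral S (\<lambda>x. \<bar>u x\<bar>))"
  by (rule nn_integral_has_integral_lebesgue')
    (auto intro!: integrable_integral compact_continuous_integral(1) assms continuous_intros)

lemma compact_integral_mono:
  fixes u w :: "'a::euclidean_space \<Rightarrow> real"
  assumes "compact S" "continuous_on S u" "continuous_on S w" "\<And>x. x \<in> S \<Longrightarrow> u x \<le> w x"
  shows "integral S u \<le> integral S w"
  by (intro integral_le compact_continuous_integral(1) assms)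

lemma compact_integral_abs_le:
  fixes u w :: "'a::euclidean_space \<Rightarrow> real"
  assumes "compact S" "continuous_on S u" "continuous_on S w" "\<And>x. x \<in> S \<Longrightarrow> \<bar>u x\<bar> \<le> w x"
  shows "\<bar>integral S u\<bar> \<le> integral S w"
  using Henstock_Kurzweil_Integration.integral_norm_bound_integral[of u S w]
    compact_continuous_integral(1)[OF assms(1,2)] compact_continuous_integral(1)[OF assms(1,3)] assms(4) by simp

lemma integral_reflect_interval:
  fixes u :: "real \<Rightarrow> real"
  assumes "continuous_on {\<alpha>..\<beta>} u"
  shows "integral {\<alpha>..\<beta>} (\<lambda>t. u (\<alpha> + \<beta> - t)) = integral {\<alpha>..\<beta>} u"
proof -
  define G where "G s = u (- s)" for s
  have "continuous_on {\<alpha> + - (\<alpha> + \<beta>)..\<beta> + - (\<alpha> + \<beta>)} G"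
    unfolding G_def by (rule continuous_on_compose2[OF assms]) (auto intro!: continuous_intros)
  from integral_shift[OF this] show ?thesis
    unfolding G_def by (simp add: o_def add.commute)
qed

text \<open>Folding about the midpoint writes the doubled integrand as \<open>(\<eta> + \<eta>') *
  \<gamma> + \<eta>' * (\<gamma>' - \<gamma>)\<close>, where primes in this formula mark reflected
  points. The first factor is small by symmetry; the difference is at most the variation of
  \<open>\<gamma>\<close>, and integrating it over the interval contributes the length.\<close>

lemma antisymmetric_interval:
  fixes \<gamma> \<gamma>' \<eta> :: "real \<Rightarrow> real"
  assumes le: "\<alpha> \<le> \<beta>" and der: "\<And>r. (\<gamma> has_real_derivative \<gamma>' r) (at r)" and cont: "continuous_on UNIV \<gamma>'"
    and \<eta>: "continuous_on {\<alpha>..\<beta>} \<eta>" and B0: "\<And>t. t \<in> {\<alpha>..\<beta>} \<Longrightarrow> \<bar>\<eta> t\<bar> \<le> B0"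
    and B1: "\<And>t. t \<in> {\<alpha>..\<beta>} \<Longrightarrow> \<bar>\<eta> t + \<eta> (\<alpha> + \<beta> - t)\<bar> \<le> B1"
  shows "2 * \<bar>integral {\<alpha>..\<beta>} (\<lambda>t. \<gamma> t * \<eta> t)\<bar>
    \<le> B1 * integral {\<alpha>..\<beta>} (\<lambda>t. \<bar>\<gamma> t\<bar>) + (\<beta> - \<alpha>) * B0 * integral {\<alpha>..\<beta>} (\<lambda>t. \<bar>\<gamma>' t\<bar>)"
proof -
  have \<gamma>: "continuous_on S \<gamma>" for S
    by (intro continuous_at_imp_continuous_on) (use der DERIV_isCont in blast)
  have \<gamma>': "continuous_on S \<gamma>'" for S using cont continuous_on_subset by blast
  let ?V = "integral {\<alpha>..\<beta>} (\<lambda>t. \<bar>\<gamma>' t\<bar>)"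
  have V: "\<bar>\<gamma> s - \<gamma> \<sigma>\<bar> \<le> ?V" if "s \<in> {\<alpha>..\<beta>}" "\<sigma> \<in> {\<alpha>..\<beta>}" for s \<sigma>
  proof -
    have "ennreal \<bar>\<gamma> s - \<gamma> \<sigma>\<bar> \<le> ennreal ?V"
      using ennreal_abs_diff_le_nn_integral[OF der cont that] compact_nn_integral[of "{\<alpha>..\<beta>}" \<gamma>'] \<gamma>' by simp
    moreover have "0 \<le> ?V" by (intro Henstock_Kurzweil_Integration.integral_nonneg compact_continuous_integral(1) continuous_intros \<gamma>') auto
    ultimately show ?thesis by (simp add: ennreal_le_iff)
  qed
  let ?r = "\<lambda>t. \<alpha> + \<beta> - t"
  have \<eta>r: "continuous_on {\<alpha>..\<beta>} (\<lambda>t. \<eta> (?r t))"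
    by (rule continuous_on_compose2[OF \<eta>]) (auto intro!: continuous_intros)
  have \<gamma>r: "continuous_on {\<alpha>..\<beta>} (\<lambda>t. \<gamma> (?r t))"
    by (rule continuous_on_compose2[OF \<gamma>[of UNIV]]) (auto intro!: continuous_intros)
  let ?I = "integral {\<alpha>..\<beta>} (\<lambda>t. \<gamma> t * \<eta> t)"
  have c1: "continuous_on {\<alpha>..\<beta>} (\<lambda>t. \<gamma> t * \<eta> t)" by (intro continuous_intros \<gamma> \<eta>)
  have c2: "continuous_on {\<alpha>..\<beta>} (\<lambda>t. \<gamma> (?r t) * \<eta> (?r t))" by (intro continuous_intros \<gamma>r \<eta>r)
  have "2 * ?I = ?I + integral {\<alpha>..\<beta>} (\<lambda>t. \<gamma> (?r t) * \<eta> (?r t))"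
    using integral_reflect_interval[OF c1] by simp
  also have "\<dots> = integral {\<alpha>..\<beta>} (\<lambda>t. \<gamma> t * \<eta> t + \<gamma> (?r t) * \<eta> (?r t))"
    by (intro integral_add[symmetric] compact_continuous_integral(1) c1 c2) auto
  finally have "2 * \<bar>?I\<bar> = \<bar>integral {\<alpha>..\<beta>} (\<lambda>t. \<gamma> t * \<eta> t + \<gamma> (?r t) * \<eta> (?r t))\<bar>" by linarith
  also have "\<dots> \<le> integral {\<alpha>..\<beta>} (\<lambda>t. B1 * \<bar>\<gamma> t\<bar> + B0 * ?V)"
  proof (rule compact_integral_abs_le)
    show "continuous_on {\<alpha>..\<beta>} (\<lambda>t. \<gamma> t * \<eta> t + \<gamma> (?r t) * \<eta> (?r t))" by (intro continuous_intros c1 c2)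
    show "continuous_on {\<alpha>..\<beta>} (\<lambda>t. B1 * \<bar>\<gamma> t\<bar> + B0 * ?V)" by (intro continuous_intros \<gamma>)
    fix t assume t: "t \<in> {\<alpha>..\<beta>}"
    then have rt: "?r t \<in> {\<alpha>..\<beta>}" by auto
    have "\<gamma> t * \<eta> t + \<gamma> (?r t) * \<eta> (?r t) = (\<eta> t + \<eta> (?r t)) * \<gamma> t + \<eta> (?r t) * (\<gamma> (?r t) - \<gamma> t)"
      by (simp add: algebra_simps)
    also have "\<bar>\<dots>\<bar> \<le> \<bar>\<eta> t + \<eta> (?r t)\<bar> * \<bar>\<gamma> t\<bar> + \<bar>\<eta> (?r t)\<bar> * \<bar>\<gamma> (?r t) - \<gamma> t\<bar>"
      by (metis abs_mult abs_triangle_ineq)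
    also have "\<dots> \<le> B1 * \<bar>\<gamma> t\<bar> + B0 * ?V"
      using B0[OF rt] B1[OF t] V[OF rt t] by (intro add_mono mult_mono) auto
    finally show "\<bar>\<gamma> t * \<eta> t + \<gamma> (?r t) * \<eta> (?r t)\<bar> \<le> B1 * \<bar>\<gamma> t\<bar> + B0 * ?V" .
  qed simp
  also have "\<dots> = B1 * integral {\<alpha>..\<beta>} (\<lambda>t. \<bar>\<gamma> t\<bar>) + (\<beta> - \<alpha>) * B0 * ?V"
  proof -
    have "(\<lambda>t. B1 * \<bar>\<gamma> t\<bar>) integrable_on {\<alpha>..\<beta>}"
      by (intro compact_continuous_integral(1) continuous_intros \<gamma>) auto
    then show ?thesis using le by (subst integral_add) auto
  qed
  finally show ?thesis .
qed

definition trace_sum :: "real^2 \<Rightarrow> real^2 \<Rightarrow> real^2 \<Rightarrow> (real^2 \<Rightarrow> real) \<Rightarrow> (real^2 \<Rightarrow> real^2) \<Rightarrow> real" where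
  "trace_sum v a b w W = 4 * integral (tri v a b) (\<lambda>x. \<bar>w x\<bar>) + integral (tri v a b) (\<lambda>x. \<bar>W x \<bullet> a\<bar>)
    + integral (tri v a b) (\<lambda>x. \<bar>W x \<bullet> (a - b)\<bar>)"

lemma integral_abs_nonneg:
  fixes u :: "'a::euclidean_space \<Rightarrow> real"
  shows "integral S (\<lambda>x. \<bar>u x\<bar>) \<ge> 0"
  by (cases "(\<lambda>x. \<bar>u x\<bar>) integrable_on S")
    (auto intro: Henstock_Kurzweil_Integration.integral_nonneg simp: not_integrable_integral)

lemma trace_bound_eq:
  assumes "gradient w W"
  shows "trace_bound v a b w W = ennreal (trace_sum v a b w W)" and "trace_sum v a b w W \<ge> 0"
proof -
  show "trace_sum v a b w W \<ge> 0" unfolding trace_sum_def by (intro add_nonneg_nonneg mult_nonneg_nonneg integral_abs_nonneg) auto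
  have "continuous_on (tri v a b) w" "continuous_on (tri v a b) (\<lambda>x. W x \<bullet> a)" "continuous_on (tri v a b) (\<lambda>x. W x \<bullet> (a - b))"
    by (intro continuous_intros gradient_continuous[OF assms])+
  then show "trace_bound v a b w W = ennreal (trace_sum v a b w W)"
    unfolding trace_bound_def trace_sum_def
    by (simp add: compact_nn_integral compact_tri ennreal_plus integral_abs_nonneg ennreal_mult' del: ennreal_plus[symmetric])
qed

lemma edge_trace_real:
  assumes w: "gradient w W" and crs: "crs a b \<noteq> 0"
  shows "\<bar>crs a b\<bar> * integral {0..1} (\<lambda>t. \<bar>w (v + t *\<^sub>R b)\<bar>) \<le> trace_sum v a b w W"
proof -
  have "continuous_on {0..1} (\<lambda>t. w (v + t *\<^sub>R b))"
    by (rule continuous_on_compose2[OF gradient_continuous(1)[OF w, of UNIV]]) (auto intro!: continuous_intros)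
  from compact_nn_integral[OF _ this] edge_trace[OF w crs, of v]
  have "ennreal (\<bar>crs a b\<bar> * integral {0..1} (\<lambda>t. \<bar>w (v + t *\<^sub>R b)\<bar>)) \<le> ennreal (trace_sum v a b w W)"
    by (simp add: trace_bound_eq[OF w] ennreal_mult')
  then show ?thesis using trace_bound_eq(2)[OF w, of v a b] by (simp add: ennreal_le_iff)
qed

definition W1_sum :: "(real^2) set \<Rightarrow> (real^2 \<Rightarrow> real) \<Rightarrow> (real^2 \<Rightarrow> real^2) \<Rightarrow> real" where
  "W1_sum S w W = integral S (\<lambda>x. \<bar>w x\<bar>) + integral S (\<lambda>x. \<bar>W x $ 1\<bar>) + integral S (\<lambda>x. \<bar>W x $ 2\<bar>)"

lemma abs_inner_vec2_le: "\<bar>(y::real^2) \<bullet> a\<bar> \<le> norm a * (\<bar>y $ 1\<bar> + \<bar>y $ 2\<bar>)"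
proof -
  have "y \<bullet> a = y $ 1 * a $ 1 + y $ 2 * a $ 2" by (simp add: inner_vec_def sum_2)
  then have "\<bar>y \<bullet> a\<bar> \<le> \<bar>y $ 1\<bar> * \<bar>a $ 1\<bar> + \<bar>y $ 2\<bar> * \<bar>a $ 2\<bar>"
    by (metis abs_mult abs_triangle_ineq)
  also have "\<dots> \<le> \<bar>y $ 1\<bar> * norm a + \<bar>y $ 2\<bar> * norm a"
    by (intro add_mono mult_left_mono component_le_norm_cart) auto
  finally show ?thesis by (simp add: algebra_simps)
qed

lemma integral_abs_inner_le:
  fixes W :: "real^2 \<Rightarrow> real^2"
  assumes "compact S" "continuous_on S W"
  shows "integral S (\<lambda>x. \<bar>W x \<bullet> a\<bar>) \<le> norm a * (integral S (\<lambda>x. \<bar>W x $ 1\<bar>) + integral S (\<lambda>x. \<bar>W x $ 2\<bar>))"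
proof -
  have "integral S (\<lambda>x. \<bar>W x \<bullet> a\<bar>) \<le> integral S (\<lambda>x. norm a * (\<bar>W x $ 1\<bar> + \<bar>W x $ 2\<bar>))"
    by (intro compact_integral_mono abs_inner_vec2_le continuous_intros assms)
  also have "\<dots> = norm a * (integral S (\<lambda>x. \<bar>W x $ 1\<bar>) + integral S (\<lambda>x. \<bar>W x $ 2\<bar>))"
    by (simp, subst integral_add) (auto intro!: compact_continuous_integral(1) continuous_intros assms)
  finally show ?thesis .
qed

lemma trace_sum_le:
  assumes w: "gradient w W"
  shows "trace_sum v a b w W \<le> (4 + norm a + norm (a - b)) * W1_sum (tri v a b) w W"
proof -
  let ?i = "integral (tri v a b) (\<lambda>x. \<bar>w x\<bar>)" and ?j = "integral (tri v a b) (\<lambda>x. \<bar>W x $ 1\<bar>) + integral (tri v a b) (\<lambda>x. \<bar>W x $ 2\<bar>)"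
  have "trace_sum v a b w W \<le> 4 * ?i + norm a * ?j + norm (a - b) * ?j"
    unfolding trace_sum_def by (intro add_mono integral_abs_inner_le compact_tri gradient_continuous[OF w] order_refl)
  also have "\<dots> \<le> 4 * (?i + ?j) + norm a * (?i + ?j) + norm (a - b) * (?i + ?j)"
  proof -
    have "0 \<le> ?i" "0 \<le> ?j" by (intro add_nonneg_nonneg integral_abs_nonneg)+
    then show ?thesis by (intro add_mono[OF add_mono] mult_left_mono) auto
  qed
  finally show ?thesis unfolding W1_sum_def by (simp add: algebra_simps)
qed

lemma tri_hull3:
  assumes "card C = 3" "\<not> affine_dependent C" "C = {x, y, z}"
  shows "convex hull C = tri x (y - x) (z - x)" "crs (y - x) (z - x) \<noteq> 0"
proof -
  show hull: "convex hull C = tri x (y - x) (z - x)" unfolding tri_eq_hull assms(3) by simp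
  have "x \<noteq> y" "x \<noteq> z" "y \<noteq> z" using assms(1,3) by (auto simp: card_insert_if split: if_splits)
  then have "\<not> collinear {x, x + (y - x), x + (z - x)}"
    using assms(2,3) by (simp add: collinear_3_eq_affine_dependent)
  then show "crs (y - x) (z - x) \<noteq> 0" unfolding collinear_translate by (rule crs_neq_0)
qed

context fe_mesh
begin

lemma compact_element: "T \<in> \<T> \<Longrightarrow> compact T"
  using element_simplex compact_simplex by blast

lemma convex_element: "T \<in> \<T> \<Longrightarrow> convex T"
  using element_simplex convex_simplex by blast

text \<open>The intersection is a face of both elements. Were it all of one of them, it would be a
  proper face of the other and of smaller dimension, although both are two-dimensional. As a proper
  face it lies in the frontier.\<close>

lemma negligible_Int_elements:
  assumes "T \<in> \<T>" "T' \<in> \<T>" "T \<noteq> T'"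
  shows "negligible (T \<inter> T')"
proof -
  have face: "(T \<inter> T') face_of T" "(T' \<inter> T) face_of T'" using element_Int_face assms by blast+
  have "T \<inter> T' \<noteq> T"
  proof
    assume eq: "T \<inter> T' = T"
    then have "T' \<inter> T \<noteq> T'" using assms(3) by blast
    from face_of_aff_dim_lt[OF convex_element[OF assms(2)] face(2) this] eq show False
      using aff_dim_simplex[OF element_simplex[OF assms(1)]] aff_dim_simplex[OF element_simplex[OF assms(2)]]
      by (simp add: Int_commute)
  qed
  then have "T \<inter> T' \<inter> interior T = {}" by (rule face_of_disjoint_interior[OF face(1)])
  then have "T \<inter> T' \<subseteq> frontier T"
    using closure_subset by (fastforce simp: frontier_def)
  then show ?thesis using negligible_subset negligible_convex_frontier convex_element assms(1) by blast
qed

lemma integral_elements: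
  fixes u :: "real^2 \<Rightarrow> real"
  assumes "\<X> \<subseteq> \<T>" "continuous_on (\<Union>\<X>) u"
  shows "integral (\<Union>\<X>) u = (\<Sum>T\<in>\<X>. integral T u)"
proof (rule integral_unique, rule has_integral_Union)
  show "finite \<X>" using assms(1) finite_mesh finite_subset by blast
  show "pairwise (\<lambda>S S'. negligible (S \<inter> S')) \<X>"
    using negligible_Int_elements assms(1) by (auto simp: pairwise_def)
  fix T assume T: "T \<in> \<X>"
  then have "u integrable_on T"
    using assms compact_element by (intro compact_continuous_integral(1) continuous_on_subset[OF assms(2)]) auto
  then show "(u has_integral integral T u) T" by (rule integrable_integral)
qed

text \<open>\<open>fh\<close> is one function that coincides with a polynomial on each closed
  element, so the finitely many pieces glue.\<close>

lemma continuous_on_err: "continuous_on \<Omega> err"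
proof -
  have "continuous_on (\<Union>T\<in>\<T>. T) fh"
  proof (rule continuous_on_closed_Union[OF finite_mesh])
    fix T assume T: "T \<in> \<T>"
    show "closed T" using compact_element[OF T] compact_imp_closed by blast
    obtain v a b where vab: "T = tri v a b" "crs a b \<noteq> 0" using elementE[OF T] by metis
    obtain p where "p \<in> polys_upto k" "\<And>x. x \<in> T \<Longrightarrow> fh x = p x"
      using element_interpolant[OF k1 interpolant] T vab by metis
    then show "continuous_on T fh" using polys_upto_continuous by (metis continuous_on_cong)
  qed
  moreover have "continuous_on \<Omega> f" using smooth by (simp add: Ck_closed_def)
  ultimately show ?thesis unfolding err_def[abs_def] using union_mesh by (auto intro!: continuous_intros)
qed

definition "skeleton_free = (\<Union>T\<in>\<T>. interior T)"

text \<open>Zero on the skeleton and outside \<open>\<Omega>\<close>: the field is then bounded and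
  measurable on the whole plane, and on \<open>\<Omega>\<close> it is the elementwise gradient of
  the error up to a null set.\<close>

definition "err_grad x = (if x \<in> skeleton_free then (\<chi> i. partial i fh x - partial i f x) else 0)"

lemma open_skeleton_free: "open skeleton_free"
  unfolding skeleton_free_def by blast

lemma skeleton_free_subset: "skeleton_free \<subseteq> \<Omega>" "skeleton_free \<subseteq> interior \<Omega>"
proof -
  show "skeleton_free \<subseteq> interior \<Omega>"
    unfolding skeleton_free_def using interior_mono element_subset by blast
  then show "skeleton_free \<subseteq> \<Omega>" using interior_subset by blast
qed

text \<open>Supplies the finitely many exceptional segments for integration by parts on
  lines.\<close>

lemma skeleton_segments:
  obtains S where "finite S" "\<Omega> - skeleton_free \<subseteq> (\<Union>(p, q)\<in>S. closed_segment p q)"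
proof -
  have "\<exists>S. finite S \<and> T - interior T \<subseteq> (\<Union>(p, q)\<in>S. closed_segment p q)" if T: "T \<in> \<T>" for T
  proof -
    obtain v a b where vab: "T = tri v a b" "crs a b \<noteq> 0" using elementE[OF T] by metis
    have "T - interior T \<subseteq> (\<Union>(p, q)\<in>{(v, v + b), (v, v + a), (v + a, v + b)}. closed_segment p q)"
    proof
      fix x assume "x \<in> T - interior T"
      then have x: "x \<in> tri v a b" "x \<notin> otri v a b" using otri_subset_interior[OF vab(2)] vab(1) by auto
      obtain s t where st: "x = v + s *\<^sub>R a + t *\<^sub>R b" "0 \<le> s" "0 \<le> t" "s + t \<le> 1" using x(1) unfolding tri_eq by blast
      then have "s = 0 \<or> t = 0 \<or> s + t = 1" using otriI[OF vab(2), of s t v] x(2) by force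
      then consider "s = 0" | "t = 0" | "s = 1 - t" by linarith
      then show "x \<in> (\<Union>(p, q)\<in>{(v, v + b), (v, v + a), (v + a, v + b)}. closed_segment p q)"
      proof cases
        case 1
        then have "x \<in> closed_segment v (v + b)" unfolding closed_segment_def using st by (auto intro!: exI[of _ t] simp: algebra_simps)
        then show ?thesis by simp
      next
        case 2
        then have "x \<in> closed_segment v (v + a)" unfolding closed_segment_def using st by (auto intro!: exI[of _ s] simp: algebra_simps)
        then show ?thesis by simp
      next
        case 3
        have "x = (1 - t) *\<^sub>R (v + a) + t *\<^sub>R (v + b)" unfolding st(1) 3 by (simp add: algebra_simps)
        then have "x \<in> closed_segment (v + a) (v + b)" unfolding closed_segment_def using st 3 by auto
        then show ?thesis by simp
      qed
    qed
    then show ?thesis by (intro exI[of _ "{(v, v + b), (v, v + a), (v + a, v + b)}"]) simp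
  qed
  then obtain S where S: "\<And>T. T \<in> \<T> \<Longrightarrow> finite (S T)" "\<And>T. T \<in> \<T> \<Longrightarrow> T - interior T \<subseteq> (\<Union>(p, q)\<in>S T. closed_segment p q)"
    by metis
  have "\<Omega> - skeleton_free \<subseteq> (\<Union>T\<in>\<T>. T - interior T)"
    unfolding skeleton_free_def union_mesh[symmetric] by blast
  also have "\<dots> \<subseteq> (\<Union>(p, q)\<in>(\<Union>T\<in>\<T>. S T). closed_segment p q)" using S(2) by fastforce
  finally show ?thesis using that S(1) finite_mesh by blast
qed

lemma err_grad_element:
  assumes "T \<in> \<T>"
  obtains P where "continuous_on UNIV P"
    "\<And>x. x \<in> interior T \<Longrightarrow> (err has_derivative (\<lambda>d. err_grad x \<bullet> d)) (at x)"
    "\<And>x. x \<in> interior T \<Longrightarrow> err_grad x = P x - (\<chi> i. partial i f x)"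
proof -
  obtain v a b where vab: "T = tri v a b" "crs a b \<noteq> 0" using elementE[OF assms] by metis
  obtain p where p: "p \<in> polys_upto k" "\<And>x. x \<in> T \<Longrightarrow> fh x = p x"
    using element_interpolant[OF k1 interpolant] assms vab by metis
  obtain P where P: "continuous_on UNIV P" "\<And>x. (p has_derivative (\<lambda>d. P x \<bullet> d)) (at x)"
    using polys_upto_has_gradient[OF p(1)] by blast
  have fh: "(fh has_derivative (\<lambda>d. P x \<bullet> d)) (at x)" if "x \<in> interior T" for x
    using has_derivative_cong_open[of "interior T" x fh p] that p(2) interior_subset P(2) by blast
  have eq: "err_grad x = P x - (\<chi> i. partial i f x)" if x: "x \<in> interior T" for x
  proof -
    have "x \<in> skeleton_free" using x assms unfolding skeleton_free_def by blast
    moreover have "partial i fh x = P x $ i" for i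
      using partial_eqI[OF fh[OF x]] by (simp add: inner_axis)
    ultimately show ?thesis by (simp add: err_grad_def vec_eq_iff)
  qed
  have "(err has_derivative (\<lambda>d. err_grad x \<bullet> d)) (at x)" if x: "x \<in> interior T" for x
  proof -
    have "x \<in> interior \<Omega>" using x interior_mono[OF element_subset[OF assms]] by blast
    moreover have "f differentiable_on interior \<Omega>" using smooth by (simp add: Ck_closed_def)
    ultimately have "f differentiable at x" by (simp add: differentiable_on_eq_differentiable_at)
    from has_derivative_diff[OF fh[OF x] has_derivative_partial[OF this]]
    show ?thesis unfolding err_def[abs_def] eq[OF x]
      by (rule has_derivative_eq_rhs) (auto simp: fun_eq_iff inner_diff_left inner_vec_def sum_2 algebra_simps)
  qed
  then show ?thesis using that P(1) eq by blast
qed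

lemma has_derivative_err:
  "x \<in> skeleton_free \<Longrightarrow> (err has_derivative (\<lambda>d. err_grad x \<bullet> d)) (at x)"
  unfolding skeleton_free_def using err_grad_element by (metis UN_E)

lemma continuous_on_err_grad: "continuous_on skeleton_free err_grad"
  unfolding skeleton_free_def
proof (rule continuous_on_open_UN)
  fix T assume T: "T \<in> \<T>"
  obtain P where P: "continuous_on UNIV P" "\<And>x. x \<in> interior T \<Longrightarrow> err_grad x = P x - (\<chi> i. partial i f x)"
    using err_grad_element[OF T] by metis
  have "continuous_on (interior \<Omega>) (partial i f)" for i
  proof -
    have "Ck_on (k + 1) (interior \<Omega>) (partial i f)" using smooth by (simp add: Ck_closed_def)
    from Ck_on_mono[OF this, of 0] show ?thesis by simp
  qed
  then have "continuous_on (interior T) (partial i f)" for i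
    using interior_mono[OF element_subset[OF T]] continuous_on_subset by blast
  then have "continuous_on (interior T) (\<lambda>x. P x - (\<chi> i. partial i f x))"
    using P(1) by (intro continuous_intros) (auto intro: continuous_on_subset)
  then show "continuous_on (interior T) err_grad" using P(2) by (simp cong: continuous_on_cong)
qed auto

text \<open>The bound may depend on the mesh. It serves integrability and dominated convergence only
  and never enters the constant of the estimate.\<close>

lemma err_grad_bounded: "\<exists>K. \<forall>x. norm (err_grad x) \<le> K"
proof -
  have "\<exists>K\<ge>0. \<forall>x\<in>interior T. norm (err_grad x) \<le> K" if T: "T \<in> \<T>" for T
  proof -
    obtain P where P: "continuous_on UNIV P" "\<And>x. x \<in> interior T \<Longrightarrow> err_grad x = P x - (\<chi> i. partial i f x)"
      using err_grad_element[OF T] by metis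
    have "bounded (P ` T)" using P(1) compact_element[OF T]
      by (intro compact_imp_bounded compact_continuous_image) (auto intro: continuous_on_subset)
    then obtain B where B: "B > 0" "\<And>x. x \<in> T \<Longrightarrow> norm (P x) \<le> B" by (auto simp: bounded_pos)
    have "norm (err_grad x) \<le> B + 2 * Ck_norm 1 \<Omega> f" if x: "x \<in> interior T" for x
    proof -
      have x\<Omega>: "x \<in> interior \<Omega>" using x interior_mono[OF element_subset[OF T]] by blast
      have pf: "\<bar>partial i f x\<bar> \<le> Ck_norm 1 \<Omega> f" for i
      proof -
        have "\<bar>mpartial (axis i 1) f x\<bar> \<le> Ck_norm 1 \<Omega> f"
          by (rule abs_mpartial_le_Ck_norm[OF smooth compact_domain _ _ x\<Omega>]) (use exhaust_2[of i] in \<open>auto simp: mi_order_def axis_def\<close>)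
        moreover have "mpartial (axis i 1) f = partial i f" using exhaust_2[of i] by (auto simp: mpartial_def axis_def)
        ultimately show ?thesis by simp
      qed
      have "norm (\<chi> i. partial i f x) \<le> 2 * Ck_norm 1 \<Omega> f"
        using pf[of 1] pf[of 2] norm_le_l1_cart[of "\<chi> i. partial i f x"] by (simp add: sum_2)
      moreover have "norm (P x) \<le> B" using B(2) x interior_subset by blast
      ultimately show ?thesis unfolding P(2)[OF x] using norm_triangle_ineq4[of "P x" "\<chi> i. partial i f x"] by linarith
    qed
    then show ?thesis
      by (intro exI[of _ "max 0 (B + 2 * Ck_norm 1 \<Omega> f)"]) (simp add: max.coboundedI2)
  qed
  then obtain K where K: "\<And>T. T \<in> \<T> \<Longrightarrow> K T \<ge> 0" "\<And>T x. T \<in> \<T> \<Longrightarrow> x \<in> interior T \<Longrightarrow> norm (err_grad x) \<le> K T"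
    by metis
  have "norm (err_grad x) \<le> (\<Sum>T\<in>\<T>. K T)" for x
  proof (cases "x \<in> skeleton_free")
    case True
    then obtain T where T: "T \<in> \<T>" "x \<in> interior T" unfolding skeleton_free_def by blast
    then have "norm (err_grad x) \<le> K T" using K(2) by blast
    also have "\<dots> \<le> (\<Sum>T\<in>\<T>. K T)" using T(1) K(1) finite_mesh by (intro member_le_sum) auto
    finally show ?thesis .
  qed (auto simp: err_grad_def intro!: sum_nonneg K(1))
  then show ?thesis by blast
qed

lemma edge_integral_le:
  assumes dom: "\<Omega> = tri w0 c d" and crs: "crs c d \<noteq> 0" and g: "gradient g G"
    and B0: "\<And>x. x \<in> \<Omega> \<Longrightarrow> \<bar>err x\<bar> \<le> B0"
  shows "\<bar>crs c d\<bar> * \<bar>integral {0..1} (\<lambda>t. g (w0 + t *\<^sub>R d) * err (w0 + t *\<^sub>R d))\<bar> \<le> B0 * trace_sum w0 c d g G"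
proof -
  have mem: "w0 + t *\<^sub>R d \<in> \<Omega>" if "t \<in> {0..1}" for t
    using tri_memI[of 0 t w0 c d] that dom by simp
  then have "B0 \<ge> 0" using B0[OF mem[of 0]] by simp
  have e: "continuous_on {0..1} (\<lambda>t. err (w0 + t *\<^sub>R d))"
    by (rule continuous_on_compose2[OF continuous_on_err]) (use mem in \<open>auto intro!: continuous_intros\<close>)
  have gc: "continuous_on {0..1} (\<lambda>t. g (w0 + t *\<^sub>R d))"
    by (rule continuous_on_compose2[OF gradient_continuous(1)[OF g, of UNIV]]) (auto intro!: continuous_intros)
  have "\<bar>integral {0..1} (\<lambda>t. g (w0 + t *\<^sub>R d) * err (w0 + t *\<^sub>R d))\<bar> \<le> integral {0..1} (\<lambda>t. B0 * \<bar>g (w0 + t *\<^sub>R d)\<bar>)"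
  proof (rule compact_integral_abs_le)
    fix t :: real assume "t \<in> {0..1}"
    then show "\<bar>g (w0 + t *\<^sub>R d) * err (w0 + t *\<^sub>R d)\<bar> \<le> B0 * \<bar>g (w0 + t *\<^sub>R d)\<bar>"
      using mult_left_mono[OF B0[OF mem[of t]], of "\<bar>g (w0 + t *\<^sub>R d)\<bar>"] by (simp add: abs_mult mult.commute)
  qed (auto intro!: continuous_intros e gc)
  then have "\<bar>crs c d\<bar> * \<bar>integral {0..1} (\<lambda>t. g (w0 + t *\<^sub>R d) * err (w0 + t *\<^sub>R d))\<bar>
      \<le> \<bar>crs c d\<bar> * (B0 * integral {0..1} (\<lambda>t. \<bar>g (w0 + t *\<^sub>R d)\<bar>))"
    by (intro mult_left_mono) auto
  also have "\<dots> \<le> B0 * trace_sum w0 c d g G"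
    using mult_left_mono[OF edge_trace_real[OF g crs, of w0] \<open>B0 \<ge> 0\<close>] by (simp add: mult_ac)
  finally show ?thesis .
qed

section \<open>The subdivision of a boundary edge\<close>

definition edge_part :: "real^2 \<Rightarrow> real^2 \<Rightarrow> (real^2) set \<Rightarrow> real set" where
  "edge_part w0 d T = {t \<in> {0..1}. w0 + t *\<^sub>R d \<in> T}"

lemma segment_param: "closed_segment w0 (w0 + d) = (\<lambda>t. w0 + t *\<^sub>R d) ` {0..1::real}"
  by (auto simp: closed_segment_def algebra_simps image_iff)

text \<open>An edge of \<open>\<Omega>\<close> is a face of it, and slicing a face with a convex
  subset yields a face of the subset. How an element can touch the boundary thus reduces to the
  faces of a triangle.\<close>

lemma edge_face:
  assumes dom: "\<Omega> = tri w0 c d" and crs: "crs c d \<noteq> 0" and T: "T \<in> \<T>"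
  shows "(closed_segment w0 (w0 + d) \<inter> T) face_of T"
proof -
  have "convex hull {w0, w0 + d} face_of convex hull {w0, w0 + c, w0 + d}"
    by (rule iffD2[OF face_of_convex_hull_affine_independent[OF tri_affine_independent(1)[OF crs]]],
      rule exI[of _ "{w0, w0 + d}"]) auto
  then have "closed_segment w0 (w0 + d) face_of \<Omega>"
    by (simp add: dom tri_eq_hull segment_convex_hull)
  from face_of_slice[OF this convex_element[OF T]] show ?thesis
    using element_subset[OF T] by (simp add: Int_absorb1)
qed

lemma aff_dim_segment_le: "aff_dim (S \<inter> closed_segment w0 (w0 + d)) \<le> 1"
proof -
  have "aff_dim (S \<inter> closed_segment w0 (w0 + d)) \<le> aff_dim (closed_segment w0 (w0 + d))"
    by (intro aff_dim_subset) auto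
  also have "\<dots> \<le> 1" by (simp add: segment_convex_hull aff_dim_convex_hull aff_dim_2)
  finally show ?thesis .
qed

lemma edge_part_small:
  assumes "d \<noteq> 0" "closed_segment w0 (w0 + d) \<inter> T \<subseteq> {x}"
  obtains s where "edge_part w0 d T \<subseteq> {s}"
proof (cases "edge_part w0 d T = {}")
  case False
  then obtain s where s: "s \<in> edge_part w0 d T" by blast
  have "t = s" if t: "t \<in> edge_part w0 d T" for t
  proof -
    have "w0 + t *\<^sub>R d \<in> closed_segment w0 (w0 + d) \<inter> T" "w0 + s *\<^sub>R d \<in> closed_segment w0 (w0 + d) \<inter> T"
      using s t by (auto simp: edge_part_def segment_param)
    then have "w0 + t *\<^sub>R d = w0 + s *\<^sub>R d" using assms(2) by blast
    then show ?thesis using assms(1) by simp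
  qed
  then show ?thesis using that by blast
qed (use that in blast)

text \<open>A face of a triangle is the hull of some of its vertices. Three are impossible inside a
  one-dimensional edge. With two, the element can be based at the vertex of smaller parameter, with
  its first edge vector along the boundary, which is the form that the reflection estimate on edges
  takes.\<close>

lemma edge_part_cases:
  assumes dom: "\<Omega> = tri w0 c d" and crs: "crs c d \<noteq> 0" and T: "T \<in> \<T>"
  shows "(\<exists>s. edge_part w0 d T \<subseteq> {s}) \<or>
    (\<exists>t0 t1 b. t0 < t1 \<and> edge_part w0 d T = {t0..t1} \<and> T = tri (w0 + t0 *\<^sub>R d) ((t1 - t0) *\<^sub>R d) b
      \<and> crs ((t1 - t0) *\<^sub>R d) b \<noteq> 0)"
proof -
  have d: "d \<noteq> 0" using tri_affine_independent[OF crs] by blast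
  let ?F = "closed_segment w0 (w0 + d) \<inter> T"
  obtain C0 where C0: "\<not> affine_dependent C0" "card C0 = 3" "T = convex hull C0"
    using element_simplex[OF T] by (auto simp: simplex_def)
  have fin: "finite C0" using C0(2) card_ge_0_finite by force
  obtain C where C: "C \<subseteq> C0" "?F = convex hull C"
    using edge_face[OF assms] face_of_convex_hull_affine_independent[OF C0(1)] C0(3) by blast
  have "card C \<le> 3" using card_mono[OF fin C(1)] C0(2) by simp
  moreover have "card C \<noteq> 3"
  proof
    assume "card C = 3"
    then have "C = C0" using card_subset_eq[OF fin C(1)] C0(2) by simp
    then have "?F = T" using C(2) C0(3) by simp
    then have "aff_dim T \<le> 1" using aff_dim_segment_le[of T w0 d] by (simp add: Int_commute)
    then show False using aff_dim_simplex[OF element_simplex[OF T]] by simp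
  qed
  moreover have "finite C" using fin C(1) finite_subset by blast
  ultimately consider "C = {}" | x where "C = {x}" | x y where "C = {x, y}" "x \<noteq> y"
    using card_1_singletonE[of C] card_2_iff[of C] by (metis One_nat_def card_0_eq le_SucE le_zero_eq numeral_2_eq_2 numeral_3_eq_3)
  then show ?thesis
  proof cases
    case 1
    then have "?F \<subseteq> {w0}" using C(2) by simp
    then show ?thesis using edge_part_small[OF d] by metis
  next
    case (2 x)
    then have "?F \<subseteq> {x}" using C(2) by simp
    then show ?thesis using edge_part_small[OF d] by metis
  next
    case (3 x y)
    have xyF: "x \<in> ?F" "y \<in> ?F" using C(2) 3 hull_inc by (metis insertCI)+
    obtain s where sx: "x = w0 + s *\<^sub>R d" "s \<in> {0..1}" using xyF(1) unfolding segment_param by blast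
    obtain s' where sy: "y = w0 + s' *\<^sub>R d" "s' \<in> {0..1}" using xyF(2) unfolding segment_param by blast
    note s = sx(1) sy(1) sx(2) sy(2)
    obtain z where z: "C0 = {x, y, z}"
    proof -
      have "card (C0 - C) = 1" using card_Diff_subset[OF \<open>finite C\<close> C(1)] C0(2) 3 by simp
      then obtain z where "C0 - C = {z}" by (auto simp: card_1_singleton_iff)
      then have "C0 = {x, y, z}" using C(1) 3(1) by auto
      then show ?thesis using that by blast
    qed
    have main: "\<exists>t0 t1 b. t0 < t1 \<and> edge_part w0 d T = {t0..t1} \<and> T = tri (w0 + t0 *\<^sub>R d) ((t1 - t0) *\<^sub>R d) b
      \<and> crs ((t1 - t0) *\<^sub>R d) b \<noteq> 0"
      if less: "s < s'" and xy: "x = w0 + s *\<^sub>R d" "y = w0 + s' *\<^sub>R d" and ss: "s \<in> {0..1}" "s' \<in> {0..1}"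
        and F: "?F = closed_segment x y" and C0': "C0 = {x, y, z}" for x y s s'
    proof -
      have diff: "y - x = (s' - s) *\<^sub>R d" by (simp add: xy scaleR_diff_left)
      have "edge_part w0 d T = {s..s'}"
      proof (intro subset_antisym subsetI)
        fix t assume t: "t \<in> edge_part w0 d T"
        then have "w0 + t *\<^sub>R d \<in> closed_segment x y" unfolding F[symmetric] by (auto simp: edge_part_def segment_param)
        then obtain u where u: "0 \<le> u" "u \<le> 1" "w0 + t *\<^sub>R d = (1 - u) *\<^sub>R x + u *\<^sub>R y" by (auto simp: closed_segment_def)
        then have "w0 + t *\<^sub>R d = w0 + (s + u * (s' - s)) *\<^sub>R d" unfolding xy by (simp add: algebra_simps)
        then have "t = s + u * (s' - s)" using d by simp
        moreover have "0 \<le> u * (s' - s)" "u * (s' - s) \<le> 1 * (s' - s)" using u less by (auto intro: mult_right_mono)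
        ultimately show "t \<in> {s..s'}" by auto
      next
        fix t assume t: "t \<in> {s..s'}"
        define u where "u = (t - s) / (s' - s)"
        have u: "0 \<le> u" "u \<le> 1" "t = s + u * (s' - s)" using t less by (auto simp: u_def field_simps)
        have "w0 + t *\<^sub>R d = (1 - u) *\<^sub>R x + u *\<^sub>R y" unfolding xy u(3) by (simp add: algebra_simps)
        then have "w0 + t *\<^sub>R d \<in> closed_segment x y" unfolding closed_segment_def using u by blast
        then show "t \<in> edge_part w0 d T" unfolding F[symmetric] edge_part_def using t ss by auto
      qed
      moreover have "T = tri x (y - x) (z - x)" "crs (y - x) (z - x) \<noteq> 0"
        using tri_hull3[OF C0(2,1) C0'] C0(3) by auto
      ultimately show ?thesis using less unfolding diff xy(1)[symmetric] by (intro exI[of _ s] exI[of _ s']) (auto simp: xy)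
    qed
    have F: "?F = closed_segment x y" using C(2) 3 by (simp add: segment_convex_hull)
    have "s \<noteq> s'" using 3 s by auto
    then consider "s < s'" | "s' < s" by linarith
    then show ?thesis
    proof cases
      case 1
      then show ?thesis using main[OF 1 s F z] by blast
    next
      case 2
      have "?F = closed_segment y x" "C0 = {y, x, z}" using F z closed_segment_commute by blast+
      then show ?thesis using main[OF 2 s(2,1,4,3)] by blast
    qed
  qed
qed

text \<open>If the common part is smaller than one of the two parts, it is a proper face of a set of
  dimension at most 1, hence empty or a point.\<close>

lemma edge_part_overlap:
  assumes dom: "\<Omega> = tri w0 c d" and crs: "crs c d \<noteq> 0" and T: "T \<in> \<T>" "T' \<in> \<T>"
    and ne: "edge_part w0 d T \<noteq> edge_part w0 d T'"
  shows "negligible (edge_part w0 d T \<inter> edge_part w0 d T')"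
proof -
  have d: "d \<noteq> 0" using tri_affine_independent[OF crs] by blast
  let ?S = "closed_segment w0 (w0 + d)"
  have small: "negligible (edge_part w0 d T \<inter> edge_part w0 d T')"
    if T: "T \<in> \<T>" "T' \<in> \<T>" and ne: "?S \<inter> T \<inter> T' \<noteq> ?S \<inter> T" for T T'
  proof -
    have "(?S \<inter> T \<inter> (T \<inter> T')) face_of T"
      by (rule face_of_Int[OF edge_face[OF dom crs T(1)] element_Int_face[OF T]])
    then have "(?S \<inter> T \<inter> T') face_of T" by (simp add: Int_assoc Int_left_absorb)
    then have "(?S \<inter> T \<inter> T') face_of (?S \<inter> T)" by (rule face_of_subset) auto
    moreover have "convex (?S \<inter> T)" using convex_element[OF T(1)] by (intro convex_Int) auto
    ultimately have "aff_dim (?S \<inter> T \<inter> T') < aff_dim (?S \<inter> T)" using face_of_aff_dim_lt ne by blast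
    then have "aff_dim (?S \<inter> T \<inter> T') \<le> 0" using aff_dim_segment_le[of T w0 d] by (simp add: Int_commute)
    then have "?S \<inter> T \<inter> T' = {} \<or> (\<exists>x. ?S \<inter> T \<inter> T' = {x})"
    proof -
      have "aff_dim (?S \<inter> T \<inter> T') = 0 \<or> aff_dim (?S \<inter> T \<inter> T') = - 1"
        using \<open>aff_dim (?S \<inter> T \<inter> T') \<le> 0\<close> aff_dim_geq[of "?S \<inter> T \<inter> T'"] by linarith
      then show ?thesis
        unfolding aff_dim_eq_0[of "?S \<inter> T \<inter> T'"] aff_dim_empty[of "?S \<inter> T \<inter> T'", symmetric] by blast
    qed
    then obtain x where "?S \<inter> (T \<inter> T') \<subseteq> {x}" unfolding Int_assoc by (metis empty_subsetI order_refl)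
    then obtain s where "edge_part w0 d (T \<inter> T') \<subseteq> {s}" using edge_part_small[OF d] by metis
    then have "edge_part w0 d T \<inter> edge_part w0 d T' \<subseteq> {s}" by (auto simp: edge_part_def)
    then show ?thesis using negligible_subset negligible_sing by blast
  qed
  show ?thesis
  proof (cases "?S \<inter> T \<inter> T' = ?S \<inter> T \<and> ?S \<inter> T' \<inter> T = ?S \<inter> T'")
    case True
    then have "?S \<inter> T = ?S \<inter> T'" by blast
    moreover have "w0 + t *\<^sub>R d \<in> ?S" if "t \<in> {0..1}" for t using that unfolding segment_param by blast
    ultimately have "edge_part w0 d T = edge_part w0 d T'" unfolding edge_part_def by blast
    then show ?thesis using ne by blast
  next
    case False
    then show ?thesis using small[OF T] small[OF T(2,1)] by (metis Int_commute)
  qed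
qed

text \<open>The sum runs over the set of parts, so elements that meet the edge in the same set count
  only once; distinct parts overlap in null sets.\<close>

lemma edge_integral_split:
  fixes u :: "real \<Rightarrow> real"
  assumes dom: "\<Omega> = tri w0 c d" and crs: "crs c d \<noteq> 0" and u: "continuous_on {0..1} u"
  shows "integral {0..1} u = (\<Sum>J\<in>edge_part w0 d ` \<T>. integral J u)"
proof -
  have un: "\<Union>(edge_part w0 d ` \<T>) = {0..1}"
  proof -
    have "w0 + t *\<^sub>R d \<in> \<Union>\<T>" if "t \<in> {0..1}" for t
      using tri_memI[of 0 t w0 c d] that dom union_mesh by simp
    then show ?thesis by (fastforce simp: edge_part_def)
  qed
  have "(u has_integral (\<Sum>J\<in>edge_part w0 d ` \<T>. integral J u)) (\<Union>(edge_part w0 d ` \<T>))"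
  proof (rule has_integral_Union)
    show "finite (edge_part w0 d ` \<T>)" using finite_mesh by simp
    show "pairwise (\<lambda>S S'. negligible (S \<inter> S')) (edge_part w0 d ` \<T>)"
      using edge_part_overlap[OF dom crs] by (auto simp: pairwise_def)
    fix J assume "J \<in> edge_part w0 d ` \<T>"
    then obtain T where T: "T \<in> \<T>" "J = edge_part w0 d T" by blast
    have "compact J"
      using edge_part_cases[OF dom crs T(1)] T(2) by (auto simp: subset_singleton_iff)
    moreover have "J \<subseteq> {0..1}" using T(2) by (auto simp: edge_part_def)
    ultimately show "(u has_integral integral J u) J"
      by (intro integrable_integral compact_continuous_integral(1) continuous_on_subset[OF u])
  qed
  then show ?thesis unfolding un by (rule integral_unique)
qed

text \<open>Every mesh interval on the edge is folded about its midpoint, and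
  \<open>h / norm d\<close> bounds the length of such an interval in the parameter. The derivative
  of \<open>g\<close> along the edge is left as an integral over the edge, and its trace costs
  second derivatives of \<open>g\<close>.\<close>

lemma edge_integral_le_even:
  assumes dom: "\<Omega> = tri w0 c d" and crs: "crs c d \<noteq> 0"
    and g: "gradient g G" and W: "gradient (\<lambda>x. G x \<bullet> d) W"
    and B0: "\<And>x. x \<in> \<Omega> \<Longrightarrow> \<bar>err x\<bar> \<le> B0"
    and B1: "\<And>v a b \<theta>. tri v a b \<in> \<T> \<Longrightarrow> crs a b \<noteq> 0 \<Longrightarrow> 0 \<le> \<theta> \<Longrightarrow> \<theta> \<le> 1 \<Longrightarrow>
      \<bar>err (v + \<theta> *\<^sub>R a) + err (v + (1 - \<theta>) *\<^sub>R a)\<bar> \<le> B1" and "B1 \<ge> 0"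
  shows "2 * (\<bar>crs c d\<bar> * \<bar>integral {0..1} (\<lambda>t. g (w0 + t *\<^sub>R d) * err (w0 + t *\<^sub>R d))\<bar>)
    \<le> B1 * trace_sum w0 c d g G + h / norm d * B0 * trace_sum w0 c d (\<lambda>x. G x \<bullet> d) W"
proof -
  have d: "d \<noteq> 0" using tri_affine_independent[OF crs] by blast
  have mem: "w0 + t *\<^sub>R d \<in> \<Omega>" if "t \<in> {0..1}" for t
    using tri_memI[of 0 t w0 c d] that dom by simp
  then have "B0 \<ge> 0" using B0[OF mem[of 0]] by simp
  let ?\<gamma> = "\<lambda>t. g (w0 + t *\<^sub>R d)" and ?\<gamma>' = "\<lambda>t. G (w0 + t *\<^sub>R d) \<bullet> d" and ?\<eta> = "\<lambda>t. err (w0 + t *\<^sub>R d)"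
  have \<eta>: "continuous_on {0..1} ?\<eta>"
    by (rule continuous_on_compose2[OF continuous_on_err]) (use mem in \<open>auto intro!: continuous_intros\<close>)
  have \<gamma>: "continuous_on S ?\<gamma>" for S
    by (rule continuous_on_compose2[OF gradient_continuous(1)[OF g, of UNIV]]) (auto intro!: continuous_intros)
  have \<gamma>': "continuous_on S ?\<gamma>'" for S
    by (rule continuous_on_compose2[OF gradient_continuous(1)[OF W, of UNIV]]) (auto intro!: continuous_intros)
  let ?\<J> = "edge_part w0 d ` \<T>"
  have one: "2 * \<bar>integral J (\<lambda>t. ?\<gamma> t * ?\<eta> t)\<bar> \<le> B1 * integral J (\<lambda>t. \<bar>?\<gamma> t\<bar>) + h / norm d * B0 * integral J (\<lambda>t. \<bar>?\<gamma>' t\<bar>)"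
    if J: "J \<in> ?\<J>" for J
  proof -
    obtain T where T: "T \<in> \<T>" "J = edge_part w0 d T" using J by blast
    from edge_part_cases[OF dom crs T(1)] consider s where "J \<subseteq> {s}"
      | t0 t1 b where "t0 < t1" "J = {t0..t1}" "T = tri (w0 + t0 *\<^sub>R d) ((t1 - t0) *\<^sub>R d) b" "crs ((t1 - t0) *\<^sub>R d) b \<noteq> 0"
      unfolding T(2)[symmetric] by blast
    then show ?thesis
    proof cases
      case (1 s)
      then have "negligible J" using negligible_subset negligible_sing by blast
      then have "integral J u = 0" for u :: "real \<Rightarrow> real"
        using integral_unique has_integral_negligible[of J UNIV] by (metis DiffE has_integral_negligible)
      then show ?thesis by simp
    next
      case (2 t0 t1 b)
      have part: "edge_part w0 d T = {t0..t1}" using 2(2) T(2) by simp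
      have sub: "{t0..t1} \<subseteq> {0..1}" unfolding part[symmetric] edge_part_def by blast
      have len: "(t1 - t0) \<le> h / norm d"
      proof -
        have "t0 \<in> edge_part w0 d T" "t1 \<in> edge_part w0 d T" unfolding part using 2(1) by auto
        then have "w0 + t0 *\<^sub>R d \<in> T" "w0 + t1 *\<^sub>R d \<in> T" unfolding edge_part_def by blast+
        then have "norm ((w0 + t1 *\<^sub>R d) - (w0 + t0 *\<^sub>R d)) \<le> h" using element_diameter[OF T(1)] by blast
        moreover have "(w0 + t1 *\<^sub>R d) - (w0 + t0 *\<^sub>R d) = (t1 - t0) *\<^sub>R d" by (simp add: scaleR_diff_left)
        ultimately show ?thesis using 2(1) d by (simp add: pos_le_divide_eq)
      qed
      have "2 * \<bar>integral {t0..t1} (\<lambda>t. ?\<gamma> t * ?\<eta> t)\<bar>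
          \<le> B1 * integral {t0..t1} (\<lambda>t. \<bar>?\<gamma> t\<bar>) + (t1 - t0) * B0 * integral {t0..t1} (\<lambda>t. \<bar>?\<gamma>' t\<bar>)"
      proof (rule antisymmetric_interval)
        show "(?\<gamma> has_real_derivative ?\<gamma>' r) (at r)" for r by (rule gradient_along[OF g])
        show "continuous_on UNIV ?\<gamma>'" by (rule \<gamma>')
        show "continuous_on {t0..t1} ?\<eta>" using \<eta> sub continuous_on_subset by blast
        show "\<bar>?\<eta> t\<bar> \<le> B0" if "t \<in> {t0..t1}" for t using B0 mem sub that by blast
        show "\<bar>?\<eta> t + ?\<eta> (t0 + t1 - t)\<bar> \<le> B1" if t: "t \<in> {t0..t1}" for t
        proof -
          define \<theta> where "\<theta> = (t - t0) / (t1 - t0)"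
          have \<theta>: "0 \<le> \<theta>" "\<theta> \<le> 1" "\<theta> * (t1 - t0) = t - t0" using t 2(1) by (auto simp: \<theta>_def field_simps)
          have e1: "w0 + t0 *\<^sub>R d + \<theta> *\<^sub>R ((t1 - t0) *\<^sub>R d) = w0 + t *\<^sub>R d"
            unfolding scaleR_scaleR \<theta>(3) by (simp add: scaleR_diff_left)
          have \<theta>': "(1 - \<theta>) * (t1 - t0) = t1 - t" using \<theta>(3) by (simp add: algebra_simps)
          have e2: "w0 + t0 *\<^sub>R d + (1 - \<theta>) *\<^sub>R ((t1 - t0) *\<^sub>R d) = w0 + (t0 + t1 - t) *\<^sub>R d"
            unfolding scaleR_scaleR \<theta>' by (simp add: scaleR_diff_left scaleR_add_left)
          show ?thesis using B1[of "w0 + t0 *\<^sub>R d" "(t1 - t0) *\<^sub>R d" b \<theta>] T(1) 2(3,4) \<theta> unfolding e1 e2 by simp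
        qed
      qed (use 2 in simp)
      also have "\<dots> \<le> B1 * integral {t0..t1} (\<lambda>t. \<bar>?\<gamma> t\<bar>) + h / norm d * B0 * integral {t0..t1} (\<lambda>t. \<bar>?\<gamma>' t\<bar>)"
        using len \<open>B0 \<ge> 0\<close> by (intro add_left_mono mult_right_mono integral_abs_nonneg) auto
      finally show ?thesis unfolding 2(2) .
    qed
  qed
  have c: "continuous_on {0..1} (\<lambda>t. ?\<gamma> t * ?\<eta> t)" "continuous_on {0..1} (\<lambda>t. \<bar>?\<gamma> t\<bar>)" "continuous_on {0..1} (\<lambda>t. \<bar>?\<gamma>' t\<bar>)"
    by (intro continuous_intros \<gamma> \<eta> \<gamma>')+
  have "2 * \<bar>integral {0..1} (\<lambda>t. ?\<gamma> t * ?\<eta> t)\<bar> \<le> (\<Sum>J\<in>?\<J>. 2 * \<bar>integral J (\<lambda>t. ?\<gamma> t * ?\<eta> t)\<bar>)"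
    unfolding edge_integral_split[OF dom crs c(1)] sum_distrib_left[symmetric] by (intro mult_left_mono sum_abs) auto
  also have "\<dots> \<le> (\<Sum>J\<in>?\<J>. B1 * integral J (\<lambda>t. \<bar>?\<gamma> t\<bar>) + h / norm d * B0 * integral J (\<lambda>t. \<bar>?\<gamma>' t\<bar>))"
    by (rule sum_mono[OF one])
  also have "\<dots> = B1 * integral {0..1} (\<lambda>t. \<bar>?\<gamma> t\<bar>) + h / norm d * B0 * integral {0..1} (\<lambda>t. \<bar>?\<gamma>' t\<bar>)"
    unfolding edge_integral_split[OF dom crs c(2)] edge_integral_split[OF dom crs c(3)]
    by (simp add: sum.distrib sum_distrib_left)
  finally have "\<bar>crs c d\<bar> * (2 * \<bar>integral {0..1} (\<lambda>t. ?\<gamma> t * ?\<eta> t)\<bar>) \<le>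
      \<bar>crs c d\<bar> * (B1 * integral {0..1} (\<lambda>t. \<bar>?\<gamma> t\<bar>) + h / norm d * B0 * integral {0..1} (\<lambda>t. \<bar>?\<gamma>' t\<bar>))"
    by (rule mult_left_mono) simp
  also have "\<dots> = B1 * (\<bar>crs c d\<bar> * integral {0..1} (\<lambda>t. \<bar>?\<gamma> t\<bar>))
      + h / norm d * B0 * (\<bar>crs c d\<bar> * integral {0..1} (\<lambda>t. \<bar>?\<gamma>' t\<bar>))" by (simp add: algebra_simps)
  also have "\<dots> \<le> B1 * trace_sum w0 c d g G + h / norm d * B0 * trace_sum w0 c d (\<lambda>x. G x \<bullet> d) W"
    using \<open>B0 \<ge> 0\<close> \<open>B1 \<ge> 0\<close> h_nonneg
    by (intro add_mono mult_left_mono edge_trace_real[OF g crs] edge_trace_real[OF W crs]) auto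
  finally show ?thesis by (simp add: mult_ac)
qed

end

section \<open>The error in the interior\<close>

lemma lborel_reflect:
  fixes u :: "real^2 \<Rightarrow> real"
  assumes [measurable]: "u \<in> borel_measurable borel"
  shows "(\<integral>x. u (c - x) \<partial>lborel) = (\<integral>x. u x \<partial>lborel)"
proof -
  have crs: "crs (- axis 1 1) (- axis 2 1) = 1" by (simp add: crs_def axis_def)
  have par: "par c (- axis 1 1) (- axis 2 1) = (\<lambda>x. c - x)"
    by (auto simp: par_def fun_eq_iff vec_eq_iff forall_2 axis_def)
  have "(lborel :: (real^2) measure) = distr lborel borel (\<lambda>x. c - x)"
    using lborel_par[of "- axis 1 1" "- axis 2 1" c] unfolding crs par by (simp add: density_1)
  then have "(\<integral>x. u x \<partial>lborel) = (\<integral>x. u x \<partial>distr lborel borel (\<lambda>x. c - x))" by metis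
  also have "\<dots> = (\<integral>x. u (c - x) \<partial>lborel)" by (rule integral_distr) auto
  finally show ?thesis by simp
qed

lemma integral_tri_reflect:
  fixes u :: "real^2 \<Rightarrow> real"
  assumes "continuous_on (tri v (- a) (- b)) u"
  shows "integral (tri v (- a) (- b)) u = integral (tri v a b) (\<lambda>x. u (2 *\<^sub>R v - x))"
proof -
  have mem: "2 *\<^sub>R v - x \<in> tri v (- a) (- b) \<longleftrightarrow> x \<in> tri v a b" for x
  proof -
    have "2 *\<^sub>R v - (v + s *\<^sub>R a + t *\<^sub>R b) = v + s *\<^sub>R (- a) + t *\<^sub>R (- b)" for s t a b by (simp add: scaleR_2)
    then have *: "x \<in> tri v a b \<Longrightarrow> 2 *\<^sub>R v - x \<in> tri v (- a) (- b)" for x a b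
      unfolding tri_eq by blast
    show ?thesis using *[of x a b] *[of "2 *\<^sub>R v - x" "- a" "- b"] by auto
  qed
  have cont: "continuous_on (tri v a b) (\<lambda>x. u (2 *\<^sub>R v - x))"
    by (rule continuous_on_compose2[OF assms]) (auto intro!: continuous_intros simp: mem)
  have m: "(\<lambda>x. indicator (tri v (- a) (- b)) x * u x) \<in> borel_measurable borel"
    by (intro measurable_indicator_mult assms borel_closed closed_tri)
  have "integral (tri v (- a) (- b)) u = (\<integral>x. indicator (tri v (- a) (- b)) x * u x \<partial>lborel)"
    using compact_continuous_integral(2)[OF compact_tri assms] by (simp add: set_lebesgue_integral_def)
  also have "\<dots> = (\<integral>x. indicator (tri v (- a) (- b)) (2 *\<^sub>R v - x) * u (2 *\<^sub>R v - x) \<partial>lborel)"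
    by (rule lborel_reflect[OF m, symmetric])
  also have "\<dots> = (\<integral>x. indicator (tri v a b) x * u (2 *\<^sub>R v - x) \<partial>lborel)"
    by (intro Bochner_Integration.integral_cong) (auto simp: indicator_def mem)
  also have "\<dots> = integral (tri v a b) (\<lambda>x. u (2 *\<^sub>R v - x))"
    using compact_continuous_integral(2)[OF compact_tri cont] by (simp add: set_lebesgue_integral_def)
  finally show ?thesis .
qed

text \<open>The parallelogram with vertices \<open>v + a\<close>, \<open>v - a\<close>,
  \<open>v + b\<close>, \<open>v - b\<close>. It is the convex hull of a symmetric pair and contains
  the detours between reflected points.\<close>

definition diamond :: "real^2 \<Rightarrow> real^2 \<Rightarrow> real^2 \<Rightarrow> (real^2) set" where
  "diamond v a b = {v + s *\<^sub>R a + t *\<^sub>R b | s t. \<bar>s\<bar> + \<bar>t\<bar> \<le> 1}"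

lemma diamond_eq:
  assumes "crs a b \<noteq> 0"
  shows "diamond v a b = {x. \<bar>co1 v a b x\<bar> + \<bar>co2 v a b x\<bar> \<le> 1}"
proof (intro subset_antisym subsetI)
  fix x assume "x \<in> {x. \<bar>co1 v a b x\<bar> + \<bar>co2 v a b x\<bar> \<le> 1}"
  then have "v + co1 v a b x *\<^sub>R a + co2 v a b x *\<^sub>R b \<in> diamond v a b" unfolding diamond_def by blast
  then show "x \<in> diamond v a b" unfolding par_coords[OF assms, symmetric] .
qed (use coords_par[OF assms] in \<open>auto simp: diamond_def\<close>)

lemma diamond_subset:
  assumes "convex S" "v \<in> S" "v + a \<in> S" "v - a \<in> S" "v + b \<in> S" "v - b \<in> S"
  shows "diamond v a b \<subseteq> S"
proof
  fix x assume "x \<in> diamond v a b"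
  then obtain s t where st: "x = v + s *\<^sub>R a + t *\<^sub>R b" "\<bar>s\<bar> + \<bar>t\<bar> \<le> 1" unfolding diamond_def by blast
  define a' where "a' = (if s \<ge> 0 then a else - a)"
  define b' where "b' = (if t \<ge> 0 then b else - b)"
  have "x = v + \<bar>s\<bar> *\<^sub>R a' + \<bar>t\<bar> *\<^sub>R b'" by (simp add: st(1) a'_def b'_def)
  then have "x \<in> tri v a' b'" using tri_memI[of "\<bar>s\<bar>" "\<bar>t\<bar>" v a' b'] st(2) by simp
  moreover have "tri v a' b' \<subseteq> S"
    unfolding tri_eq_hull by (rule hull_minimal) (use assms in \<open>auto simp: a'_def b'_def\<close>)
  ultimately show "x \<in> S" by blast
qed

lemma compact_diamond:
  assumes "crs a b \<noteq> 0"
  shows "compact (diamond v a b)"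
proof -
  have "closed (diamond v a b)" unfolding diamond_eq[OF assms]
    by (intro closed_Collect_le continuous_intros continuous_on_co)
  moreover have "diamond v a b \<subseteq> cball v (norm a + norm b)"
  proof
    fix x assume "x \<in> diamond v a b"
    then obtain s t where st: "x = v + s *\<^sub>R a + t *\<^sub>R b" "\<bar>s\<bar> + \<bar>t\<bar> \<le> 1" unfolding diamond_def by blast
    have "norm (s *\<^sub>R a + t *\<^sub>R b) \<le> \<bar>s\<bar> * norm a + \<bar>t\<bar> * norm b"
      using norm_triangle_ineq[of "s *\<^sub>R a" "t *\<^sub>R b"] by simp
    also have "\<dots> \<le> 1 * norm a + 1 * norm b" using st(2) by (intro add_mono mult_right_mono) auto
    finally show "x \<in> cball v (norm a + norm b)"
      by (simp add: st(1) dist_norm add.assoc flip: norm_minus_cancel[of "s *\<^sub>R a + t *\<^sub>R b"])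
  qed
  ultimately show ?thesis using bounded_subset bounded_cball compact_eq_bounded_closed by blast
qed

lemma pair_difference_real:
  assumes w: "gradient w W" and crs: "crs a b \<noteq> 0"
  shows "integral (tri v a b) (\<lambda>x. \<bar>w x - w (2 *\<^sub>R v - x)\<bar>)
    \<le> integral (diamond v a b) (\<lambda>x. \<bar>W x \<bullet> a\<bar>) + integral (diamond v a b) (\<lambda>x. \<bar>W x \<bullet> b\<bar>)"
proof -
  have c1: "continuous_on (tri v a b) (\<lambda>x. w x - w (2 *\<^sub>R v - x))"
    by (intro continuous_intros gradient_continuous[OF w] continuous_on_compose2[OF gradient_continuous(1)[OF w, of UNIV]]) auto
  have c2: "continuous_on (diamond v a b) (\<lambda>x. W x \<bullet> a)" "continuous_on (diamond v a b) (\<lambda>x. W x \<bullet> b)"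
    by (intro continuous_intros gradient_continuous[OF w])+
  have "ennreal (integral (tri v a b) (\<lambda>x. \<bar>w x - w (2 *\<^sub>R v - x)\<bar>))
      \<le> ennreal (integral (diamond v a b) (\<lambda>x. \<bar>W x \<bullet> a\<bar>)) + ennreal (integral (diamond v a b) (\<lambda>x. \<bar>W x \<bullet> b\<bar>))"
    using pair_difference[OF w crs, of v] unfolding diamond_eq[OF crs, symmetric]
    by (simp add: compact_nn_integral[OF compact_tri c1] compact_nn_integral[OF compact_diamond[OF crs] c2(1)]
        compact_nn_integral[OF compact_diamond[OF crs] c2(2)])
  then show ?thesis by (simp add: integral_abs_nonneg ennreal_le_iff flip: ennreal_plus)
qed

lemma abs_crs_le: "\<bar>crs a b\<bar> \<le> 2 * norm a * norm b"
proof -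
  have "\<bar>crs a b\<bar> \<le> \<bar>a $ 1\<bar> * \<bar>b $ 2\<bar> + \<bar>a $ 2\<bar> * \<bar>b $ 1\<bar>"
    unfolding crs_def by (metis abs_mult abs_triangle_ineq4)
  also have "\<dots> \<le> norm a * norm b + norm a * norm b"
    by (intro add_mono mult_mono component_le_norm_cart) auto
  finally show ?thesis by simp
qed

lemma co1_lipschitz:
  assumes "crs a b \<noteq> 0"
  shows "\<bar>co1 v a b x - co1 v a b y\<bar> \<le> 2 * norm b / \<bar>crs a b\<bar> * norm (x - y)"
proof -
  have "co1 v a b x - co1 v a b y = crs (x - y) b / crs a b"
    by (simp add: co1_def crs_def diff_divide_distrib[symmetric] algebra_simps)
  then show ?thesis using abs_crs_le[of "x - y" b] assms by (simp add: abs_divide divide_right_mono mult_ac)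
qed

text \<open>The three edges of \<open>tri v a b\<close>, each as the zero set of \<open>co1\<close> for a relabelled triangle.\<close>

definition relabels :: "real^2 \<Rightarrow> real^2 \<Rightarrow> real^2 \<Rightarrow> ((real^2) \<times> (real^2) \<times> (real^2)) set" where
  "relabels v a b = {(v, a, b), (v, b, a), (v + a, - a, b - a)}"

lemma relabels_tri: "(v', a', b') \<in> relabels v a b \<Longrightarrow> tri v' a' b' = tri v a b"
  by (auto simp: relabels_def tri_eq_hull insert_commute)

lemma relabels_crs: "(v', a', b') \<in> relabels v a b \<Longrightarrow> \<bar>crs a' b'\<bar> = \<bar>crs a b\<bar>"
  by (auto simp: relabels_def crs_def algebra_simps abs_minus_commute)

lemma relabels_norm:
  "(v', a', b') \<in> relabels v a b \<Longrightarrow> norm a' \<le> norm a + norm b \<and> norm b' \<le> norm a + norm b \<and> norm (a' - b') \<le> norm a + norm b"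
  using norm_triangle_ineq4[of a b] by (auto simp: relabels_def norm_minus_commute)

lemma frontier_tri_relabel:
  assumes "crs a b \<noteq> 0" "y \<in> frontier (tri v a b)"
  obtains v' a' b' where "(v', a', b') \<in> relabels v a b" "co1 v' a' b' y = 0"
proof -
  have y: "y \<in> tri v a b" "y \<notin> otri v a b"
    using assms(2) otri_subset_interior[OF assms(1)] closed_tri[of v a b] by (auto simp: frontier_def closure_closed)
  have c2: "co1 v b a y = co2 v a b y"
    using assms(1) by (simp add: co1_def co2_def crs_def field_simps)
  have crs': "crs (- a) (b - a) = - crs a b" by (simp add: crs_def algebra_simps)
  have c3: "co1 (v + a) (- a) (b - a) y = 1 - co1 v a b y - co2 v a b y"
    using assms(1) unfolding co1_def co2_def crs' by (simp add: field_simps) (simp add: crs_def algebra_simps)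
  have "co1 v a b y = 0 \<or> co2 v a b y = 0 \<or> 1 - co1 v a b y - co2 v a b y = 0"
    using y mem_tri_iff[OF assms(1)] unfolding otri_def by force
  then show ?thesis
  proof (elim disjE)
    assume "co1 v a b y = 0" then show ?thesis using that[of v a b] by (simp add: relabels_def)
  next
    assume "co2 v a b y = 0" then show ?thesis using that[of v b a] c2 by (simp add: relabels_def)
  next
    assume "1 - co1 v a b y - co2 v a b y = 0"
    then show ?thesis using that[of "v + a" "- a" "b - a"] c3 by (simp add: relabels_def)
  qed
qed

text \<open>At a frontier point one barycentric coordinate vanishes, and the coordinates are
  Lipschitz, so a point near the frontier lies in a strip of small coordinate along one of the
  edges. Three strips and the factor 2 of the Lipschitz constant give the 6.\<close>

lemma boundary_strip_bound:
  assumes w: "gradient w W" and crs: "crs a b \<noteq> 0" and "\<delta> \<ge> 0"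
    and S: "compact S" "S \<subseteq> {x \<in> tri v a b. infdist x (frontier (tri v a b)) \<le> \<delta>}"
  shows "integral S (\<lambda>x. \<bar>w x\<bar>) \<le> \<delta> * (6 * (norm a + norm b) / \<bar>crs a b\<bar> * (4 + 2 * (norm a + norm b))) * W1_sum (tri v a b) w W"
proof -
  let ?R = "norm a + norm b" and ?\<Omega> = "tri v a b"
  let ?\<mu> = "2 * ?R / \<bar>crs a b\<bar> * \<delta>"
  note [measurable] = gradient_measurable[OF w]
  have fr: "frontier ?\<Omega> \<noteq> {}"
    unfolding frontier_eq_empty using compact_tri[of v a b] compact_imp_bounded not_bounded_UNIV tri_memI[of 0 0 v a b] by auto
  have W0: "W1_sum ?\<Omega> w W \<ge> 0" unfolding W1_sum_def by (intro add_nonneg_nonneg integral_abs_nonneg)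
  have \<mu>: "?\<mu> \<ge> 0" using assms(3) by simp
  let ?A = "\<lambda>(v', a', b'). {x \<in> tri v' a' b'. co1 v' a' b' x \<le> ?\<mu>}"
  have cover: "S \<subseteq> (\<Union>r\<in>relabels v a b. ?A r)"
  proof
    fix x assume "x \<in> S"
    then have x: "x \<in> ?\<Omega>" "infdist x (frontier ?\<Omega>) \<le> \<delta>" using S(2) by auto
    obtain y where y: "y \<in> frontier ?\<Omega>" "infdist x (frontier ?\<Omega>) = dist x y"
      using infdist_attains_inf[OF frontier_closed fr] by metis
    obtain v' a' b' where r: "(v', a', b') \<in> relabels v a b" "co1 v' a' b' y = 0"
      using frontier_tri_relabel[OF crs y(1)] by metis
    have crs': "crs a' b' \<noteq> 0" using relabels_crs[OF r(1)] crs by auto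
    have "co1 v' a' b' x \<le> 2 * norm b' / \<bar>crs a' b'\<bar> * norm (x - y)"
      using co1_lipschitz[OF crs', of v' x y] r(2) by linarith
    also have "\<dots> \<le> 2 * ?R / \<bar>crs a b\<bar> * \<delta>"
      unfolding relabels_crs[OF r(1)] using relabels_norm[OF r(1)] x(2) y(2)
      by (intro mult_mono divide_right_mono) (auto simp: dist_norm)
    finally show "x \<in> (\<Union>r\<in>relabels v a b. ?A r)"
      using r(1) x(1) relabels_tri[OF r(1)] by (intro UN_I[OF r(1)]) auto
  qed
  have fin: "finite (relabels v a b)" and card: "card (relabels v a b) \<le> 3"
  proof -
    have eq: "relabels v a b = set [(v, a, b), (v, b, a), (v + a, - a, b - a)]" by (simp add: relabels_def)
    show "finite (relabels v a b)" unfolding eq by (rule finite_set)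
    show "card (relabels v a b) \<le> 3" unfolding eq by (rule order_trans[OF card_length]) simp
  qed
  have meas: "?A r \<in> sets borel" for r
  proof (cases r)
    case (fields v' a' b')
    have "{x \<in> tri v' a' b'. co1 v' a' b' x \<le> ?\<mu>} = tri v' a' b' \<inter> {x. co1 v' a' b' x \<le> ?\<mu>}" by blast
    moreover have "closed (tri v' a' b' \<inter> {x. co1 v' a' b' x \<le> ?\<mu>})"
      by (intro closed_Int closed_tri closed_Collect_le continuous_intros continuous_on_co)
    ultimately show ?thesis using fields by simp
  qed
  have cont: "continuous_on S w" by (rule gradient_continuous[OF w])
  have "ennreal (integral S (\<lambda>x. \<bar>w x\<bar>)) = (\<integral>\<^sup>+x\<in>S. ennreal \<bar>w x\<bar> \<partial>lborel)"
    by (rule compact_nn_integral[OF S(1) cont, symmetric])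
  also have "\<dots> \<le> (\<integral>\<^sup>+x. (\<Sum>r\<in>relabels v a b. ennreal \<bar>w x\<bar> * indicator (?A r) x) \<partial>lborel)"
  proof (intro nn_integral_mono)
    fix x
    show "ennreal \<bar>w x\<bar> * indicator S x \<le> (\<Sum>r\<in>relabels v a b. ennreal \<bar>w x\<bar> * indicator (?A r) x)"
    proof (cases "x \<in> S")
      case True
      then obtain r where r: "r \<in> relabels v a b" "x \<in> ?A r" using cover by blast
      then have "ennreal \<bar>w x\<bar> * indicator S x = ennreal \<bar>w x\<bar> * indicator (?A r) x" using True by simp
      also have "\<dots> \<le> (\<Sum>r\<in>relabels v a b. ennreal \<bar>w x\<bar> * indicator (?A r) x)"
        by (rule member_le_sum[OF r(1) _ fin]) simp
      finally show ?thesis .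
    qed simp
  qed
  also have "\<dots> = (\<Sum>r\<in>relabels v a b. \<integral>\<^sup>+x\<in>?A r. ennreal \<bar>w x\<bar> \<partial>lborel)"
    by (rule nn_integral_sum) (use meas in measurable)
  also have "\<dots> \<le> (\<Sum>r\<in>relabels v a b. ennreal (?\<mu> * ((4 + 2 * ?R) * W1_sum ?\<Omega> w W)))"
  proof (rule sum_mono)
    fix r assume "r \<in> relabels v a b"
    then obtain v' a' b' where r: "r = (v', a', b')" "(v', a', b') \<in> relabels v a b" by (cases r) auto
    have crs': "crs a' b' \<noteq> 0" using relabels_crs[OF r(2)] crs by auto
    have "(\<integral>\<^sup>+x\<in>?A r. ennreal \<bar>w x\<bar> \<partial>lborel) \<le> ennreal ?\<mu> * ennreal (trace_sum v' a' b' w W)"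
      using strip_bound[OF w crs' \<mu>, of v'] unfolding r(1) trace_bound_eq(1)[OF w] by simp
    also have "\<dots> \<le> ennreal ?\<mu> * ennreal ((4 + 2 * ?R) * W1_sum ?\<Omega> w W)"
    proof (intro mult_left_mono ennreal_leI)
      have "trace_sum v' a' b' w W \<le> (4 + norm a' + norm (a' - b')) * W1_sum ?\<Omega> w W"
        using trace_sum_le[OF w, of v' a' b'] unfolding relabels_tri[OF r(2)] .
      also have "\<dots> \<le> (4 + 2 * ?R) * W1_sum ?\<Omega> w W"
        using relabels_norm[OF r(2)] by (intro mult_right_mono W0) auto
      finally show "trace_sum v' a' b' w W \<le> (4 + 2 * ?R) * W1_sum ?\<Omega> w W" .
    qed simp
    finally show "(\<integral>\<^sup>+x\<in>?A r. ennreal \<bar>w x\<bar> \<partial>lborel) \<le> ennreal (?\<mu> * ((4 + 2 * ?R) * W1_sum ?\<Omega> w W))"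
      unfolding ennreal_mult'[OF \<mu>] .
  qed
  also have "\<dots> = ennreal (real (card (relabels v a b)) * (?\<mu> * ((4 + 2 * ?R) * W1_sum ?\<Omega> w W)))"
    by (simp only: sum_constant ennreal_mult'[OF of_nat_0_le_iff] ennreal_of_nat_eq_real_of_nat)
  also have "\<dots> \<le> ennreal (3 * (?\<mu> * ((4 + 2 * ?R) * W1_sum ?\<Omega> w W)))"
    using card W0 \<mu> assms(3) by (intro ennreal_leI mult_right_mono mult_nonneg_nonneg) auto
  finally have "integral S (\<lambda>x. \<bar>w x\<bar>) \<le> 3 * (?\<mu> * ((4 + 2 * ?R) * W1_sum ?\<Omega> w W))"
    using W0 \<mu> assms(3) by (subst (asm) ennreal_le_iff) (auto intro!: mult_nonneg_nonneg)
  then show ?thesis by (simp add: field_simps)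
qed

context fe_mesh
begin

text \<open>Uses \<open>e w + e' w' = (e + e') w - e' (w - w')\<close>, with primes for reflected
  points. The first factor is small by symmetry; the difference costs derivatives along the two edge
  vectors, whose lengths are at most \<open>h\<close>.\<close>

lemma pair_integral_le:
  assumes T: "tri x0 a b \<in> \<T>" "tri x0 (- a) (- b) \<in> \<T>" and crs: "crs a b \<noteq> 0" and w: "gradient w W"
    and B0: "\<And>x. x \<in> \<Omega> \<Longrightarrow> \<bar>err x\<bar> \<le> B0"
    and B1: "\<And>x. x \<in> tri x0 a b \<Longrightarrow> \<bar>err x + err (2 *\<^sub>R x0 - x)\<bar> \<le> B1"
  shows "\<bar>integral (tri x0 a b) (\<lambda>x. err x * w x) + integral (tri x0 (- a) (- b)) (\<lambda>x. err x * w x)\<bar>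
    \<le> B1 * integral (tri x0 a b) (\<lambda>x. \<bar>w x\<bar>)
      + 2 * h * B0 * (integral (diamond x0 a b) (\<lambda>x. \<bar>W x $ 1\<bar>) + integral (diamond x0 a b) (\<lambda>x. \<bar>W x $ 2\<bar>))"
proof -
  let ?T = "tri x0 a b" and ?r = "\<lambda>x. 2 *\<^sub>R x0 - x"
  have rmem: "?r x \<in> tri x0 (- a) (- b)" if "x \<in> ?T" for x
  proof -
    have "2 *\<^sub>R x0 - (x0 + s *\<^sub>R a + t *\<^sub>R b) = x0 + s *\<^sub>R (- a) + t *\<^sub>R (- b)" for s t by (simp add: scaleR_2)
    then show ?thesis using that unfolding tri_eq by blast
  qed
  have x0: "x0 \<in> ?T" "x0 + a \<in> ?T" "x0 + b \<in> ?T"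
    using tri_memI[of 0 0 x0 a b] tri_memI[of 1 0 x0 a b] tri_memI[of 0 1 x0 a b] by simp_all
  then have "x0 \<in> \<Omega>" using element_subset[OF T(1)] by blast
  then have "B0 \<ge> 0" using B0[of x0] by linarith
  have e: "continuous_on ?T err" "continuous_on (tri x0 (- a) (- b)) err"
    using continuous_on_err continuous_on_subset element_subset T by blast+
  have er: "continuous_on ?T (\<lambda>x. err (?r x))"
    by (rule continuous_on_compose2[OF e(2)]) (auto intro!: continuous_intros rmem)
  have wr: "continuous_on ?T (\<lambda>x. w (?r x))"
    by (rule continuous_on_compose2[OF gradient_continuous(1)[OF w, of UNIV]]) (auto intro!: continuous_intros)
  have wc: "continuous_on S w" for S by (rule gradient_continuous[OF w])
  have "integral ?T (\<lambda>x. err x * w x) + integral (tri x0 (- a) (- b)) (\<lambda>x. err x * w x)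
      = integral ?T (\<lambda>x. err x * w x) + integral ?T (\<lambda>x. err (?r x) * w (?r x))"
    by (subst integral_tri_reflect) (auto intro!: continuous_intros e wc)
  also have "\<dots> = integral ?T (\<lambda>x. err x * w x + err (?r x) * w (?r x))"
    by (intro integral_add[symmetric] compact_continuous_integral(1) compact_tri continuous_intros e er wc wr)
  finally have split: "integral ?T (\<lambda>x. err x * w x) + integral (tri x0 (- a) (- b)) (\<lambda>x. err x * w x)
      = integral ?T (\<lambda>x. err x * w x + err (?r x) * w (?r x))" .
  have "\<bar>integral ?T (\<lambda>x. err x * w x + err (?r x) * w (?r x))\<bar> \<le> integral ?T (\<lambda>x. B1 * \<bar>w x\<bar> + B0 * \<bar>w x - w (?r x)\<bar>)"
  proof (rule compact_integral_abs_le[OF compact_tri])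
    fix x assume x: "x \<in> ?T"
    then have "?r x \<in> \<Omega>" using rmem element_subset[OF T(2)] by blast
    have "err x * w x + err (?r x) * w (?r x) = (err x + err (?r x)) * w x - err (?r x) * (w x - w (?r x))"
      by (simp add: algebra_simps)
    also have "\<bar>\<dots>\<bar> \<le> \<bar>err x + err (?r x)\<bar> * \<bar>w x\<bar> + \<bar>err (?r x)\<bar> * \<bar>w x - w (?r x)\<bar>"
      unfolding abs_mult[symmetric] by (rule abs_triangle_ineq4)
    also have "\<dots> \<le> B1 * \<bar>w x\<bar> + B0 * \<bar>w x - w (?r x)\<bar>"
      using B1[OF x] B0[OF \<open>?r x \<in> \<Omega>\<close>] by (intro add_mono mult_right_mono) auto
    finally show "\<bar>err x * w x + err (?r x) * w (?r x)\<bar> \<le> B1 * \<bar>w x\<bar> + B0 * \<bar>w x - w (?r x)\<bar>" .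
  qed (intro continuous_intros e er wc wr)+
  also have "\<dots> = B1 * integral ?T (\<lambda>x. \<bar>w x\<bar>) + B0 * integral ?T (\<lambda>x. \<bar>w x - w (?r x)\<bar>)"
    by (subst integral_add) (auto intro!: compact_continuous_integral(1) compact_tri continuous_intros wc wr)
  also have "B0 * integral ?T (\<lambda>x. \<bar>w x - w (?r x)\<bar>)
      \<le> B0 * (2 * h * (integral (diamond x0 a b) (\<lambda>x. \<bar>W x $ 1\<bar>) + integral (diamond x0 a b) (\<lambda>x. \<bar>W x $ 2\<bar>)))"
  proof (intro mult_left_mono \<open>B0 \<ge> 0\<close>)
    let ?D = "integral (diamond x0 a b) (\<lambda>x. \<bar>W x $ 1\<bar>) + integral (diamond x0 a b) (\<lambda>x. \<bar>W x $ 2\<bar>)"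
    have D0: "?D \<ge> 0" by (intro add_nonneg_nonneg integral_abs_nonneg)
    have ab: "norm a \<le> h" "norm b \<le> h"
      using element_diameter[OF T(1) x0(2,1)] element_diameter[OF T(1) x0(3,1)] by simp_all
    have "integral ?T (\<lambda>x. \<bar>w x - w (?r x)\<bar>) \<le> norm a * ?D + norm b * ?D"
      using pair_difference_real[OF w crs, of x0]
        integral_abs_inner_le[OF compact_diamond[OF crs] gradient_continuous(2)[OF w], of x0 a]
        integral_abs_inner_le[OF compact_diamond[OF crs] gradient_continuous(2)[OF w], of x0 b] by linarith
    also have "\<dots> \<le> h * ?D + h * ?D" using ab D0 by (intro add_mono mult_right_mono)
    finally show "integral ?T (\<lambda>x. \<bar>w x - w (?r x)\<bar>) \<le> 2 * h * ?D" by simp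
  qed
  finally show ?thesis unfolding split by (simp add: mult_ac)
qed

text \<open>The two regularity conditions combine to
  \<open>h / (\<kappa> * q) \<le> inradius T\<close>, so the element contains a disc of comparable
  radius and its area is at least of order \<open>h ^ 2\<close>.\<close>

lemma element_measure_lower:
  assumes "shape_regular \<kappa> \<T>" "quasi_uniform q \<T>" "T \<in> \<T>"
  shows "0 < h" "0 < \<kappa> * q" "unit_ball_vol 2 * (h / (2 * (\<kappa> * q)))\<^sup>2 \<le> measure lebesgue T"
proof -
  obtain v a b where vab: "T = tri v a b" "crs a b \<noteq> 0" using elementE[OF assms(3)] by metis
  have bd: "bounded T" using compact_element[OF assms(3)] compact_imp_bounded by blast
  have "v \<in> T" "v + a \<in> T" using tri_memI[of 0 0 v a b] tri_memI[of 1 0 v a b] vab(1) by simp_all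
  then have "norm a \<le> diameter T" using diameter_bounded_bound[OF bd, of "v + a" v] by (simp add: dist_norm)
  moreover have "norm a > 0" using tri_affine_independent(2)[OF vab(2)] by simp
  ultimately have diam: "diameter T > 0" by linarith
  have diamh: "diameter T \<le> h" unfolding h_def mesh_size_def using finite_mesh assms(3) by auto
  then show h: "0 < h" using diam by linarith
  have "h \<le> q * diameter T" using assms(2,3) by (simp add: quasi_uniform_def h_def)
  then have q: "q > 0" using h diam by (metis less_le_trans zero_less_mult_pos2)
  let ?R = "{r. 0 \<le> r \<and> (\<exists>x. cball x r \<subseteq> T)}"
  have bdd: "bdd_above ?R"
  proof (rule bdd_aboveI)
    fix r assume "r \<in> ?R"
    then obtain x where x: "0 \<le> r" "cball x r \<subseteq> T" by blast
    have "x + r *\<^sub>R axis 1 1 \<in> T" "x \<in> T" using x by (auto simp: dist_norm norm_axis_1 subset_iff)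
    then show "r \<le> diameter T" using diameter_bounded_bound[OF bd, of "x + r *\<^sub>R axis 1 1" x] x(1)
      by (simp add: dist_norm norm_axis_1)
  qed
  have "diameter T \<le> \<kappa> * inradius T" using assms(1,3) by (simp add: shape_regular_def)
  have R0: "0 \<in> ?R" using \<open>v \<in> T\<close> by auto
  have in0: "inradius T \<ge> 0" unfolding inradius_def by (rule cSup_upper[OF R0 bdd])
  have "\<kappa> * inradius T > 0" using \<open>diameter T \<le> \<kappa> * inradius T\<close> diam by linarith
  then have \<kappa>: "\<kappa> > 0" and inr: "inradius T > 0" using in0 by (auto simp: zero_less_mult_iff)
  show kq: "0 < \<kappa> * q" using \<kappa> q by simp
  have "h \<le> q * (\<kappa> * inradius T)"
    using \<open>h \<le> q * diameter T\<close> mult_left_mono[OF \<open>diameter T \<le> \<kappa> * inradius T\<close>, of q] q by linarith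
  then have "h / (\<kappa> * q) \<le> inradius T" using kq by (simp add: field_simps)
  \<comment> \<open>The inradius is a supremum; descending to half of its lower bound guarantees a
    disc that really lies in \<open>T\<close>.\<close>
  then have "h / (2 * (\<kappa> * q)) < inradius T" using h kq by (smt (verit) divide_pos_pos divide_strict_left_mono mult_pos_pos)
  then obtain r where r: "r \<in> ?R" "h / (2 * (\<kappa> * q)) < r"
    unfolding inradius_def using less_cSup_iff[OF _ bdd] R0 by blast
  then obtain x where x: "cball x r \<subseteq> T" by blast
  let ?r = "h / (2 * (\<kappa> * q))"
  have "cball x ?r \<subseteq> T" using x r(2) by auto
  have "unit_ball_vol 2 * ?r\<^sup>2 = measure lebesgue (cball x ?r)"
    using content_cball[of ?r x] h kq by simp
  also have "\<dots> \<le> measure lebesgue T"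
    using \<open>cball x ?r \<subseteq> T\<close> lmeasurable_compact[OF compact_element[OF assms(3)]]
    by (intro measure_mono_fmeasurable) auto
  finally show "unit_ball_vol 2 * ?r\<^sup>2 \<le> measure lebesgue T" .
qed

text \<open>Area packing: the elements overlap in null sets, each has at least the area of a disc of
  radius \<open>h / (2 * (\<kappa> * q))\<close>, and together they lie in a disc of radius
  \<open>2 * h\<close>. The quotient of the two areas is
  \<open>16 * (\<kappa> * q)\<^sup>2\<close>.\<close>

lemma element_count:
  assumes "shape_regular \<kappa> \<T>" "quasi_uniform q \<T>"
  shows "real (card {T \<in> \<T>. T \<subseteq> cball x (2 * h)}) \<le> 16 * (\<kappa> * q)\<^sup>2"
proof (cases "{T \<in> \<T>. T \<subseteq> cball x (2 * h)} = {}")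
  case False
  let ?X = "{T \<in> \<T>. T \<subseteq> cball x (2 * h)}"
  obtain T0 where T0: "T0 \<in> \<T>" using False by blast
  note pos = element_measure_lower(1,2)[OF assms T0]
  have fin: "finite ?X" using finite_mesh by simp
  have ubv: "unit_ball_vol (2::real) > 0" by simp
  have "real (card ?X) * (unit_ball_vol 2 * (h / (2 * (\<kappa> * q)))\<^sup>2) = (\<Sum>T\<in>?X. unit_ball_vol 2 * (h / (2 * (\<kappa> * q)))\<^sup>2)"
    by simp
  also have "\<dots> \<le> (\<Sum>T\<in>?X. measure lebesgue T)"
    by (intro sum_mono element_measure_lower(3)[OF assms]) auto
  also have "\<dots> = measure lebesgue (\<Union>?X)"
    using negligible_Int_elements lmeasurable_compact[OF compact_element]
    by (intro measure_negligible_finite_Union[symmetric] fin) (auto simp: pairwise_def)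
  also have "\<dots> \<le> measure lebesgue (cball x (2 * h))"
    using lmeasurable_compact[OF compact_element] fin by (intro measure_mono_fmeasurable) (auto intro!: fmeasurableD)
  also have "\<dots> = unit_ball_vol 2 * (2 * h)\<^sup>2"
    using content_cball[of "2 * h" x] pos(1) by simp
  finally have "unit_ball_vol 2 * (real (card ?X) * (h / (2 * (\<kappa> * q)))\<^sup>2) \<le> unit_ball_vol 2 * (2 * h)\<^sup>2"
    by (simp add: mult_ac)
  then have "real (card ?X) * (h / (2 * (\<kappa> * q)))\<^sup>2 \<le> (2 * h)\<^sup>2" using ubv by simp
  moreover have "(h / (2 * (\<kappa> * q)))\<^sup>2 = h\<^sup>2 / (4 * (\<kappa> * q)\<^sup>2)"
    by (simp only: power_divide power_mult_distrib) simp
  ultimately have "real (card ?X) * h\<^sup>2 / (4 * (\<kappa> * q)\<^sup>2) \<le> 4 * h\<^sup>2"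
    by (simp add: power_mult_distrib)
  moreover have "4 * (\<kappa> * q)\<^sup>2 > 0" using zero_less_power[OF pos(2), of 2] by linarith
  ultimately have "real (card ?X) * h\<^sup>2 \<le> 4 * h\<^sup>2 * (4 * (\<kappa> * q)\<^sup>2)" by (simp only: pos_divide_le_eq)
  then have "real (card ?X) * h\<^sup>2 \<le> (16 * (\<kappa> * q)\<^sup>2) * h\<^sup>2" by (simp only: mult_ac)
  then show ?thesis using pos(1) by simp
next
  case True
  then show ?thesis by (metis card.empty of_nat_0 zero_le_mult_iff zero_le_numeral zero_le_power2)
qed

end

text \<open>The hulls of different pairs may overlap; exchanging sum and integral reduces the total
  to their multiplicity at a point.\<close>

lemma sum_integral_overlap:
  fixes u :: "real^2 \<Rightarrow> real"
  assumes "finite P" "compact \<Omega>" and u: "continuous_on \<Omega> u"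
    and D: "\<And>p. p \<in> P \<Longrightarrow> compact (D p)" "\<And>p. p \<in> P \<Longrightarrow> D p \<subseteq> \<Omega>"
    and N: "\<And>x. real (card {p \<in> P. x \<in> D p}) \<le> N"
  shows "(\<Sum>p\<in>P. integral (D p) (\<lambda>x. \<bar>u x\<bar>)) \<le> N * integral \<Omega> (\<lambda>x. \<bar>u x\<bar>)"
proof -
  have N0: "N \<ge> 0" using N[of undefined] by (rule order_trans[rotated]) simp
  have m: "(\<lambda>x. ennreal \<bar>u x\<bar> * indicator S x) \<in> borel_measurable borel" if "compact S" "S \<subseteq> \<Omega>" for S
  proof -
    have "(\<lambda>x. indicator S x * \<bar>u x\<bar>) \<in> borel_measurable borel"
      using that by (intro measurable_indicator_mult continuous_intros continuous_on_subset[OF u] borel_closed compact_imp_closed)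
    then have "(\<lambda>x. ennreal (indicator S x * \<bar>u x\<bar>)) \<in> borel_measurable borel" by simp
    moreover have "(\<lambda>x. ennreal (indicator S x * \<bar>u x\<bar>)) = (\<lambda>x. ennreal \<bar>u x\<bar> * indicator S x)"
      by (auto simp: indicator_def)
    ultimately show ?thesis by simp
  qed
  have "ennreal (\<Sum>p\<in>P. integral (D p) (\<lambda>x. \<bar>u x\<bar>)) = (\<Sum>p\<in>P. \<integral>\<^sup>+x\<in>D p. ennreal \<bar>u x\<bar> \<partial>lborel)"
    using D compact_nn_integral[OF D(1) continuous_on_subset[OF u D(2)]]
    by (simp add: sum_ennreal integral_abs_nonneg flip: sum_ennreal)
  also have "\<dots> = (\<integral>\<^sup>+x. (\<Sum>p\<in>P. ennreal \<bar>u x\<bar> * indicator (D p) x) \<partial>lborel)"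
    by (rule nn_integral_sum[symmetric]) (use m D in auto)
  also have "\<dots> \<le> (\<integral>\<^sup>+x. ennreal N * (ennreal \<bar>u x\<bar> * indicator \<Omega> x) \<partial>lborel)"
  proof (intro nn_integral_mono)
    fix x
    have "(\<Sum>p\<in>P. ennreal \<bar>u x\<bar> * indicator (D p) x) = ennreal \<bar>u x\<bar> * (\<Sum>p\<in>P. indicator (D p) x)"
      by (simp add: sum_distrib_left)
    also have "(\<Sum>p\<in>P. indicator (D p) x :: ennreal) = of_nat (card {p \<in> P. x \<in> D p})"
      using assms(1) by (simp add: indicator_def sum.If_cases Int_def)
    also have "ennreal \<bar>u x\<bar> * of_nat (card {p \<in> P. x \<in> D p}) \<le> ennreal N * (ennreal \<bar>u x\<bar> * indicator \<Omega> x)"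
    proof (cases "x \<in> \<Omega>")
      case True
      have "of_nat (card {p \<in> P. x \<in> D p}) \<le> ennreal N"
        unfolding ennreal_of_nat_eq_real_of_nat by (rule ennreal_leI[OF N])
      from mult_left_mono[OF this, of "ennreal \<bar>u x\<bar>"] show ?thesis using True by (simp add: mult.commute)
    next
      case False
      then have empty: "{p \<in> P. x \<in> D p} = {}" using D(2) by blast
      show ?thesis unfolding empty by simp
    qed
    finally show "(\<Sum>p\<in>P. ennreal \<bar>u x\<bar> * indicator (D p) x) \<le> ennreal N * (ennreal \<bar>u x\<bar> * indicator \<Omega> x)" .
  qed
  also have "\<dots> = ennreal N * (\<integral>\<^sup>+x\<in>\<Omega>. ennreal \<bar>u x\<bar> \<partial>lborel)"
    by (rule nn_integral_cmult) (use m assms(2) in auto)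
  also have "\<dots> = ennreal (N * integral \<Omega> (\<lambda>x. \<bar>u x\<bar>))"
    unfolding compact_nn_integral[OF assms(2) u] ennreal_mult'[OF N0] ..
  finally show ?thesis
    using N0 by (simp add: ennreal_le_iff integral_abs_nonneg)
qed

lemma gradient_inner:
  fixes G :: "real^2 \<Rightarrow> real^2"
  assumes "gradient (\<lambda>x. G x $ 1) H1" "gradient (\<lambda>x. G x $ 2) H2"
  shows "gradient (\<lambda>x. G x \<bullet> d) (\<lambda>x. d $ 1 *\<^sub>R H1 x + d $ 2 *\<^sub>R H2 x)"
proof -
  have "(\<lambda>x. G x \<bullet> d) = (\<lambda>x. d $ 1 * G x $ 1 + d $ 2 * G x $ 2)"
    by (auto simp: inner_vec_def sum_2 mult.commute)
  then show ?thesis using assms unfolding gradient_def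
    by (auto intro!: continuous_intros derivative_eq_intros simp: inner_add_left)
qed

text \<open>First derivatives and mixed second derivatives are counted twice, which affects only
  constants.\<close>

definition W2_sum :: "(real^2) set \<Rightarrow> (real^2 \<Rightarrow> real) \<Rightarrow> (real^2 \<Rightarrow> real^2) \<Rightarrow> (real^2 \<Rightarrow> real^2) \<Rightarrow> (real^2 \<Rightarrow> real^2) \<Rightarrow> real" where
  "W2_sum S g G H1 H2 = W1_sum S g G + W1_sum S (\<lambda>x. G x $ 1) H1 + W1_sum S (\<lambda>x. G x $ 2) H2"

lemma W1_sum_nonneg: "W1_sum S w W \<ge> 0"
  unfolding W1_sum_def by (intro add_nonneg_nonneg integral_abs_nonneg)

lemma W2_sum_nonneg: "W2_sum S g G H1 H2 \<ge> 0"
  unfolding W2_sum_def by (intro add_nonneg_nonneg W1_sum_nonneg)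

lemma W1_sum_inner_le:
  fixes d :: "real^2"
  assumes "compact S" "gradient (\<lambda>x. G x $ 1) H1" "gradient (\<lambda>x. G x $ 2) H2" and g: "gradient g G"
  shows "W1_sum S (\<lambda>x. G x \<bullet> d) (\<lambda>x. d $ 1 *\<^sub>R H1 x + d $ 2 *\<^sub>R H2 x) \<le> norm d * W2_sum S g G H1 H2"
proof -
  have G: "continuous_on S G" by (rule gradient_continuous[OF g])
  have H: "continuous_on S H1" "continuous_on S H2"
    using gradient_continuous(2)[OF assms(2)] gradient_continuous(2)[OF assms(3)] by auto
  have i: "integral S (\<lambda>x. \<bar>(d $ 1 *\<^sub>R H1 x + d $ 2 *\<^sub>R H2 x) $ i\<bar>)
      \<le> norm d * (integral S (\<lambda>x. \<bar>H1 x $ i\<bar>) + integral S (\<lambda>x. \<bar>H2 x $ i\<bar>))" for i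
  proof -
    have "integral S (\<lambda>x. \<bar>(d $ 1 *\<^sub>R H1 x + d $ 2 *\<^sub>R H2 x) $ i\<bar>) \<le> integral S (\<lambda>x. norm d * (\<bar>H1 x $ i\<bar> + \<bar>H2 x $ i\<bar>))"
    proof (intro compact_integral_mono assms(1))
      fix x
      have "\<bar>(d $ 1 *\<^sub>R H1 x + d $ 2 *\<^sub>R H2 x) $ i\<bar> \<le> \<bar>d $ 1\<bar> * \<bar>H1 x $ i\<bar> + \<bar>d $ 2\<bar> * \<bar>H2 x $ i\<bar>"
        using abs_triangle_ineq[of "d $ 1 * H1 x $ i" "d $ 2 * H2 x $ i"] by (simp add: abs_mult)
      also have "\<dots> \<le> norm d * \<bar>H1 x $ i\<bar> + norm d * \<bar>H2 x $ i\<bar>"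
        by (intro add_mono mult_right_mono component_le_norm_cart) auto
      finally show "\<bar>(d $ 1 *\<^sub>R H1 x + d $ 2 *\<^sub>R H2 x) $ i\<bar> \<le> norm d * (\<bar>H1 x $ i\<bar> + \<bar>H2 x $ i\<bar>)"
        by (simp add: algebra_simps)
    qed (intro continuous_intros H)+
    also have "\<dots> = norm d * (integral S (\<lambda>x. \<bar>H1 x $ i\<bar>) + integral S (\<lambda>x. \<bar>H2 x $ i\<bar>))"
      by (simp, subst integral_add) (auto intro!: compact_continuous_integral(1) continuous_intros assms H)
    finally show ?thesis .
  qed
  have "W1_sum S (\<lambda>x. G x \<bullet> d) (\<lambda>x. d $ 1 *\<^sub>R H1 x + d $ 2 *\<^sub>R H2 x) \<le>
     norm d * (integral S (\<lambda>x. \<bar>G x $ 1\<bar>) + integral S (\<lambda>x. \<bar>G x $ 2\<bar>))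
     + norm d * (integral S (\<lambda>x. \<bar>H1 x $ 1\<bar>) + integral S (\<lambda>x. \<bar>H2 x $ 1\<bar>))
     + norm d * (integral S (\<lambda>x. \<bar>H1 x $ 2\<bar>) + integral S (\<lambda>x. \<bar>H2 x $ 2\<bar>))"
    unfolding W1_sum_def by (intro add_mono i integral_abs_inner_le assms(1) G)
  also have "\<dots> = norm d * (integral S (\<lambda>x. \<bar>G x $ 1\<bar>) + integral S (\<lambda>x. \<bar>G x $ 2\<bar>)
     + integral S (\<lambda>x. \<bar>H1 x $ 1\<bar>) + integral S (\<lambda>x. \<bar>H2 x $ 1\<bar>)
     + integral S (\<lambda>x. \<bar>H1 x $ 2\<bar>) + integral S (\<lambda>x. \<bar>H2 x $ 2\<bar>))" by (simp add: algebra_simps)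
  also have "\<dots> \<le> norm d * W2_sum S g G H1 H2"
    unfolding W2_sum_def W1_sum_def
    using integral_abs_nonneg[of S g] integral_abs_nonneg[of S "\<lambda>x. G x $ 1"] integral_abs_nonneg[of S "\<lambda>x. G x $ 2"]
    by (intro mult_left_mono) auto
  finally show ?thesis .
qed

text \<open>Each of two edges contributes \<open>2 + norm a + norm b\<close>. The rest comes from
  the interior estimate for the derivative of \<open>g\<close> along \<open>a\<close>:
  \<open>32 = 2 * 16\<close> from the overlap of the pairs, the last summand from the boundary
  strip.\<close>

definition "second_order_const \<kappa> q a b = 4 + 2 * (norm a + norm b) + (norm a + norm b) *
  (1 + 32 * (\<kappa> * q)\<^sup>2 + 6 * (norm a + norm b) / \<bar>crs a b\<bar> * (4 + 2 * (norm a + norm b)))" for \<kappa> q :: real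

context fe_mesh
begin

text \<open>The pairs give \<open>B1\<close> from the symmetric sums and \<open>h * B0\<close> from
  the differences of \<open>w\<close>; the unpaired elements give \<open>h * B0\<close> through the
  integral of \<open>\<bar>w\<bar>\<close> over the strip. With \<open>B0\<close> of order
  \<open>k + 1\<close> and \<open>B1\<close> of order \<open>k + 2\<close>, everything is of order
  \<open>k + 2\<close>.\<close>

lemma interior_estimate:
  assumes reg: "shape_regular \<kappa> \<T>" "quasi_uniform q \<T>" and sym: "symmetric_triangulation \<T> \<Omega>"
    and dom: "\<Omega> = tri v a b" and crs: "crs a b \<noteq> 0" and w: "gradient w W"
    and B0: "\<And>x. x \<in> \<Omega> \<Longrightarrow> \<bar>err x\<bar> \<le> B0"
    and B1: "\<And>x0 a b x. tri x0 a b \<in> \<T> \<Longrightarrow> tri x0 (- a) (- b) \<in> \<T> \<Longrightarrow> crs a b \<noteq> 0 \<Longrightarrow> x0 \<in> interior \<Omega> \<Longrightarrow>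
      x \<in> tri x0 a b \<Longrightarrow> \<bar>err x + err (2 *\<^sub>R x0 - x)\<bar> \<le> B1" and "B1 \<ge> 0"
  shows "\<bar>integral \<Omega> (\<lambda>x. err x * w x)\<bar>
    \<le> (B1 + h * B0 * (32 * (\<kappa> * q)\<^sup>2 + 6 * (norm a + norm b) / \<bar>crs a b\<bar> * (4 + 2 * (norm a + norm b)))) * W1_sum \<Omega> w W"
proof -
  let ?Kb = "6 * (norm a + norm b) / \<bar>crs a b\<bar> * (4 + 2 * (norm a + norm b))"
  have "v \<in> \<Omega>" using tri_memI[of 0 0 v a b] dom by simp
  then have B00: "B0 \<ge> 0" using B0[of v] by linarith
  have wc: "continuous_on S w" and Wc: "continuous_on S W" for S by (rule gradient_continuous[OF w])+
  obtain \<A> \<B> P where AB: "\<T> = \<A> \<union> \<B>" "\<A> \<inter> \<B> = {}" and P: "partition_on \<A> P"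
    and pairs: "\<And>p. p \<in> P \<Longrightarrow> \<exists>T1 T2. p = {T1, T2} \<and> symmetric_pair T1 T2"
    and strip: "\<Union>\<B> \<subseteq> {x\<in>\<Omega>. infdist x (frontier \<Omega>) \<le> mesh_size \<T>}"
    using sym unfolding symmetric_triangulation_def
    by (elim exE conjE) (rule that, assumption+, drule (1) bspec, assumption+)
  have fin: "finite \<A>" "finite \<B>" using AB(1) finite_mesh by auto
  note UP = partition_onD1[OF P]
  note disj = disjointD[OF partition_onD2[OF P]]
  have finP: "finite P" using fin(1) UP finite_UnionD by metis
  have "\<exists>x0 a b. crs a b \<noteq> 0 \<and> p = {tri x0 a b, tri x0 (- a) (- b)} \<and> tri x0 a b \<noteq> tri x0 (- a) (- b) \<and> x0 \<in> interior \<Omega>"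
    if p: "p \<in> P" for p
  proof -
    obtain T1 T2 where T: "p = {T1, T2}" "symmetric_pair T1 T2" using pairs[OF p] by blast
    have "T1 \<in> \<T>" "T2 \<in> \<T>" using T(1) p UP AB(1) by auto
    then obtain x0 a b where x: "crs a b \<noteq> 0" "T1 = tri x0 a b" "T2 = tri x0 (- a) (- b)" "x0 \<in> interior \<Omega>" "T1 \<inter> T2 = {x0}"
      using symmetric_pairE T(2) by metis
    have "x0 + a \<in> T1" using tri_memI[of 1 0 x0 a b] x(2) by simp
    \<comment> \<open>If the two elements coincided, the sum over the block would have one term
      instead of two.\<close>
    then have "T1 \<noteq> T2" using x(5) tri_affine_independent(2)[OF x(1)] by auto
    then show ?thesis using x T(1) by blast
  qed
  then obtain X A B where XAB: "\<And>p. p \<in> P \<Longrightarrow> crs (A p) (B p) \<noteq> 0"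
    "\<And>p. p \<in> P \<Longrightarrow> p = {tri (X p) (A p) (B p), tri (X p) (- A p) (- B p)}"
    "\<And>p. p \<in> P \<Longrightarrow> tri (X p) (A p) (B p) \<noteq> tri (X p) (- A p) (- B p)"
    "\<And>p. p \<in> P \<Longrightarrow> X p \<in> interior \<Omega>" by metis
  let ?T = "\<lambda>p. tri (X p) (A p) (B p)" and ?T' = "\<lambda>p. tri (X p) (- A p) (- B p)"
  let ?D = "\<lambda>p. diamond (X p) (A p) (B p)"
  have Tin: "?T p \<in> p" "?T' p \<in> p" if "p \<in> P" for p using XAB(2)[OF that] by blast+
  have T\<T>: "?T p \<in> \<T>" "?T' p \<in> \<T>" if "p \<in> P" for p using Tin[OF that] that UP AB(1) by auto
  have verts: "X p \<in> ?T p" "X p + A p \<in> ?T p" "X p + B p \<in> ?T p" "X p - A p \<in> ?T' p" "X p - B p \<in> ?T' p" for p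
    using tri_memI[of 0 0 "X p" "A p" "B p"] tri_memI[of 1 0 "X p" "A p" "B p"] tri_memI[of 0 1 "X p" "A p" "B p"]
      tri_memI[of 1 0 "X p" "- A p" "- B p"] tri_memI[of 0 1 "X p" "- A p" "- B p"] by simp_all
  have injT: "inj_on ?T P"
  proof (rule inj_onI, rule ccontr)
    fix p p' assume p: "p \<in> P" "p' \<in> P" "?T p = ?T p'" "p \<noteq> p'"
    then have "?T p \<in> p \<inter> p'" using Tin(1)[of p] Tin(1)[of p'] by simp
    then show False using disj[OF p(1,2,4)] by simp
  qed
  have D\<Omega>: "?D p \<subseteq> \<Omega>" if p: "p \<in> P" for p
    using verts[of p] element_subset[OF T\<T>(1)[OF p]] element_subset[OF T\<T>(2)[OF p]]
    by (intro diamond_subset[OF convex_domain]) auto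
  have count: "real (card {p \<in> P. x \<in> ?D p}) \<le> 16 * (\<kappa> * q)\<^sup>2" for x
  proof -
    \<comment> \<open>A pair whose diamond contains \<open>x\<close> has its vertex within
      \<open>h\<close> of \<open>x\<close> and its first element within \<open>h\<close> of that
      vertex. Sending a pair to its first element is injective, since the blocks of a partition are
      disjoint, so the count of elements bounds the count of pairs.\<close>
    have "?T ` {p \<in> P. x \<in> ?D p} \<subseteq> {T \<in> \<T>. T \<subseteq> cball x (2 * h)}"
    proof clarify
      fix p assume p: "p \<in> P" and x: "x \<in> ?D p"
      obtain s t where st: "x = X p + s *\<^sub>R A p + t *\<^sub>R B p" "\<bar>s\<bar> + \<bar>t\<bar> \<le> 1" using x unfolding diamond_def by blast
      have ab: "norm (A p) \<le> h" "norm (B p) \<le> h"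
        using element_diameter[OF T\<T>(1)[OF p] verts(2,1)] element_diameter[OF T\<T>(1)[OF p] verts(3,1)] by simp_all
      have "norm (x - X p) \<le> \<bar>s\<bar> * norm (A p) + \<bar>t\<bar> * norm (B p)"
        unfolding st(1) using norm_triangle_ineq[of "s *\<^sub>R A p" "t *\<^sub>R B p"] by (simp add: add.assoc)
      also have "\<dots> \<le> \<bar>s\<bar> * h + \<bar>t\<bar> * h" using ab by (intro add_mono mult_left_mono) auto
      also have "\<dots> = (\<bar>s\<bar> + \<bar>t\<bar>) * h" by (simp add: algebra_simps)
      also have "\<dots> \<le> 1 * h" using st(2) h_nonneg by (intro mult_right_mono)
      finally have xX: "norm (x - X p) \<le> h" by simp
      have "?T p \<subseteq> cball x (2 * h)"
      proof
        fix y assume "y \<in> ?T p"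
        then have "norm (X p - y) \<le> h" using element_diameter[OF T\<T>(1)[OF p] verts(1)] by blast
        then show "y \<in> cball x (2 * h)"
          using xX norm_triangle_ineq[of "x - X p" "X p - y"] by (simp add: dist_norm)
      qed
      then show "?T p \<in> \<T> \<and> ?T p \<subseteq> cball x (2 * h)" using T\<T>[OF p] by blast
    qed
    moreover have "inj_on ?T {p \<in> P. x \<in> ?D p}"
      by (rule inj_on_subset[OF injT]) auto
    ultimately have "card {p \<in> P. x \<in> ?D p} \<le> card {T \<in> \<T>. T \<subseteq> cball x (2 * h)}"
      using finite_mesh by (intro card_inj_on_le) auto
    then show ?thesis using element_count[OF reg, of x] by linarith
  qed
  let ?u = "\<lambda>x. err x * w x"
  have ec: "continuous_on S err" if "S \<subseteq> \<Omega>" for S using continuous_on_err that continuous_on_subset by blast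
  have total: "integral \<Omega> ?u = (\<Sum>p\<in>P. integral (?T p) ?u + integral (?T' p) ?u) + (\<Sum>T\<in>\<B>. integral T ?u)"
  proof -
    have "integral \<Omega> ?u = (\<Sum>T\<in>\<T>. integral T ?u)"
      using integral_elements[of \<T> ?u] union_mesh by (simp add: continuous_intros ec wc)
    also have "\<dots> = (\<Sum>T\<in>\<A>. integral T ?u) + (\<Sum>T\<in>\<B>. integral T ?u)"
      unfolding AB(1) by (rule sum.union_disjoint) (use fin AB(2) in auto)
    also have "(\<Sum>T\<in>\<A>. integral T ?u) = (\<Sum>p\<in>P. \<Sum>T\<in>p. integral T ?u)"
      unfolding UP using disj fin(1) UP
      by (subst sum.Union_disjoint) (auto intro: finite_subset[of _ \<A>])
    also have "\<dots> = (\<Sum>p\<in>P. integral (?T p) ?u + integral (?T' p) ?u)"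
    proof (rule sum.cong[OF refl])
      fix p assume p: "p \<in> P"
      show "(\<Sum>T\<in>p. integral T ?u) = integral (?T p) ?u + integral (?T' p) ?u"
        by (subst XAB(2)[OF p]) (use XAB(3)[OF p] in simp)
    qed
    finally show ?thesis .
  qed
  have Dsum: "(\<Sum>p\<in>P. integral (?D p) (\<lambda>x. \<bar>W x $ i\<bar>)) \<le> 16 * (\<kappa> * q)\<^sup>2 * integral \<Omega> (\<lambda>x. \<bar>W x $ i\<bar>)" for i
    by (rule sum_integral_overlap[OF finP compact_domain]) (use compact_diamond XAB(1) D\<Omega> count in \<open>auto intro!: continuous_intros Wc\<close>)
  have "\<bar>\<Sum>p\<in>P. integral (?T p) ?u + integral (?T' p) ?u\<bar> \<le> (\<Sum>p\<in>P. \<bar>integral (?T p) ?u + integral (?T' p) ?u\<bar>)"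
    by (rule sum_abs)
  also have "\<dots> \<le> (\<Sum>p\<in>P. B1 * integral (?T p) (\<lambda>x. \<bar>w x\<bar>)
      + 2 * h * B0 * (integral (?D p) (\<lambda>x. \<bar>W x $ 1\<bar>) + integral (?D p) (\<lambda>x. \<bar>W x $ 2\<bar>)))"
  proof (rule sum_mono)
    fix p assume p: "p \<in> P"
    show "\<bar>integral (?T p) ?u + integral (?T' p) ?u\<bar> \<le> B1 * integral (?T p) (\<lambda>x. \<bar>w x\<bar>)
      + 2 * h * B0 * (integral (?D p) (\<lambda>x. \<bar>W x $ 1\<bar>) + integral (?D p) (\<lambda>x. \<bar>W x $ 2\<bar>))"
      by (rule pair_integral_le[OF T\<T>[OF p] XAB(1)[OF p] w B0 B1[OF T\<T>[OF p] XAB(1)[OF p] XAB(4)[OF p]]])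
  qed
  also have "\<dots> = B1 * (\<Sum>p\<in>P. integral (?T p) (\<lambda>x. \<bar>w x\<bar>))
      + 2 * h * B0 * ((\<Sum>p\<in>P. integral (?D p) (\<lambda>x. \<bar>W x $ 1\<bar>)) + (\<Sum>p\<in>P. integral (?D p) (\<lambda>x. \<bar>W x $ 2\<bar>)))"
    by (simp only: sum.distrib sum_distrib_left[symmetric])
  also have "\<dots> \<le> B1 * integral \<Omega> (\<lambda>x. \<bar>w x\<bar>)
      + 2 * h * B0 * (16 * (\<kappa> * q)\<^sup>2 * integral \<Omega> (\<lambda>x. \<bar>W x $ 1\<bar>) + 16 * (\<kappa> * q)\<^sup>2 * integral \<Omega> (\<lambda>x. \<bar>W x $ 2\<bar>))"
  proof (intro add_mono mult_left_mono)
    have "(\<Sum>p\<in>P. integral (?T p) (\<lambda>x. \<bar>w x\<bar>)) = (\<Sum>T\<in>?T ` P. integral T (\<lambda>x. \<bar>w x\<bar>))"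
      by (simp add: sum.reindex[OF injT])
    also have "\<dots> \<le> (\<Sum>T\<in>\<T>. integral T (\<lambda>x. \<bar>w x\<bar>))"
      using T\<T> finite_mesh by (intro sum_mono2) (auto simp: integral_abs_nonneg)
    also have "\<dots> = integral \<Omega> (\<lambda>x. \<bar>w x\<bar>)"
      using integral_elements[of \<T> "\<lambda>x. \<bar>w x\<bar>"] union_mesh by (simp add: continuous_intros wc)
    finally show "(\<Sum>p\<in>P. integral (?T p) (\<lambda>x. \<bar>w x\<bar>)) \<le> integral \<Omega> (\<lambda>x. \<bar>w x\<bar>)" .
  qed (use \<open>B1 \<ge> 0\<close> B00 h_nonneg Dsum in auto)
  finally have paired: "\<bar>\<Sum>p\<in>P. integral (?T p) ?u + integral (?T' p) ?u\<bar> \<le> B1 * integral \<Omega> (\<lambda>x. \<bar>w x\<bar>)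
      + 2 * h * B0 * (16 * (\<kappa> * q)\<^sup>2 * integral \<Omega> (\<lambda>x. \<bar>W x $ 1\<bar>) + 16 * (\<kappa> * q)\<^sup>2 * integral \<Omega> (\<lambda>x. \<bar>W x $ 2\<bar>))" .
  have "\<bar>\<Sum>T\<in>\<B>. integral T ?u\<bar> \<le> (\<Sum>T\<in>\<B>. \<bar>integral T ?u\<bar>)" by (rule sum_abs)
  also have "\<dots> \<le> (\<Sum>T\<in>\<B>. B0 * integral T (\<lambda>x. \<bar>w x\<bar>))"
  proof (rule sum_mono)
    fix T assume "T \<in> \<B>"
    then have T: "T \<in> \<T>" using AB(1) by blast
    have "\<bar>integral T ?u\<bar> \<le> integral T (\<lambda>x. B0 * \<bar>w x\<bar>)"
    proof (rule compact_integral_abs_le[OF compact_element[OF T]])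
      fix x assume "x \<in> T"
      then show "\<bar>?u x\<bar> \<le> B0 * \<bar>w x\<bar>" unfolding abs_mult using B0 element_subset[OF T] by (intro mult_right_mono) auto
    qed (intro continuous_intros ec wc element_subset[OF T])+
    then show "\<bar>integral T ?u\<bar> \<le> B0 * integral T (\<lambda>x. \<bar>w x\<bar>)" by simp
  qed
  also have "\<dots> = B0 * integral (\<Union>\<B>) (\<lambda>x. \<bar>w x\<bar>)"
    using integral_elements[of \<B> "\<lambda>x. \<bar>w x\<bar>"] AB(1) by (simp add: continuous_intros wc sum_distrib_left)
  also have "\<dots> \<le> B0 * (h * ?Kb * W1_sum \<Omega> w W)"
  proof (intro mult_left_mono B00)
    have "compact (\<Union>\<B>)" using fin(2) compact_element AB(1) by (intro compact_Union) auto
    then show "integral (\<Union>\<B>) (\<lambda>x. \<bar>w x\<bar>) \<le> h * ?Kb * W1_sum \<Omega> w W"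
      using boundary_strip_bound[OF w crs h_nonneg, of "\<Union>\<B>" v] strip unfolding dom h_def by blast
  qed
  finally have unpaired: "\<bar>\<Sum>T\<in>\<B>. integral T ?u\<bar> \<le> B0 * (h * ?Kb * W1_sum \<Omega> w W)" .
  have Ws: "W1_sum \<Omega> w W = integral \<Omega> (\<lambda>x. \<bar>w x\<bar>) + integral \<Omega> (\<lambda>x. \<bar>W x $ 1\<bar>) + integral \<Omega> (\<lambda>x. \<bar>W x $ 2\<bar>)"
    by (simp add: W1_sum_def)
  have nn: "0 \<le> integral \<Omega> (\<lambda>x. \<bar>w x\<bar>)" "0 \<le> integral \<Omega> (\<lambda>x. \<bar>W x $ 1\<bar>)" "0 \<le> integral \<Omega> (\<lambda>x. \<bar>W x $ 2\<bar>)"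
    by (intro integral_abs_nonneg)+
  have "B1 * integral \<Omega> (\<lambda>x. \<bar>w x\<bar>) \<le> B1 * W1_sum \<Omega> w W"
    using nn \<open>B1 \<ge> 0\<close> unfolding Ws by (intro mult_left_mono) auto
  moreover have "2 * h * B0 * (16 * (\<kappa> * q)\<^sup>2 * integral \<Omega> (\<lambda>x. \<bar>W x $ 1\<bar>) + 16 * (\<kappa> * q)\<^sup>2 * integral \<Omega> (\<lambda>x. \<bar>W x $ 2\<bar>))
      \<le> 2 * h * B0 * (16 * (\<kappa> * q)\<^sup>2 * W1_sum \<Omega> w W)"
    unfolding distrib_left[symmetric] using nn B00 h_nonneg unfolding Ws by (intro mult_left_mono) auto
  ultimately have "\<bar>integral \<Omega> ?u\<bar> \<le> B1 * W1_sum \<Omega> w W + 2 * h * B0 * (16 * (\<kappa> * q)\<^sup>2 * W1_sum \<Omega> w W)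
      + B0 * (h * ?Kb * W1_sum \<Omega> w W)"
    using paired unpaired unfolding total by linarith
  also have "\<dots> = (B1 + h * B0 * (32 * (\<kappa> * q)\<^sup>2 + ?Kb)) * W1_sum \<Omega> w W"
  proof -
    have "b * y + 2 * s * c * (16 * r * y) + c * (s * m * y) = (b + s * c * (32 * r + m)) * y" for b y s c r m :: real
      by (simp add: algebra_simps)
    then show ?thesis .
  qed
  finally show ?thesis .
qed

text \<open>The edge of \<open>\<Omega>\<close> in direction \<open>a\<close> gives no boundary
  term, because the lines of integration run parallel to it. The other two edges remain.\<close>

lemma integration_by_parts_err:
  assumes dom: "\<Omega> = tri v a b" and crs: "crs a b \<noteq> 0" and g: "gradient g G"
  shows "\<bar>LINT x:\<Omega>|lborel. g x * (err_grad x \<bullet> a)\<bar>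
    \<le> \<bar>crs a b\<bar> * \<bar>integral {0..1} (\<lambda>t. g (v + a + t *\<^sub>R (b - a)) * err (v + a + t *\<^sub>R (b - a)))\<bar>
      + \<bar>crs a b\<bar> * \<bar>integral {0..1} (\<lambda>t. g (v + t *\<^sub>R b) * err (v + t *\<^sub>R b))\<bar>
      + \<bar>integral \<Omega> (\<lambda>x. err x * (G x \<bullet> a))\<bar>"
proof -
  obtain S where S: "finite S" "\<Omega> - skeleton_free \<subseteq> (\<Union>(p, q)\<in>S. closed_segment p q)" by (rule skeleton_segments)
  obtain K where K: "\<And>x. norm (err_grad x) \<le> K" using err_grad_bounded by blast
  let ?e1 = "\<lambda>t. g (v + a + t *\<^sub>R (b - a)) * err (v + a + t *\<^sub>R (b - a))" and ?e2 = "\<lambda>t. g (v + t *\<^sub>R b) * err (v + t *\<^sub>R b)"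
  have ibp: "(LINT x:\<Omega>|lborel. g x * (err_grad x \<bullet> a)) =
    \<bar>crs a b\<bar> * (LINT t:{0..1}|lborel. g (v + (1 - t) *\<^sub>R a + t *\<^sub>R b) * err (v + (1 - t) *\<^sub>R a + t *\<^sub>R b)
        - g (v + t *\<^sub>R b) * err (v + t *\<^sub>R b))
    - (LINT x:\<Omega>|lborel. err x * (G x \<bullet> a))"
    using integration_by_parts_tri[OF crs continuous_on_err[unfolded dom] open_skeleton_free
        skeleton_free_subset(1)[unfolded dom] S[unfolded dom] has_derivative_err continuous_on_err_grad _ K g]
    unfolding dom by (simp add: err_grad_def)
  have rw: "v + (1 - t) *\<^sub>R a + t *\<^sub>R b = v + a + t *\<^sub>R (b - a)" for t by (simp add: algebra_simps)
  have mem: "v + a + t *\<^sub>R (b - a) \<in> \<Omega>" "v + t *\<^sub>R b \<in> \<Omega>" if "t \<in> {0..1}" for t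
    using tri_memI[of "1 - t" t v a b] tri_memI[of 0 t v a b] that dom by (simp_all add: rw)
  have c: "continuous_on {0..1} ?e1" "continuous_on {0..1} ?e2"
    by (intro continuous_intros continuous_on_compose2[OF continuous_on_err]
        continuous_on_compose2[OF gradient_continuous(1)[OF g, of UNIV]]; use mem in auto)+
  have A: "(LINT t:{0..1}|lborel. ?e1 t - ?e2 t) = integral {0..1} ?e1 - integral {0..1} ?e2"
    using compact_continuous_integral(2)[of "{0..1}" "\<lambda>t. ?e1 t - ?e2 t"] c
    by (simp add: continuous_intros integral_diff compact_continuous_integral(1))
  have B: "(LINT x:\<Omega>|lborel. err x * (G x \<bullet> a)) = integral \<Omega> (\<lambda>x. err x * (G x \<bullet> a))"
    by (intro compact_continuous_integral(2) compact_domain continuous_intros continuous_on_err gradient_continuous[OF g])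
  have "(LINT x:\<Omega>|lborel. g x * (err_grad x \<bullet> a)) =
      \<bar>crs a b\<bar> * integral {0..1} ?e1 - \<bar>crs a b\<bar> * integral {0..1} ?e2 - integral \<Omega> (\<lambda>x. err x * (G x \<bullet> a))"
    unfolding ibp rw A B by (simp only: right_diff_distrib)
  then show ?thesis
    using abs_triangle_ineq4[of "\<bar>crs a b\<bar> * integral {0..1} ?e1 - \<bar>crs a b\<bar> * integral {0..1} ?e2" "integral \<Omega> (\<lambda>x. err x * (G x \<bullet> a))"]
      abs_triangle_ineq4[of "\<bar>crs a b\<bar> * integral {0..1} ?e1" "\<bar>crs a b\<bar> * integral {0..1} ?e2"]
    unfolding abs_mult abs_idempotent by linarith
qed

text \<open>The error is replaced by its maximum everywhere. With \<open>R = norm a + norm b\<close>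
  the constant is \<open>2 * (4 + 2 * R) + R\<close>, for two edges and the interior.\<close>

lemma gradient_error_estimate_1:
  assumes dom: "\<Omega> = tri v a b" and crs: "crs a b \<noteq> 0" and g: "gradient g G"
    and B0: "\<And>x. x \<in> \<Omega> \<Longrightarrow> \<bar>err x\<bar> \<le> B0"
  shows "\<bar>LINT x:\<Omega>|lborel. g x * (err_grad x \<bullet> a)\<bar> \<le> (8 + 5 * (norm a + norm b)) * B0 * W1_sum \<Omega> g G"
proof -
  let ?R = "norm a + norm b"
  have "v \<in> \<Omega>" using tri_memI[of 0 0 v a b] dom by simp
  then have B00: "B0 \<ge> 0" using B0[of v] by linarith
  have edge: "\<bar>crs a b\<bar> * \<bar>integral {0..1} (\<lambda>t. g (v' + t *\<^sub>R b') * err (v' + t *\<^sub>R b'))\<bar> \<le> (4 + 2 * ?R) * B0 * W1_sum \<Omega> g G"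
    if r: "(v', a', b') \<in> relabels v a b" for v' a' b'
  proof -
    have crs': "crs a' b' \<noteq> 0" using relabels_crs[OF r] crs by auto
    have dom': "\<Omega> = tri v' a' b'" using relabels_tri[OF r] dom by simp
    have "\<bar>crs a b\<bar> * \<bar>integral {0..1} (\<lambda>t. g (v' + t *\<^sub>R b') * err (v' + t *\<^sub>R b'))\<bar> \<le> B0 * trace_sum v' a' b' g G"
      using edge_integral_le[OF dom' crs' g B0] relabels_crs[OF r] by simp
    also have "\<dots> \<le> B0 * ((4 + norm a' + norm (a' - b')) * W1_sum \<Omega> g G)"
      using trace_sum_le[OF g, of v' a' b'] dom' B00 by (intro mult_left_mono) auto
    also have "\<dots> \<le> B0 * ((4 + 2 * ?R) * W1_sum \<Omega> g G)"
      using relabels_norm[OF r] B00 by (intro mult_left_mono mult_right_mono W1_sum_nonneg) auto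
    finally show ?thesis by (simp add: mult_ac)
  qed
  have "\<bar>integral \<Omega> (\<lambda>x. err x * (G x \<bullet> a))\<bar> \<le> integral \<Omega> (\<lambda>x. B0 * \<bar>G x \<bullet> a\<bar>)"
    using B0 by (intro compact_integral_abs_le compact_domain continuous_intros continuous_on_err gradient_continuous[OF g])
      (auto simp: abs_mult intro!: mult_right_mono)
  also have "\<dots> = B0 * integral \<Omega> (\<lambda>x. \<bar>G x \<bullet> a\<bar>)" by simp
  also have "\<dots> \<le> B0 * (norm a * (integral \<Omega> (\<lambda>x. \<bar>G x $ 1\<bar>) + integral \<Omega> (\<lambda>x. \<bar>G x $ 2\<bar>)))"
    by (intro mult_left_mono B00 integral_abs_inner_le compact_domain gradient_continuous[OF g])
  also have "\<dots> \<le> B0 * (?R * W1_sum \<Omega> g G)"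
    unfolding W1_sum_def using B00 integral_abs_nonneg
    by (intro mult_left_mono mult_mono) (auto simp: integral_abs_nonneg intro!: add_nonneg_nonneg)
  finally have int: "\<bar>integral \<Omega> (\<lambda>x. err x * (G x \<bullet> a))\<bar> \<le> ?R * B0 * W1_sum \<Omega> g G" by (simp add: mult_ac)
  have rel: "(v + a, - a, b - a) \<in> relabels v a b" "(v, a, b) \<in> relabels v a b" by (simp_all add: relabels_def)
  have "\<bar>LINT x:\<Omega>|lborel. g x * (err_grad x \<bullet> a)\<bar>
      \<le> (4 + 2 * ?R) * B0 * W1_sum \<Omega> g G + (4 + 2 * ?R) * B0 * W1_sum \<Omega> g G + ?R * B0 * W1_sum \<Omega> g G"
    using integration_by_parts_err[OF dom crs g] edge[OF rel(1)] edge[OF rel(2)] int by linarith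
  also have "\<dots> = (8 + 5 * ?R) * B0 * W1_sum \<Omega> g G" by (simp add: algebra_simps)
  finally show ?thesis .
qed

text \<open>The interior estimate is applied to the weight \<open>G x \<bullet> a\<close>, a first
  derivative of \<open>g\<close>, so second derivatives of \<open>g\<close> appear; the boundary
  terms come from the folded edges.\<close>

lemma gradient_error_estimate_2:
  assumes reg: "shape_regular \<kappa> \<T>" "quasi_uniform q \<T>" and sym: "symmetric_triangulation \<T> \<Omega>"
    and dom: "\<Omega> = tri v a b" and crs: "crs a b \<noteq> 0"
    and g: "gradient g G" and H: "gradient (\<lambda>x. G x $ 1) H1" "gradient (\<lambda>x. G x $ 2) H2"
    and B0: "\<And>x. x \<in> \<Omega> \<Longrightarrow> \<bar>err x\<bar> \<le> B0"
    and pair: "\<And>x0 a b x. tri x0 a b \<in> \<T> \<Longrightarrow> tri x0 (- a) (- b) \<in> \<T> \<Longrightarrow> crs a b \<noteq> 0 \<Longrightarrow> x0 \<in> interior \<Omega> \<Longrightarrow>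
      x \<in> tri x0 a b \<Longrightarrow> \<bar>err x + err (2 *\<^sub>R x0 - x)\<bar> \<le> B1"
    and edge: "\<And>v a b \<theta>. tri v a b \<in> \<T> \<Longrightarrow> crs a b \<noteq> 0 \<Longrightarrow> 0 \<le> \<theta> \<Longrightarrow> \<theta> \<le> 1 \<Longrightarrow>
      \<bar>err (v + \<theta> *\<^sub>R a) + err (v + (1 - \<theta>) *\<^sub>R a)\<bar> \<le> B1" and B1: "B1 \<ge> 0"
  shows "\<bar>LINT x:\<Omega>|lborel. g x * (err_grad x \<bullet> a)\<bar> \<le> second_order_const \<kappa> q a b * (B1 + h * B0) * W2_sum \<Omega> g G H1 H2"
proof -
  let ?R = "norm a + norm b" and ?W = "W2_sum \<Omega> g G H1 H2"
  let ?Kb = "6 * ?R / \<bar>crs a b\<bar> * (4 + 2 * ?R)"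
  have "v \<in> \<Omega>" using tri_memI[of 0 0 v a b] dom by simp
  then have B00: "B0 \<ge> 0" using B0[of v] by linarith
  have W0: "?W \<ge> 0" by (rule W2_sum_nonneg)
  have W12: "W1_sum \<Omega> g G \<le> ?W" unfolding W2_sum_def using W1_sum_nonneg by (simp add: add_nonneg_nonneg)
  have edge': "\<bar>crs a b\<bar> * \<bar>integral {0..1} (\<lambda>t. g (v' + t *\<^sub>R b') * err (v' + t *\<^sub>R b'))\<bar> \<le> (2 + ?R) * (B1 + h * B0) * ?W"
    if r: "(v', a', b') \<in> relabels v a b" for v' a' b'
  proof -
    have crs': "crs a' b' \<noteq> 0" using relabels_crs[OF r] crs by auto
    have b': "norm b' > 0" using tri_affine_independent[OF crs'] by simp
    have dom': "\<Omega> = tri v' a' b'" using relabels_tri[OF r] dom by simp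
    have tb': "trace_sum v' a' b' w W \<le> (4 + 2 * ?R) * W1_sum \<Omega> w W" if "gradient w W" for w W
    proof -
      have "trace_sum v' a' b' w W \<le> (4 + norm a' + norm (a' - b')) * W1_sum \<Omega> w W"
        using trace_sum_le[OF that, of v' a' b'] dom' by simp
      also have "\<dots> \<le> (4 + 2 * ?R) * W1_sum \<Omega> w W"
        using relabels_norm[OF r] by (intro mult_right_mono W1_sum_nonneg) auto
      finally show ?thesis .
    qed
    let ?Wb = "\<lambda>x. b' $ 1 *\<^sub>R H1 x + b' $ 2 *\<^sub>R H2 x"
    have Wb: "gradient (\<lambda>x. G x \<bullet> b') ?Wb" by (rule gradient_inner[OF H])
    have "2 * (\<bar>crs a b\<bar> * \<bar>integral {0..1} (\<lambda>t. g (v' + t *\<^sub>R b') * err (v' + t *\<^sub>R b'))\<bar>)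
        \<le> B1 * trace_sum v' a' b' g G + h / norm b' * B0 * trace_sum v' a' b' (\<lambda>x. G x \<bullet> b') ?Wb"
      using edge_integral_le_even[OF dom' crs' g Wb B0 edge B1] relabels_crs[OF r] by simp
    also have "\<dots> \<le> B1 * ((4 + 2 * ?R) * ?W) + h / norm b' * B0 * ((4 + 2 * ?R) * (norm b' * ?W))"
    proof (intro add_mono mult_left_mono)
      show "trace_sum v' a' b' g G \<le> (4 + 2 * ?R) * ?W"
        by (rule order_trans[OF tb'[OF g]]) (intro mult_left_mono W12, simp)
      show "trace_sum v' a' b' (\<lambda>x. G x \<bullet> b') ?Wb \<le> (4 + 2 * ?R) * (norm b' * ?W)"
        by (rule order_trans[OF tb'[OF Wb]]) (intro mult_left_mono W1_sum_inner_le[OF compact_domain H g], simp)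
    qed (use B1 B00 h_nonneg in auto)
    \<comment> \<open>The length of the edge cancels: a derivative along \<open>b'\<close> carries a
      factor \<open>norm b'\<close>, while an interval of length at most \<open>h\<close> has
      parameter length at most \<open>h / norm b'\<close>.\<close>
    also have "h / norm b' * B0 * ((4 + 2 * ?R) * (norm b' * ?W)) = h * B0 * ((4 + 2 * ?R) * ?W)"
      using b' by simp
    finally have "2 * (\<bar>crs a b\<bar> * \<bar>integral {0..1} (\<lambda>t. g (v' + t *\<^sub>R b') * err (v' + t *\<^sub>R b'))\<bar>)
        \<le> 2 * ((2 + ?R) * (B1 + h * B0) * ?W)"
      by (simp add: algebra_simps)
    then show ?thesis by simp
  qed
  let ?Wa = "\<lambda>x. a $ 1 *\<^sub>R H1 x + a $ 2 *\<^sub>R H2 x"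
  have Wa: "gradient (\<lambda>x. G x \<bullet> a) ?Wa" by (rule gradient_inner[OF H])
  have "W1_sum \<Omega> (\<lambda>x. G x \<bullet> a) ?Wa \<le> norm a * ?W"
    by (rule W1_sum_inner_le[OF compact_domain H g])
  also have "\<dots> \<le> ?R * ?W" using W0 by (intro mult_right_mono) auto
  finally have Wa_le: "W1_sum \<Omega> (\<lambda>x. G x \<bullet> a) ?Wa \<le> ?R * ?W" .
  have "\<bar>integral \<Omega> (\<lambda>x. err x * (G x \<bullet> a))\<bar> \<le> (B1 + h * B0 * (32 * (\<kappa> * q)\<^sup>2 + ?Kb)) * W1_sum \<Omega> (\<lambda>x. G x \<bullet> a) ?Wa"
    by (rule interior_estimate[OF reg sym dom crs Wa B0 pair B1])
  also have "\<dots> \<le> ((1 + 32 * (\<kappa> * q)\<^sup>2 + ?Kb) * (B1 + h * B0)) * (?R * ?W)"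
  proof (intro mult_mono Wa_le)
    have Kb: "0 \<le> 32 * (\<kappa> * q)\<^sup>2 + ?Kb" by simp
    have "(1 + (32 * (\<kappa> * q)\<^sup>2 + ?Kb)) * (B1 + h * B0)
        = B1 + h * B0 * (32 * (\<kappa> * q)\<^sup>2 + ?Kb) + (h * B0 + (32 * (\<kappa> * q)\<^sup>2 + ?Kb) * B1)"
      by (simp only: distrib_left distrib_right mult_ac add_ac)
    moreover have "0 \<le> h * B0 + (32 * (\<kappa> * q)\<^sup>2 + ?Kb) * B1"
      using Kb B1 B00 h_nonneg by (intro add_nonneg_nonneg mult_nonneg_nonneg) auto
    ultimately show "B1 + h * B0 * (32 * (\<kappa> * q)\<^sup>2 + ?Kb) \<le> (1 + 32 * (\<kappa> * q)\<^sup>2 + ?Kb) * (B1 + h * B0)"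
      unfolding add.assoc by linarith
  qed (use B1 B00 h_nonneg W0 in \<open>auto intro!: mult_nonneg_nonneg add_nonneg_nonneg W1_sum_nonneg\<close>)
  finally have int: "\<bar>integral \<Omega> (\<lambda>x. err x * (G x \<bullet> a))\<bar> \<le> ((1 + 32 * (\<kappa> * q)\<^sup>2 + ?Kb) * (B1 + h * B0)) * (?R * ?W)" .
  have rel: "(v + a, - a, b - a) \<in> relabels v a b" "(v, a, b) \<in> relabels v a b" by (simp_all add: relabels_def)
  have "\<bar>LINT x:\<Omega>|lborel. g x * (err_grad x \<bullet> a)\<bar>
      \<le> (2 + ?R) * (B1 + h * B0) * ?W + (2 + ?R) * (B1 + h * B0) * ?W + ((1 + 32 * (\<kappa> * q)\<^sup>2 + ?Kb) * (B1 + h * B0)) * (?R * ?W)"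
    using integration_by_parts_err[OF dom crs g] edge'[OF rel(1)] edge'[OF rel(2)] int by linarith
  also have "\<dots> = ((2 + ?R) + (2 + ?R) + ?R * (1 + 32 * (\<kappa> * q)\<^sup>2 + ?Kb)) * (B1 + h * B0) * ?W"
  proof -
    have "x * s * y + x * s * y + (m * s) * (r * y) = (x + x + r * m) * s * y" for x s y m r :: real
      by (simp add: algebra_simps)
    then show ?thesis .
  qed
  also have "(2 + ?R) + (2 + ?R) + ?R * (1 + 32 * (\<kappa> * q)\<^sup>2 + ?Kb) = second_order_const \<kappa> q a b"
    unfolding second_order_const_def by simp
  finally show ?thesis .
qed

end

section \<open>Mollification\<close>

primrec diff_times :: "nat \<Rightarrow> (real \<Rightarrow> real) \<Rightarrow> bool" where
  "diff_times 0 u \<longleftrightarrow> True"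
| "diff_times (Suc n) u \<longleftrightarrow> (\<exists>u'. (\<forall>t. (u has_real_derivative u' t) (at t)) \<and> diff_times n u')"

lemma diff_times_Suc_imp: "diff_times (Suc n) u \<Longrightarrow> diff_times n u"
proof (induction n arbitrary: u)
  case (Suc n)
  then show ?case by (metis diff_times.simps(2))
qed simp

lemma diff_times_add: "diff_times n u \<Longrightarrow> diff_times n w \<Longrightarrow> diff_times n (\<lambda>t. u t + w t)"
proof (induction n arbitrary: u w)
  case (Suc n)
  then obtain u' w' where "\<And>t. (u has_real_derivative u' t) (at t)" "diff_times n u'"
    "\<And>t. (w has_real_derivative w' t) (at t)" "diff_times n w'" by auto
  then have "\<And>t. ((\<lambda>t. u t + w t) has_real_derivative u' t + w' t) (at t)" "diff_times n (\<lambda>t. u' t + w' t)"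
    using Suc.IH by (auto intro: DERIV_add)
  then show ?case
    unfolding diff_times.simps by (intro exI[of _ "\<lambda>t. u' t + w' t"] conjI allI)
qed simp

lemma diff_times_mult: "diff_times n u \<Longrightarrow> diff_times n w \<Longrightarrow> diff_times n (\<lambda>t. u t * w t)"
proof (induction n arbitrary: u w)
  case (Suc n)
  then obtain u' w' where *: "\<And>t. (u has_real_derivative u' t) (at t)" "diff_times n u'"
    "\<And>t. (w has_real_derivative w' t) (at t)" "diff_times n w'" by auto
  have "((\<lambda>t. u t * w t) has_real_derivative u' t * w t + w' t * u t) (at t)" for t
    by (rule DERIV_mult[OF *(1,3)])
  moreover have "diff_times n (\<lambda>t. u' t * w t + w' t * u t)"
    by (rule diff_times_add[OF Suc.IH[OF *(2) diff_times_Suc_imp[OF Suc.prems(2)]]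
        Suc.IH[OF *(4) diff_times_Suc_imp[OF Suc.prems(1)]]])
  ultimately show ?case
    unfolding diff_times.simps by (intro exI[of _ "\<lambda>t. u' t * w t + w' t * u t"] conjI allI)
qed simp

lemma diff_times_const: "diff_times n (\<lambda>_. c)"
proof (induction n arbitrary: c)
  case (Suc n)
  then show ?case by (auto intro!: exI[of _ "\<lambda>_. 0"])
qed simp

lemma diff_times_affine: "diff_times n u \<Longrightarrow> diff_times n (\<lambda>t. u (c + s * t))"
proof (induction n arbitrary: u)
  case (Suc n)
  then obtain u' where *: "\<And>t. (u has_real_derivative u' t) (at t)" "diff_times n u'" by auto
  have "((\<lambda>t. u (c + s * t)) has_real_derivative u' (c + s * t) * s) (at t)" for t
    by (rule DERIV_chain'[OF _ *(1)]) (auto intro!: derivative_eq_intros)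
  moreover have "diff_times n (\<lambda>t. u' (c + s * t) * s)"
    by (rule diff_times_mult[OF Suc.IH[OF *(2)] diff_times_const])
  ultimately show ?case
    unfolding diff_times.simps by (intro exI[of _ "\<lambda>t. u' (c + s * t) * s"] conjI allI)
qed simp

text \<open>The span of these functions is closed under differentiation.\<close>

definition flat :: "nat \<Rightarrow> real \<Rightarrow> real" where
  "flat k t = (if 0 < t then inverse t ^ k * exp (- inverse t) else 0)"

lemma flat_has_real_derivative:
  "(flat k has_real_derivative - real k * flat (Suc k) t + flat (Suc (Suc k)) t) (at t)"
proof -
  consider "t > 0" | "t < 0" | "t = 0" by linarith
  then show ?thesis
  proof cases
    case 1
    have "((\<lambda>t. inverse t ^ k * exp (- inverse t)) has_real_derivative
        - real k * flat (Suc k) t + flat (Suc (Suc k)) t) (at t)"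
    proof -
      have "((\<lambda>t. inverse t ^ k * exp (- inverse t)) has_real_derivative
          real k * inverse t ^ (k - 1) * (- (inverse t * inverse t)) * exp (- inverse t)
            + (inverse t * inverse t) * exp (- inverse t) * inverse t ^ k) (at t)"
        using 1 by (auto intro!: derivative_eq_intros simp: power2_eq_square)
      moreover have "real k * inverse t ^ (k - 1) * (- (inverse t * inverse t)) * exp (- inverse t)
            + (inverse t * inverse t) * exp (- inverse t) * inverse t ^ k
          = - real k * flat (Suc k) t + flat (Suc (Suc k)) t"
        \<comment> \<open>For \<open>k = 0\<close> the exponent \<open>k - 1\<close> is truncated,
          but the factor \<open>real k\<close> removes that term.\<close>
        using 1 by (cases k) (simp_all add: flat_def algebra_simps)
      ultimately show ?thesis by simp
    qed
    then show ?thesis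
      by (rule has_field_derivative_transform_within_open[where S = "{0<..}"]) (use 1 in \<open>auto simp: flat_def\<close>)
  next
    case 2
    have "((\<lambda>t. 0) has_real_derivative - real k * flat (Suc k) t + flat (Suc (Suc k)) t) (at t)"
      using 2 by (simp add: flat_def)
    then show ?thesis
      by (rule has_field_derivative_transform_within_open[where S = "{..<0}"]) (use 2 in \<open>auto simp: flat_def\<close>)
  next
    case 3
    have "(\<lambda>h. flat k h / h) \<midarrow>0\<rightarrow> 0"
    proof (rule filterlim_split_at)
      show "((\<lambda>h. flat k h / h) \<longlongrightarrow> 0) (at_left 0)"
        by (rule tendsto_eventually) (auto simp: eventually_at_filter flat_def)
      \<comment> \<open>With \<open>x = 1 / h\<close> the difference quotient at 0 from the right
        becomes \<open>x ^ Suc k / exp x\<close>.\<close>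
      have "((\<lambda>x. x ^ Suc k / exp x :: real) \<longlongrightarrow> 0) at_top" by (rule tendsto_power_div_exp_0)
      then show "((\<lambda>h. flat k h / h) \<longlongrightarrow> 0) (at_right 0)"
        unfolding filterlim_at_right_to_top
        by (rule Lim_transform_eventually)
          (use eventually_gt_at_top[of 0] in eventually_elim, simp add: flat_def exp_minus field_simps)
    qed
    then show ?thesis unfolding DERIV_def 3 by (simp add: flat_def)
  qed
qed

lemma diff_times_flat: "diff_times n (flat k)"
proof (induction n arbitrary: k)
  case (Suc n)
  have "diff_times n (\<lambda>t. - real k * flat (Suc k) t + flat (Suc (Suc k)) t)"
    by (rule diff_times_add[OF diff_times_mult[OF diff_times_const Suc] Suc])
  then show ?case
    unfolding diff_times.simps using flat_has_real_derivative
    by (intro exI[of _ "\<lambda>t. - real k * flat (Suc k) t + flat (Suc (Suc k)) t"] conjI allI)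
qed simp

lemma diff_times_deriv:
  assumes "\<And>n. diff_times n u"
  shows "diff_times n ((deriv ^^ m) u)"
    and "((deriv ^^ m) u has_real_derivative (deriv ^^ Suc m) u t) (at t)"
proof -
  have step: "(w has_real_derivative deriv w t) (at t)" "diff_times n (deriv w)" if w: "diff_times (Suc n) w" for n t w
  proof -
    obtain w' where w': "\<And>t. (w has_real_derivative w' t) (at t)" "diff_times n w'"
      using w unfolding diff_times.simps by blast
    then have "deriv w = w'" by (auto intro: DERIV_imp_deriv)
    then show "(w has_real_derivative deriv w t) (at t)" "diff_times n (deriv w)" using w' by auto
  qed
  have all: "diff_times n ((deriv ^^ m) u)" for n m
  proof (induction m arbitrary: n)
    case (Suc m)
    show ?case using step(2)[OF Suc.IH] by (simp del: diff_times.simps)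
  qed (simp add: assms)
  then show "diff_times n ((deriv ^^ m) u)" .
  show "((deriv ^^ m) u has_real_derivative (deriv ^^ Suc m) u t) (at t)"
    using step(1)[OF all[of "Suc 0" m]] by simp
qed

text \<open>The whole sequence of derivatives is produced at once, so that derivatives of the
  mollifier belong to one explicit family.\<close>

lemma smooth_bump_exists:
  "\<exists>X::nat \<Rightarrow> real \<Rightarrow> real. (\<forall>n t. (X n has_real_derivative X (Suc n) t) (at t)) \<and>
     (\<forall>n t. \<bar>t\<bar> > 1 \<longrightarrow> X n t = 0) \<and> (\<forall>t. X 0 t \<ge> 0) \<and> (\<integral>t. X 0 t \<partial>lborel) = 1"
proof -
  \<comment> \<open>One factor is flat at 1, the other at -1; the product is positive exactly in
    between.\<close>
  define b where "b t = flat 0 (1 + (-1) * t) * flat 0 (1 + 1 * t)" for t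
  have b: "diff_times n b" for n
    unfolding b_def by (rule diff_times_mult[OF diff_times_affine[OF diff_times_flat] diff_times_affine[OF diff_times_flat]])
  have bc: "continuous_on S b" for S
    using diff_times_deriv(2)[OF b, of 0]
    by (intro continuous_at_imp_continuous_on ballI DERIV_isCont) auto
  have b0: "b t \<ge> 0" "\<bar>t\<bar> > 1 \<Longrightarrow> b t = 0" "\<bar>t\<bar> < 1 \<Longrightarrow> b t > 0" for t
    by (auto simp: b_def flat_def abs_if split: if_splits)
  have ind: "b = (\<lambda>t. indicator {-1..1} t *\<^sub>R b t)"
  proof
    fix t show "b t = indicator {-1..1} t *\<^sub>R b t" using b0(2)[of t] by (cases "t \<in> {-1..1}") auto
  qed
  have int: "integrable lborel b"
    by (subst ind, rule borel_integrable_compact[OF _ bc]) simp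
  define I where "I = (\<integral>t. b t \<partial>lborel)"
  \<comment> \<open>A nonnegative function with vanishing integral is zero almost everywhere,
    against positivity on an interval.\<close>
  have "I \<noteq> 0"
  proof
    assume "I = 0"
    then have "AE t in lborel. b t = 0"
      using integral_nonneg_eq_0_iff_AE[OF int] b0(1) unfolding I_def by simp
    then have "AE t in lborel. t \<notin> {-1<..<1::real}"
      by eventually_elim (use b0(3) in \<open>force simp: abs_less_iff\<close>)
    then have "{-1<..<1::real} \<in> null_sets lborel" by (subst AE_iff_null_sets) auto
    then show False by (auto dest: null_setsD1)
  qed
  moreover have "I \<ge> 0" unfolding I_def by (simp add: b0(1))
  ultimately have I: "I > 0" by simp
  define w where "w t = inverse I * b t" for t
  have w: "diff_times n w" for n unfolding w_def[abs_def] by (rule diff_times_mult[OF diff_times_const b])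
  define X where "X n = (deriv ^^ n) w" for n
  have der: "(X n has_real_derivative X (Suc n) t) (at t)" for n t
    unfolding X_def by (rule diff_times_deriv(2)[OF w])
  have zero: "X n t = 0" if "\<bar>t\<bar> > 1" for n t
    using that
  proof (induction n arbitrary: t)
    case 0
    then show ?case using b0(2) by (simp add: X_def w_def)
  next
    case (Suc n)
    have "((\<lambda>t. 0) has_real_derivative 0) (at t)" by simp
    then have "(X n has_real_derivative 0) (at t)"
      by (rule has_field_derivative_transform_within_open[where S = "{t. 1 < \<bar>t\<bar>}"])
        (use Suc in \<open>auto intro!: open_Collect_less continuous_intros\<close>)
    then show ?case using DERIV_unique der by blast
  qed
  have "(\<integral>t. X 0 t \<partial>lborel) = 1"
    using I by (simp add: X_def w_def[abs_def] I_def[symmetric])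
  then show ?thesis using der zero b0(1) I by (intro exI[of _ X]) (auto simp: X_def w_def)
qed

definition bump :: "nat \<Rightarrow> real \<Rightarrow> real" where
  "bump = (SOME X. (\<forall>n t. (X n has_real_derivative X (Suc n) t) (at t)) \<and>
     (\<forall>n t. \<bar>t\<bar> > 1 \<longrightarrow> X n t = 0) \<and> (\<forall>t. X 0 t \<ge> 0) \<and> (\<integral>t. X 0 t \<partial>lborel) = 1)"

lemma bump:
  shows bump_deriv: "(bump n has_real_derivative bump (Suc n) t) (at t)"
    and bump_zero: "\<bar>t\<bar> > 1 \<Longrightarrow> bump n t = 0" and bump_nonneg: "bump 0 t \<ge> 0"
    and bump_integral: "(\<integral>t. bump 0 t \<partial>lborel) = 1"
  using someI_ex[OF smooth_bump_exists, folded bump_def] by blast+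

lemma bump_continuous: "continuous_on S (bump n)"
  by (intro continuous_at_imp_continuous_on ballI DERIV_isCont[OF bump_deriv])

lemma bump_bounded: "\<exists>B. \<forall>t. \<bar>bump n t\<bar> \<le> B"
proof -
  have "bounded (bump n ` {-1..1})" by (intro compact_imp_bounded compact_continuous_image bump_continuous) simp
  then obtain B where B: "B > 0" "\<And>t. t \<in> {-1..1} \<Longrightarrow> \<bar>bump n t\<bar> \<le> B" by (auto simp: bounded_pos)
  have "\<bar>bump n t\<bar> \<le> B" for t
    using B(2)[of t] bump_zero[of t n] B(1) by (cases "t \<in> {-1..1}") auto
  then show ?thesis by blast
qed

text \<open>The indices count derivatives in the two coordinates, so that differentiation only
  raises an index. The power of \<open>\<epsilon>\<close> has one factor for each derivative and two
  for unit mass in the plane.\<close>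

definition kernel :: "real \<Rightarrow> nat \<Rightarrow> nat \<Rightarrow> real^2 \<Rightarrow> real" where
  "kernel \<epsilon> m n u = bump m (u $ 1 / \<epsilon>) * bump n (u $ 2 / \<epsilon>) / \<epsilon> ^ (m + n + 2)"

definition kernel_grad :: "real \<Rightarrow> nat \<Rightarrow> nat \<Rightarrow> real^2 \<Rightarrow> real^2" where
  "kernel_grad \<epsilon> m n u = vector [kernel \<epsilon> (Suc m) n u, kernel \<epsilon> m (Suc n) u]"

lemma kernel_continuous: "continuous_on S (kernel \<epsilon> m n)"
  unfolding kernel_def[abs_def] divide_inverse
  by (intro continuous_intros continuous_on_compose2[OF bump_continuous[of UNIV]]) auto

lemma kernel_zero:
  assumes "\<epsilon> > 0" "\<bar>u $ i\<bar> > \<epsilon>"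
  shows "kernel \<epsilon> m n u = 0"
proof -
  have "\<bar>u $ i / \<epsilon>\<bar> > 1" using assms by (simp add: abs_divide)
  then show ?thesis using bump_zero exhaust_2[of i] by (auto simp: kernel_def)
qed

lemma kernel_nonneg: "\<epsilon> > 0 \<Longrightarrow> kernel \<epsilon> 0 0 u \<ge> 0"
  by (simp add: kernel_def bump_nonneg)

lemma kernel_bounded: "\<exists>B\<ge>0. \<forall>u. \<bar>kernel \<epsilon> m n u\<bar> \<le> B"
proof -
  obtain B1 where B1: "\<And>t. \<bar>bump m t\<bar> \<le> B1" using bump_bounded by blast
  obtain B2 where B2: "\<And>t. \<bar>bump n t\<bar> \<le> B2" using bump_bounded by blast
  have "\<bar>kernel \<epsilon> m n u\<bar> \<le> B1 * B2 / \<bar>\<epsilon> ^ (m + n + 2)\<bar>" for u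
    unfolding kernel_def abs_divide abs_mult
    using B1 B2 order_trans[OF abs_ge_zero B1] by (intro divide_right_mono mult_mono) auto
  then show ?thesis by (meson abs_ge_zero order_trans)
qed

lemma gradient_kernel:
  assumes "\<epsilon> > 0"
  shows "gradient (kernel \<epsilon> m n) (kernel_grad \<epsilon> m n)"
  unfolding gradient_def
proof (intro conjI allI)
  have "kernel_grad \<epsilon> m n = (\<lambda>u. kernel \<epsilon> (Suc m) n u *\<^sub>R axis 1 1 + kernel \<epsilon> m (Suc n) u *\<^sub>R axis 2 1)"
    by (auto simp: kernel_grad_def fun_eq_iff vec_eq_iff forall_2 axis_def)
  then show "continuous_on UNIV (kernel_grad \<epsilon> m n)" by (simp add: continuous_intros kernel_continuous)
  fix u :: "real^2"
  have c: "((\<lambda>u::real^2. bump j (u $ i / \<epsilon>)) has_derivative (\<lambda>d. bump (Suc j) (u $ i / \<epsilon>) * (d $ i / \<epsilon>))) (at u)" for i j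
  proof -
    have "((\<lambda>u::real^2. u $ i / \<epsilon>) has_derivative (\<lambda>d. d $ i / \<epsilon>)) (at u)"
      by (intro bounded_linear.has_derivative[OF bounded_linear_compose[OF bounded_linear_divide bounded_linear_vec_nth]] has_derivative_ident[THEN has_derivative_eq_rhs]) auto
    from has_derivative_compose[OF this has_field_derivative_imp_has_derivative[OF bump_deriv]]
    show ?thesis .
  qed
  show "(kernel \<epsilon> m n has_derivative (\<lambda>d. kernel_grad \<epsilon> m n u \<bullet> d)) (at u)"
    unfolding kernel_def[abs_def]
    by (rule has_derivative_eq_rhs[OF has_derivative_divide'[OF has_derivative_mult[OF c c] has_derivative_const]])
      (use assms in \<open>auto simp: kernel_grad_def kernel_def inner_vec_def sum_2 field_simps\<close>)
qed

lemma kernel_integral: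
  assumes "\<epsilon> > 0"
  shows "(\<integral>\<^sup>+u. ennreal (kernel \<epsilon> 0 0 u) \<partial>lborel) = 1"
proof -
  have [measurable]: "bump 0 \<in> borel_measurable borel" "kernel \<epsilon> 0 0 \<in> borel_measurable borel"
    by (auto intro: borel_measurable_continuous_onI bump_continuous kernel_continuous)
  have int: "integrable lborel (bump 0)"
  proof -
    have ind: "bump 0 = (\<lambda>t. indicator {-1..1} t *\<^sub>R bump 0 t)"
    proof
      fix t show "bump 0 t = indicator {-1..1} t *\<^sub>R bump 0 t" using bump_zero[of t 0] by (cases "t \<in> {-1..1}") auto
    qed
    show ?thesis by (subst ind, rule borel_integrable_compact[OF _ bump_continuous]) simp
  qed
  have one: "(\<integral>\<^sup>+t. ennreal (bump 0 t) \<partial>lborel) = 1"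
    using nn_integral_eq_integral[OF int] bump_nonneg bump_integral by simp
  have crs: "crs (\<epsilon> *\<^sub>R axis 1 1) (\<epsilon> *\<^sub>R axis 2 1) = \<epsilon> ^ 2"
    by (simp add: crs_def axis_def power2_eq_square)
  have "(\<integral>\<^sup>+u. ennreal (kernel \<epsilon> 0 0 u) \<partial>lborel) = ennreal \<bar>\<epsilon> ^ 2\<bar> *
      (\<integral>\<^sup>+t. \<integral>\<^sup>+s. ennreal (kernel \<epsilon> 0 0 (0 + s *\<^sub>R (\<epsilon> *\<^sub>R axis 1 1) + t *\<^sub>R (\<epsilon> *\<^sub>R axis 2 1))) \<partial>lborel \<partial>lborel)"
    using assms unfolding crs[symmetric] by (intro nn_integral_par(1)) (auto simp: crs)
  also have "(\<lambda>t s. ennreal (kernel \<epsilon> 0 0 (0 + s *\<^sub>R (\<epsilon> *\<^sub>R axis 1 1) + t *\<^sub>R (\<epsilon> *\<^sub>R axis 2 1))))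
      = (\<lambda>t s. ennreal (inverse (\<epsilon> ^ 2)) * (ennreal (bump 0 s) * ennreal (bump 0 t)))"
    using assms by (auto simp: fun_eq_iff kernel_def axis_def ennreal_mult'[symmetric] bump_nonneg ennreal_mult[symmetric] divide_inverse mult_ac power2_eq_square)
  also have "(\<integral>\<^sup>+t. \<integral>\<^sup>+s. ennreal (inverse (\<epsilon> ^ 2)) * (ennreal (bump 0 s) * ennreal (bump 0 t)) \<partial>lborel \<partial>lborel)
      = ennreal (inverse (\<epsilon> ^ 2))"
    by (simp add: nn_integral_cmult nn_integral_multc one)
  also have "ennreal \<bar>\<epsilon> ^ 2\<bar> * ennreal (inverse (\<epsilon> ^ 2)) = 1"
    using assms by (simp add: ennreal_mult'[symmetric])
  finally show ?thesis .
qed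

section \<open>Convolution with smooth kernels and weak derivatives\<close>

definition conv :: "(real^2 \<Rightarrow> 'a::{banach, second_countable_topology}) \<Rightarrow> (real^2 \<Rightarrow> real) \<Rightarrow> real^2 \<Rightarrow> 'a" where
  "conv k g y = (\<integral>z. g z *\<^sub>R k (y - z) \<partial>lborel)"

lemma conv_integrable:
  fixes k :: "real^2 \<Rightarrow> 'a::{banach, second_countable_topology}"
  assumes "continuous_on UNIV k" "\<And>u. norm (k u) \<le> B" "integrable lborel g"
  shows "integrable lborel (\<lambda>z. g z *\<^sub>R k (y - z))"
proof (rule Bochner_Integration.integrable_bound)
  have [measurable]: "k \<in> borel_measurable borel" "g \<in> borel_measurable borel"
    using assms by (auto intro: borel_measurable_continuous_onI)
  show "(\<lambda>z. g z *\<^sub>R k (y - z)) \<in> borel_measurable lborel" by measurable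
  show "integrable lborel (\<lambda>z. B * norm (g z))" using assms(3) by simp
  have "B \<ge> 0" using order_trans[OF norm_ge_zero assms(2)] .
  then show "AE z in lborel. norm (g z *\<^sub>R k (y - z)) \<le> norm (B * norm (g z))"
    using mult_right_mono[OF assms(2), of "\<bar>g _\<bar>"] by (auto simp: abs_mult mult.commute)
qed

lemma conv_continuous:
  fixes k :: "real^2 \<Rightarrow> 'a::{banach, second_countable_topology}"
  assumes k: "continuous_on UNIV k" and B: "\<And>u. norm (k u) \<le> B" and g: "integrable lborel g"
  shows "continuous_on UNIV (conv k g)"
proof (rule continuous_on_sequentiallyI)
  have [measurable]: "k \<in> borel_measurable borel" "g \<in> borel_measurable borel"
    using assms by (auto intro: borel_measurable_continuous_onI)
  have "B \<ge> 0" using order_trans[OF norm_ge_zero B] .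
  fix y :: "nat \<Rightarrow> real^2" and y0 assume y: "y \<longlonglongrightarrow> y0"
  show "(\<lambda>n. conv k g (y n)) \<longlonglongrightarrow> conv k g y0"
    unfolding conv_def
  proof (rule integral_dominated_convergence[where w = "\<lambda>z. B * norm (g z)"])
    show "integrable lborel (\<lambda>z. B * norm (g z))" using g by simp
    show "AE z in lborel. (\<lambda>n. g z *\<^sub>R k (y n - z)) \<longlonglongrightarrow> g z *\<^sub>R k (y0 - z)"
    proof (intro AE_I2 tendsto_intros)
      fix z
      show "(\<lambda>n. k (y n - z)) \<longlonglongrightarrow> k (y0 - z)"
        using k y by (intro continuous_on_tendsto_compose[OF k]) (auto intro!: tendsto_intros)
    qed
    show "AE z in lborel. norm (g z *\<^sub>R k (y n - z)) \<le> B * norm (g z)" for n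
      using mult_right_mono[OF B, of "\<bar>g _\<bar>"] by (auto simp: mult.commute)
  qed measurable
qed

text \<open>Differentiation under the integral: a bounded gradient makes \<open>k\<close> Lipschitz,
  so the remainders of the difference quotients are dominated by
  \<open>2 * B * \<bar>g z\<bar>\<close>.\<close>

lemma conv_gradient:
  assumes k: "gradient k K" and B: "\<And>u. \<bar>k u\<bar> \<le> B" "\<And>u. norm (K u) \<le> B" and g: "integrable lborel g"
  shows "gradient (conv k g) (conv K g)"
  unfolding gradient_def
proof (intro conjI allI)
  note [measurable] = gradient_measurable[OF k]
  have [measurable]: "g \<in> borel_measurable borel" using g by auto
  note kc = gradient_continuous[OF k, of UNIV]
  have B0: "B \<ge> 0" using order_trans[OF norm_ge_zero B(2)] .
  show "continuous_on UNIV (conv K g)" by (rule conv_continuous[OF kc(2) B(2) g])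
  have ik: "integrable lborel (\<lambda>z. g z *\<^sub>R k (y - z))" for y using B(1) by (intro conv_integrable[OF kc(1) _ g]) auto
  have iK: "integrable lborel (\<lambda>z. g z *\<^sub>R K (y - z))" for y by (rule conv_integrable[OF kc(2) B(2) g])
  have der: "(k has_derivative (\<lambda>d. K u \<bullet> d)) (at u)" for u using k by (simp add: gradient_def)
  have lip: "\<bar>k (u + h) - k u\<bar> \<le> B * norm h" for u h
  proof -
    have "norm (k (u + h) - k u) \<le> B * norm ((u + h) - u)"
    proof (rule differentiable_bound[where S = UNIV and f' = "\<lambda>u d. K u \<bullet> d"])
      fix x :: "real^2"
      have "\<bar>K x \<bullet> d\<bar> \<le> B * norm d" for d
        using Cauchy_Schwarz_ineq2[of "K x" d] mult_right_mono[OF B(2)[of x], of "norm d"] by simp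
      then show "onorm (\<lambda>d. K x \<bullet> d) \<le> B" by (intro onorm_le) simp
    qed (auto intro: der)
    then show ?thesis by simp
  qed
  fix y :: "real^2"
  show "(conv k g has_derivative (\<lambda>d. conv K g y \<bullet> d)) (at y)"
    unfolding has_derivative_at
  proof
    show "bounded_linear (\<lambda>d. conv K g y \<bullet> d)" by (rule bounded_linear_inner_right)
    show "(\<lambda>h. norm (conv k g (y + h) - conv k g y - conv K g y \<bullet> h) / norm h) \<midarrow>0\<rightarrow> 0"
      unfolding tendsto_at_iff_sequentially
    proof (intro allI impI)
      fix H :: "nat \<Rightarrow> real^2" assume H: "\<forall>i. H i \<in> UNIV - {0}" "H \<longlonglongrightarrow> 0"
      let ?q = "\<lambda>n z. (k (y + H n - z) - k (y - z) - K (y - z) \<bullet> H n) / norm (H n)"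
      have eq: "(conv k g (y + H n) - conv k g y - conv K g y \<bullet> H n) / norm (H n) = (\<integral>z. g z * ?q n z \<partial>lborel)" for n
      proof -
        have "conv K g y \<bullet> H n = (\<integral>z. (g z *\<^sub>R K (y - z)) \<bullet> H n \<partial>lborel)"
          unfolding conv_def by (rule integral_inner_left[symmetric]) (rule iK)
        then have "conv k g (y + H n) - conv k g y - conv K g y \<bullet> H n
            = (\<integral>z. g z *\<^sub>R k (y + H n - z) - g z *\<^sub>R k (y - z) - (g z *\<^sub>R K (y - z)) \<bullet> H n \<partial>lborel)"
          unfolding conv_def
          using Bochner_Integration.integral_diff[OF Bochner_Integration.integrable_diff[OF ik ik] integrable_inner_left[OF iK]]
            Bochner_Integration.integral_diff[OF ik ik] by simp
        then show ?thesis
          by (simp add: algebra_simps diff_divide_distrib flip: Bochner_Integration.integral_divide_zero)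
      qed
      have "(\<lambda>n. \<integral>z. g z * ?q n z \<partial>lborel) \<longlonglongrightarrow> (\<integral>z. 0 \<partial>(lborel :: (real^2) measure))"
      proof (rule Bochner_Integration.integral_dominated_convergence[where w = "\<lambda>z. 2 * B * norm (g z)"])
        show "integrable lborel (\<lambda>z. 2 * B * norm (g z))" using g by simp
        show "AE z in lborel. (\<lambda>n. g z * ?q n z) \<longlonglongrightarrow> 0"
        proof (intro AE_I2)
          fix z
          have "(\<lambda>h. norm (k (y - z + h) - k (y - z) - K (y - z) \<bullet> h) / norm h) \<midarrow>0\<rightarrow> 0"
            using der[of "y - z"] unfolding has_derivative_at by blast
          then have "(\<lambda>n. norm (k (y - z + H n) - k (y - z) - K (y - z) \<bullet> H n) / norm (H n)) \<longlonglongrightarrow> 0"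
            using H unfolding tendsto_at_iff_sequentially o_def by blast
          then have "(\<lambda>n. norm (?q n z)) \<longlonglongrightarrow> 0" by (simp add: algebra_simps)
          then have "(\<lambda>n. ?q n z) \<longlonglongrightarrow> 0" by (rule tendsto_norm_zero_cancel)
          from tendsto_mult[OF tendsto_const this] show "(\<lambda>n. g z * ?q n z) \<longlonglongrightarrow> 0" by simp
        qed
        show "AE z in lborel. norm (g z * ?q n z) \<le> 2 * B * norm (g z)" for n
        proof (intro AE_I2)
          fix z
          have "\<bar>k (y + H n - z) - k (y - z) - K (y - z) \<bullet> H n\<bar> \<le> \<bar>k (y + H n - z) - k (y - z)\<bar> + \<bar>K (y - z) \<bullet> H n\<bar>"
            by (rule abs_triangle_ineq4)
          also have "\<dots> \<le> B * norm (H n) + B * norm (H n)"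
            using lip[of "y - z" "H n"] Cauchy_Schwarz_ineq2[of "K (y - z)" "H n"] mult_right_mono[OF B(2)[of "y - z"], of "norm (H n)"]
            by (intro add_mono) (auto simp: algebra_simps)
          finally have "\<bar>?q n z\<bar> \<le> 2 * B" using H(1) by (simp add: divide_le_eq)
          from mult_left_mono[OF this, of "\<bar>g z\<bar>"]
          show "norm (g z * ?q n z) \<le> 2 * B * norm (g z)" by (simp add: abs_mult mult_ac)
        qed
      qed measurable
      then have "(\<lambda>n. (conv k g (y + H n) - conv k g y - conv K g y \<bullet> H n) / norm (H n)) \<longlonglongrightarrow> 0"
        unfolding eq by simp
      from tendsto_norm[OF this]
      show "((\<lambda>h. norm (conv k g (y + h) - conv k g y - conv K g y \<bullet> h) / norm h) \<circ> H) \<longlonglongrightarrow> 0"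
        by (simp add: o_def)
    qed
  qed
qed

text \<open>The test functions are kernels reflected about \<open>y\<close>, so every derivative
  brings a sign. These signs cancel against those in the definition of the weak derivative.\<close>

lemma mpartial_reflected_kernel:
  assumes "\<epsilon> > 0"
  shows has_derivative_reflected_kernel: "((\<lambda>z. r * kernel \<epsilon> m n (y - z)) has_derivative (\<lambda>d. r * (kernel_grad \<epsilon> m n (y - z) \<bullet> (- d)))) (at z)"
    and "partial 1 (\<lambda>z. r * kernel \<epsilon> m n (y - z)) = (\<lambda>z. - r * kernel \<epsilon> (Suc m) n (y - z))"
    and "partial 2 (\<lambda>z. r * kernel \<epsilon> m n (y - z)) = (\<lambda>z. - r * kernel \<epsilon> m (Suc n) (y - z))"
    and "mpartial \<beta> (\<lambda>z. kernel \<epsilon> 0 0 (y - z)) = (\<lambda>z. (-1) ^ mi_order \<beta> * kernel \<epsilon> (\<beta> $ 1) (\<beta> $ 2) (y - z))"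
proof -
  show D: "((\<lambda>z. r * kernel \<epsilon> m n (y - z)) has_derivative (\<lambda>d. r * (kernel_grad \<epsilon> m n (y - z) \<bullet> (- d)))) (at z)" for r m n z
  proof -
    have 1: "((\<lambda>z. y - z) has_derivative (\<lambda>d. - d)) (at z)" by (auto intro!: derivative_eq_intros)
    have 2: "(kernel \<epsilon> m n has_derivative (\<lambda>d. kernel_grad \<epsilon> m n (y - z) \<bullet> d)) (at (y - z))"
      using gradient_kernel[OF assms] unfolding gradient_def by blast
    show ?thesis
      using has_derivative_mult_right[OF has_derivative_compose[OF 1 2], of r] .
  qed
  show P1: "partial 1 (\<lambda>z. r * kernel \<epsilon> m n (y - z)) = (\<lambda>z. - r * kernel \<epsilon> (Suc m) n (y - z))" for r m n
    by (rule ext, subst partial_eqI[OF D]) (simp add: kernel_grad_def inner_axis)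
  show P2: "partial 2 (\<lambda>z. r * kernel \<epsilon> m n (y - z)) = (\<lambda>z. - r * kernel \<epsilon> m (Suc n) (y - z))" for r m n
    by (rule ext, subst partial_eqI[OF D]) (simp add: kernel_grad_def inner_axis)
  have 2: "(partial 2 ^^ j) (\<lambda>z. r * kernel \<epsilon> m n (y - z)) = (\<lambda>z. ((-1) ^ j * r) * kernel \<epsilon> m (n + j) (y - z))" for j r m n
  proof (induction j)
    case (Suc j)
    then show ?case by (simp only: funpow.simps o_def Suc P2) simp
  qed simp
  have 1: "(partial 1 ^^ j) (\<lambda>z. r * kernel \<epsilon> m n (y - z)) = (\<lambda>z. ((-1) ^ j * r) * kernel \<epsilon> (m + j) n (y - z))" for j r m n
  proof (induction j)
    case (Suc j)
    then show ?case by (simp only: funpow.simps o_def Suc P1) simp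
  qed simp
  show "mpartial \<beta> (\<lambda>z. kernel \<epsilon> 0 0 (y - z)) = (\<lambda>z. (-1) ^ mi_order \<beta> * kernel \<epsilon> (\<beta> $ 1) (\<beta> $ 2) (y - z))"
    unfolding mpartial_def mi_order_def
    using 1[of "\<beta> $ 1" "(-1) ^ (\<beta> $ 2)" 0 "\<beta> $ 2"] 2[of "\<beta> $ 2" 1 0 0] by (simp add: power_add)
qed

lemma norm_vec2_le: "norm (u::real^2) \<le> \<bar>u $ 1\<bar> + \<bar>u $ 2\<bar>"
  using norm_le_l1_cart[of u] by (simp add: sum_2)

lemma kernel_support:
  assumes "\<epsilon> > 0" "kernel \<epsilon> m n u \<noteq> 0"
  shows "norm u \<le> 2 * \<epsilon>"
proof -
  have "\<bar>u $ i\<bar> \<le> \<epsilon>" for i using kernel_zero[of \<epsilon> u i m n] assms by force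
  from add_mono[OF this[of 1] this[of 2]] show ?thesis using norm_vec2_le[of u] by simp
qed

lemma test_function_kernel:
  assumes "\<epsilon> > 0" "cball y (2 * \<epsilon>) \<subseteq> U"
  shows "test_function U (\<lambda>z. kernel \<epsilon> 0 0 (y - z))"
proof -
  have C: "Ck_on N UNIV (\<lambda>z. r * kernel \<epsilon> m n (y - z))" for N r m n
  proof (induction N arbitrary: r m n)
    case 0
    show ?case
      by (simp, intro continuous_intros continuous_on_compose2[OF kernel_continuous[of UNIV]]) auto
  next
    case (Suc N)
    have "Ck_on N UNIV (partial i (\<lambda>z. r * kernel \<epsilon> m n (y - z)))" for i
      using exhaust_2[of i] mpartial_reflected_kernel(2,3)[OF assms(1), of r m n y] Suc[of "- r"] by metis
    then show ?case
      unfolding Ck_on.simps differentiable_on_def differentiable_def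
      using has_derivative_reflected_kernel[OF assms(1), of r m n y] by (meson has_derivative_at_withinI)
  qed
  have sub: "closure {z. kernel \<epsilon> 0 0 (y - z) \<noteq> 0} \<subseteq> cball y (2 * \<epsilon>)"
    using kernel_support[OF assms(1)] by (intro closure_minimal) (auto simp: dist_norm)
  moreover have "compact (closure {z. kernel \<epsilon> 0 0 (y - z) \<noteq> 0})"
    using bounded_subset[OF bounded_cball sub] closure_closed by (simp add: compact_eq_bounded_closed)
  ultimately show ?thesis
    using C[of _ 1 0 0] assms(2) unfolding test_function_def by auto
qed

text \<open>The given functions are Lebesgue measurable and matter only on \<open>S\<close>, up to
  null sets. Extended by zero and made Borel, they can enter iterated integrals with respect to
  \<open>lborel\<close>.\<close>

definition borel_version :: "(real^2) set \<Rightarrow> (real^2 \<Rightarrow> real) \<Rightarrow> (real^2 \<Rightarrow> real) \<Rightarrow> bool" where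
  "borel_version S v v' \<longleftrightarrow> integrable lborel v' \<and> (\<forall>x. x \<notin> S \<longrightarrow> v' x = 0) \<and>
     (\<lambda>x. indicator S x * v x) \<in> borel_measurable lebesgue \<and> (AE x in lebesgue. indicator S x * v x = v' x)"

lemma borel_version_exists:
  assumes "v absolutely_integrable_on S" "S \<in> sets borel"
  shows "\<exists>v'. borel_version S v v'"
proof -
  have w: "integrable lebesgue (\<lambda>x. indicator S x * v x)" using assms(1) by (simp add: set_integrable_def)
  then obtain g where g: "g \<in> borel_measurable lborel" "AE x in lborel. indicator S x * v x = g x"
    using completion_ex_borel_measurable_real[OF borel_measurable_integrable[OF w]] by blast
  define v' where "v' x = indicator S x * g x" for x
  have m: "v' \<in> borel_measurable lborel" unfolding v'_def[abs_def] using g(1) assms(2) by measurable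
  have ae: "AE x in lebesgue. indicator S x * v x = v' x"
    using AE_completion[OF g(2)] by eventually_elim (auto simp: v'_def split: split_indicator)
  have "integrable lebesgue v'"
    by (rule integrable_cong_AE_imp[OF w _ ae[THEN AE_mp]]) (use m in \<open>auto intro: measurable_completion\<close>)
  then show ?thesis
    unfolding borel_version_def using ae integrable_completion[OF m] borel_measurable_integrable[OF w]
    by (intro exI[of _ v']) (auto simp: v'_def)
qed

lemma borel_version_integral:
  assumes "borel_version S v v'" and p: "p \<in> borel_measurable borel"
  shows "(LINT x:S|lebesgue. v x * p x) = (\<integral>x. v' x * p x \<partial>lborel)"
    and "(LINT x:S|lebesgue. \<bar>v x\<bar>) = (\<integral>x. \<bar>v' x\<bar> \<partial>lborel)"
proof -
  have v: "integrable lborel v'" "(\<lambda>x. indicator S x * v x) \<in> borel_measurable lebesgue"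
    "AE x in lebesgue. indicator S x * v x = v' x" using assms by (auto simp: borel_version_def)
  have v' [measurable]: "v' \<in> borel_measurable borel" using v(1) by auto
  have vl: "v' \<in> borel_measurable lebesgue" "p \<in> borel_measurable lebesgue"
    using v' p by (auto intro: measurable_completion)
  have "(LINT x:S|lebesgue. v x * p x) = (\<integral>x. (indicator S x * v x) * p x \<partial>lebesgue)"
    unfolding set_lebesgue_integral_def by (simp add: mult.assoc)
  also have "\<dots> = (\<integral>x. v' x * p x \<partial>lebesgue)"
    using v(3) by (intro integral_cong_AE borel_measurable_times v(2) vl) auto
  also have "\<dots> = (\<integral>x. v' x * p x \<partial>lborel)"
    using p by (intro integral_completion) simp
  finally show "(LINT x:S|lebesgue. v x * p x) = (\<integral>x. v' x * p x \<partial>lborel)" .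
  have "(LINT x:S|lebesgue. \<bar>v x\<bar>) = (\<integral>x. \<bar>indicator S x * v x\<bar> \<partial>lebesgue)"
    unfolding set_lebesgue_integral_def by (simp add: abs_mult)
  also have "\<dots> = (\<integral>x. \<bar>v' x\<bar> \<partial>lebesgue)"
    using v(3) by (intro integral_cong_AE borel_measurable_abs v(2) vl) auto
  also have "\<dots> = (\<integral>x. \<bar>v' x\<bar> \<partial>lborel)"
    by (intro integral_completion) simp
  finally show "(LINT x:S|lebesgue. \<bar>v x\<bar>) = (\<integral>x. \<bar>v' x\<bar> \<partial>lborel)" .
qed

text \<open>As soon as the reflected kernel is supported in the interior, the definition of the weak
  derivative moves the derivative from the kernel to \<open>g\<close>.\<close>

lemma conv_weak_derivative:
  assumes "is_weak_derivative S \<beta> g v" "borel_version S g g'" "borel_version S v v'"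
    and \<epsilon>: "\<epsilon> > 0" and y: "cball y (2 * \<epsilon>) \<subseteq> interior S"
  shows "conv (kernel \<epsilon> (\<beta> $ 1) (\<beta> $ 2)) g' y = conv (kernel \<epsilon> 0 0) v' y"
proof -
  let ?s = "(-1::real) ^ mi_order \<beta>"
  have [measurable]: "kernel \<epsilon> m n \<in> borel_measurable borel" for m n
    by (intro borel_measurable_continuous_onI kernel_continuous)
  have "(LINT x:S|lebesgue. g x * mpartial \<beta> (\<lambda>z. kernel \<epsilon> 0 0 (y - z)) x)
      = ?s * (LINT x:S|lebesgue. v x * kernel \<epsilon> 0 0 (y - x))"
    using assms(1) test_function_kernel[OF \<epsilon> y] unfolding is_weak_derivative_def by blast
  moreover have "(LINT x:S|lebesgue. g x * mpartial \<beta> (\<lambda>z. kernel \<epsilon> 0 0 (y - z)) x) = ?s * conv (kernel \<epsilon> (\<beta> $ 1) (\<beta> $ 2)) g' y"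
  proof -
    have "(LINT x:S|lebesgue. g x * mpartial \<beta> (\<lambda>z. kernel \<epsilon> 0 0 (y - z)) x)
        = (\<integral>x. g' x * (?s * kernel \<epsilon> (\<beta> $ 1) (\<beta> $ 2) (y - x)) \<partial>lborel)"
      unfolding mpartial_reflected_kernel(4)[OF \<epsilon>] by (rule borel_version_integral[OF assms(2)]) measurable
    also have "\<dots> = ?s * (\<integral>x. g' x * kernel \<epsilon> (\<beta> $ 1) (\<beta> $ 2) (y - x) \<partial>lborel)"
      by (subst Bochner_Integration.integral_mult_right_zero[symmetric]) (simp add: mult_ac)
    finally show ?thesis by (simp add: conv_def)
  qed
  moreover have "(LINT x:S|lebesgue. v x * kernel \<epsilon> 0 0 (y - x)) = conv (kernel \<epsilon> 0 0) v' y"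
    unfolding conv_def real_scaleR_def by (rule borel_version_integral[OF assms(3)]) measurable
  ultimately show ?thesis by (simp add: mult_cancel_left)
qed

section \<open>Mollification on a contracted domain\<close>

lemma nn_integral_dilate:
  fixes u :: "real^2 \<Rightarrow> ennreal"
  assumes s: "s > 0" and u [measurable]: "u \<in> borel_measurable borel"
  shows "(\<integral>\<^sup>+x. u (s *\<^sub>R x + c) \<partial>lborel) = ennreal (inverse (s ^ 2)) * (\<integral>\<^sup>+x. u x \<partial>lborel)"
proof -
  let ?I = "\<integral>\<^sup>+t. \<integral>\<^sup>+r. u (c + r *\<^sub>R (s *\<^sub>R axis 1 1) + t *\<^sub>R (s *\<^sub>R axis 2 1)) \<partial>lborel \<partial>lborel"
  have crs: "crs (s *\<^sub>R axis 1 1) (s *\<^sub>R axis 2 1) = s ^ 2" "crs (axis 1 1) (axis 2 1) = 1"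
    by (simp_all add: crs_def axis_def power2_eq_square)
  have 1: "(\<integral>\<^sup>+x. u x \<partial>lborel) = ennreal (s ^ 2) * ?I"
    using nn_integral_par(1)[OF _ u, of "s *\<^sub>R axis 1 1" "s *\<^sub>R axis 2 1" c] s by (simp add: crs)
  have m: "(\<lambda>x. u (s *\<^sub>R x + c)) \<in> borel_measurable borel" by measurable
  have 2: "(\<integral>\<^sup>+x. u (s *\<^sub>R x + c) \<partial>lborel) = ?I"
    using nn_integral_par(1)[OF _ m, of "axis 1 1" "axis 2 1" 0] by (simp add: crs algebra_simps)
  have "ennreal (inverse (s ^ 2)) * ennreal (s ^ 2) = 1" using s by (simp add: ennreal_mult'[symmetric])
  then show ?thesis unfolding 1 2 by (simp add: mult.assoc[symmetric])
qed

lemma nn_integral_dilated_kernel: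
  assumes "s > 0" "\<epsilon> > 0"
  shows "(\<integral>\<^sup>+x. ennreal (kernel \<epsilon> 0 0 (s *\<^sub>R x + c)) \<partial>lborel) = ennreal (inverse (s ^ 2))"
proof -
  have [measurable]: "kernel \<epsilon> 0 0 \<in> borel_measurable borel"
    by (intro borel_measurable_continuous_onI kernel_continuous)
  show ?thesis
    using nn_integral_dilate[OF assms(1), of "\<lambda>u. ennreal (kernel \<epsilon> 0 0 u)" c] kernel_integral[OF assms(2)] by simp
qed

text \<open>The convolution is evaluated at the image of \<open>x\<close> under a dilation with
  translation. The power of \<open>s\<close> is the factor of the chain rule, so the indices again
  count derivatives.\<close>

definition mollified :: "real \<Rightarrow> real \<Rightarrow> real^2 \<Rightarrow> (real^2 \<Rightarrow> real) \<Rightarrow> nat \<Rightarrow> nat \<Rightarrow> real^2 \<Rightarrow> real" where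
  "mollified \<epsilon> s c g m n x = s ^ (m + n) * conv (kernel \<epsilon> m n) g (s *\<^sub>R x + c)"

lemma kernel_grad_bounded: "\<epsilon> > 0 \<Longrightarrow> \<exists>B. (\<forall>u. \<bar>kernel \<epsilon> m n u\<bar> \<le> B) \<and> (\<forall>u. norm (kernel_grad \<epsilon> m n u) \<le> B)"
proof -
  obtain B0 where B0: "B0 \<ge> 0" "\<And>u. \<bar>kernel \<epsilon> m n u\<bar> \<le> B0" using kernel_bounded by blast
  obtain B1 where B1: "B1 \<ge> 0" "\<And>u. \<bar>kernel \<epsilon> (Suc m) n u\<bar> \<le> B1" using kernel_bounded by blast
  obtain B2 where B2: "B2 \<ge> 0" "\<And>u. \<bar>kernel \<epsilon> m (Suc n) u\<bar> \<le> B2" using kernel_bounded by blast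
  have "norm (kernel_grad \<epsilon> m n u) \<le> B0 + B1 + B2" for u
    using norm_vec2_le[of "kernel_grad \<epsilon> m n u"] B0(1) add_mono[OF B1(2)[of u] B2(2)[of u]] by (simp add: kernel_grad_def)
  moreover have "\<bar>kernel \<epsilon> m n u\<bar> \<le> B0 + B1 + B2" for u using B0(2)[of u] B1(1) B2(1) by simp
  ultimately show ?thesis by blast
qed

lemma gradient_mollified:
  assumes \<epsilon>: "\<epsilon> > 0" and g: "integrable lborel g"
  shows "gradient (mollified \<epsilon> s c g m n) (\<lambda>x. vector [mollified \<epsilon> s c g (Suc m) n x, mollified \<epsilon> s c g m (Suc n) x])"
    (is "gradient _ ?M")
proof -
  obtain B where B: "\<And>u. \<bar>kernel \<epsilon> m n u\<bar> \<le> B" "\<And>u. norm (kernel_grad \<epsilon> m n u) \<le> B" using kernel_grad_bounded[OF \<epsilon>] by blast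
  let ?K = "conv (kernel_grad \<epsilon> m n) g"
  have gr: "gradient (conv (kernel \<epsilon> m n) g) ?K" by (rule conv_gradient[OF gradient_kernel[OF \<epsilon>] B g])
  have int: "integrable lborel (\<lambda>z. g z *\<^sub>R kernel_grad \<epsilon> m n (y - z))" for y
    by (rule conv_integrable[OF gradient_continuous(2)[OF gradient_kernel[OF \<epsilon>]] B(2) g])
  have K: "?K y $ 1 = conv (kernel \<epsilon> (Suc m) n) g y" "?K y $ 2 = conv (kernel \<epsilon> m (Suc n)) g y" for y
    unfolding conv_def using integral_bounded_linear[OF bounded_linear_vec_nth int, symmetric]
    by (simp_all add: kernel_grad_def)
  have M: "?M = (\<lambda>x. s ^ (m + n + 1) *\<^sub>R ?K (s *\<^sub>R x + c))"
    by (auto simp: fun_eq_iff vec_eq_iff forall_2 mollified_def K)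
  show ?thesis
    unfolding gradient_def
  proof (intro conjI allI)
    show "continuous_on UNIV ?M"
      unfolding M by (intro continuous_intros continuous_on_compose2[OF gradient_continuous(2)[OF gr, of UNIV]]) auto
    fix x
    have 1: "((\<lambda>x. s *\<^sub>R x + c) has_derivative (\<lambda>d. s *\<^sub>R d)) (at x)" by (auto intro!: derivative_eq_intros)
    have 2: "(conv (kernel \<epsilon> m n) g has_derivative (\<lambda>d. ?K (s *\<^sub>R x + c) \<bullet> d)) (at (s *\<^sub>R x + c))"
      using gr unfolding gradient_def by blast
    from has_derivative_mult_right[OF has_derivative_compose[OF 1 2], of "s ^ (m + n)"]
    show "(mollified \<epsilon> s c g m n has_derivative (\<lambda>d. ?M x \<bullet> d)) (at x)"
      unfolding fun_cong[OF M] by (simp add: mult_ac mollified_def[abs_def])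
  qed
qed

text \<open>Young's inequality in \<open>L1\<close> with a kernel of mass 1;
  \<open>inverse (s ^ 2)\<close> is the Jacobian of the dilation.\<close>

lemma integral_abs_conv_kernel_le:
  assumes "compact S" "\<epsilon> > 0" and s: "s > 0" and v: "integrable lborel v"
  shows "integral S (\<lambda>x. \<bar>conv (kernel \<epsilon> 0 0) v (s *\<^sub>R x + c)\<bar>) \<le> inverse (s ^ 2) * (\<integral>z. \<bar>v z\<bar> \<partial>lborel)"
proof -
  have [measurable]: "kernel \<epsilon> 0 0 \<in> borel_measurable borel" "v \<in> borel_measurable borel"
    using v by (auto intro: borel_measurable_continuous_onI kernel_continuous)
  obtain B where B: "\<And>u. norm (kernel \<epsilon> 0 0 u) \<le> B" using kernel_bounded[of \<epsilon> 0 0] by auto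
  note cont = conv_continuous[OF kernel_continuous B v]
  have "ennreal (integral S (\<lambda>x. \<bar>conv (kernel \<epsilon> 0 0) v (s *\<^sub>R x + c)\<bar>))
      = (\<integral>\<^sup>+x\<in>S. ennreal \<bar>conv (kernel \<epsilon> 0 0) v (s *\<^sub>R x + c)\<bar> \<partial>lborel)"
    by (rule compact_nn_integral[symmetric, OF assms(1)])
      (intro continuous_on_compose2[OF cont] continuous_intros subset_UNIV)
  also have "\<dots> \<le> (\<integral>\<^sup>+x. \<integral>\<^sup>+z. ennreal \<bar>v z\<bar> * ennreal (kernel \<epsilon> 0 0 (s *\<^sub>R x + (c - z))) \<partial>lborel \<partial>lborel)"
  proof (intro nn_integral_mono)
    fix x :: "real^2"
    have "ennreal (norm (conv (kernel \<epsilon> 0 0) v (s *\<^sub>R x + c))) \<le> (\<integral>\<^sup>+z. ennreal (norm (v z *\<^sub>R kernel \<epsilon> 0 0 (s *\<^sub>R x + c - z))) \<partial>lborel)"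
      unfolding conv_def by (rule integral_norm_bound_ennreal) (rule conv_integrable[OF kernel_continuous B v])
    also have "\<dots> = (\<integral>\<^sup>+z. ennreal \<bar>v z\<bar> * ennreal (kernel \<epsilon> 0 0 (s *\<^sub>R x + (c - z))) \<partial>lborel)"
      using kernel_nonneg[OF assms(2)] by (intro nn_integral_cong) (simp add: abs_mult ennreal_mult add_diff_eq)
    finally show "ennreal \<bar>conv (kernel \<epsilon> 0 0) v (s *\<^sub>R x + c)\<bar> * indicator S x
        \<le> (\<integral>\<^sup>+z. ennreal \<bar>v z\<bar> * ennreal (kernel \<epsilon> 0 0 (s *\<^sub>R x + (c - z))) \<partial>lborel)"
      by (auto split: split_indicator)
  qed
  also have "\<dots> = (\<integral>\<^sup>+z. \<integral>\<^sup>+x. ennreal \<bar>v z\<bar> * ennreal (kernel \<epsilon> 0 0 (s *\<^sub>R x + (c - z))) \<partial>lborel \<partial>lborel)"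
    by (rule lborel_pair.Fubini') measurable
  also have "\<dots> = (\<integral>\<^sup>+z. ennreal \<bar>v z\<bar> * ennreal (inverse (s ^ 2)) \<partial>lborel)"
    by (simp add: nn_integral_cmult nn_integral_dilated_kernel[OF s assms(2)])
  also have "\<dots> = (\<integral>\<^sup>+z. ennreal \<bar>v z\<bar> \<partial>lborel) * ennreal (inverse (s ^ 2))"
    by (rule nn_integral_multc) measurable
  also have "(\<integral>\<^sup>+z. ennreal \<bar>v z\<bar> \<partial>lborel) = ennreal (\<integral>z. \<bar>v z\<bar> \<partial>lborel)"
    using v by (intro nn_integral_eq_integral) auto
  finally show ?thesis
    by (subst (asm) ennreal_mult'[symmetric]) (auto simp: mult.commute)
qed

text \<open>By Fubini the averaging moves from \<open>g\<close> to the bounded function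
  \<open>e\<close>, whose averages converge wherever \<open>e\<close> is continuous. Dominated
  convergence with a multiple of \<open>\<bar>g z\<bar>\<close> then gives the limit, without
  approximating \<open>g\<close> in norm.\<close>

lemma mollified_tendsto:
  assumes g: "integrable lborel g" and e [measurable]: "e \<in> borel_measurable borel" and M: "\<And>x. \<bar>e x\<bar> \<le> M"
    and cont: "AE z in lborel. g z = 0 \<or> isCont e z"
    and s: "\<And>n. 1/2 \<le> s n" "s \<longlonglongrightarrow> 1" and \<epsilon>: "\<And>n. \<epsilon> n > 0" "\<epsilon> \<longlonglongrightarrow> 0"
  shows "(\<lambda>n. \<integral>x. mollified (\<epsilon> n) (s n) ((1 - s n) *\<^sub>R c) g 0 0 x * e x \<partial>lborel) \<longlonglongrightarrow> (\<integral>z. g z * e z \<partial>lborel)"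
proof -
  have [measurable]: "kernel \<epsilon> 0 0 \<in> borel_measurable borel" "g \<in> borel_measurable borel" for \<epsilon>
    using g by (auto intro: borel_measurable_continuous_onI kernel_continuous)
  have s0: "s n > 0" for n using s(1)[of n] by simp
  \<comment> \<open>Since \<open>s n \<ge> 1/2\<close>, the Jacobian of the inverse dilation is at
    most 4.\<close>
  have s4: "inverse (s n ^ 2) \<le> 4" for n
    using power_mono[OF s(1)[of n], of 2] s0[of n] by (simp add: power2_eq_square field_simps)
  have M0: "M \<ge> 0" using M order_trans abs_ge_zero by blast
  define \<kappa> where "\<kappa> n z x = kernel (\<epsilon> n) 0 0 (s n *\<^sub>R x + ((1 - s n) *\<^sub>R c - z))" for n and z x :: "real^2"
  have [measurable]: "\<kappa> n z \<in> borel_measurable borel" for n z unfolding \<kappa>_def by measurable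
  have \<kappa>0: "\<kappa> n z x \<ge> 0" for n z x unfolding \<kappa>_def by (rule kernel_nonneg[OF \<epsilon>(1)])
  have \<kappa>n: "(\<integral>\<^sup>+x. ennreal (\<kappa> n z x) \<partial>lborel) = ennreal (inverse (s n ^ 2))" for n z
    unfolding \<kappa>_def by (rule nn_integral_dilated_kernel[OF s0 \<epsilon>(1)])
  have \<kappa>i: "integrable lborel (\<kappa> n z)" "(\<integral>x. \<kappa> n z x \<partial>lborel) = inverse (s n ^ 2)" for n z
    using \<kappa>n[of n z] \<kappa>0 s0[of n] nn_integral_eq_integrable[of "\<kappa> n z" lborel "inverse (s n ^ 2)"] by auto
  have \<kappa>e: "integrable lborel (\<lambda>x. \<kappa> n z x * e x)" for n z
    using M M0 \<kappa>0[of n z] by (intro Bochner_Integration.integrable_bound[OF Bochner_Integration.integrable_mult_right[OF \<kappa>i(1)[of n z], of M]])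
      (auto simp: abs_mult mult.commute[of M] intro!: mult_left_mono)
  have abs_le: "\<bar>\<integral>x. \<kappa> n z x * p x \<partial>lborel\<bar> \<le> P * inverse (s n ^ 2)"
    if "P \<ge> 0" "\<And>x. \<kappa> n z x \<noteq> 0 \<Longrightarrow> \<bar>p x\<bar> \<le> P" for n z p P
  proof (cases "integrable lborel (\<lambda>x. \<kappa> n z x * p x)")
    case True
    have "norm (\<integral>x. \<kappa> n z x * p x \<partial>lborel) \<le> (\<integral>x. P * \<kappa> n z x \<partial>lborel)"
    proof (rule Bochner_Integration.integral_norm_bound_integral)
      fix x show "norm (\<kappa> n z x * p x) \<le> P * \<kappa> n z x"
        using that(2)[of x] \<kappa>0[of n z x] by (cases "\<kappa> n z x = 0") (auto simp: abs_mult mult.commute)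
    qed (use \<kappa>i True in auto)
    then show ?thesis by (simp add: \<kappa>i(2))
  next
    case False
    then show ?thesis using \<open>P \<ge> 0\<close> by (simp add: not_integrable_integral_eq)
  qed
  define q where "q n z = (\<integral>x. \<kappa> n z x * e x \<partial>lborel)" for n z
  have swap: "(\<integral>x. mollified (\<epsilon> n) (s n) ((1 - s n) *\<^sub>R c) g 0 0 x * e x \<partial>lborel) = (\<integral>z. g z * q n z \<partial>lborel)" for n
  proof -
    have int: "integrable (lborel \<Otimes>\<^sub>M lborel) (\<lambda>(z, x). g z * (\<kappa> n z x * e x))"
    proof (rule lborel_pair.Fubini_integrable)
      show "(\<lambda>(z, x). g z * (\<kappa> n z x * e x)) \<in> borel_measurable (lborel \<Otimes>\<^sub>M lborel)"
        unfolding \<kappa>_def by measurable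
      show "AE z in lborel. integrable lborel (\<lambda>x. (case (z, x) of (z, x) \<Rightarrow> g z * (\<kappa> n z x * e x)))"
        using \<kappa>e by simp
      have b: "(\<integral>x. \<bar>g z * (\<kappa> n z x * e x)\<bar> \<partial>lborel) = \<bar>g z\<bar> * (\<integral>x. \<kappa> n z x * \<bar>e x\<bar> \<partial>lborel)" for z
        using \<kappa>0 by (simp add: abs_mult)
      have m: "(\<lambda>z. \<integral>x. \<kappa> n z x * \<bar>e x\<bar> \<partial>lborel) \<in> borel_measurable lborel" unfolding \<kappa>_def by measurable
      have "integrable lborel (\<lambda>z. \<bar>g z\<bar> * (\<integral>x. \<kappa> n z x * \<bar>e x\<bar> \<partial>lborel))"
        using abs_le[OF M0, of n _ "\<lambda>x. \<bar>e x\<bar>"] M m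
        by (intro Bochner_Integration.integrable_bound[OF Bochner_Integration.integrable_mult_left[OF integrable_abs[OF g], of "M * inverse (s n ^ 2)"]])
          (auto simp: abs_mult M0 intro!: AE_I2 mult_left_mono)
      then show "integrable lborel (\<lambda>z. \<integral>x. norm (case (z, x) of (z, x) \<Rightarrow> g z * (\<kappa> n z x * e x)) \<partial>lborel)"
        by (simp add: b)
    qed
    have "(\<integral>x. mollified (\<epsilon> n) (s n) ((1 - s n) *\<^sub>R c) g 0 0 x * e x \<partial>lborel)
        = (\<integral>x. \<integral>z. g z * (\<kappa> n z x * e x) \<partial>lborel \<partial>lborel)"
      by (simp add: mollified_def conv_def \<kappa>_def add_diff_eq mult.assoc flip: Bochner_Integration.integral_mult_left_zero)
    also have "\<dots> = (\<integral>z. \<integral>x. g z * (\<kappa> n z x * e x) \<partial>lborel \<partial>lborel)"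
      by (rule lborel_pair.Fubini_integral[OF int])
    also have "\<dots> = (\<integral>z. g z * q n z \<partial>lborel)" by (simp add: q_def)
    finally show ?thesis .
  qed
  have lim: "(\<lambda>n. q n z) \<longlonglongrightarrow> e z" if "isCont e z" for z
  proof -
    have inv_s: "(\<lambda>n. inverse (s n ^ 2)) \<longlonglongrightarrow> inverse (1 ^ 2)" by (intro tendsto_intros s) simp
    have "(\<lambda>n. q n z - e z * inverse (s n ^ 2)) \<longlonglongrightarrow> 0"
      unfolding LIMSEQ_def
    proof (intro allI impI)
      fix r :: real assume r: "r > 0"
      \<comment> \<open>The tolerance \<open>r / 8\<close> leaves \<open>r / 2\<close> after
        multiplication by the Jacobian bound 4.\<close>
      then obtain \<delta> where \<delta>: "\<delta> > 0" "\<And>x. dist x z < \<delta> \<Longrightarrow> dist (e x) (e z) < r / 8"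
        using \<open>isCont e z\<close> unfolding continuous_at_eps_delta by (metis divide_pos_pos zero_less_numeral)
      have "(\<lambda>n. 2 * (2 * \<epsilon> n + \<bar>1 - s n\<bar> * norm (c - z))) \<longlonglongrightarrow> 2 * (2 * 0 + \<bar>1 - 1\<bar> * norm (c - z))"
        by (intro tendsto_intros s \<epsilon>)
      then have "\<forall>\<^sub>F n in sequentially. 2 * (2 * \<epsilon> n + \<bar>1 - s n\<bar> * norm (c - z)) < \<delta>"
        using \<delta>(1) by (intro order_tendstoD(2)) auto
      then obtain N where N: "\<And>n. n \<ge> N \<Longrightarrow> 2 * (2 * \<epsilon> n + \<bar>1 - s n\<bar> * norm (c - z)) < \<delta>"
        by (auto simp: eventually_sequentially)
      have "\<bar>q n z - e z * inverse (s n ^ 2)\<bar> < r" if n: "n \<ge> N" for n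
      proof -
        have "q n z - e z * inverse (s n ^ 2) = (\<integral>x. \<kappa> n z x * e x - \<kappa> n z x * e z \<partial>lborel)"
          using Bochner_Integration.integral_diff[OF \<kappa>e Bochner_Integration.integrable_mult_left[OF \<kappa>i(1)], of n z n z "e z"] unfolding q_def by (simp add: \<kappa>i(2) mult.commute)
        also have "\<bar>\<dots>\<bar> \<le> r / 8 * inverse (s n ^ 2)"
          unfolding right_diff_distrib[symmetric]
        proof (rule abs_le)
          show "0 \<le> r / 8" using r by simp
          fix x assume "\<kappa> n z x \<noteq> 0"
          then have k: "norm (s n *\<^sub>R x + ((1 - s n) *\<^sub>R c - z)) \<le> 2 * \<epsilon> n"
            unfolding \<kappa>_def by (rule kernel_support[OF \<epsilon>(1)])
          have "s n *\<^sub>R (x - z) = (s n *\<^sub>R x + ((1 - s n) *\<^sub>R c - z)) - (1 - s n) *\<^sub>R (c - z)"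
            by (simp add: algebra_simps)
          then have "s n * norm (x - z) \<le> norm (s n *\<^sub>R x + ((1 - s n) *\<^sub>R c - z)) + norm ((1 - s n) *\<^sub>R (c - z))"
            using norm_triangle_ineq4 s0[of n] by (metis abs_of_pos norm_scaleR)
          \<comment> \<open>Solving for \<open>x - z\<close> divides by
            \<open>s n \<ge> 1/2\<close>, which explains the outer factor 2 in the choice of
            \<open>N\<close>.\<close>
          moreover have "1/2 * norm (x - z) \<le> s n * norm (x - z)" by (intro mult_right_mono s(1)) simp
          ultimately have "norm (x - z) < \<delta>" using k N[OF n] by simp
          then show "\<bar>e x - e z\<bar> \<le> r / 8" using \<delta>(2)[of x] by (simp add: dist_norm)
        qed
        also have "\<dots> \<le> r / 8 * 4" using r s4 by (intro mult_left_mono) auto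
        also have "\<dots> < r" using r by simp
        finally show ?thesis .
      qed
      then show "\<exists>N. \<forall>n\<ge>N. dist (q n z - e z * inverse (s n ^ 2)) 0 < r" by (auto simp: dist_real_def)
    qed
    from tendsto_add[OF this tendsto_mult[OF tendsto_const[of "e z"] inv_s]] show ?thesis by simp
  qed
  show ?thesis
    unfolding swap
  proof (rule Bochner_Integration.integral_dominated_convergence[where w = "\<lambda>z. \<bar>g z\<bar> * (M * 4)"])
    show "integrable lborel (\<lambda>z. \<bar>g z\<bar> * (M * 4))" using g by simp
    show "AE z in lborel. (\<lambda>n. g z * q n z) \<longlonglongrightarrow> g z * e z"
      using cont
    proof eventually_elim
      case (elim z)
      then show ?case by (cases "g z = 0") (auto intro!: tendsto_mult lim)
    qed
    show "AE z in lborel. norm (g z * q n z) \<le> \<bar>g z\<bar> * (M * 4)" for n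
    proof (intro AE_I2)
      fix z
      have "\<bar>q n z\<bar> \<le> M * inverse (s n ^ 2)" unfolding q_def by (rule abs_le[OF M0 M])
      also have "\<dots> \<le> M * 4" by (intro mult_left_mono s4 M0)
      finally show "norm (g z * q n z) \<le> \<bar>g z\<bar> * (M * 4)" by (simp add: abs_mult mult_left_mono)
    qed
  qed (unfold q_def \<kappa>_def, measurable)
qed

text \<open>
  The domain is contracted towards the interior point \<open>c\<close> before convolving, so that the kernels centred at points of
  \<open>S\<close> are test functions on the interior of \<open>S\<close>; nothing is needed about traces or extensions of \<open>g\<close>.
\<close>

lemma mollification:
  assumes S: "compact S" "convex S" "interior S \<noteq> {}" and g: "sobolev_W1 l S g"
    and e: "e \<in> borel_measurable borel" and M: "\<And>x. \<bar>e x\<bar> \<le> M" and ae: "AE z in lborel. z \<in> S \<longrightarrow> isCont e z"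
  shows "\<exists>w :: nat \<Rightarrow> nat \<Rightarrow> nat \<Rightarrow> real^2 \<Rightarrow> real.
    (\<forall>n i j. gradient (w n i j) (\<lambda>x. vector [w n (Suc i) j x, w n i (Suc j) x])) \<and>
    (\<forall>n i j. i + j \<le> l \<longrightarrow> integral S (\<lambda>x. \<bar>w n i j x\<bar>) \<le> 4 * sobolev_W1_norm l S g) \<and>
    (\<lambda>n. \<integral>x. w n 0 0 x * e x \<partial>lborel) \<longlonglongrightarrow> (LINT x:S|lebesgue. g x * e x)"
proof -
  have Sb: "S \<in> sets borel" using S(1) by (simp add: compact_imp_closed)
  have "g absolutely_integrable_on S" using g by (simp add: sobolev_W1_def)
  then obtain g' where g': "borel_version S g g'" using borel_version_exists[OF _ Sb] by blast
  have gi: "integrable lborel g'" and g0: "\<And>x. x \<notin> S \<Longrightarrow> g' x = 0" using g' by (auto simp: borel_version_def)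
  obtain c where c: "c \<in> interior S" using S(3) by blast
  \<comment> \<open>Contraction factors that tend to 1; starting the sequence at 1/2 keeps the
    Jacobian bounded by 4.\<close>
  define s where "s n = 1 - inverse (real (Suc (Suc n)))" for n
  have s: "1/2 \<le> s n" "s n < 1" for n by (auto simp: s_def field_simps)
  have slim: "s \<longlonglongrightarrow> 1" unfolding s_def[abs_def] using tendsto_diff[OF tendsto_const LIMSEQ_Suc[OF LIMSEQ_inverse_real_of_nat], of 1] by simp
  have "\<exists>\<epsilon>>0. \<epsilon> \<le> inverse (real (Suc n)) \<and> (\<forall>x\<in>S. cball (s n *\<^sub>R x + (1 - s n) *\<^sub>R c) (2 * \<epsilon>) \<subseteq> interior S)" for n
  proof -
    let ?A = "(\<lambda>x. s n *\<^sub>R x + (1 - s n) *\<^sub>R c) ` S"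
    \<comment> \<open>Contraction towards an interior point maps the compact set \<open>S\<close>
      into its interior, so one radius serves all its points.\<close>
    have "s n *\<^sub>R x + (1 - s n) *\<^sub>R c \<in> interior S" if "x \<in> S" for x
      using mem_interior_convex_shrink[OF S(2) c that, of "1 - s n"] s[of n] by (simp add: algebra_simps)
    then have "?A \<subseteq> interior S" by blast
    moreover have "compact ?A" by (intro compact_continuous_image S(1) continuous_intros)
    ultimately obtain r where r: "r > 0" "(\<Union>x\<in>?A. cball x r) \<subseteq> interior S"
      using compact_subset_open_imp_cball_epsilon_subset[of ?A "interior S"] by auto
    let ?e = "min (r / 2) (inverse (real (Suc n)))"
    have "cball (s n *\<^sub>R x + (1 - s n) *\<^sub>R c) (2 * ?e) \<subseteq> interior S" if "x \<in> S" for x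
      using r(2) that by (intro order_trans[OF subset_cball[of "2 * ?e" r]]) auto
    then show ?thesis using r(1) by (intro exI[of _ ?e]) auto
  qed
  then obtain \<epsilon> where \<epsilon>: "\<And>n. \<epsilon> n > 0" "\<And>n. \<epsilon> n \<le> inverse (real (Suc n))"
    "\<And>n x. x \<in> S \<Longrightarrow> cball (s n *\<^sub>R x + (1 - s n) *\<^sub>R c) (2 * \<epsilon> n) \<subseteq> interior S" by metis
  have \<epsilon>lim: "\<epsilon> \<longlonglongrightarrow> 0"
  proof (rule tendsto_sandwich[of "\<lambda>_. 0" _ _ "\<lambda>n. inverse (real (Suc n))"])
    show "(\<lambda>n. inverse (real (Suc n))) \<longlonglongrightarrow> 0" by (rule LIMSEQ_inverse_real_of_nat)
  qed (use \<epsilon>(1,2) in \<open>auto intro!: always_eventually less_imp_le\<close>)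
  define w where "w n i j = mollified (\<epsilon> n) (s n) ((1 - s n) *\<^sub>R c) g' i j" for n i j
  have "gradient (w n i j) (\<lambda>x. vector [w n (Suc i) j x, w n i (Suc j) x])" for n i j
    unfolding w_def by (rule gradient_mollified[OF \<epsilon>(1) gi])
  moreover have "integral S (\<lambda>x. \<bar>w n i j x\<bar>) \<le> 4 * sobolev_W1_norm l S g" if ij: "i + j \<le> l" for n i j
  proof -
    define \<beta> :: "nat^2" where "\<beta> = vector [i, j]"
    have \<beta>: "\<beta> $ 1 = i" "\<beta> $ 2 = j" "mi_order \<beta> = i + j" by (simp_all add: \<beta>_def mi_order_def)
    let ?v = "weak_derivative S \<beta> g"
    have v: "is_weak_derivative S \<beta> g ?v"
      unfolding weak_derivative_def by (rule someI_ex[of "is_weak_derivative S \<beta> g"]) (use g ij \<beta>(3) in \<open>simp add: sobolev_W1_def\<close>)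
    then obtain v' where v': "borel_version S ?v v'"
      using borel_version_exists[OF _ Sb] unfolding is_weak_derivative_def by blast
    then have vi: "integrable lborel v'" by (simp add: borel_version_def)
    obtain B where B: "\<And>u. norm (kernel (\<epsilon> n) 0 0 u) \<le> B" using kernel_bounded[of "\<epsilon> n" 0 0] by auto
    \<comment> \<open>On \<open>S\<close> the derivative of the mollified function is the mollified
      weak derivative, up to the factor \<open>s n ^ (i + j) \<le> 1\<close>.\<close>
    have "integral S (\<lambda>x. \<bar>w n i j x\<bar>) = s n ^ (i + j) * integral S (\<lambda>x. \<bar>conv (kernel (\<epsilon> n) 0 0) v' (s n *\<^sub>R x + (1 - s n) *\<^sub>R c)\<bar>)"
    proof (subst Henstock_Kurzweil_Integration.integral_mult_right[symmetric], rule Henstock_Kurzweil_Integration.integral_cong)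
      fix x assume x: "x \<in> S"
      show "\<bar>w n i j x\<bar> = s n ^ (i + j) * \<bar>conv (kernel (\<epsilon> n) 0 0) v' (s n *\<^sub>R x + (1 - s n) *\<^sub>R c)\<bar>"
        using conv_weak_derivative[OF v g' v' \<epsilon>(1) \<epsilon>(3)[OF x]] s(1)[of n]
        by (simp add: w_def mollified_def abs_mult \<beta>(1,2))
    qed
    also have "\<dots> \<le> 1 * (4 * (\<integral>z. \<bar>v' z\<bar> \<partial>lborel))"
    proof (intro mult_mono integral_abs_nonneg)
      have s0: "s n > 0" using s(1)[of n] by simp
      have s4: "inverse (s n ^ 2) \<le> 4"
        using power_mono[OF s(1)[of n], of 2] s0 by (simp add: power2_eq_square field_simps)
      show "s n ^ (i + j) \<le> 1" using s[of n] by (intro power_le_one) auto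
      have "integral S (\<lambda>x. \<bar>conv (kernel (\<epsilon> n) 0 0) v' (s n *\<^sub>R x + (1 - s n) *\<^sub>R c)\<bar>) \<le> inverse (s n ^ 2) * (\<integral>z. \<bar>v' z\<bar> \<partial>lborel)"
        by (rule integral_abs_conv_kernel_le[OF S(1) \<epsilon>(1) s0 vi])
      also have "\<dots> \<le> 4 * (\<integral>z. \<bar>v' z\<bar> \<partial>lborel)"
        by (intro mult_right_mono s4) simp
      finally show "integral S (\<lambda>x. \<bar>conv (kernel (\<epsilon> n) 0 0) v' (s n *\<^sub>R x + (1 - s n) *\<^sub>R c)\<bar>) \<le> 4 * (\<integral>z. \<bar>v' z\<bar> \<partial>lborel)" .
    qed simp
    also have "(\<integral>z. \<bar>v' z\<bar> \<partial>lborel) = (LINT x:S|lebesgue. \<bar>?v x\<bar>)"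
      by (rule borel_version_integral(2)[OF v' borel_measurable_const[of 0], symmetric])
    also have "\<dots> \<le> sobolev_W1_norm l S g"
      unfolding sobolev_W1_norm_def using ij \<beta>(3)
      by (intro member_le_sum finite_mi_order_le) (auto simp: set_lebesgue_integral_def)
    finally show ?thesis by simp
  qed
  moreover have "(\<lambda>n. \<integral>x. w n 0 0 x * e x \<partial>lborel) \<longlonglongrightarrow> (LINT x:S|lebesgue. g x * e x)"
  proof -
    have "AE z in lborel. g' z = 0 \<or> isCont e z" using ae by eventually_elim (use g0 in blast)
    from mollified_tendsto[OF gi e M this s(1) slim \<epsilon>(1) \<epsilon>lim]
    show ?thesis unfolding w_def borel_version_integral(1)[OF g' e] .
  qed
  ultimately show ?thesis by (intro exI[of _ w]) blast
qed

lemma sobolev_W1_norm_nonneg: "sobolev_W1_norm l S u \<ge> 0"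
  unfolding sobolev_W1_norm_def by (intro sum_nonneg) (simp add: set_lebesgue_integral_def)

text \<open>A bound for smooth weights passes to the limit. The factors count integrals:
  \<open>W1_sum\<close> has three, each at most 4 times the Sobolev norm, which gives 12, and
  \<open>W2_sum\<close> consists of three such sums.\<close>

lemma sobolev_estimate:
  assumes S: "compact S" "convex S" "interior S \<noteq> {}"
    and e: "e \<in> borel_measurable borel" "\<And>x. \<bar>e x\<bar> \<le> M" "AE z in lborel. z \<in> S \<longrightarrow> isCont e z" "\<And>x. x \<notin> S \<Longrightarrow> e x = 0"
    and "C \<ge> 0"
  shows "(\<And>w W. gradient w W \<Longrightarrow> \<bar>LINT x:S|lborel. w x * e x\<bar> \<le> C * W1_sum S w W) \<Longrightarrow>
      sobolev_W1 1 S g \<Longrightarrow> \<bar>LINT x:S|lebesgue. g x * e x\<bar> \<le> 12 * C * sobolev_W1_norm 1 S g"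
    and "(\<And>w W H1 H2. gradient w W \<Longrightarrow> gradient (\<lambda>x. W x $ 1) H1 \<Longrightarrow> gradient (\<lambda>x. W x $ 2) H2 \<Longrightarrow>
        \<bar>LINT x:S|lborel. w x * e x\<bar> \<le> C * W2_sum S w W H1 H2) \<Longrightarrow>
      sobolev_W1 2 S g \<Longrightarrow> \<bar>LINT x:S|lebesgue. g x * e x\<bar> \<le> 36 * C * sobolev_W1_norm 2 S g"
proof -
  have lint: "(LINT x:S|lborel. w x * e x) = (\<integral>x. w x * e x \<partial>lborel)" for w
    unfolding set_lebesgue_integral_def using e(4)
    by (intro Bochner_Integration.integral_cong) (auto split: split_indicator)
  have le: "\<bar>LINT x:S|lebesgue. g x * e x\<bar> \<le> K"
    if lim: "(\<lambda>n. \<integral>x. w n x * e x \<partial>lborel) \<longlonglongrightarrow> (LINT x:S|lebesgue. g x * e x)"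
      and b: "\<And>n. \<bar>LINT x:S|lborel. w n x * e x\<bar> \<le> K" for w :: "nat \<Rightarrow> real^2 \<Rightarrow> real" and K
    using b by (intro LIMSEQ_le_const2[OF tendsto_rabs[OF lim]]) (auto simp: lint)
  {
    assume est: "\<And>w W. gradient w W \<Longrightarrow> \<bar>LINT x:S|lborel. w x * e x\<bar> \<le> C * W1_sum S w W" and g: "sobolev_W1 1 S g"
    from mollification[OF S g e(1-3)] obtain w where
      gr': "\<forall>n i j. gradient (w n i j) (\<lambda>x. vector [w n (Suc i) j x, w n i (Suc j) x])"
      and N': "\<forall>n i j. i + j \<le> 1 \<longrightarrow> integral S (\<lambda>x. \<bar>w n i j x\<bar>) \<le> 4 * sobolev_W1_norm 1 S g"
      and lim: "(\<lambda>n. \<integral>x. w n 0 0 x * e x \<partial>lborel) \<longlonglongrightarrow> (LINT x:S|lebesgue. g x * e x)"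
      by (elim exE conjE) (rule that)
    note gr = gr'[rule_format] and N = N'[rule_format]
    have "W1_sum S (w n 0 0) (\<lambda>x. vector [w n (Suc 0) 0 x, w n 0 (Suc 0) x]) \<le> 12 * sobolev_W1_norm 1 S g" for n
      using N[of 0 0 n] N[of "Suc 0" 0 n] N[of 0 "Suc 0" n] unfolding W1_sum_def by simp
    then have "\<bar>LINT x:S|lborel. w n 0 0 x * e x\<bar> \<le> C * (12 * sobolev_W1_norm 1 S g)" for n
      using est[OF gr] mult_left_mono[OF _ \<open>C \<ge> 0\<close>] order_trans by blast
    then show "\<bar>LINT x:S|lebesgue. g x * e x\<bar> \<le> 12 * C * sobolev_W1_norm 1 S g"
      by (intro le[where w = "\<lambda>n. w n 0 0", OF lim]) (simp add: mult_ac)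
  }
  {
    assume est: "\<And>w W H1 H2. gradient w W \<Longrightarrow> gradient (\<lambda>x. W x $ 1) H1 \<Longrightarrow> gradient (\<lambda>x. W x $ 2) H2 \<Longrightarrow>
        \<bar>LINT x:S|lborel. w x * e x\<bar> \<le> C * W2_sum S w W H1 H2" and g: "sobolev_W1 2 S g"
    from mollification[OF S g e(1-3)] obtain w where
      gr': "\<forall>n i j. gradient (w n i j) (\<lambda>x. vector [w n (Suc i) j x, w n i (Suc j) x])"
      and N': "\<forall>n i j. i + j \<le> 2 \<longrightarrow> integral S (\<lambda>x. \<bar>w n i j x\<bar>) \<le> 4 * sobolev_W1_norm 2 S g"
      and lim: "(\<lambda>n. \<integral>x. w n 0 0 x * e x \<partial>lborel) \<longlonglongrightarrow> (LINT x:S|lebesgue. g x * e x)"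
      by (elim exE conjE) (rule that)
    note gr = gr'[rule_format] and N = N'[rule_format]
    define W where "W n i j = (\<lambda>x. vector [w n (Suc i) j x, w n i (Suc j) x] :: real^2)" for n i j
    have W: "gradient (w n i j) (W n i j)" "(\<lambda>x. W n i j x $ 1) = w n (Suc i) j" "(\<lambda>x. W n i j x $ 2) = w n i (Suc j)" for n i j
      using gr by (simp_all add: W_def)
    have "W1_sum S (w n i j) (W n i j) \<le> 12 * sobolev_W1_norm 2 S g" if "i + j \<le> 1" for n i j
      using N[of i j n] N[of "Suc i" j n] N[of i "Suc j" n] that unfolding W1_sum_def by (simp add: W_def)
    from this[of 0 0] this[of "Suc 0" 0] this[of 0 "Suc 0"]
    have "W2_sum S (w n 0 0) (W n 0 0) (W n (Suc 0) 0) (W n 0 (Suc 0)) \<le> 36 * sobolev_W1_norm 2 S g" for n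
      unfolding W2_sum_def W(2,3) by (smt (verit) add_0 add_0_right One_nat_def order_refl zero_le)
    then have "\<bar>LINT x:S|lborel. w n 0 0 x * e x\<bar> \<le> C * (36 * sobolev_W1_norm 2 S g)" for n
      using est[OF W(1), of n 0 0 "W n (Suc 0) 0" "W n 0 (Suc 0)", unfolded W(2,3), OF W(1) W(1)]
        mult_left_mono[OF _ \<open>C \<ge> 0\<close>] order_trans by blast
    then show "\<bar>LINT x:S|lebesgue. g x * e x\<bar> \<le> 36 * C * sobolev_W1_norm 2 S g"
      by (intro le[where w = "\<lambda>n. w n 0 0", OF lim]) (simp add: mult_ac)
  }
qed

section \<open>The superconvergence estimate\<close>

lemma Ck_norm_nonneg:
  assumes "Ck_closed n S u" "compact S" "interior S \<noteq> {}" "m \<le> n"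
  shows "Ck_norm m S u \<ge> 0"
proof -
  obtain x where "x \<in> interior S" using assms(3) by blast
  then have "\<bar>mpartial 0 u x\<bar> \<le> Ck_norm m S u"
    using assms by (intro abs_mpartial_le_Ck_norm[of n]) (auto simp: mi_order_def)
  then show ?thesis by linarith
qed

lemma Ck_norm_mono: "m \<le> n \<Longrightarrow> Ck_norm m S u \<le> Ck_norm n S u"
  unfolding Ck_norm_def
proof (intro Max_mono image_mono)
  have "0 \<in> {\<beta>. mi_order \<beta> \<le> m}" by (simp add: mi_order_def)
  then show "(\<lambda>\<beta>. SUP x\<in>interior S. \<bar>mpartial \<beta> u x\<bar>) ` {\<beta>. mi_order \<beta> \<le> m} \<noteq> {}" by blast
qed (auto simp: finite_mi_order_le)

lemma mi_order_1_cases: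
  assumes "mi_order \<beta> = 1"
  obtains i where "mpartial \<beta> = partial i"
proof (cases "\<beta> $ 1 = 1")
  case True
  then show ?thesis using assms that[of 1] by (auto simp: mi_order_def mpartial_def fun_eq_iff)
next
  case False
  then have "\<beta> $ 1 = 0" "\<beta> $ 2 = 1" using assms by (auto simp: mi_order_def)
  then show ?thesis using that[of 2] by (auto simp: mpartial_def fun_eq_iff)
qed

lemma sobolev_W1_mono: "l \<le> l' \<Longrightarrow> sobolev_W1 l' S g \<Longrightarrow> sobolev_W1 l S g"
  by (auto simp: sobolev_W1_def)

context fe_mesh
begin

lemma skeleton_null: "\<Omega> - skeleton_free \<in> null_sets lborel"
proof -
  obtain S where S: "finite S" "\<Omega> - skeleton_free \<subseteq> (\<Union>(p, q)\<in>S. closed_segment p q)"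
    by (rule skeleton_segments)
  have "negligible (closed_segment p q)" for p q :: "real^2"
    by (simp add: negligible_convex_interior interior_closed_segment_ge2)
  then have "negligible (\<Omega> - skeleton_free)"
    by (intro negligible_subset[OF _ S(2)] negligible_Union) (auto simp: S(1))
  moreover have "\<Omega> - skeleton_free \<in> sets lborel"
    using compact_domain open_skeleton_free by (simp add: compact_imp_closed)
  ultimately show ?thesis
    by (simp add: negligible_iff_null_sets null_sets_completion_iff)
qed

lemma err_grad_measurable: "(\<lambda>x. err_grad x \<bullet> d) \<in> borel_measurable borel"
proof -
  have "(\<lambda>x. err_grad x \<bullet> d) = (\<lambda>x. indicator skeleton_free x * (err_grad x \<bullet> d))"
    by (auto simp: fun_eq_iff err_grad_def split: split_indicator)
  moreover have "(\<lambda>x. indicator skeleton_free x * (err_grad x \<bullet> d)) \<in> borel_measurable borel"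
    using open_skeleton_free by (intro measurable_indicator_mult continuous_intros continuous_on_err_grad) auto
  ultimately show ?thesis by simp
qed

lemma err_grad_inner_bounded: "\<exists>M. \<forall>x. \<bar>err_grad x \<bullet> d\<bar> \<le> M"
proof -
  obtain K where "\<And>x. norm (err_grad x) \<le> K" using err_grad_bounded by blast
  then have "\<bar>err_grad x \<bullet> d\<bar> \<le> K * norm d" for x
    using Cauchy_Schwarz_ineq2[of "err_grad x" d] mult_right_mono[of "norm (err_grad x)" K "norm d"] by force
  then show ?thesis by blast
qed

lemma AE_isCont_err_grad: "AE z in lborel. z \<in> \<Omega> \<longrightarrow> isCont (\<lambda>x. err_grad x \<bullet> d) z"
  using AE_not_in[OF skeleton_null]
proof eventually_elim
  case (elim z)
  have "continuous_on skeleton_free (\<lambda>x. err_grad x \<bullet> d)" by (intro continuous_intros continuous_on_err_grad)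
  then show ?case using elim open_skeleton_free by (auto simp: continuous_on_eq_continuous_at)
qed

lemma set_integrable_err_grad:
  assumes "continuous_on UNIV w"
  shows "set_integrable lborel \<Omega> (\<lambda>x. w x * (err_grad x \<bullet> d))"
proof -
  obtain M where M: "\<And>x. \<bar>err_grad x \<bullet> d\<bar> \<le> M" using err_grad_inner_bounded by blast
  have "bounded (w ` \<Omega>)"
    using compact_domain assms by (intro compact_imp_bounded compact_continuous_image) (auto intro: continuous_on_subset)
  then obtain B where B: "\<And>x. x \<in> \<Omega> \<Longrightarrow> \<bar>w x\<bar> \<le> B" by (auto simp: bounded_iff)
  have [measurable]: "w \<in> borel_measurable borel" "(\<lambda>x. err_grad x \<bullet> d) \<in> borel_measurable borel"
    using assms err_grad_measurable by (auto intro: borel_measurable_continuous_onI)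
  show ?thesis
    unfolding set_integrable_def
  proof (rule integrableI_bounded_set_indicator[where B = "B * M"])
    show "\<Omega> \<in> sets lborel" using compact_domain by (simp add: compact_imp_closed)
    show "(\<lambda>x. w x * (err_grad x \<bullet> d)) \<in> borel_measurable lborel" by measurable
    show "emeasure lborel \<Omega> < \<infinity>" using emeasure_compact_finite[OF compact_domain] by (simp add: less_top)
    show "AE x in lborel. x \<in> \<Omega> \<longrightarrow> norm (w x * (err_grad x \<bullet> d)) \<le> B * M"
    proof (intro AE_I2 impI)
      fix x assume "x \<in> \<Omega>"
      from B[OF this] show "norm (w x * (err_grad x \<bullet> d)) \<le> B * M"
        unfolding real_norm_def abs_mult using M[of x] by (intro mult_mono) auto
    qed
  qed
qed

text \<open>Integration by parts works in the directions of the edges; any other direction is a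
  combination of these, with its coordinates in the frame as coefficients.\<close>

lemma err_grad_direction_le:
  assumes crs: "crs a b \<noteq> 0" and w: "continuous_on UNIV w"
    and X: "\<bar>LINT x:\<Omega>|lborel. w x * (err_grad x \<bullet> a)\<bar> \<le> X" "\<bar>LINT x:\<Omega>|lborel. w x * (err_grad x \<bullet> b)\<bar> \<le> X"
  shows "\<bar>LINT x:\<Omega>|lborel. w x * (err_grad x \<bullet> d)\<bar> \<le> (\<bar>co1 0 a b d\<bar> + \<bar>co2 0 a b d\<bar>) * X"
proof -
  let ?c = "co1 0 a b d" and ?d = "co2 0 a b d"
  have "err_grad x \<bullet> d = ?c * (err_grad x \<bullet> a) + ?d * (err_grad x \<bullet> b)" for x
    using arg_cong[where f = "\<lambda>u. err_grad x \<bullet> u", OF par_coords[OF crs, of d 0]] by (simp add: inner_add_right)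
  then have "(LINT x:\<Omega>|lborel. w x * (err_grad x \<bullet> d))
      = (LINT x:\<Omega>|lborel. ?c * (w x * (err_grad x \<bullet> a)) + ?d * (w x * (err_grad x \<bullet> b)))"
    by (simp add: algebra_simps)
  also have "\<dots> = ?c * (LINT x:\<Omega>|lborel. w x * (err_grad x \<bullet> a)) + ?d * (LINT x:\<Omega>|lborel. w x * (err_grad x \<bullet> b))"
    by (subst set_integral_add(2)) (auto intro!: set_integrable_mult_right set_integrable_err_grad w)
  also have "\<bar>\<dots>\<bar> \<le> \<bar>?c\<bar> * X + \<bar>?d\<bar> * X"
    by (rule order_trans[OF abs_triangle_ineq]) (unfold abs_mult, intro add_mono mult_left_mono X abs_ge_zero)
  finally show ?thesis by (simp add: distrib_right)
qed

lemma interior_domain_nonempty: "interior \<Omega> \<noteq> {}"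
  using two_simplexE[OF simplex_domain] interior_tri_nonempty by metis

lemma sobolev_error_estimate_1:
  assumes dom: "\<Omega> = tri v a b" and crs: "crs a b \<noteq> 0" and g: "sobolev_W1 1 \<Omega> g"
    and B0: "\<And>x. x \<in> \<Omega> \<Longrightarrow> \<bar>err x\<bar> \<le> B0" "B0 \<ge> 0"
  shows "\<bar>LINT x:\<Omega>|lebesgue. g x * (err_grad x \<bullet> d)\<bar>
    \<le> 12 * ((\<bar>co1 0 a b d\<bar> + \<bar>co2 0 a b d\<bar>) * ((8 + 5 * (norm a + norm b)) * B0)) * sobolev_W1_norm 1 \<Omega> g"
proof -
  obtain M where M: "\<And>x. \<bar>err_grad x \<bullet> d\<bar> \<le> M" using err_grad_inner_bounded by blast
  \<comment> \<open>Exchanging \<open>a\<close> and \<open>b\<close> yields the second edge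
    direction from the estimate for the first.\<close>
  have dom': "\<Omega> = tri v b a" and crs': "crs b a \<noteq> 0"
    using dom tri_rotate(2)[of v a b] crs crs_rotate(2)[of a b] by simp_all
  have "\<bar>LINT x:\<Omega>|lborel. w x * (err_grad x \<bullet> d)\<bar>
      \<le> ((\<bar>co1 0 a b d\<bar> + \<bar>co2 0 a b d\<bar>) * ((8 + 5 * (norm a + norm b)) * B0)) * W1_sum \<Omega> w W" if w: "gradient w W" for w W
    unfolding mult.assoc[of "\<bar>co1 0 a b d\<bar> + \<bar>co2 0 a b d\<bar>"]
  proof (rule err_grad_direction_le[OF crs gradient_continuous(1)[OF w]])
    show "\<bar>LINT x:\<Omega>|lborel. w x * (err_grad x \<bullet> a)\<bar> \<le> (8 + 5 * (norm a + norm b)) * B0 * W1_sum \<Omega> w W"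
      by (rule gradient_error_estimate_1[OF dom crs w B0(1)])
    have "\<bar>LINT x:\<Omega>|lborel. w x * (err_grad x \<bullet> b)\<bar> \<le> (8 + 5 * (norm b + norm a)) * B0 * W1_sum \<Omega> w W"
      by (rule gradient_error_estimate_1[OF dom' crs' w B0(1)])
    then show "\<bar>LINT x:\<Omega>|lborel. w x * (err_grad x \<bullet> b)\<bar> \<le> (8 + 5 * (norm a + norm b)) * B0 * W1_sum \<Omega> w W"
      by (simp add: add.commute)
  qed
  then show ?thesis
    using B0(2) skeleton_free_subset
    by (intro sobolev_estimate(1)[OF compact_domain convex_domain interior_domain_nonempty err_grad_measurable M AE_isCont_err_grad _ _ _ g])
      (auto simp: err_grad_def)
qed

text \<open>The maximum covers the two orders of the edge vectors, one for each direction of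
  differentiation.\<close>

lemma sobolev_error_estimate_2:
  assumes reg: "shape_regular \<kappa> \<T>" "quasi_uniform q \<T>" and sym: "symmetric_triangulation \<T> \<Omega>"
    and dom: "\<Omega> = tri v a b" and crs: "crs a b \<noteq> 0" and g: "sobolev_W1 2 \<Omega> g"
    and B0: "\<And>x. x \<in> \<Omega> \<Longrightarrow> \<bar>err x\<bar> \<le> B0" "B0 \<ge> 0"
    and pair: "\<And>x0 a b x. tri x0 a b \<in> \<T> \<Longrightarrow> tri x0 (- a) (- b) \<in> \<T> \<Longrightarrow> crs a b \<noteq> 0 \<Longrightarrow> x0 \<in> interior \<Omega> \<Longrightarrow>
      x \<in> tri x0 a b \<Longrightarrow> \<bar>err x + err (2 *\<^sub>R x0 - x)\<bar> \<le> B1"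
    and edge: "\<And>v a b \<theta>. tri v a b \<in> \<T> \<Longrightarrow> crs a b \<noteq> 0 \<Longrightarrow> 0 \<le> \<theta> \<Longrightarrow> \<theta> \<le> 1 \<Longrightarrow>
      \<bar>err (v + \<theta> *\<^sub>R a) + err (v + (1 - \<theta>) *\<^sub>R a)\<bar> \<le> B1" and B1: "B1 \<ge> 0"
  shows "\<bar>LINT x:\<Omega>|lebesgue. g x * (err_grad x \<bullet> d)\<bar>
    \<le> 36 * ((\<bar>co1 0 a b d\<bar> + \<bar>co2 0 a b d\<bar>) * (max (second_order_const \<kappa> q a b) (second_order_const \<kappa> q b a) * (B1 + h * B0))) * sobolev_W1_norm 2 \<Omega> g"
    (is "_ \<le> 36 * (?c * (?E * ?B)) * _")
proof -
  obtain M where M: "\<And>x. \<bar>err_grad x \<bullet> d\<bar> \<le> M" using err_grad_inner_bounded by blast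
  have dom': "\<Omega> = tri v b a" and crs': "crs b a \<noteq> 0"
    using dom tri_rotate(2)[of v a b] crs crs_rotate(2)[of a b] by simp_all
  have B: "?B \<ge> 0" using B0(2) B1 h_nonneg by simp
  have E0: "?E \<ge> 0" by (simp add: second_order_const_def le_max_iff_disj)
  have "\<bar>LINT x:\<Omega>|lborel. w x * (err_grad x \<bullet> d)\<bar> \<le> (?c * (?E * ?B)) * W2_sum \<Omega> w W H1 H2"
    if w: "gradient w W" "gradient (\<lambda>x. W x $ 1) H1" "gradient (\<lambda>x. W x $ 2) H2" for w W H1 H2
    unfolding mult.assoc[of ?c]
  proof (rule err_grad_direction_le[OF crs gradient_continuous(1)[OF w(1)]])
    have "\<bar>LINT x:\<Omega>|lborel. w x * (err_grad x \<bullet> a)\<bar> \<le> second_order_const \<kappa> q a b * ?B * W2_sum \<Omega> w W H1 H2"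
      by (rule gradient_error_estimate_2[OF reg sym dom crs w B0(1) pair edge B1])
    also have "\<dots> \<le> ?E * ?B * W2_sum \<Omega> w W H1 H2" by (intro mult_right_mono B W2_sum_nonneg) simp
    finally show "\<bar>LINT x:\<Omega>|lborel. w x * (err_grad x \<bullet> a)\<bar> \<le> ?E * ?B * W2_sum \<Omega> w W H1 H2" .
    have "\<bar>LINT x:\<Omega>|lborel. w x * (err_grad x \<bullet> b)\<bar> \<le> second_order_const \<kappa> q b a * ?B * W2_sum \<Omega> w W H1 H2"
      by (rule gradient_error_estimate_2[OF reg sym dom' crs' w B0(1) pair edge B1])
    also have "\<dots> \<le> ?E * ?B * W2_sum \<Omega> w W H1 H2" by (intro mult_right_mono B W2_sum_nonneg) simp
    finally show "\<bar>LINT x:\<Omega>|lborel. w x * (err_grad x \<bullet> b)\<bar> \<le> ?E * ?B * W2_sum \<Omega> w W H1 H2" .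
  qed
  then show ?thesis
    using B E0 skeleton_free_subset
    by (intro sobolev_estimate(2)[OF compact_domain convex_domain interior_domain_nonempty err_grad_measurable M AE_isCont_err_grad _ _ _ g])
      (auto simp: err_grad_def)
qed

lemma integral_elementwise_mpartial:
  assumes i: "mpartial \<beta> = partial i" and g: "g absolutely_integrable_on \<Omega>"
  shows "(LINT x:\<Omega>|lebesgue. g x * (elementwise_mpartial \<T> \<beta> fh x - mpartial \<beta> f x))
    = (LINT x:\<Omega>|lebesgue. g x * (err_grad x \<bullet> axis i 1))"
proof -
  let ?u = "\<lambda>x. indicator \<Omega> x * (g x * (elementwise_mpartial \<T> \<beta> fh x - mpartial \<beta> f x))"
  \<comment> \<open>The indicator stays with \<open>g\<close>, because integrability on
    \<open>\<Omega>\<close> gives measurability of this product on the plane.\<close>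
  let ?w = "\<lambda>x. (indicator \<Omega> x * g x) * (err_grad x \<bullet> axis i 1)"
  have ae: "AE x in lebesgue. ?w x = ?u x"
    using AE_completion[OF AE_not_in[OF skeleton_null]]
  proof eventually_elim
    case (elim x)
    show ?case
    proof (cases "x \<in> \<Omega>")
      case True
      then have "x \<in> skeleton_free" using elim by blast
      moreover then have "\<exists>T\<in>\<T>. x \<in> interior T" by (simp add: skeleton_free_def)
      ultimately show ?thesis by (simp add: elementwise_mpartial_def i err_grad_def inner_axis)
    qed simp
  qed
  have "(\<lambda>x. indicator \<Omega> x * g x) \<in> borel_measurable lebesgue"
    using borel_measurable_integrable g unfolding set_integrable_def by fastforce
  then have w: "?w \<in> borel_measurable lebesgue"
    by (rule borel_measurable_times) (use err_grad_measurable in \<open>auto intro: measurable_completion\<close>)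
  have "integral\<^sup>L lebesgue ?u = integral\<^sup>L lebesgue ?w"
    using ae by (intro integral_cong_AE w borel_measurable_AE[OF w]) auto
  then show ?thesis unfolding set_lebesgue_integral_def by (simp add: mult.assoc)
qed

end

theorem lemma3p5:
  fixes k :: nat and \<Omega> :: "(real^2) set" and \<kappa> q :: real
  assumes "k \<ge> 1" and "2 simplex \<Omega>"
  shows "\<exists>C::real. \<forall>(h0::real) (h::real) \<T> f fh g (l::nat) \<beta>.
    diameter \<Omega> \<le> h0 \<longrightarrow> h < h0 \<longrightarrow>
    conforming_triangulation_of \<T> \<Omega> \<longrightarrow> h = mesh_size \<T> \<longrightarrow>
    shape_regular \<kappa> \<T> \<longrightarrow> quasi_uniform q \<T> \<longrightarrow>
    symmetric_triangulation \<T> \<Omega> \<longrightarrow> uniform_boundary \<T> \<Omega> \<longrightarrow>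
    Ck_closed (k + 2) \<Omega> f \<longrightarrow> is_lagrange_interpolant k \<T> f fh \<longrightarrow>
    l \<in> {1, 2} \<longrightarrow> sobolev_W1 l \<Omega> g \<longrightarrow> mi_order \<beta> = 1 \<longrightarrow>
    \<bar>LINT x:\<Omega>|lebesgue. g x * (elementwise_mpartial \<T> \<beta> fh x - mpartial \<beta> f x)\<bar>
      \<le> (if even k
          then C * h ^ (k + l) * sobolev_W1_norm l \<Omega> g * Ck_norm (k + l) \<Omega> f
          else C * h ^ (k + 1) * sobolev_W1_norm 1 \<Omega> g * Ck_norm (k + 1) \<Omega> f)"
proof -
  obtain v a b where dom: "\<Omega> = tri v a b" and crs: "crs a b \<noteq> 0" using two_simplexE[OF assms(2)] by metis
  \<comment> \<open>Summing over both coordinate directions lets one constant serve every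
    \<open>\<beta>\<close> of order 1.\<close>
  define c where "c = (\<Sum>i::2\<in>UNIV. \<bar>co1 0 a b (axis i 1)\<bar> + \<bar>co2 0 a b (axis i 1)\<bar>)"
  define L where "L = (lebesgue_const k + 1) * 2 ^ (k + 1)"
  define K where "K = 8 + 5 * (norm a + norm b)"
  define E where "E = max (second_order_const \<kappa> q a b) (second_order_const \<kappa> q b a)"
  \<comment> \<open>The summands serve the estimates of first and second order in \<open>g\<close>.
    In \<open>5 * L\<close>, the reflection bounds account for \<open>4 * L\<close>, since
    \<open>2 * 2 ^ (k + 2) = 4 * 2 ^ (k + 1)\<close>, and \<open>h\<close> times the plain error
    bound for \<open>L\<close>.\<close>
  define C where "C = 12 * (c * (K * L)) + 36 * (c * (E * (5 * L)))"
  have L: "L \<ge> 0" using lebesgue_const(1)[OF assms(1)] by (simp add: L_def)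
  have K: "K \<ge> 0" by (simp add: K_def)
  have E: "E \<ge> 0" by (simp add: E_def second_order_const_def le_max_iff_disj)
  have c: "\<bar>co1 0 a b (axis i 1)\<bar> + \<bar>co2 0 a b (axis i 1)\<bar> \<le> c" for i
    unfolding c_def by (rule member_le_sum) auto
  then have c0: "c \<ge> 0" by (meson abs_ge_zero add_nonneg_nonneg order_trans)
  have C: "12 * (c * (K * L)) \<le> C" "36 * (c * (E * (5 * L))) \<le> C"
    using c0 K L E by (simp_all add: C_def)
  show ?thesis
  proof (rule exI[of _ C], intro allI impI)
    fix h0 h :: real and \<T> f fh g and l :: nat and \<beta>
    assume mesh: "conforming_triangulation_of \<T> \<Omega>" and h: "h = mesh_size \<T>"
      and reg: "shape_regular \<kappa> \<T>" "quasi_uniform q \<T>" and sym: "symmetric_triangulation \<T> \<Omega>"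
      and f: "Ck_closed (k + 2) \<Omega> f" and fh: "is_lagrange_interpolant k \<T> f fh"
      and l: "l \<in> {1, 2}" and g: "sobolev_W1 l \<Omega> g" and \<beta>: "mi_order \<beta> = 1"
    interpret M: fe_mesh k \<Omega> \<T> f fh by unfold_locales (use assms mesh f fh in auto)
    have hM: "M.h = h" by (simp add: M.h_def h)
    have h0: "h \<ge> 0" using M.h_nonneg hM by simp
    let ?N1 = "Ck_norm (k + 1) \<Omega> f" and ?N2 = "Ck_norm (k + 2) \<Omega> f"
    have N: "?N1 \<ge> 0" "?N1 \<le> ?N2"
      using Ck_norm_nonneg[OF f M.compact_domain M.interior_domain_nonempty] Ck_norm_mono by auto
    obtain i where i: "mpartial \<beta> = partial i" using mi_order_1_cases[OF \<beta>] .
    have eq: "(LINT x:\<Omega>|lebesgue. g x * (elementwise_mpartial \<T> \<beta> fh x - mpartial \<beta> f x))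
        = (LINT x:\<Omega>|lebesgue. g x * (M.err_grad x \<bullet> axis i 1))"
      using g by (intro M.integral_elementwise_mpartial[OF i]) (simp add: sobolev_W1_def)
    have B0: "\<bar>M.err x\<bar> \<le> L * (?N1 * h ^ (k + 1))" if "x \<in> \<Omega>" for x
      using M.err_bound[OF that] by (simp add: L_def hM mult_ac)
    have B00: "L * (?N1 * h ^ (k + 1)) \<ge> 0" using L N h0 by simp
    \<comment> \<open>Holds for either parity and either \<open>l\<close>; it settles odd
      \<open>k\<close>, and even \<open>k\<close> with \<open>l = 1\<close>.\<close>
    have first: "\<bar>LINT x:\<Omega>|lebesgue. g x * (elementwise_mpartial \<T> \<beta> fh x - mpartial \<beta> f x)\<bar>
        \<le> C * h ^ (k + 1) * sobolev_W1_norm 1 \<Omega> g * ?N1"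
    proof -
      have g1: "sobolev_W1 1 \<Omega> g" by (rule sobolev_W1_mono[OF _ g]) (use l in auto)
      have "\<bar>LINT x:\<Omega>|lebesgue. g x * (M.err_grad x \<bullet> axis i 1)\<bar>
          \<le> 12 * ((\<bar>co1 0 a b (axis i 1)\<bar> + \<bar>co2 0 a b (axis i 1)\<bar>) * (K * (L * (?N1 * h ^ (k + 1))))) * sobolev_W1_norm 1 \<Omega> g"
        unfolding K_def by (rule M.sobolev_error_estimate_1[OF dom crs g1 B0 B00])
      also have "\<dots> \<le> 12 * (c * (K * (L * (?N1 * h ^ (k + 1))))) * sobolev_W1_norm 1 \<Omega> g"
        by (intro mult_right_mono mult_left_mono c sobolev_W1_norm_nonneg mult_nonneg_nonneg[OF K B00]) simp
      also have "\<dots> = 12 * (c * (K * L)) * (h ^ (k + 1) * sobolev_W1_norm 1 \<Omega> g * ?N1)" by (simp add: mult_ac)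
      also have "\<dots> \<le> C * (h ^ (k + 1) * sobolev_W1_norm 1 \<Omega> g * ?N1)"
        using h0 N sobolev_W1_norm_nonneg by (intro mult_right_mono C(1)) simp
      finally show ?thesis unfolding eq by (simp add: mult.assoc)
    qed
    have second: "\<bar>LINT x:\<Omega>|lebesgue. g x * (elementwise_mpartial \<T> \<beta> fh x - mpartial \<beta> f x)\<bar>
        \<le> C * h ^ (k + 2) * sobolev_W1_norm 2 \<Omega> g * ?N2" if even: "even k" and l2: "l = 2"
    proof -
      let ?B0 = "L * (?N1 * h ^ (k + 1))" and ?B1 = "4 * (L * (?N2 * h ^ (k + 2)))"
      have N2: "?N2 \<ge> 0" using N by linarith
      have B1: "?B1 \<ge> 0" using L N2 h0 by simp
      have B1_eq: "2 * (lebesgue_const k + 1) * (2 ^ (k + 2) * ?N2 * h ^ (k + 2)) = ?B1"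
        by (simp add: L_def)
      have "\<bar>LINT x:\<Omega>|lebesgue. g x * (M.err_grad x \<bullet> axis i 1)\<bar>
          \<le> 36 * ((\<bar>co1 0 a b (axis i 1)\<bar> + \<bar>co2 0 a b (axis i 1)\<bar>) * (E * (?B1 + h * ?B0))) * sobolev_W1_norm 2 \<Omega> g"
        unfolding E_def hM[symmetric]
      proof (rule M.sobolev_error_estimate_2[OF reg sym dom crs g[unfolded l2]], unfold hM)
        show "\<bar>M.err x + M.err (2 *\<^sub>R x0 - x)\<bar> \<le> ?B1" if "tri x0 a b \<in> \<T>" "tri x0 (- a) (- b) \<in> \<T>" "crs a b \<noteq> 0" "x0 \<in> interior \<Omega>"
          "x \<in> tri x0 a b" for x0 a b x
          using M.err_pair[OF even that] unfolding hM B1_eq .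
        show "\<bar>M.err (v + \<theta> *\<^sub>R a) + M.err (v + (1 - \<theta>) *\<^sub>R a)\<bar> \<le> ?B1" if "tri v a b \<in> \<T>" "crs a b \<noteq> 0" "0 \<le> \<theta>" "\<theta> \<le> 1" for v a b \<theta>
          using M.err_edge[OF even that] unfolding hM B1_eq .
      qed (fact B0 B00 B1)+
      also have "\<dots> \<le> 36 * (c * (E * (5 * L * (?N2 * h ^ (k + 2))))) * sobolev_W1_norm 2 \<Omega> g"
      proof (intro mult_right_mono mult_left_mono mult_mono c E sobolev_W1_norm_nonneg c0)
        \<comment> \<open>The extra factor \<open>h\<close> lifts the plain error bound to order
          \<open>k + 2\<close>; its norm of \<open>f\<close> is then enlarged to match that of the
          reflection bounds.\<close>
        have "h * ?B0 = L * (?N1 * h ^ (k + 2))" by simp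
        also have "\<dots> \<le> L * (?N2 * h ^ (k + 2))" using L N h0 by (intro mult_left_mono mult_right_mono) auto
        finally show "?B1 + h * ?B0 \<le> 5 * L * (?N2 * h ^ (k + 2))"
          by (simp only: mult.assoc)
        show "0 \<le> E * (?B1 + h * ?B0)" using E B1 h0 B00 by simp
      qed simp
      also have "\<dots> = 36 * (c * (E * (5 * L))) * (h ^ (k + 2) * sobolev_W1_norm 2 \<Omega> g * ?N2)" by (simp add: mult_ac)
      also have "\<dots> \<le> C * (h ^ (k + 2) * sobolev_W1_norm 2 \<Omega> g * ?N2)"
        using h0 N2 sobolev_W1_norm_nonneg by (intro mult_right_mono C(2)) simp
      finally show ?thesis unfolding eq by (simp add: mult.assoc)
    qed
    show "\<bar>LINT x:\<Omega>|lebesgue. g x * (elementwise_mpartial \<T> \<beta> fh x - mpartial \<beta> f x)\<bar>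
      \<le> (if even k
          then C * h ^ (k + l) * sobolev_W1_norm l \<Omega> g * Ck_norm (k + l) \<Omega> f
          else C * h ^ (k + 1) * sobolev_W1_norm 1 \<Omega> g * Ck_norm (k + 1) \<Omega> f)"
      using first second l by auto
  qed
qed

end
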